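(* Let $d\ge2$. For every $\delta\in\,]0,\tfrac12]$ there exists a constant $C>0$ such that for all dyadic integers $N,M\geq 1$ and all $u,v\in L^2(\mathbb{R}^d)$, $$\|e^{itH}\Delta_N(v)\;e^{itH}\Delta_M(u)\|_{L^2([-1,1],L^2(\mathbb{R}^d))}\le C\,\min(N,M)^{\frac{d-2}{2}}\Big(\frac{\min(N,M)}{\max(N,M)}\Big)^{\frac12-\delta}\|\Delta_N(v)\|_{L^2(\mathbb{R}^d)}\|\Delta_M(u)\|_{L^2(\mathbb{R}^d)}.$$
   Context: $H=-\Delta+|x|^2$ is the harmonic oscillator on $\mathbb{R}^d$. Fix $\eta\in C_0^\infty(\mathbb{R})$ with $\eta=1$ on $[0,1]$ and $\eta=0$ on $[2,\infty)$. For dyadic $N=2^k$, $k\in\mathbb{N}$, define by functional calculus $\Delta_N(u)=\big(\eta(H/N^2)-\eta(4H/N^2)\big)u$. *)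

theory Defs
  imports "HOL-Analysis.Analysis"
begin

section \<open>Smooth functions and the Laplacian\<close>

definition partial_deriv ::
  "'a::euclidean_space \<Rightarrow> ('a \<Rightarrow> 'b::real_normed_vector) \<Rightarrow> 'a \<Rightarrow> 'b" where
  "partial_deriv b f = (\<lambda>x. frechet_derivative f (at x) b)"

text \<open>All iterated partial derivatives exist and are themselves differentiable,
  which is the same as being of class \<open>C\<close>-infinity. For the domain \<^typ>\<open>real\<close> the
  only partial derivative is the ordinary one.\<close>

definition smooth :: "('a::euclidean_space \<Rightarrow> 'b::real_normed_vector) \<Rightarrow> bool" where
  "smooth f \<longleftrightarrow>
    (\<forall>bs. set bs \<subseteq> Basis \<longrightarrow> (\<forall>x. foldr partial_deriv bs f differentiable (at x)))"

definition test_function :: "('a::euclidean_space \<Rightarrow> 'b::real_normed_vector) \<Rightarrow> bool" where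
  "test_function f \<longleftrightarrow> smooth f \<and> compact (closure {x. f x \<noteq> 0})"

definition laplacian :: "('a::euclidean_space \<Rightarrow> 'b::real_normed_vector) \<Rightarrow> 'a \<Rightarrow> 'b" where
  "laplacian f x = (\<Sum>b\<in>Basis. partial_deriv b (partial_deriv b f) x)"


section \<open>The space \<open>L\<^sup>2\<close>\<close>

text \<open>The norm of a function with values in \<open>[0,\<infinity>]\<close>; it takes the value \<open>\<infinity>\<close> off the space,
  so that a finite bound on it includes square-integrability.\<close>

definition L2_norm_on :: "'a measure \<Rightarrow> ('a \<Rightarrow> ennreal) \<Rightarrow> ennreal" where
  "L2_norm_on M g = (let I = (\<integral>\<^sup>+ x. (g x)\<^sup>2 \<partial>M)
                     in if I = \<infinity> then \<infinity> else ennreal (sqrt (enn2real I)))"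

definition L2_norm :: "('a::euclidean_space \<Rightarrow> complex) \<Rightarrow> ennreal" where
  "L2_norm f = L2_norm_on lborel (\<lambda>x. ennreal (cmod (f x)))"

text \<open>Elements of the space are represented by Borel functions; equality of classes is \<open>ae_eq\<close>.\<close>

definition L2 :: "('a::euclidean_space \<Rightarrow> complex) set" where
  "L2 = {f. f \<in> borel_measurable lborel \<and> L2_norm f < \<infinity>}"

definition ae_eq :: "('a::euclidean_space \<Rightarrow> complex) \<Rightarrow> ('a \<Rightarrow> complex) \<Rightarrow> bool" where
  "ae_eq f g \<longleftrightarrow> (AE x in lborel. f x = g x)"

definition L2_inner :: "('a::euclidean_space \<Rightarrow> complex) \<Rightarrow> ('a \<Rightarrow> complex) \<Rightarrow> complex" where
  "L2_inner f g = (\<integral>x. f x * cnj (g x) \<partial>lborel)"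

definition L2_lim ::
  "(nat \<Rightarrow> 'a::euclidean_space \<Rightarrow> complex) \<Rightarrow> ('a \<Rightarrow> complex) \<Rightarrow> bool" where
  "L2_lim w v \<longleftrightarrow> (\<lambda>n. L2_norm (\<lambda>x. w n x - v x)) \<longlonglongrightarrow> 0"

text \<open>The norm of \<open>L\<^sup>2(T, L\<^sup>2)\<close> for a time set \<open>T\<close>. It depends only on the classes \<open>F t\<close>.\<close>

definition L2_L2_norm ::
  "real set \<Rightarrow> (real \<Rightarrow> 'a::euclidean_space \<Rightarrow> complex) \<Rightarrow> ennreal" where
  "L2_L2_norm T F = L2_norm_on (restrict_space lborel T) (\<lambda>t. L2_norm (F t))"


section \<open>The bounded Borel functional calculus\<close>

definition bounded_borel :: "(real \<Rightarrow> complex) set" where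
  "bounded_borel = {h. h \<in> borel_measurable borel \<and> bounded (range h)}"

text \<open>An unbounded operator is given by its graph \<open>A\<close>. The following are the properties that
  characterise the functional calculus \<open>\<Phi> h = h(A)\<close> of a self-adjoint \<open>A\<close> in the spectral theorem
  (Reed and Simon, Methods of Modern Mathematical Physics I, Theorem VIII.5): \<open>\<Phi>\<close> is a unital
  \<open>*\<close>-homomorphism into the bounded operators, bounded by the supremum norm, with
  \<open>\<Phi> h\<^sub>n u \<rightarrow> A u\<close> on the domain of \<open>A\<close> whenever \<open>h\<^sub>n(s) \<rightarrow> s\<close> and \<open>|h\<^sub>n(s)| \<le> |s|\<close>, and strongly
  continuous under bounded pointwise convergence. For self-adjoint \<open>A\<close> such a \<open>\<Phi>\<close> exists and is
  unique up to equality almost everywhere. That \<open>\<Phi> h\<close> is well defined on classes follows from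
  linearity and the norm bound.\<close>

definition is_functional_calculus ::
  "(('a::euclidean_space \<Rightarrow> complex) \<times> ('a \<Rightarrow> complex)) set \<Rightarrow>
   ((real \<Rightarrow> complex) \<Rightarrow> ('a \<Rightarrow> complex) \<Rightarrow> ('a \<Rightarrow> complex)) \<Rightarrow> bool" where
  "is_functional_calculus A \<Phi> \<longleftrightarrow>
    (\<forall>h\<in>bounded_borel. \<forall>u\<in>L2. \<Phi> h u \<in> L2) \<and>
    (\<forall>h\<in>bounded_borel. \<forall>u\<in>L2. \<forall>v\<in>L2. \<forall>a b.
       ae_eq (\<Phi> h (\<lambda>x. a * u x + b * v x)) (\<lambda>x. a * \<Phi> h u x + b * \<Phi> h v x)) \<and>
    (\<forall>h\<in>bounded_borel. \<forall>u\<in>L2.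
       L2_norm (\<Phi> h u) \<le> ennreal (SUP s. cmod (h s)) * L2_norm u) \<and>
    (\<forall>u\<in>L2. ae_eq (\<Phi> (\<lambda>s. 1) u) u) \<and>
    (\<forall>g\<in>bounded_borel. \<forall>h\<in>bounded_borel. \<forall>u\<in>L2. \<forall>a b.
       ae_eq (\<Phi> (\<lambda>s. a * g s + b * h s) u) (\<lambda>x. a * \<Phi> g u x + b * \<Phi> h u x)) \<and>
    (\<forall>g\<in>bounded_borel. \<forall>h\<in>bounded_borel. \<forall>u\<in>L2.
       ae_eq (\<Phi> (\<lambda>s. g s * h s) u) (\<Phi> g (\<Phi> h u))) \<and>
    (\<forall>h\<in>bounded_borel. \<forall>u\<in>L2. \<forall>v\<in>L2.
       L2_inner (\<Phi> h u) v = L2_inner u (\<Phi> (\<lambda>s. cnj (h s)) v)) \<and>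
    (\<forall>h. (\<forall>n. h n \<in> bounded_borel) \<and> (\<forall>s. (\<lambda>n. h n s) \<longlonglongrightarrow> complex_of_real s) \<and>
         (\<forall>n s. cmod (h n s) \<le> \<bar>s\<bar>) \<longrightarrow>
       (\<forall>(u, w)\<in>A. L2_lim (\<lambda>n. \<Phi> (h n) u) w)) \<and>
    (\<forall>h g. (\<forall>n. h n \<in> bounded_borel) \<and> (\<forall>s. (\<lambda>n. h n s) \<longlonglongrightarrow> g s) \<and>
         (\<exists>K. \<forall>n s. cmod (h n s) \<le> K) \<longrightarrow>
       (\<forall>u\<in>L2. L2_lim (\<lambda>n. \<Phi> (h n) u) (\<Phi> g u)))"

definition functional_calculus ::
  "(('a::euclidean_space \<Rightarrow> complex) \<times> ('a \<Rightarrow> complex)) set \<Rightarrow>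
   (real \<Rightarrow> complex) \<Rightarrow> ('a \<Rightarrow> complex) \<Rightarrow> ('a \<Rightarrow> complex)" where
  "functional_calculus A = (SOME \<Phi>. is_functional_calculus A \<Phi>)"


section \<open>The harmonic oscillator\<close>

text \<open>The graph of \<open>H = -\<Delta> + |x|\<^sup>2\<close> on its self-adjoint domain, the set of all \<open>u\<close> in \<open>L\<^sup>2\<close> such that
  \<open>-\<Delta>u + |x|\<^sup>2 u\<close>, taken in the sense of distributions, belongs to \<open>L\<^sup>2\<close>.\<close>

definition harmonic_oscillator ::
  "(('a::euclidean_space \<Rightarrow> complex) \<times> ('a \<Rightarrow> complex)) set" where
  "harmonic_oscillator =
    {(u, w). u \<in> L2 \<and> w \<in> L2 \<and>
       (\<forall>\<phi>. test_function \<phi> \<longrightarrow>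
          (\<integral>x. u x * (- laplacian \<phi> x + of_real ((norm x)\<^sup>2) * \<phi> x) \<partial>lborel) =
          (\<integral>x. w x * \<phi> x \<partial>lborel))}"

definition schroedinger_flow ::
  "real \<Rightarrow> ('a::euclidean_space \<Rightarrow> complex) \<Rightarrow> ('a \<Rightarrow> complex)" where
  "schroedinger_flow t = functional_calculus harmonic_oscillator (\<lambda>s. exp (\<i> * of_real (t * s)))"

definition freq_localization ::
  "(real \<Rightarrow> real) \<Rightarrow> nat \<Rightarrow> ('a::euclidean_space \<Rightarrow> complex) \<Rightarrow> ('a \<Rightarrow> complex)" where
  "freq_localization \<eta> N u = (\<lambda>x.
     functional_calculus harmonic_oscillator (\<lambda>s. of_real (\<eta> (s / (real N)\<^sup>2))) u x -
     functional_calculus harmonic_oscillator (\<lambda>s. of_real (\<eta> (4 * s / (real N)\<^sup>2))) u x)"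

definition dyadic :: "nat set" where
  "dyadic = range (\<lambda>k. 2 ^ k)"

end

theory Submission
  imports Defs "HOL-Probability.Probability"
begin

text \<open>In the Hermite basis \<open>h\<^sub>\<alpha>\<close> the flow multiplies coefficients by \<open>e\<^bsup>it(2|\<alpha>|+d)\<^esup>\<close>, and any functional
  calculus of \<open>H\<close> acts diagonally, so a localized function is a finite Hermite sum with
  \<open>N\<^sup>2/4 < 2|\<alpha>| + d < 2 N\<^sup>2\<close>. A product \<open>u(x) v(x)\<close> is the trace on \<open>y = x\<close> of a solution of the
  oscillator in the pair \<open>(x, y)\<close>; in the rotated variables \<open>(x+y)/\<surd>2\<close>, \<open>(x-y)/\<surd>2\<close> the trace is an
  evaluation at the origin in the second variable, and orthogonality in time (the flow is periodic)
  and in the first variable leaves only a sum of squares \<open>h\<^sub>b(0)\<^sup>2\<close>. For comparable frequencies this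
  sum already gives the bound. For \<open>N \<gg> M\<close> some coordinate of \<open>\<alpha>\<close> is of size \<open>N\<^sup>2\<close>; powers of the
  difference of the two rotated number operators show that in this coordinate both rotated indices
  are comparable to \<open>N\<^sup>2\<close> up to an exponentially small part, and \<open>h\<^sub>b(0)\<^sup>2 \<lesssim> b\<^bsup>-1/2\<^esup>\<close> yields the
  gain \<open>1/N\<close>. The other coordinates cost a factor \<open>M\<close> each by the bound
  \<open>\<Sum>\<^bsub>n \<le> \<mu>\<^esub> h\<^sub>n(x)\<^sup>2 \<lesssim> \<mu>\<^bsup>1/2\<^esup>\<close>.\<close>

section \<open>One-dimensional Hermite functions\<close>

text \<open>Two separate facts tie the calculus to the Hermite basis.
  \<open>functional_calculus\<close> is a choice, so some calculus must first be exhibited: the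
  diagonal one, which needs completeness of the Hermite functions and the coefficients of every
  element of the weakly defined domain. The chosen calculus may be another one, so its diagonal
  action is then derived from the clauses alone, which needs the Hermite functions to be
  eigenvectors. On the analytic side, summing \<open>h_b(0)^2\<close> over all coordinates yields a
  power of the larger frequency and no factor min/max, so separated frequencies need another source
  of decay. It lies in one coordinate carrying the high frequency: only small \<open>b\<close> could
  spoil the decay of \<open>h_b(0)^2\<close>, and the \<open>2p\<close>-th moment of
  \<open>a - b\<close>, with \<open>p\<close> of order \<open>N^2\<close>, excludes them. The
  constant \<open>512 d\<close> dividing the regimes makes the base of this moment bound at most
  1/4. The estimate is proved with exponent 1/2; the passage to 1/2 - delta uses that the ratio of
  frequencies is at most 1.\<close>

definition gauss_poly :: "(real \<Rightarrow> real) set" where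
  "gauss_poly = {f. \<exists>p. f = (\<lambda>x. poly p x * exp (- (x\<^sup>2) / 2))}"

lemma gauss_polyI: "(\<And>x. f x = poly p x * exp (- (x\<^sup>2) / 2)) \<Longrightarrow> f \<in> gauss_poly"
  unfolding gauss_poly_def by blast

lemma gauss_polyE:
  assumes "f \<in> gauss_poly"
  obtains p where "\<And>x. f x = poly p x * exp (- (x\<^sup>2) / 2)"
  using assms unfolding gauss_poly_def by auto

lemma gauss_poly_add:
  assumes "f \<in> gauss_poly" "g \<in> gauss_poly"
  shows "(\<lambda>x. f x + g x) \<in> gauss_poly"
proof -
  obtain p q where "\<And>x. f x = poly p x * exp (- (x\<^sup>2) / 2)" "\<And>x. g x = poly q x * exp (- (x\<^sup>2) / 2)"
    using assms by (metis gauss_polyE)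
  then show ?thesis by (intro gauss_polyI[of _ "p + q"]) (simp add: ring_distribs)
qed

lemma gauss_poly_cmult:
  assumes "f \<in> gauss_poly"
  shows "(\<lambda>x. c * f x) \<in> gauss_poly"
proof -
  obtain p where "\<And>x. f x = poly p x * exp (- (x\<^sup>2) / 2)" using assms by (metis gauss_polyE)
  then show ?thesis by (intro gauss_polyI[of _ "smult c p"]) simp
qed

lemma gauss_poly_diff: "f \<in> gauss_poly \<Longrightarrow> g \<in> gauss_poly \<Longrightarrow> (\<lambda>x. f x - g x) \<in> gauss_poly"
  using gauss_poly_add[OF _ gauss_poly_cmult[of g "-1"], of f] by simp

lemma gauss_poly_x:
  assumes "f \<in> gauss_poly"
  shows "(\<lambda>x. x * f x) \<in> gauss_poly"
proof -
  obtain p where "\<And>x. f x = poly p x * exp (- (x\<^sup>2) / 2)" using assms by (metis gauss_polyE)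
  then show ?thesis by (intro gauss_polyI[of _ "[:0, 1:] * p"]) simp
qed

text \<open>With sums, scalars and multiplication by \<open>x\<close>, closure under derivatives
  keeps everything the ladder operators produce inside the class, so decay and integrability are
  settled once.\<close>

lemma gauss_poly_deriv:
  assumes "f \<in> gauss_poly"
  obtains f' where "f' \<in> gauss_poly" "\<And>x. (f has_real_derivative f' x) (at x)"
proof -
  obtain p where f: "f = (\<lambda>x. poly p x * exp (- (x\<^sup>2) / 2))"
    using assms by (auto simp: gauss_poly_def)
  let ?f' = "\<lambda>x. poly (pderiv p - [:0,1:] * p) x * exp (- (x\<^sup>2) / 2)"
  have "(f has_real_derivative ?f' x) (at x)" for x
    unfolding f by (auto intro!: derivative_eq_intros simp: field_simps)
  then show ?thesis by (intro that[of ?f'] gauss_polyI[of _ "pderiv p - [:0,1:] * p"]) auto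
qed

lemma gauss_poly_continuous: "f \<in> gauss_poly \<Longrightarrow> continuous_on A f"
  unfolding gauss_poly_def by (auto intro!: continuous_intros)

lemma gauss_poly_measurable [measurable_dest]: "f \<in> gauss_poly \<Longrightarrow> f \<in> borel_measurable borel"
  by (intro borel_measurable_continuous_onI gauss_poly_continuous)

text \<open>One term of the exponential series of \<open>x^2/4\<close> is at most the whole series;
  this bounds \<open>x^(2k)\<close>, which dominates \<open>|x|^k\<close> when
  \<open>|x| > 1\<close>. For \<open>|x| <= 1\<close> the summand 1 suffices.\<close>

lemma power_gauss_bounded:
  fixes x :: real
  shows "\<bar>x\<bar> ^ k * exp (- (x\<^sup>2) / 4) \<le> 1 + fact k * 4 ^ k"
proof (cases "\<bar>x\<bar> \<le> 1")
  case True
  then have "\<bar>x\<bar> ^ k * exp (- (x\<^sup>2) / 4) \<le> 1 * 1"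
    by (intro mult_mono) (auto intro: power_le_one)
  moreover have "0 \<le> fact k * (4::real) ^ k" by simp
  ultimately show ?thesis by linarith
next
  case False
  have s: "summable (\<lambda>n. (x\<^sup>2 / 4) ^ n /\<^sub>R fact n)" by (rule summable_exp_generic)
  have "(x\<^sup>2 / 4) ^ k /\<^sub>R fact k = (\<Sum>n\<in>{k}. (x\<^sup>2 / 4) ^ n /\<^sub>R fact n)" by simp
  also have "\<dots> \<le> (\<Sum>n. (x\<^sup>2 / 4) ^ n /\<^sub>R fact n)"
    by (intro sum_le_suminf s) auto
  also have "\<dots> = exp (x\<^sup>2 / 4)" by (simp add: exp_def)
  finally have "(x\<^sup>2 / 4) ^ k \<le> fact k * exp (x\<^sup>2 / 4)" by (simp add: field_simps)
  then have "(x\<^sup>2) ^ k \<le> fact k * 4 ^ k * exp (x\<^sup>2 / 4)" by (simp add: field_simps)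
  moreover have "\<bar>x\<bar> ^ k \<le> (x\<^sup>2) ^ k"
  proof (rule power_mono)
    have "1 * \<bar>x\<bar> \<le> \<bar>x\<bar> * \<bar>x\<bar>" using False by (intro mult_right_mono) auto
    then show "\<bar>x\<bar> \<le> x\<^sup>2" by (simp add: power2_eq_square)
  qed simp
  ultimately have "\<bar>x\<bar> ^ k \<le> fact k * 4 ^ k * exp (x\<^sup>2 / 4)" by linarith
  then have "\<bar>x\<bar> ^ k * exp (- (x\<^sup>2) / 4) \<le> fact k * 4 ^ k * exp (x\<^sup>2 / 4) * exp (- (x\<^sup>2) / 4)"
    by (intro mult_right_mono) auto
  also have "\<dots> = fact k * 4 ^ k" by (simp add: mult.assoc exp_add[symmetric])
  finally show ?thesis by simp
qed

text \<open>Half of the Gaussian absorbs the polynomial. The other half is kept, so that a product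
  of two such functions is still bounded by the integrable \<open>exp(-x^2/2)\<close>.\<close>

lemma gauss_poly_bounded:
  assumes "f \<in> gauss_poly"
  obtains C where "C \<ge> 0" "\<And>x. \<bar>f x\<bar> \<le> C * exp (- (x\<^sup>2) / 4)"
proof -
  obtain p where f: "\<And>x. f x = poly p x * exp (- (x\<^sup>2) / 2)" using assms by (metis gauss_polyE)
  have "\<bar>f x\<bar> \<le> (\<Sum>i\<le>degree p. \<bar>coeff p i\<bar> * (1 + fact i * 4 ^ i)) * exp (- (x\<^sup>2) / 4)" for x
  proof -
    have "\<bar>f x\<bar> = \<bar>poly p x\<bar> * exp (- (x\<^sup>2) / 4) * exp (- (x\<^sup>2) / 4)"
      by (simp add: f abs_mult mult.assoc exp_add[symmetric])
    also have "\<bar>poly p x\<bar> \<le> (\<Sum>i\<le>degree p. \<bar>coeff p i\<bar> * \<bar>x\<bar> ^ i)"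
      unfolding poly_altdef by (rule order_trans[OF sum_abs]) (simp add: abs_mult power_abs)
    then have "\<bar>poly p x\<bar> * exp (- (x\<^sup>2) / 4)
        \<le> (\<Sum>i\<le>degree p. \<bar>coeff p i\<bar> * \<bar>x\<bar> ^ i) * exp (- (x\<^sup>2) / 4)"
      by (rule mult_right_mono) simp
    also have "\<dots> = (\<Sum>i\<le>degree p. \<bar>coeff p i\<bar> * (\<bar>x\<bar> ^ i * exp (- (x\<^sup>2) / 4)))"
      by (simp add: sum_distrib_right mult.assoc)
    also have "\<dots> \<le> (\<Sum>i\<le>degree p. \<bar>coeff p i\<bar> * (1 + fact i * 4 ^ i))"
      by (intro sum_mono mult_left_mono power_gauss_bounded) auto
    finally show ?thesis by (simp add: mult_right_mono)
  qed
  then show ?thesis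
    by (intro that[of "\<Sum>i\<le>degree p. \<bar>coeff p i\<bar> * (1 + fact i * 4 ^ i)"]) (auto intro!: sum_nonneg)
qed

section \<open>Integrability, decay and integration by parts for polynomials times Gaussians\<close>

lemma integrable_exp_square: "integrable lborel (\<lambda>x::real. exp (- (x\<^sup>2) / 2))"
proof -
  have "integrable lborel (\<lambda>x. normal_density 0 1 x)" by simp
  then have "integrable lborel (\<lambda>x. sqrt (2 * pi) * normal_density 0 1 x)" by (rule integrable_mult_right)
  then show ?thesis by (simp add: normal_density_def)
qed

lemma integral_exp_square: "(\<integral>x. exp (- ((x::real)\<^sup>2)) \<partial>lborel) = sqrt pi"
  using has_bochner_integral_even_function[OF gaussian_moment_0] by (simp add: has_bochner_integral_iff)

lemma integrable_gauss_poly_mult: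
  assumes "f \<in> gauss_poly" "g \<in> gauss_poly"
  shows "integrable lborel (\<lambda>x. f x * g x)"
proof -
  obtain C D where C: "C \<ge> 0" "\<And>x. \<bar>f x\<bar> \<le> C * exp (- (x\<^sup>2) / 4)"
    and D: "D \<ge> 0" "\<And>x. \<bar>g x\<bar> \<le> D * exp (- (x\<^sup>2) / 4)"
    using assms by (metis gauss_poly_bounded)
  note [measurable] = assms[THEN gauss_poly_measurable]
  show ?thesis
  proof (rule Bochner_Integration.integrable_bound[OF integrable_mult_right[OF integrable_exp_square, of "C * D"]])
    show "AE x in lborel. norm (f x * g x) \<le> norm (C * D * exp (- x\<^sup>2 / 2))"
    proof (intro AE_I2)
      fix x
      have "\<bar>f x\<bar> * \<bar>g x\<bar> \<le> C * exp (- (x\<^sup>2) / 4) * (D * exp (- (x\<^sup>2) / 4))"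
        using C D by (intro mult_mono) auto
      also have "\<dots> = C * D * exp (- x\<^sup>2 / 2)" by (simp add: exp_add[symmetric])
      finally show "norm (f x * g x) \<le> norm (C * D * exp (- x\<^sup>2 / 2))"
        using C D by (simp add: abs_mult)
    qed
  qed simp
qed

lemma gauss_poly_tendsto_0:
  assumes "f \<in> gauss_poly"
  shows "(f \<longlongrightarrow> 0) at_top" "(f \<longlongrightarrow> 0) at_bot"
proof -
  obtain C where C: "C \<ge> 0" "\<And>x. \<bar>f x\<bar> \<le> C * exp (- (x\<^sup>2) / 4)"
    using assms by (metis gauss_poly_bounded)
  have "((\<lambda>x::real. C * exp (- (x\<^sup>2) / 4)) \<longlongrightarrow> 0) at_top" by real_asymp
  then show "(f \<longlongrightarrow> 0) at_top" by (rule Lim_null_comparison[rotated]) (use C(2) in auto)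
  have "((\<lambda>x::real. C * exp (- (x\<^sup>2) / 4)) \<longlongrightarrow> 0) at_bot" by real_asymp
  then show "(f \<longlongrightarrow> 0) at_bot" by (rule Lim_null_comparison[rotated]) (use C(2) in auto)
qed

text \<open>Both factors tend to 0 at either end, so the fundamental theorem on the whole line has
  no boundary contribution.\<close>

lemma gauss_poly_parts:
  assumes f: "f \<in> gauss_poly" "f' \<in> gauss_poly" "\<And>x. (f has_real_derivative f' x) (at x)"
    and g: "g \<in> gauss_poly" "g' \<in> gauss_poly" "\<And>x. (g has_real_derivative g' x) (at x)"
  shows "(\<integral>x. f' x * g x \<partial>lborel) = - (\<integral>x. f x * g' x \<partial>lborel)"
proof -
  let ?F = "\<lambda>x. f x * g x" and ?F' = "\<lambda>x. f' x * g x + f x * g' x"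
  have i: "integrable lborel (\<lambda>x. f' x * g x)" "integrable lborel (\<lambda>x. f x * g' x)"
    by (intro integrable_gauss_poly_mult f g)+
  have "(LBINT x=-\<infinity>..\<infinity>. ?F' x) = 0 - 0"
  proof (rule interval_integral_FTC_integrable[where F = ?F])
    show "(?F has_vector_derivative ?F' x) (at x)" for x
      unfolding has_real_derivative_iff_has_vector_derivative[symmetric]
      by (rule DERIV_cong[OF DERIV_mult[OF f(3) g(3)]]) simp
    show "isCont ?F' x" for x
    proof -
      have "continuous_on UNIV ?F'" by (intro continuous_intros gauss_poly_continuous f g)
      then show ?thesis by (simp add: continuous_on_eq_continuous_at)
    qed
    show "set_integrable lborel (einterval (- \<infinity>) \<infinity>) ?F'"
      using i by (simp add: set_integrable_def)
    show "((?F \<circ> real_of_ereal) \<longlongrightarrow> 0) (at_right (- \<infinity>))"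
      using tendsto_mult[OF gauss_poly_tendsto_0(2)[OF f(1)] gauss_poly_tendsto_0(2)[OF g(1)]]
      by (simp add: ereal_tendsto_simps)
    show "((?F \<circ> real_of_ereal) \<longlongrightarrow> 0) (at_left \<infinity>)"
      using tendsto_mult[OF gauss_poly_tendsto_0(1)[OF f(1)] gauss_poly_tendsto_0(1)[OF g(1)]]
      by (simp add: ereal_tendsto_simps)
  qed simp
  then have "(\<integral>x. ?F' x \<partial>lborel) = 0"
    by (simp add: interval_lebesgue_integral_def set_lebesgue_integral_def)
  then show ?thesis using i by simp
qed

text \<open>The L2-normalised Hermite functions
  \<open>H_n(x) exp(-x^2/2) / sqrt(2^n n! sqrt pi)\<close>, generated by their normalised three-term
  recurrence, so that neither factorials nor the polynomials \<open>H_n\<close> have to be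
  handled.\<close>

fun hermite_fun :: "nat \<Rightarrow> real \<Rightarrow> real" where
  "hermite_fun 0 x = exp (- (x\<^sup>2) / 2) / sqrt (sqrt pi)"
| "hermite_fun (Suc n) x =
    (sqrt 2 * x * hermite_fun n x - sqrt n * (if n = 0 then 0 else hermite_fun (n - 1) x)) / sqrt (Suc n)"

declare hermite_fun.simps(2) [simp del]

text \<open>For \<open>n = 0\<close> the truncated index \<open>n - 1\<close> is harmless because of
  its factor \<open>sqrt 0\<close>. All lowering formulas below rely on this convention.\<close>

lemma hermite_fun_Suc:
  "sqrt (Suc n) * hermite_fun (Suc n) x = sqrt 2 * x * hermite_fun n x - sqrt n * hermite_fun (n - 1) x"
  by (simp add: hermite_fun.simps(2))

lemma hermite_fun_gauss_poly: "hermite_fun n \<in> gauss_poly"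
proof (induction n rule: less_induct)
  case (less n)
  show ?case
  proof (cases n)
    case 0
    then show ?thesis by (intro gauss_polyI[of _ "[:1 / sqrt (sqrt pi):]"]) simp
  next
    case (Suc m)
    have "(\<lambda>x. (1 / sqrt n) * (sqrt 2 * (x * hermite_fun m x) - sqrt m * hermite_fun (m - 1) x)) \<in> gauss_poly"
      using less.IH[of m] less.IH[of "m - 1"] Suc
      by (intro gauss_poly_cmult gauss_poly_diff gauss_poly_x) auto
    also have "(\<lambda>x. (1 / sqrt n) * (sqrt 2 * (x * hermite_fun m x) - sqrt m * hermite_fun (m - 1) x)) = hermite_fun n"
      using hermite_fun_Suc[of m] Suc by (auto simp: fun_eq_iff field_simps)
    finally show ?thesis .
  qed
qed

text \<open>The lowering form of the derivative: up to the factor \<open>sqrt 2\<close>,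
  \<open>h_n' + x h_n\<close> is the annihilation operator applied to \<open>h_n\<close>.\<close>

definition hermite_fun' :: "nat \<Rightarrow> real \<Rightarrow> real" where
  "hermite_fun' n x = sqrt (2 * n) * hermite_fun (n - 1) x - x * hermite_fun n x"

lemma hermite_fun_deriv: "(hermite_fun n has_real_derivative hermite_fun' n x) (at x)"
proof (induction n rule: less_induct)
  case (less n)
  show ?case
  proof (cases n)
    case 0
    have eq: "hermite_fun 0 = (\<lambda>x. exp (- (x\<^sup>2) / 2) / sqrt (sqrt pi))" by (simp add: fun_eq_iff)
    show ?thesis unfolding 0 hermite_fun'_def unfolding eq
      by (auto intro!: derivative_eq_intros simp: field_simps)
  next
    case (Suc m)
    have eq: "hermite_fun n = (\<lambda>x. (sqrt 2 * x * hermite_fun m x - sqrt m * hermite_fun (m - 1) x) / sqrt n)"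
      using hermite_fun_Suc[of m] Suc by (auto simp: fun_eq_iff field_simps)
    have d1: "(hermite_fun m has_real_derivative hermite_fun' m x) (at x)"
      using less.IH[of m] Suc by simp
    have d2: "((\<lambda>x. sqrt m * hermite_fun (m - 1) x) has_real_derivative sqrt m * hermite_fun' (m - 1) x) (at x)"
      using less.IH[of "m - 1"] Suc by (intro DERIV_cmult) auto
    have "(hermite_fun n has_real_derivative
        (sqrt 2 * hermite_fun m x + sqrt 2 * x * hermite_fun' m x - sqrt m * hermite_fun' (m - 1) x) / sqrt n) (at x)"
    proof -
      have "((\<lambda>x. sqrt 2 * x * hermite_fun m x) has_real_derivative
          sqrt 2 * hermite_fun m x + sqrt 2 * x * hermite_fun' m x) (at x)"
        by (rule derivative_eq_intros d1 refl)+ simp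
      from DERIV_diff[OF this d2] show ?thesis
        unfolding eq by (rule DERIV_cdivide)
    qed
    moreover have "sqrt 2 * hermite_fun m x + sqrt 2 * x * hermite_fun' m x - sqrt m * hermite_fun' (m - 1) x
      = sqrt n * hermite_fun' n x"
    proof (cases m)
      case 0
      then show ?thesis using hermite_fun_Suc[of 0 x] Suc
        by (simp add: hermite_fun'_def algebra_simps)
    next
      case (Suc k)
      have r1: "sqrt m * hermite_fun m x = sqrt 2 * x * hermite_fun k x - sqrt k * hermite_fun (k - 1) x"
        using hermite_fun_Suc[of k x] Suc by simp
      have r2: "sqrt n * hermite_fun n x = sqrt 2 * x * hermite_fun m x - sqrt m * hermite_fun k x"
        using hermite_fun_Suc[of m x] Suc \<open>n = Suc m\<close> by simp
      have n: "real n = real m + 1" using \<open>n = Suc m\<close> by simp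
      have "sqrt n * hermite_fun' n x = sqrt 2 * (sqrt n * sqrt n) * hermite_fun m x - x * (sqrt n * hermite_fun n x)"
        unfolding hermite_fun'_def using \<open>n = Suc m\<close>
        by (simp only: real_sqrt_mult of_nat_mult of_nat_numeral algebra_simps diff_Suc_1)
      also have "\<dots> = sqrt 2 * (m + 1) * hermite_fun m x - x * (sqrt 2 * x * hermite_fun m x - sqrt m * hermite_fun k x)"
        by (simp only: r2) (simp add: n)
      also have "sqrt 2 * (m + 1) * hermite_fun m x = sqrt 2 * hermite_fun m x + sqrt 2 * sqrt m * (sqrt m * hermite_fun m x)"
      proof -
        have "sqrt 2 * sqrt m * (sqrt m * hermite_fun m x) = sqrt 2 * (sqrt m * sqrt m) * hermite_fun m x"
          by (simp only: mult.assoc)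
        then show ?thesis by (simp add: algebra_simps)
      qed
      also have "\<dots> = sqrt 2 * hermite_fun m x + sqrt 2 * sqrt m * (sqrt 2 * x * hermite_fun k x - sqrt k * hermite_fun (k - 1) x)"
        by (simp add: r1)
      finally have "sqrt n * hermite_fun' n x = sqrt 2 * hermite_fun m x
          + sqrt 2 * sqrt m * (sqrt 2 * x * hermite_fun k x - sqrt k * hermite_fun (k - 1) x)
          - x * (sqrt 2 * x * hermite_fun m x - sqrt m * hermite_fun k x)" .
      moreover have "hermite_fun' m x = sqrt 2 * sqrt m * hermite_fun k x - x * hermite_fun m x"
        by (simp only: Suc hermite_fun'_def real_sqrt_mult of_nat_mult of_nat_numeral diff_Suc_1)
      moreover have "hermite_fun' k x = sqrt 2 * sqrt k * hermite_fun (k - 1) x - x * hermite_fun k x"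
        by (simp add: hermite_fun'_def real_sqrt_mult)
      \<comment> \<open>Stated for free variables in place of the roots and function values, the
        remaining claim is a plain ring identity.\<close>
      moreover have ring: "s * hm + s * x * A - q * B = T"
        if "T = s * hm + s * q * (s * x * hk - r * hk1) - x * (s * x * hm - q * hk)"
          "A = s * q * hk - x * hm" "B = s * r * hk1 - x * hk" for s T hm A q B hk r hk1 :: real
        unfolding that by (simp add: algebra_simps)
      ultimately show ?thesis
        unfolding Suc diff_Suc_1 by (intro ring) auto
    qed
    ultimately show ?thesis using Suc by simp
  qed
qed

lemma hermite_fun'_gauss_poly: "hermite_fun' n \<in> gauss_poly"
  unfolding hermite_fun'_def[abs_def]
  by (intro gauss_poly_diff gauss_poly_cmult gauss_poly_x hermite_fun_gauss_poly)

text \<open>Eliminating the lower index by the recurrence leaves the creation operator. The ladder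
  and telescoping arguments below play the two forms of this derivative against each other.\<close>

lemma hermite_fun'_raise:
  "hermite_fun' n x = x * hermite_fun n x - sqrt (2 * Suc n) * hermite_fun (Suc n) x"
proof -
  have "sqrt (2 * Suc n) * hermite_fun (Suc n) x = sqrt 2 * (sqrt (Suc n) * hermite_fun (Suc n) x)"
    by (simp only: real_sqrt_mult of_nat_mult of_nat_numeral mult.assoc)
  also have "\<dots> = (sqrt 2 * sqrt 2) * x * hermite_fun n x - sqrt 2 * sqrt n * hermite_fun (n - 1) x"
    unfolding hermite_fun_Suc by (simp only: algebra_simps)
  finally show ?thesis by (simp add: hermite_fun'_def real_sqrt_mult)
qed

text \<open>The eigenvalue equation of the one-dimensional oscillator: differentiate the lowering
  form and insert the raising form at \<open>n - 1\<close>.\<close>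

lemma hermite_fun'_deriv:
  "(hermite_fun' n has_real_derivative (x\<^sup>2 - (2 * real n + 1)) * hermite_fun n x) (at x)"
proof -
  have "(hermite_fun' n has_real_derivative
      sqrt (2 * n) * hermite_fun' (n - 1) x - (hermite_fun n x + x * hermite_fun' n x)) (at x)"
    unfolding hermite_fun'_def[of n, abs_def]
    by (rule derivative_eq_intros hermite_fun_deriv refl)+ (simp add: hermite_fun'_def)
  moreover have "sqrt (2 * n) * hermite_fun' (n - 1) x
      = sqrt (2 * n) * x * hermite_fun (n - 1) x - 2 * n * hermite_fun n x"
  proof (cases n)
    case (Suc k)
    have "sqrt (2 * n) * hermite_fun' (n - 1) x
        = sqrt (2 * n) * (x * hermite_fun k x) - (sqrt (2 * n) * sqrt (2 * n)) * hermite_fun n x"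
      unfolding Suc diff_Suc_1 hermite_fun'_raise[of k] by (simp only: algebra_simps)
    then show ?thesis using Suc by (simp add: mult.assoc)
  qed simp
  ultimately show ?thesis
    by (elim DERIV_cong) (simp add: hermite_fun'_def algebra_simps power2_eq_square)
qed

text \<open>\<open>x - d/dx\<close> raises, \<open>x + d/dx\<close> lowers, and integration by parts
  makes them adjoint to each other.\<close>

lemma hermite_ladder:
  "sqrt (Suc n) * (\<integral>x. hermite_fun (Suc n) x * hermite_fun m x \<partial>lborel)
    = sqrt m * (\<integral>x. hermite_fun n x * hermite_fun (m - 1) x \<partial>lborel)"
proof -
  note H = hermite_fun_gauss_poly hermite_fun'_gauss_poly
  have i: "integrable lborel (\<lambda>x. x * hermite_fun n x * hermite_fun m x)"
    "integrable lborel (\<lambda>x. hermite_fun' n x * hermite_fun m x)"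
    "integrable lborel (\<lambda>x. hermite_fun n x * hermite_fun' m x)"
    by (intro integrable_gauss_poly_mult gauss_poly_x H)+
  have "sqrt (2 * Suc n) * (\<integral>x. hermite_fun (Suc n) x * hermite_fun m x \<partial>lborel)
      = (\<integral>x. (x * hermite_fun n x - hermite_fun' n x) * hermite_fun m x \<partial>lborel)"
    by (subst integral_mult_right_zero[symmetric], intro Bochner_Integration.integral_cong refl)
      (simp only: hermite_fun'_raise mult.assoc diff_diff_eq2 add_diff_cancel_left')
  also have "\<dots> = (\<integral>x. x * hermite_fun n x * hermite_fun m x \<partial>lborel)
      + (\<integral>x. hermite_fun n x * hermite_fun' m x \<partial>lborel)"
    using i gauss_poly_parts[OF H[of n] hermite_fun_deriv H[of m] hermite_fun_deriv]
    by (simp add: left_diff_distrib)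
  also have "\<dots> = (\<integral>x. sqrt (2 * m) * (hermite_fun n x * hermite_fun (m - 1) x) \<partial>lborel)"
    using i by (subst Bochner_Integration.integral_add[symmetric])
      (auto intro!: Bochner_Integration.integral_cong simp: hermite_fun'_def algebra_simps)
  also have "\<dots> = sqrt (2 * m) * (\<integral>x. hermite_fun n x * hermite_fun (m - 1) x \<partial>lborel)"
    by simp
  finally have "sqrt 2 * (sqrt (Suc n) * (\<integral>x. hermite_fun (Suc n) x * hermite_fun m x \<partial>lborel))
      = sqrt 2 * (sqrt m * (\<integral>x. hermite_fun n x * hermite_fun (m - 1) x \<partial>lborel))"
    by (simp only: real_sqrt_mult of_nat_mult of_nat_numeral mult.assoc)
  then show ?thesis by simp
qed

lemma integrable_hermite_mult: "integrable lborel (\<lambda>x. hermite_fun n x * hermite_fun m x)"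
  by (intro integrable_gauss_poly_mult hermite_fun_gauss_poly)

text \<open>The ladder identity lowers both indices at once, down to a zero index, where the factor
  \<open>sqrt 0\<close> kills the product. Only the Gaussian integral for \<open>n = m = 0\<close>
  is computed.\<close>

lemma hermite_orthonormal:
  "(\<integral>x. hermite_fun n x * hermite_fun m x \<partial>lborel) = (if n = m then 1 else 0)"
proof (induction n arbitrary: m)
  case 0
  show ?case
  proof (cases m)
    case 0
    have "(\<integral>x. hermite_fun 0 x * hermite_fun 0 x \<partial>lborel) = (\<integral>x. exp (- ((x::real)\<^sup>2)) / sqrt pi \<partial>lborel)"
      by (intro Bochner_Integration.integral_cong)
        (auto simp: exp_add[symmetric] real_sqrt_mult_self field_simps)
    also have "\<dots> = 1" using integral_exp_square by simp
    finally show ?thesis unfolding 0 by (simp only: refl if_True)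
  next
    case (Suc k)
    have "sqrt (Suc k) * (\<integral>x. hermite_fun (Suc k) x * hermite_fun 0 x \<partial>lborel) = 0"
      using hermite_ladder[of k 0] by simp
    then show ?thesis using Suc by (simp add: mult.commute)
  qed
next
  case (Suc n)
  show ?case
  proof (cases m)
    case 0
    then show ?thesis using hermite_ladder[of n 0] by simp
  next
    case (Suc k)
    then show ?thesis using hermite_ladder[of n m] Suc.IH[of k] by auto
  qed
qed

section \<open>Size of Hermite functions: values at the origin and the diagonal kernel\<close>

lemma hermite_fun_measurable [measurable]: "hermite_fun n \<in> borel_measurable borel"
  by (intro gauss_poly_measurable hermite_fun_gauss_poly)

text \<open>At the origin the recurrence skips one index: odd values vanish, and the squares of the
  even ones are products of ratios \<open>(n-1)/n\<close>. The induction closes because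
  \<open>(k+1)(k+3) <= (k+2)^2\<close>.\<close>

lemma hermite_fun_0_bound: "(hermite_fun n 0)\<^sup>2 \<le> 1 / sqrt (n + 1)"
proof (induction n rule: less_induct)
  case (less n)
  consider "n = 0" | "n = 1" | k where "n = Suc (Suc k)" by (metis One_nat_def not0_implies_Suc)
  then show ?case
  proof cases
    case 1
    have "1 \<le> sqrt pi" using pi_gt3 by simp
    then show ?thesis using 1 by (simp add: power_divide)
  next
    case 2
    then show ?thesis using hermite_fun_Suc[of 0 0] by simp
  next
    case 3
    have "sqrt n * hermite_fun n 0 = - sqrt (k + 1) * hermite_fun k 0"
      using hermite_fun_Suc[of "Suc k" 0] 3 by (simp add: algebra_simps)
    then have "(sqrt n * hermite_fun n 0)\<^sup>2 = (sqrt (k + 1) * hermite_fun k 0)\<^sup>2" by simp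
    then have "n * (hermite_fun n 0)\<^sup>2 = (k + 1) * (hermite_fun k 0)\<^sup>2"
      by (simp add: power_mult_distrib)
    also have "\<dots> \<le> (k + 1) * (1 / sqrt (k + 1))"
      using less.IH[of k] 3 by (intro mult_left_mono) auto
    also have "\<dots> = sqrt (k + 1)" by (simp add: real_div_sqrt)
    also have "\<dots> \<le> n / sqrt (n + 1)"
    proof -
      have "sqrt (k + 1) * sqrt (n + 1) = sqrt ((k + 1) * (n + 1))"
        by (simp only: real_sqrt_mult of_nat_mult)
      also have "\<dots> \<le> sqrt ((real n)\<^sup>2)"
        using 3 by (intro real_sqrt_le_mono) (simp add: power2_eq_square algebra_simps)
      finally show ?thesis by (simp add: pos_le_divide_eq)
    qed
    finally have "n * (hermite_fun n 0)\<^sup>2 \<le> n * (1 / sqrt (n + 1))" by simp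
    then show ?thesis using 3 by (subst (asm) mult_le_cancel_left_pos) auto
  qed
qed

text \<open>Writing \<open>2 h h'\<close> as one lowering plus one raising form turns each summand
  into a difference of neighbouring products, and the sum telescopes. This is the
  Christoffel-Darboux kernel on the diagonal.\<close>

lemma hermite_christoffel_deriv:
  "((\<lambda>x. \<Sum>n\<le>m. (hermite_fun n x)\<^sup>2) has_real_derivative
     - sqrt (2 * Suc m) * (hermite_fun m x * hermite_fun (Suc m) x)) (at x)"
proof -
  have d: "((\<lambda>x. (hermite_fun n x)\<^sup>2) has_real_derivative
      sqrt (2 * n) * (hermite_fun (n - 1) x * hermite_fun n x)
      - sqrt (2 * Suc n) * (hermite_fun n x * hermite_fun (Suc n) x)) (at x)" for n
  proof -
    have "((\<lambda>x. (hermite_fun n x)\<^sup>2) has_real_derivative 2 * hermite_fun n x * hermite_fun' n x) (at x)"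
      by (rule derivative_eq_intros hermite_fun_deriv refl)+ simp
    moreover have "2 * hermite_fun n x * hermite_fun' n x = hermite_fun n x * (hermite_fun' n x + hermite_fun' n x)"
      by simp
    also have "\<dots> = hermite_fun n x * ((sqrt (2 * n) * hermite_fun (n - 1) x - x * hermite_fun n x)
        + (x * hermite_fun n x - sqrt (2 * Suc n) * hermite_fun (Suc n) x))"
      by (subst (2) hermite_fun'_raise) (simp only: hermite_fun'_def)
    ultimately show ?thesis by (elim DERIV_cong) (simp only: algebra_simps)
  qed
  have "((\<lambda>x. \<Sum>n\<le>m. (hermite_fun n x)\<^sup>2) has_real_derivative
     (\<Sum>n\<le>m. sqrt (2 * n) * (hermite_fun (n - 1) x * hermite_fun n x)
      - sqrt (2 * Suc n) * (hermite_fun n x * hermite_fun (Suc n) x))) (at x)"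
    by (intro DERIV_sum d)
  also have "(\<Sum>n\<le>m. sqrt (2 * n) * (hermite_fun (n - 1) x * hermite_fun n x)
      - sqrt (2 * Suc n) * (hermite_fun n x * hermite_fun (Suc n) x))
      = - sqrt (2 * Suc m) * (hermite_fun m x * hermite_fun (Suc m) x)"
  proof (induction m)
    case (Suc m)
    then show ?case unfolding sum.atMost_Suc by (simp only: diff_Suc_1)
  qed simp
  finally show ?thesis .
qed

text \<open>The sum tends to 0 at infinity, so it is the integral of minus its derivative over a
  half-line. By the arithmetic-geometric inequality this is at most \<open>sqrt(2(m+1))\<close>
  times the mean of the squared norms of \<open>h_m\<close> and \<open>h_(m+1)\<close>, both of
  which are 1.\<close>

lemma hermite_christoffel_le: "(\<Sum>n\<le>m. (hermite_fun n x)\<^sup>2) \<le> sqrt (2 * Suc m)"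
proof -
  let ?K = "\<lambda>x. \<Sum>n\<le>m. (hermite_fun n x)\<^sup>2"
  let ?k = "\<lambda>x. - sqrt (2 * Suc m) * (hermite_fun m x * hermite_fun (Suc m) x)"
  have bound: "?K x - ?K y \<le> sqrt (2 * Suc m)" if "x \<le> y" for y
  proof -
    have cont: "continuous_on {x..y} ?k"
      by (intro continuous_intros gauss_poly_continuous hermite_fun_gauss_poly)
    have FTC: "(\<integral>t. indicator {x..y} t *\<^sub>R ?k t \<partial>lborel) = ?K y - ?K x"
    proof (rule integral_FTC_atLeastAtMost[OF that _ cont])
      show "(?K has_vector_derivative ?k t) (at t within {x..y})" for t
        unfolding has_real_derivative_iff_has_vector_derivative[symmetric]
        by (rule has_field_derivative_at_within[OF hermite_christoffel_deriv])
    qed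
    have i: "integrable lborel (\<lambda>t. hermite_fun m t * hermite_fun (Suc m) t)"
      "integrable lborel (\<lambda>t. (hermite_fun m t)\<^sup>2)" "integrable lborel (\<lambda>t. (hermite_fun (Suc m) t)\<^sup>2)"
      unfolding power2_eq_square by (rule integrable_hermite_mult)+
    have "?K x - ?K y = (\<integral>t. - (indicator {x..y} t *\<^sub>R ?k t) \<partial>lborel)"
      using FTC by simp
    also have "\<dots> \<le> (\<integral>t. sqrt (2 * Suc m) * (((hermite_fun m t)\<^sup>2 + (hermite_fun (Suc m) t)\<^sup>2) / 2) \<partial>lborel)"
    proof (rule integral_mono)
      show "integrable lborel (\<lambda>t. - (indicator {x..y} t *\<^sub>R ?k t))"
        using i(1) by (intro Bochner_Integration.integrable_minus integrable_mult_indicator integrable_mult_right) auto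
      show "integrable lborel (\<lambda>t. sqrt (2 * Suc m) * (((hermite_fun m t)\<^sup>2 + (hermite_fun (Suc m) t)\<^sup>2) / 2))"
        using i by (intro integrable_mult_right integrable_divide Bochner_Integration.integrable_add)
      fix t
      have "0 \<le> (hermite_fun m t - hermite_fun (Suc m) t)\<^sup>2" by simp
      then have 1: "hermite_fun m t * hermite_fun (Suc m) t \<le> ((hermite_fun m t)\<^sup>2 + (hermite_fun (Suc m) t)\<^sup>2) / 2"
        by (simp add: power2_diff)
      have "0 \<le> sqrt (2 * Suc m) * (((hermite_fun m t)\<^sup>2 + (hermite_fun (Suc m) t)\<^sup>2) / 2)" by simp
      moreover have "sqrt (2 * Suc m) * (hermite_fun m t * hermite_fun (Suc m) t)
          \<le> sqrt (2 * Suc m) * (((hermite_fun m t)\<^sup>2 + (hermite_fun (Suc m) t)\<^sup>2) / 2)"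
        by (intro mult_left_mono 1) simp
      ultimately show "- (indicator {x..y} t *\<^sub>R ?k t)
          \<le> sqrt (2 * Suc m) * (((hermite_fun m t)\<^sup>2 + (hermite_fun (Suc m) t)\<^sup>2) / 2)"
        by (auto simp: indicator_def)
    qed
    also have "\<dots> = sqrt (2 * Suc m)"
      using i hermite_orthonormal[of m m] hermite_orthonormal[of "Suc m" "Suc m"]
      by (simp add: power2_eq_square)
    finally show ?thesis .
  qed
  have "((\<lambda>y. ?K x - ?K y) \<longlongrightarrow> ?K x - (\<Sum>n\<le>m. 0\<^sup>2)) at_top"
    by (intro tendsto_intros gauss_poly_tendsto_0 hermite_fun_gauss_poly)
  then have "?K x - (\<Sum>n\<le>m. 0\<^sup>2) \<le> sqrt (2 * Suc m)"
    by (rule tendsto_upperbound) (use bound in \<open>auto intro: eventually_at_top_linorderI[of x]\<close>)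
  then show ?thesis by simp
qed

section \<open>Rotating a pair of oscillators\<close>

text \<open>On coefficient arrays of \<open>h_a(X) h_b(Y)\<close> this is the creation operator in
  \<open>X\<close> plus \<open>e\<close> times the one in \<open>Y\<close>. For \<open>e = 1\<close>
  and \<open>e = -1\<close> it is \<open>sqrt 2\<close> times the creation operator of
  \<open>x\<close> and of \<open>y\<close>; \<open>fock_down\<close> is its adjoint.\<close>

definition fock_up :: "real \<Rightarrow> (nat \<Rightarrow> nat \<Rightarrow> real) \<Rightarrow> nat \<Rightarrow> nat \<Rightarrow> real" where
  "fock_up e f a b = sqrt a * f (a - 1) b + e * (sqrt b * f a (b - 1))"

definition fock_down :: "real \<Rightarrow> (nat \<Rightarrow> nat \<Rightarrow> real) \<Rightarrow> nat \<Rightarrow> nat \<Rightarrow> real" where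
  "fock_down e f a b = sqrt (Suc a) * f (Suc a) b + e * (sqrt (Suc b) * f a (Suc b))"

lemma fock_up_commute: "fock_up e (fock_up e' f) a b = fock_up e' (fock_up e f) a b"
  unfolding fock_up_def by (simp add: algebra_simps)

lemma sqrt_mult_self_left: "x \<ge> 0 \<Longrightarrow> sqrt x * (sqrt x * y) = x * y"
  by (simp flip: mult.assoc)

text \<open>The canonical commutation relation. For signs the scalar is 2 if they are equal and 0 if
  they are opposite, so the operators of \<open>x\<close> and of \<open>y\<close> commute with each
  other.\<close>

lemma fock_down_up:
  "fock_down e (fock_up e' f) a b = fock_up e' (fock_down e f) a b + (1 + e * e') * f a b"
  by (cases a; cases b)
    (simp_all add: fock_up_def fock_down_def algebra_simps sqrt_mult_self_left del: of_nat_Suc,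
     simp_all add: algebra_simps)

text \<open>Expanding \<open>(X' + Y')(X - Y) + (X' - Y')(X + Y)\<close>, with primes for creation,
  cancels the mixed terms. Here the difference of the rotated number operators becomes an exchange
  of quanta between \<open>x\<close> and \<open>y\<close>.\<close>

lemma fock_number_diff:
  "fock_up 1 (fock_down (-1) f) a b + fock_up (-1) (fock_down 1 f) a b = 2 * (real a - real b) * f a b"
  by (cases a; cases b)
    (simp_all add: fock_up_def fock_down_def algebra_simps sqrt_mult_self_left del: of_nat_Suc)

lemma fock_up_cmult: "fock_up e (\<lambda>a b. c * f a b) a b = c * fock_up e f a b"
  by (simp add: fock_up_def algebra_simps)

lemma fock_down_cmult: "fock_down e (\<lambda>a b. c * f a b) a b = c * fock_down e f a b"
  by (simp add: fock_down_def algebra_simps)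

text \<open>\<open>rot_coeff n m\<close> is the coefficient array of \<open>h\<^sub>n(x) h\<^sub>m(y)\<close> in the products
  \<open>h\<^sub>a((x+y)/\<surd>2) h\<^sub>b((x-y)/\<surd>2)\<close>; it is built with the creation operators of the two
  rotated variables.\<close>

fun rot_coeff :: "nat \<Rightarrow> nat \<Rightarrow> nat \<Rightarrow> nat \<Rightarrow> real" where
  "rot_coeff 0 0 a b = (if a = 0 \<and> b = 0 then 1 else 0)"
| "rot_coeff 0 (Suc m) a b = fock_up (-1) (rot_coeff 0 m) a b / sqrt (2 * Suc m)"
| "rot_coeff (Suc n) m a b = fock_up 1 (rot_coeff n m) a b / sqrt (2 * Suc n)"

lemma rot_raise_left: "fock_up 1 (rot_coeff n m) a b = sqrt (2 * Suc n) * rot_coeff (Suc n) m a b"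
  by simp

text \<open>The recursion of \<open>rot_coeff\<close> adds the quanta of \<open>x\<close> last, so
  the raising operator of \<open>y\<close> has to be moved past them; it commutes with each.\<close>

lemma rot_raise_right: "fock_up (-1) (rot_coeff n m) a b = sqrt (2 * Suc m) * rot_coeff n (Suc m) a b"
proof (induction n arbitrary: a b)
  case (Suc n)
  have 1: "rot_coeff (Suc n) m' = (\<lambda>a b. 1 / sqrt (2 * Suc n) * fock_up 1 (rot_coeff n m') a b)" for m'
    by (simp add: fun_eq_iff)
  have 2: "fock_up (-1) (rot_coeff n m) = (\<lambda>a b. sqrt (2 * Suc m) * rot_coeff n (Suc m) a b)"
    using Suc.IH by (auto simp: fun_eq_iff)
  have "fock_up (-1) (rot_coeff (Suc n) m) a b
      = 1 / sqrt (2 * Suc n) * fock_up 1 (fock_up (-1) (rot_coeff n m)) a b"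
    by (subst 1, subst fock_up_cmult, subst fock_up_commute, rule refl)
  also have "\<dots> = sqrt (2 * Suc m) * (1 / sqrt (2 * Suc n) * fock_up 1 (rot_coeff n (Suc m)) a b)"
    by (subst 2, subst fock_up_cmult) (simp only: mult.left_commute)
  also have "\<dots> = sqrt (2 * Suc m) * rot_coeff (Suc n) (Suc m) a b"
    by (subst 1) simp
  finally show ?case .
qed simp

text \<open>Each creation operator raises \<open>a + b\<close> by one. Conservation of the total
  index is what carries the time phase through the rotation.\<close>

lemma rot_support: "rot_coeff n m a b \<noteq> 0 \<Longrightarrow> a + b = n + m"
proof (induction n m a b rule: rot_coeff.induct)
  case (1 a b)
  then show ?case by (auto split: if_splits)
next
  case (2 m a b)
  then have "a \<noteq> 0 \<and> rot_coeff 0 m (a - 1) b \<noteq> 0 \<or> b \<noteq> 0 \<and> rot_coeff 0 m a (b - 1) \<noteq> 0"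
    by (auto simp: fock_up_def)
  then show ?case using 2(1)[of "a - 1" b] 2(1)[of a "b - 1"] by auto
next
  case (3 n m a b)
  then have "a \<noteq> 0 \<and> rot_coeff n m (a - 1) b \<noteq> 0 \<or> b \<noteq> 0 \<and> rot_coeff n m a (b - 1) \<noteq> 0"
    by (auto simp: fock_up_def)
  then show ?case using 3(1)[of "a - 1" b] 3(1)[of a "b - 1"] by auto
qed

text \<open>No quantum of \<open>x\<close> is present, and the lowering operator of \<open>x\<close>
  commutes with the raising operators of \<open>y\<close> that build the array.\<close>

lemma rot_lower_base: "fock_down 1 (rot_coeff 0 m) a b = 0"
proof (induction m arbitrary: a b)
  case 0
  then show ?case by (simp add: fock_down_def)
next
  case (Suc m)
  have 1: "rot_coeff 0 (Suc m) = (\<lambda>a b. 1 / sqrt (2 * Suc m) * fock_up (-1) (rot_coeff 0 m) a b)"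
    by (simp add: fun_eq_iff)
  have 2: "fock_down 1 (rot_coeff 0 m) = (\<lambda>a b. 0)" using Suc.IH by (simp add: fun_eq_iff)
  show ?case
    by (subst 1, subst fock_down_cmult, subst fock_down_up, subst 2) (simp add: fock_up_def)
qed

text \<open>Each raising operator passed adds 2 to the scalar; with the normalising roots the total
  \<open>2 * n\<close> becomes \<open>sqrt (2 * n)\<close>.\<close>

lemma rot_lower_left: "fock_down 1 (rot_coeff n m) a b = sqrt (2 * n) * rot_coeff (n - 1) m a b"
proof (induction n arbitrary: a b)
  case 0
  then show ?case using rot_lower_base by simp
next
  case (Suc n)
  have 1: "rot_coeff (Suc n) m = (\<lambda>a b. 1 / sqrt (2 * Suc n) * fock_up 1 (rot_coeff n m) a b)"
    by (simp add: fun_eq_iff)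
  have 2: "fock_down 1 (rot_coeff n m) = (\<lambda>a b. sqrt (2 * n) * rot_coeff (n - 1) m a b)"
    using Suc.IH by (simp add: fun_eq_iff)
  have 3: "fock_up 1 (\<lambda>a b. sqrt (2 * n) * rot_coeff (n - 1) m a b) a b = 2 * n * rot_coeff n m a b"
  proof (cases n)
    case (Suc k)
    have "fock_up 1 (\<lambda>a b. sqrt (2 * n) * rot_coeff (n - 1) m a b) a b
        = sqrt (2 * n) * (sqrt (2 * n) * rot_coeff n m a b)"
      by (subst fock_up_cmult) (simp only: Suc diff_Suc_1 rot_raise_left)
    then show ?thesis by (simp add: sqrt_mult_self_left del: rot_coeff.simps)
  qed (simp add: fock_up_def)
  have "fock_down 1 (rot_coeff (Suc n) m) a b = 1 / sqrt (2 * Suc n) * (2 * Suc n * rot_coeff n m a b)"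
    by (subst 1, subst fock_down_cmult, subst fock_down_up, subst 2, subst 3) (simp add: algebra_simps)
  also have "\<dots> = (2 * Suc n) / sqrt (2 * Suc n) * rot_coeff n m a b" by simp
  also have "\<dots> = sqrt (2 * Suc n) * rot_coeff n m a b" by (subst real_div_sqrt) simp_all
  finally show ?case by (simp only: diff_Suc_1)
qed

lemma rot_lower_right: "fock_down (-1) (rot_coeff n m) a b = sqrt (2 * m) * rot_coeff n (m - 1) a b"
proof (induction n arbitrary: a b)
  case 0
  show ?case
  proof (induction m arbitrary: a b)
    case 0
    then show ?case by (simp add: fock_down_def)
  next
    case (Suc m)
    have 1: "rot_coeff 0 (Suc m) = (\<lambda>a b. 1 / sqrt (2 * Suc m) * fock_up (-1) (rot_coeff 0 m) a b)"
      by (simp add: fun_eq_iff)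
    have 2: "fock_down (-1) (rot_coeff 0 m) = (\<lambda>a b. sqrt (2 * m) * rot_coeff 0 (m - 1) a b)"
      using Suc.IH by (simp add: fun_eq_iff)
    have 3: "fock_up (-1) (\<lambda>a b. sqrt (2 * m) * rot_coeff 0 (m - 1) a b) a b = 2 * m * rot_coeff 0 m a b"
    proof (cases m)
      case (Suc k)
      have "fock_up (-1) (\<lambda>a b. sqrt (2 * m) * rot_coeff 0 (m - 1) a b) a b
          = sqrt (2 * m) * (sqrt (2 * m) * rot_coeff 0 m a b)"
        by (subst fock_up_cmult) (simp only: Suc diff_Suc_1 rot_raise_right)
      then show ?thesis by (simp add: sqrt_mult_self_left del: rot_coeff.simps)
    qed (simp add: fock_up_def)
    have "fock_down (-1) (rot_coeff 0 (Suc m)) a b = 1 / sqrt (2 * Suc m) * (2 * Suc m * rot_coeff 0 m a b)"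
      by (subst 1, subst fock_down_cmult, subst fock_down_up, subst 2, subst 3) (simp add: algebra_simps)
    also have "\<dots> = (2 * Suc m) / sqrt (2 * Suc m) * rot_coeff 0 m a b" by simp
    also have "\<dots> = sqrt (2 * Suc m) * rot_coeff 0 m a b" by (subst real_div_sqrt) simp_all
    finally show ?case by (simp only: diff_Suc_1)
  qed
next
  case (Suc n)
  have 1: "rot_coeff (Suc n) m' = (\<lambda>a b. 1 / sqrt (2 * Suc n) * fock_up 1 (rot_coeff n m') a b)" for m'
    by (simp add: fun_eq_iff)
  have 2: "fock_down (-1) (rot_coeff n m) = (\<lambda>a b. sqrt (2 * m) * rot_coeff n (m - 1) a b)"
    using Suc.IH by (simp add: fun_eq_iff)
  show ?case
    by (subst (1 2) 1, subst fock_down_cmult, subst fock_down_up, subst 2, subst fock_up_cmult) simp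
qed

text \<open>\<open>fock_number_diff\<close> on the rotated states: multiplication by
  \<open>a - b\<close> moves one quantum between \<open>x\<close> and \<open>y\<close>. Read on
  coefficients, this becomes \<open>exchange\<close>.\<close>

lemma rot_number_diff:
  "(real a - real b) * rot_coeff n m a b
     = sqrt (n * Suc m) * rot_coeff (n - 1) (Suc m) a b + sqrt (Suc n * m) * rot_coeff (Suc n) (m - 1) a b"
proof -
  have 1: "fock_down (-1) (rot_coeff n m) = (\<lambda>a b. sqrt (2 * m) * rot_coeff n (m - 1) a b)"
    "fock_down 1 (rot_coeff n m) = (\<lambda>a b. sqrt (2 * n) * rot_coeff (n - 1) m a b)"
    using rot_lower_left rot_lower_right by (auto simp: fun_eq_iff)
  have "2 * (real a - real b) * rot_coeff n m a b
      = sqrt (2 * m) * (sqrt (2 * Suc n) * rot_coeff (Suc n) (m - 1) a b)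
      + sqrt (2 * n) * (sqrt (2 * Suc m) * rot_coeff (n - 1) (Suc m) a b)"
    by (subst fock_number_diff[symmetric], subst 1, subst 1)
      (simp only: fock_up_cmult rot_raise_left rot_raise_right)
  also have "\<dots> = (sqrt 2 * sqrt 2) * (sqrt (Suc n * m) * rot_coeff (Suc n) (m - 1) a b
      + sqrt (n * Suc m) * rot_coeff (n - 1) (Suc m) a b)"
    by (simp only: real_sqrt_mult of_nat_mult of_nat_numeral algebra_simps)
  finally have "2 * ((real a - real b) * rot_coeff n m a b) = 2 * (sqrt (Suc n * m) * rot_coeff (Suc n) (m - 1) a b
      + sqrt (n * Suc m) * rot_coeff (n - 1) (Suc m) a b)"
    by (simp only: real_sqrt_mult_self abs_numeral mult.assoc)
  then have "(real a - real b) * rot_coeff n m a b = sqrt (Suc n * m) * rot_coeff (Suc n) (m - 1) a b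
      + sqrt (n * Suc m) * rot_coeff (n - 1) (Suc m) a b"
    by (simp only: mult_cancel_left) (simp del: rot_coeff.simps)
  then show ?thesis by (simp only: add.commute)
qed

text \<open>A rotated state lives on the single diagonal \<open>a + b = n + m\<close>. Summing over
  a whole triangle adds only zeros and lets states of different levels share one index set.\<close>

definition tri :: "nat \<Rightarrow> (nat \<times> nat) set" where
  "tri K = {(a, b). a + b \<le> K}"

lemma mem_tri [simp]: "(a, b) \<in> tri K \<longleftrightarrow> a + b \<le> K"
  by (simp add: tri_def)

lemma finite_tri [simp]: "finite (tri K)"
  by (rule finite_subset[of _ "{..K} \<times> {..K}"]) (auto simp: tri_def)

lemma sum_tri_Suc_fst:
  fixes F :: "nat \<Rightarrow> nat \<Rightarrow> 'a::comm_monoid_add"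
  assumes "\<And>b. F 0 b = 0"
  shows "(\<Sum>(a, b)\<in>tri (Suc K). F a b) = (\<Sum>(a, b)\<in>tri K. F (Suc a) b)"
proof -
  have "(\<Sum>(a, b)\<in>tri (Suc K). F a b) = (\<Sum>(a, b)\<in>(\<lambda>(a, b). (Suc a, b)) ` tri K. F a b)"
  proof (rule sum.mono_neutral_right)
    show "\<forall>i\<in>tri (Suc K) - (\<lambda>(a, b). (Suc a, b)) ` tri K. (case i of (a, b) \<Rightarrow> F a b) = 0"
    proof
      fix i assume i: "i \<in> tri (Suc K) - (\<lambda>(a, b). (Suc a, b)) ` tri K"
      obtain a b where ab: "i = (a, b)" by (cases i)
      have "a = 0"
      proof (rule ccontr)
        assume "a \<noteq> 0"
        then have "i = (\<lambda>(a, b). (Suc a, b)) (a - 1, b)" "(a - 1, b) \<in> tri K"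
          using i ab by auto
        then show False using i by blast
      qed
      then show "(case i of (a, b) \<Rightarrow> F a b) = 0" using ab assms by simp
    qed
    show "(\<lambda>(a, b). (Suc a, b)) ` tri K \<subseteq> tri (Suc K)" by (auto split: if_splits)
  qed simp
  also have "\<dots> = (\<Sum>(a, b)\<in>tri K. F (Suc a) b)"
    by (subst sum.reindex) (auto simp: inj_on_def case_prod_unfold)
  finally show ?thesis .
qed

lemma sum_tri_swap: "(\<Sum>(a, b)\<in>tri K. F a b) = (\<Sum>(a, b)\<in>tri K. F b a)"
  by (rule sum.reindex_bij_witness[of _ prod.swap prod.swap]) (auto split: if_splits)

lemma sum_tri_Suc_snd:
  fixes F :: "nat \<Rightarrow> nat \<Rightarrow> 'a::comm_monoid_add"
  assumes "\<And>a. F a 0 = 0"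
  shows "(\<Sum>(a, b)\<in>tri (Suc K). F a b) = (\<Sum>(a, b)\<in>tri K. F a (Suc b))"
  by (subst (1 2) sum_tri_swap, rule sum_tri_Suc_fst) (rule assms)

text \<open>An index shift in each of the two terms; the triangle on the left is one level larger
  because creation raises the level.\<close>

lemma fock_up_adjoint:
  "(\<Sum>(a, b)\<in>tri (Suc K). fock_up e f a b * g a b) = (\<Sum>(a, b)\<in>tri K. f a b * fock_down e g a b)"
proof -
  have "(\<Sum>(a, b)\<in>tri (Suc K). fock_up e f a b * g a b)
      = (\<Sum>(a, b)\<in>tri (Suc K). sqrt a * f (a - 1) b * g a b) + (\<Sum>(a, b)\<in>tri (Suc K). e * (sqrt b * f a (b - 1)) * g a b)"
    by (simp add: fock_up_def sum.distrib[symmetric] case_prod_unfold algebra_simps)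
  also have "\<dots> = (\<Sum>(a, b)\<in>tri K. sqrt (Suc a) * f a b * g (Suc a) b) + (\<Sum>(a, b)\<in>tri K. e * (sqrt (Suc b) * f a b) * g a (Suc b))"
    by (subst sum_tri_Suc_fst, simp, subst sum_tri_Suc_snd) simp_all
  also have "\<dots> = (\<Sum>(a, b)\<in>tri K. f a b * fock_down e g a b)"
    by (simp add: fock_down_def sum.distrib[symmetric] case_prod_unfold algebra_simps)
  finally show ?thesis .
qed

text \<open>A creation operator is peeled off the first array and moved to the second as a lowering
  operator. Each move lowers \<open>K\<close> by one, which the hypothesis on \<open>K\<close>
  leaves room for.\<close>

lemma rot_orthonormal:
  assumes "n + m \<le> K"
  shows "(\<Sum>(a, b)\<in>tri K. rot_coeff n m a b * rot_coeff n' m' a b) = (if n = n' \<and> m = m' then 1 else 0)"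
  using assms
proof (induction n arbitrary: n' K)
  case 0
  then show ?case
  proof (induction m arbitrary: m' K)
    case 0
    have "(\<Sum>(a, b)\<in>tri K. rot_coeff 0 0 a b * rot_coeff n' m' a b)
        = (\<Sum>(a, b)\<in>{(0, 0)}. rot_coeff 0 0 a b * rot_coeff n' m' a b)"
      by (intro sum.mono_neutral_right) (auto split: if_splits)
    also have "\<dots> = (if 0 = n' \<and> 0 = m' then 1 else 0)"
      using rot_support[of n' m' 0 0] by (cases "n' = 0 \<and> m' = 0") auto
    finally show ?case .
  next
    case (Suc m)
    then obtain K' where K: "K = Suc K'" "0 + m \<le> K'" by (cases K) auto
    have "sqrt (2 * Suc m) * (\<Sum>(a, b)\<in>tri K. rot_coeff 0 (Suc m) a b * rot_coeff n' m' a b)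
        = (\<Sum>(a, b)\<in>tri K. fock_up (-1) (rot_coeff 0 m) a b * rot_coeff n' m' a b)"
      unfolding sum_distrib_left rot_raise_right by (simp only: case_prod_unfold mult.assoc)
    also have "\<dots> = sqrt (2 * m') * (\<Sum>(a, b)\<in>tri K'. rot_coeff 0 m a b * rot_coeff n' (m' - 1) a b)"
      unfolding K(1) fock_up_adjoint rot_lower_right sum_distrib_left
      by (simp only: case_prod_unfold mult.left_commute)
    also have "\<dots> = sqrt (2 * Suc m) * (if 0 = n' \<and> Suc m = m' then 1 else 0)"
      using Suc.IH[OF K(2), of "m' - 1"] by (cases m') (auto simp: case_prod_unfold)
    finally show ?case by simp
  qed
next
  case (Suc n)
  then obtain K' where K: "K = Suc K'" "n + m \<le> K'" by (cases K) auto
  have "sqrt (2 * Suc n) * (\<Sum>(a, b)\<in>tri K. rot_coeff (Suc n) m a b * rot_coeff n' m' a b)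
      = (\<Sum>(a, b)\<in>tri K. fock_up 1 (rot_coeff n m) a b * rot_coeff n' m' a b)"
    unfolding sum_distrib_left rot_raise_left by (simp only: case_prod_unfold mult.assoc)
  also have "\<dots> = sqrt (2 * n') * (\<Sum>(a, b)\<in>tri K'. rot_coeff n m a b * rot_coeff (n' - 1) m' a b)"
    unfolding K(1) fock_up_adjoint rot_lower_left sum_distrib_left
    by (simp only: case_prod_unfold mult.left_commute)
  also have "\<dots> = sqrt (2 * Suc n) * (if Suc n = n' \<and> m = m' then 1 else 0)"
    using Suc.IH[OF K(2), of "n' - 1"] by (cases n') (auto simp: case_prod_unfold)
  finally show ?case by simp
qed

text \<open>Adjointness moves the raising operator onto the array of function values, where
  \<open>hermite_fun_Suc\<close> turns lowering into multiplication by
  \<open>sqrt 2 * (X + e * Y)\<close> minus raising. The raising part is moved back and evaluated by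
  the hypothesis \<open>low\<close>; level 0 is separate because there \<open>K - 1\<close> may
  truncate.\<close>

lemma hermite_rotation_step:
  assumes K: "n + m \<le> K"
    and e: "e = 1 \<or> e = -1"
    and IH: "\<And>K. n + m \<le> K \<Longrightarrow> (\<Sum>(a, b)\<in>tri K. rot_coeff n m a b * (hermite_fun a X * hermite_fun b Y)) = P"
    and low: "n + m \<noteq> 0 \<Longrightarrow> (\<Sum>(a, b)\<in>tri (K - 1). fock_down e (rot_coeff n m) a b * (hermite_fun a X * hermite_fun b Y)) = Q"
    and Q0: "n + m = 0 \<Longrightarrow> Q = 0"
  shows "(\<Sum>(a, b)\<in>tri (Suc K). fock_up e (rot_coeff n m) a b * (hermite_fun a X * hermite_fun b Y))
    = sqrt 2 * (X + e * Y) * P - Q"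
proof -
  let ?h = "\<lambda>a b. hermite_fun a X * hermite_fun b Y"
  have 1: "fock_down e ?h a b = sqrt 2 * (X + e * Y) * ?h a b - fock_up e ?h a b" for a b
  proof -
    have "fock_down e ?h a b = (sqrt (Suc a) * hermite_fun (Suc a) X) * hermite_fun b Y
        + e * (hermite_fun a X * (sqrt (Suc b) * hermite_fun (Suc b) Y))"
      unfolding fock_down_def by (simp only: mult.assoc mult.left_commute)
    then show ?thesis
      unfolding hermite_fun_Suc fock_up_def by (simp only: algebra_simps)
  qed
  have 2: "(\<Sum>(a, b)\<in>tri K. rot_coeff n m a b * fock_up e ?h a b) = Q"
  proof (cases "n + m = 0")
    case True
    then have z: "rot_coeff n m a b * fock_up e ?h a b = 0" for a b
      by (simp add: fock_up_def)
    show ?thesis by (simp only: Q0[OF True] z case_prod_unfold sum.neutral_const)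
  next
    case False
    then obtain K' where "K = Suc K'" using K by (cases K) auto
    then show ?thesis using fock_up_adjoint[where K = K' and e = e and f = ?h and g = "rot_coeff n m"] low[OF False]
      by (simp only: mult.commute diff_Suc_1)
  qed
  have "(\<Sum>(a, b)\<in>tri (Suc K). fock_up e (rot_coeff n m) a b * ?h a b)
      = (\<Sum>(a, b)\<in>tri K. rot_coeff n m a b * fock_down e ?h a b)"
    by (rule fock_up_adjoint)
  also have "\<dots> = sqrt 2 * (X + e * Y) * (\<Sum>(a, b)\<in>tri K. rot_coeff n m a b * ?h a b)
      - (\<Sum>(a, b)\<in>tri K. rot_coeff n m a b * fock_up e ?h a b)"
    unfolding 1 sum_distrib_left sum_subtractf[symmetric]
    by (simp only: case_prod_unfold algebra_simps)
  finally show ?thesis using 2 IH[OF K] by simp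
qed

text \<open>Both sides obey the same three-term recurrence in \<open>n\<close> and in
  \<open>m\<close>, since \<open>X + Y\<close> and \<open>X - Y\<close> are \<open>sqrt 2\<close>
  times \<open>x\<close> and \<open>y\<close>. At level 0 the claim is
  \<open>X^2 + Y^2 = x^2 + y^2\<close> in the exponent.\<close>

lemma hermite_rotation:
  assumes "n + m \<le> K" and X: "X = (x + y) / sqrt 2" and Y: "Y = (x - y) / sqrt 2"
  shows "(\<Sum>(a, b)\<in>tri K. rot_coeff n m a b * (hermite_fun a X * hermite_fun b Y)) = hermite_fun n x * hermite_fun m y"
  using assms(1)
proof (induction "n + m" arbitrary: n m K rule: less_induct)
  case less
  let ?h = "\<lambda>a b. hermite_fun a X * hermite_fun b Y"
  have XY: "sqrt 2 * (X + 1 * Y) = 2 * x" "sqrt 2 * (X + (-1) * Y) = 2 * y"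
    using X Y by (simp_all add: field_simps)
  consider "n = 0" "m = 0" | m' where "n = 0" "m = Suc m'" | n' where "n = Suc n'"
    by (metis not0_implies_Suc)
  then show ?case
  proof cases
    case 1
    have "(\<Sum>(a, b)\<in>tri K. rot_coeff 0 0 a b * ?h a b) = (\<Sum>(a, b)\<in>{(0, 0)}. rot_coeff 0 0 a b * ?h a b)"
      by (intro sum.mono_neutral_right) (auto split: if_splits)
    also have "\<dots> = hermite_fun 0 x * hermite_fun 0 y"
    proof -
      have "X\<^sup>2 + Y\<^sup>2 = x\<^sup>2 + y\<^sup>2"
        unfolding X Y power_divide by (simp add: power2_eq_square field_simps)
      then have "- (X\<^sup>2) / 2 + - (Y\<^sup>2) / 2 = - (x\<^sup>2) / 2 + - (y\<^sup>2) / 2" by (simp add: field_simps)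
      then have "exp (- (X\<^sup>2) / 2) * exp (- (Y\<^sup>2) / 2) = exp (- (x\<^sup>2) / 2) * exp (- (y\<^sup>2) / 2)"
        by (simp only: exp_add[symmetric])
      then show ?thesis by simp
    qed
    finally show ?thesis using 1 by simp
  next
    case 2
    then obtain K' where K: "K = Suc K'" "n + m' \<le> K'" using less.prems by (cases K) auto
    have "(\<Sum>(a, b)\<in>tri K. fock_up (-1) (rot_coeff n m') a b * ?h a b)
       = sqrt 2 * (X + (-1) * Y) * (hermite_fun n x * hermite_fun m' y)
         - sqrt (2 * m') * (hermite_fun n x * hermite_fun (m' - 1) y)"
      unfolding K(1)
    proof (rule hermite_rotation_step[OF K(2)])
      fix L assume "n + m' \<le> L"
      then show "(\<Sum>(a, b)\<in>tri L. rot_coeff n m' a b * ?h a b) = hermite_fun n x * hermite_fun m' y"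
        using 2 by (intro less.hyps) auto
    next
      assume "n + m' \<noteq> 0"
      then have "(\<Sum>(a, b)\<in>tri (K' - 1). rot_coeff n (m' - 1) a b * ?h a b) = hermite_fun n x * hermite_fun (m' - 1) y"
        using 2 K by (intro less.hyps) auto
      then show "(\<Sum>(a, b)\<in>tri (K' - 1). fock_down (-1) (rot_coeff n m') a b * ?h a b)
          = sqrt (2 * m') * (hermite_fun n x * hermite_fun (m' - 1) y)"
        unfolding rot_lower_right
        by (simp only: mult.assoc case_prod_unfold sum_distrib_left[symmetric])
    qed auto
    also have "\<dots> = sqrt 2 * hermite_fun n x * (sqrt 2 * y * hermite_fun m' y - sqrt m' * hermite_fun (m' - 1) y)"
      unfolding XY by (simp add: algebra_simps real_sqrt_mult)
    also have "\<dots> = sqrt 2 * hermite_fun n x * (sqrt m * hermite_fun m y)"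
      using hermite_fun_Suc[of m' y] 2 by simp
    also have "\<dots> = sqrt (2 * Suc m') * (hermite_fun n x * hermite_fun m y)"
      unfolding 2(2) by (simp only: real_sqrt_mult of_nat_mult of_nat_numeral mult.assoc mult.left_commute)
    finally have "sqrt (2 * Suc m') * (\<Sum>(a, b)\<in>tri K. rot_coeff n m a b * ?h a b)
        = sqrt (2 * Suc m') * (hermite_fun n x * hermite_fun m y)"
      unfolding rot_raise_right 2(2) by (simp only: mult.assoc case_prod_unfold sum_distrib_left)
    then show ?thesis by simp
  next
    case 3
    then obtain K' where K: "K = Suc K'" "n' + m \<le> K'" using less.prems by (cases K) auto
    have "(\<Sum>(a, b)\<in>tri K. fock_up 1 (rot_coeff n' m) a b * ?h a b)
       = sqrt 2 * (X + 1 * Y) * (hermite_fun n' x * hermite_fun m y)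
         - sqrt (2 * n') * (hermite_fun (n' - 1) x * hermite_fun m y)"
      unfolding K(1)
    proof (rule hermite_rotation_step[OF K(2)])
      fix L assume "n' + m \<le> L"
      then show "(\<Sum>(a, b)\<in>tri L. rot_coeff n' m a b * ?h a b) = hermite_fun n' x * hermite_fun m y"
        using 3 by (intro less.hyps) auto
    next
      assume nz: "n' + m \<noteq> 0"
      show "(\<Sum>(a, b)\<in>tri (K' - 1). fock_down 1 (rot_coeff n' m) a b * ?h a b)
          = sqrt (2 * n') * (hermite_fun (n' - 1) x * hermite_fun m y)"
      proof (cases "n' = 0")
        case True
        then show ?thesis unfolding rot_lower_left by (simp add: case_prod_unfold)
      next
        case False
        then have "(\<Sum>(a, b)\<in>tri (K' - 1). rot_coeff (n' - 1) m a b * ?h a b) = hermite_fun (n' - 1) x * hermite_fun m y"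
          using 3 K by (intro less.hyps) auto
        then show ?thesis
          unfolding rot_lower_left
          by (simp only: mult.assoc case_prod_unfold sum_distrib_left[symmetric])
      qed
    qed auto
    also have "\<dots> = sqrt 2 * hermite_fun m y * (sqrt 2 * x * hermite_fun n' x - sqrt n' * hermite_fun (n' - 1) x)"
      unfolding XY by (simp add: algebra_simps real_sqrt_mult)
    also have "\<dots> = sqrt 2 * hermite_fun m y * (sqrt n * hermite_fun n x)"
      using hermite_fun_Suc[of n' x] 3 by simp
    also have "\<dots> = sqrt (2 * Suc n') * (hermite_fun n x * hermite_fun m y)"
      unfolding 3 by (simp only: real_sqrt_mult of_nat_mult of_nat_numeral mult.assoc mult.left_commute mult.commute)
    finally have "sqrt (2 * Suc n') * (\<Sum>(a, b)\<in>tri K. rot_coeff n m a b * ?h a b)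
        = sqrt (2 * Suc n') * (hermite_fun n x * hermite_fun m y)"
      unfolding rot_raise_left 3 by (simp only: mult.assoc case_prod_unfold sum_distrib_left)
    then show ?thesis by simp
  qed
qed

text \<open>On the diagonal \<open>y = x\<close> the second rotated variable is 0 and the first is
  \<open>sqrt 2 * x\<close>.\<close>

lemma hermite_mult_expansion:
  assumes "n + m \<le> K"
  shows "hermite_fun n x * hermite_fun m x
    = (\<Sum>(a, b)\<in>tri K. rot_coeff n m a b * (hermite_fun a (sqrt 2 * x) * hermite_fun b 0))"
proof -
  have "(x + x) / sqrt 2 = sqrt 2 * x" by (simp add: field_simps)
  then show ?thesis using hermite_rotation[OF assms, of "sqrt 2 * x" x x 0] by simp
qed

section \<open>Parseval identities for finite orthogonal sums\<close>

lemma integral_orthogonal_sum: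
  fixes \<phi> :: "'i \<Rightarrow> 'x \<Rightarrow> complex" and c :: "'i \<Rightarrow> real"
  assumes "finite A"
    and int: "\<And>i j. i \<in> A \<Longrightarrow> j \<in> A \<Longrightarrow> integrable M (\<lambda>x. \<phi> i x * cnj (\<phi> j x))"
    and orth: "\<And>i j. i \<in> A \<Longrightarrow> j \<in> A \<Longrightarrow> (\<integral>x. \<phi> i x * cnj (\<phi> j x) \<partial>M) = (if i = j then of_real (c i) else 0)"
  shows "integrable M (\<lambda>x. (cmod (\<Sum>i\<in>A. \<phi> i x))\<^sup>2)"
    and "(\<integral>x. (cmod (\<Sum>i\<in>A. \<phi> i x))\<^sup>2 \<partial>M) = (\<Sum>i\<in>A. c i)"
proof -
  let ?F = "\<lambda>x. \<Sum>i\<in>A. \<Sum>j\<in>A. \<phi> i x * cnj (\<phi> j x)"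
  have eq: "complex_of_real ((cmod (\<Sum>i\<in>A. \<phi> i x))\<^sup>2) = ?F x" for x
    unfolding complex_norm_square cnj_sum sum_product ..
  have intF: "integrable M ?F"
    using int by (intro Bochner_Integration.integrable_sum) auto
  have "integrable M (\<lambda>x. Re (?F x))" using intF by (rule integrable_Re)
  also have "(\<lambda>x. Re (?F x)) = (\<lambda>x. (cmod (\<Sum>i\<in>A. \<phi> i x))\<^sup>2)"
    by (simp only: eq[symmetric] Re_complex_of_real)
  finally show "integrable M (\<lambda>x. (cmod (\<Sum>i\<in>A. \<phi> i x))\<^sup>2)" .
  have "complex_of_real (\<integral>x. (cmod (\<Sum>i\<in>A. \<phi> i x))\<^sup>2 \<partial>M) = (\<integral>x. ?F x \<partial>M)"
    by (simp only: integral_complex_of_real[symmetric] eq)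
  also have "\<dots> = (\<Sum>i\<in>A. \<integral>x. (\<Sum>j\<in>A. \<phi> i x * cnj (\<phi> j x)) \<partial>M)"
    using int by (intro Bochner_Integration.integral_sum Bochner_Integration.integrable_sum)
  also have "\<dots> = (\<Sum>i\<in>A. \<Sum>j\<in>A. \<integral>x. \<phi> i x * cnj (\<phi> j x) \<partial>M)"
    using int by (intro sum.cong refl Bochner_Integration.integral_sum)
  also have "\<dots> = (\<Sum>i\<in>A. of_real (c i))"
    using \<open>finite A\<close> by (simp add: orth cong: sum.cong)
  finally show "(\<integral>x. (cmod (\<Sum>i\<in>A. \<phi> i x))\<^sup>2 \<partial>M) = (\<Sum>i\<in>A. c i)"
    by (simp only: of_real_sum[symmetric] of_real_eq_iff)
qed

lemma integral_orthonormal_sum: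
  fixes \<phi> :: "'i \<Rightarrow> 'x \<Rightarrow> complex"
  assumes "finite A"
    and int: "\<And>i j. i \<in> A \<Longrightarrow> j \<in> A \<Longrightarrow> integrable M (\<lambda>x. \<phi> i x * cnj (\<phi> j x))"
    and orth: "\<And>i j. i \<in> A \<Longrightarrow> j \<in> A \<Longrightarrow> (\<integral>x. \<phi> i x * cnj (\<phi> j x) \<partial>M) = (if i = j then 1 else 0)"
  shows "integrable M (\<lambda>x. (cmod (\<Sum>i\<in>A. w i * \<phi> i x))\<^sup>2)"
    and "(\<integral>x. (cmod (\<Sum>i\<in>A. w i * \<phi> i x))\<^sup>2 \<partial>M) = (\<Sum>i\<in>A. (cmod (w i))\<^sup>2)"
proof -
  have eq: "w i * \<phi> i x * cnj (w j * \<phi> j x) = w i * cnj (w j) * (\<phi> i x * cnj (\<phi> j x))" for i j x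
    by simp
  have *: "integrable M (\<lambda>x. w i * \<phi> i x * cnj (w j * \<phi> j x))"
    "(\<integral>x. w i * \<phi> i x * cnj (w j * \<phi> j x) \<partial>M) = (if i = j then of_real ((cmod (w i))\<^sup>2) else 0)"
    if "i \<in> A" "j \<in> A" for i j
    unfolding eq using int[OF that] orth[OF that] by (auto simp: complex_norm_square simp del: of_real_power)
  show "integrable M (\<lambda>x. (cmod (\<Sum>i\<in>A. w i * \<phi> i x))\<^sup>2)"
    by (rule integral_orthogonal_sum(1)[where c = "\<lambda>i. (cmod (w i))\<^sup>2", OF \<open>finite A\<close> *])
  show "(\<integral>x. (cmod (\<Sum>i\<in>A. w i * \<phi> i x))\<^sup>2 \<partial>M) = (\<Sum>i\<in>A. (cmod (w i))\<^sup>2)"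
    by (rule integral_orthogonal_sum(2)[where c = "\<lambda>i. (cmod (w i))\<^sup>2", OF \<open>finite A\<close> *])
qed

text \<open>The counting measure case; it turns orthonormality of the rows of a rotation matrix into
  an isometry.\<close>

lemma sum_orthonormal_sum:
  fixes r :: "'i \<Rightarrow> 'x \<Rightarrow> real"
  assumes "finite A" "finite B"
    and orth: "\<And>i j. i \<in> A \<Longrightarrow> j \<in> A \<Longrightarrow> (\<Sum>x\<in>B. r i x * r j x) = (if i = j then 1 else 0)"
  shows "(\<Sum>x\<in>B. (cmod (\<Sum>i\<in>A. w i * of_real (r i x)))\<^sup>2) = (\<Sum>i\<in>A. (cmod (w i))\<^sup>2)"
proof -
  have "(\<integral>x. (cmod (\<Sum>i\<in>A. w i * of_real (r i x)))\<^sup>2 \<partial>count_space B) = (\<Sum>i\<in>A. (cmod (w i))\<^sup>2)"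
  proof (rule integral_orthonormal_sum(2)[OF \<open>finite A\<close>])
    fix i j assume ij: "i \<in> A" "j \<in> A"
    show "integrable (count_space B) (\<lambda>x. of_real (r i x) * cnj (of_real (r j x)))"
      using \<open>finite B\<close> by (rule integrable_count_space)
    have "(\<Sum>x\<in>B. complex_of_real (r i x * r j x)) = of_real (if i = j then 1 else 0)"
      unfolding of_real_sum[symmetric] using orth[OF ij] by simp
    then show "(\<integral>x. of_real (r i x) * cnj (of_real (r j x)) \<partial>count_space B) = (if i = j then 1 else (0::complex))"
      using \<open>finite B\<close> by (simp add: lebesgue_integral_count_space_finite)
  qed
  then show ?thesis using \<open>finite B\<close> by (simp add: lebesgue_integral_count_space_finite)
qed

section \<open>Concentration of the rotated coefficients\<close>

text \<open>If \<open>w\<close> holds coefficients with respect to \<open>h_n(x) h_m(y)\<close>,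
  this is the coefficient array of the same function in the rotated products.\<close>

definition rot_sum :: "nat \<Rightarrow> (nat \<Rightarrow> nat \<Rightarrow> complex) \<Rightarrow> nat \<Rightarrow> nat \<Rightarrow> complex" where
  "rot_sum K w a b = (\<Sum>(n, m)\<in>tri K. w n m * of_real (rot_coeff n m a b))"

abbreviation tri_norm2 :: "nat \<Rightarrow> (nat \<Rightarrow> nat \<Rightarrow> complex) \<Rightarrow> real" where
  "tri_norm2 K w \<equiv> (\<Sum>(n, m)\<in>tri K. (cmod (w n m))\<^sup>2)"

lemma rot_sum_isometry: "tri_norm2 K (rot_sum K w) = tri_norm2 K w"
proof -
  have "(\<Sum>x\<in>tri K. (cmod (\<Sum>i\<in>tri K. w (fst i) (snd i) * of_real (rot_coeff (fst i) (snd i) (fst x) (snd x))))\<^sup>2)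
      = (\<Sum>i\<in>tri K. (cmod (w (fst i) (snd i)))\<^sup>2)"
  proof (rule sum_orthonormal_sum)
    fix i j assume "i \<in> tri K" "j \<in> tri K"
    then show "(\<Sum>x\<in>tri K. rot_coeff (fst i) (snd i) (fst x) (snd x) * rot_coeff (fst j) (snd j) (fst x) (snd x))
        = (if i = j then 1 else 0)"
      using rot_orthonormal[of "fst i" "snd i" K "fst j" "snd j"]
      by (cases i; cases j) (auto simp: case_prod_unfold)
  qed auto
  then show ?thesis by (simp add: rot_sum_def case_prod_unfold)
qed

text \<open>The difference of the two number operators of the rotated variables, written in the
  original variables.\<close>

definition exchange :: "(nat \<Rightarrow> nat \<Rightarrow> complex) \<Rightarrow> nat \<Rightarrow> nat \<Rightarrow> complex" where
  "exchange w n m = of_real (sqrt (Suc n * m)) * w (Suc n) (m - 1) + of_real (sqrt (n * Suc m)) * w (n - 1) (Suc m)"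

text \<open>Reindexing along antidiagonals, \<open>(n, m)\<close> to \<open>(n - 1, m + 1)\<close>.
  The hypothesis removes the edge \<open>n = 0\<close>; the conditional marks the edge
  \<open>m = 0\<close>, which no shift reaches.\<close>

lemma sum_tri_shift:
  fixes G :: "nat \<Rightarrow> nat \<Rightarrow> 'a::comm_monoid_add"
  assumes "\<And>m. G 0 m = 0"
  shows "(\<Sum>(n, m)\<in>tri K. G n m) = (\<Sum>(n, m)\<in>tri K. if m = 0 then 0 else G (Suc n) (m - 1))"
  by (rule sum.reindex_bij_witness_not_neutral[of "{x \<in> tri K. fst x = 0}" "{x \<in> tri K. snd x = 0}" _
        "\<lambda>(n, m). (Suc n, m - 1)" "\<lambda>(n, m). if n = 0 then (0, 0) else (n - 1, Suc m)"])
    (use assms in \<open>auto split: if_splits\<close>)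

lemma sum_tri_shift':
  fixes G :: "nat \<Rightarrow> nat \<Rightarrow> 'a::comm_monoid_add"
  assumes "\<And>n. G n 0 = 0"
  shows "(\<Sum>(n, m)\<in>tri K. G n m) = (\<Sum>(n, m)\<in>tri K. if n = 0 then 0 else G (n - 1) (Suc m))"
  using sum_tri_shift[of "\<lambda>n m. G m n" K] assms
  by (subst (1 2) sum_tri_swap) simp

text \<open>\<open>rot_number_diff\<close> moves a quantum in the index of the rotated states;
  summation by parts along antidiagonals moves it to the coefficients instead.\<close>

lemma rot_sum_exchange: "of_real (real a - real b) * rot_sum K w a b = rot_sum K (exchange w) a b"
proof -
  let ?R = "\<lambda>n m. complex_of_real (rot_coeff n m a b)"
  let ?s = "\<lambda>n. complex_of_real (sqrt (real n))"
  have "of_real (real a - real b) * rot_sum K w a b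
      = (\<Sum>(n, m)\<in>tri K. w n m * of_real ((real a - real b) * rot_coeff n m a b))"
    by (simp add: rot_sum_def sum_distrib_left case_prod_unfold mult_ac)
  also have "\<dots> = (\<Sum>(n, m)\<in>tri K. ?s (n * Suc m) * w n m * ?R (n - 1) (Suc m))
      + (\<Sum>(n, m)\<in>tri K. ?s (Suc n * m) * w n m * ?R (Suc n) (m - 1))"
    unfolding rot_number_diff
    by (simp add: sum.distrib[symmetric] case_prod_unfold algebra_simps del: of_nat_Suc of_nat_mult rot_coeff.simps)
  also have "(\<Sum>(n, m)\<in>tri K. ?s (n * Suc m) * w n m * ?R (n - 1) (Suc m))
      = (\<Sum>(n, m)\<in>tri K. ?s (Suc n * m) * w (Suc n) (m - 1) * ?R n m)"
    by (subst sum_tri_shift) (auto intro!: sum.cong simp del: of_nat_Suc of_nat_mult rot_coeff.simps)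
  also have "(\<Sum>(n, m)\<in>tri K. ?s (Suc n * m) * w n m * ?R (Suc n) (m - 1))
      = (\<Sum>(n, m)\<in>tri K. ?s (n * Suc m) * w (n - 1) (Suc m) * ?R n m)"
    by (subst sum_tri_shift') (auto intro!: sum.cong simp del: of_nat_Suc of_nat_mult rot_coeff.simps)
  finally show ?thesis
    by (simp add: rot_sum_def exchange_def sum.distrib[symmetric] case_prod_unfold algebra_simps
        del: of_nat_Suc of_nat_mult rot_coeff.simps)
qed

text \<open>Each shifted term carries a weight at most \<open>K * (\<mu> + 1)\<close> on the support
  of \<open>w\<close>; the 4 is 2 from squaring a sum of two terms, times the two terms. For small
  \<open>\<mu>\<close> this is linear in \<open>K\<close> rather than quadratic, which is the source
  of the concentration.\<close>

lemma exchange_norm_le: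
  assumes supp: "\<And>n m. w n m \<noteq> 0 \<Longrightarrow> n + m \<le> K \<and> m \<le> \<mu>"
  shows "tri_norm2 K (exchange w) \<le> 4 * real K * (real \<mu> + 1) * tri_norm2 K w"
proof -
  let ?c = "\<lambda>n m. (cmod (w n m))\<^sup>2"
  have sq: "(x + y)\<^sup>2 \<le> 2 * x\<^sup>2 + 2 * y\<^sup>2" for x y :: real
    using zero_le_power2[of "x - y"] by (simp add: power2_sum power2_diff)
  have "(cmod (exchange w n m))\<^sup>2 \<le> 2 * (real (Suc n * m) * ?c (Suc n) (m - 1)) + 2 * (real (n * Suc m) * ?c (n - 1) (Suc m))" for n m
  proof -
    have "cmod (exchange w n m) \<le> sqrt (Suc n * m) * cmod (w (Suc n) (m - 1)) + sqrt (n * Suc m) * cmod (w (n - 1) (Suc m))"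
      unfolding exchange_def by (rule order_trans[OF norm_triangle_ineq]) (simp add: norm_mult)
    then have "(cmod (exchange w n m))\<^sup>2 \<le> (sqrt (Suc n * m) * cmod (w (Suc n) (m - 1)) + sqrt (n * Suc m) * cmod (w (n - 1) (Suc m)))\<^sup>2"
      by (rule power_mono) simp
    also have "\<dots> \<le> 2 * (sqrt (Suc n * m) * cmod (w (Suc n) (m - 1)))\<^sup>2 + 2 * (sqrt (n * Suc m) * cmod (w (n - 1) (Suc m)))\<^sup>2"
      by (rule sq)
    finally show ?thesis by (simp only: power_mult_distrib real_sqrt_pow2 of_nat_0_le_iff)
  qed
  then have "tri_norm2 K (exchange w)
      \<le> (\<Sum>(n, m)\<in>tri K. 2 * (real (Suc n * m) * ?c (Suc n) (m - 1)) + 2 * (real (n * Suc m) * ?c (n - 1) (Suc m)))"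
    by (intro sum_mono) (auto simp del: of_nat_Suc of_nat_mult)
  also have "\<dots> = 2 * (\<Sum>(n, m)\<in>tri K. real (Suc n * m) * ?c (Suc n) (m - 1))
      + 2 * (\<Sum>(n, m)\<in>tri K. real (n * Suc m) * ?c (n - 1) (Suc m))"
    by (simp add: sum.distrib sum_distrib_left case_prod_unfold del: of_nat_Suc of_nat_mult)
  also have "(\<Sum>(n, m)\<in>tri K. real (Suc n * m) * ?c (Suc n) (m - 1)) = (\<Sum>(n, m)\<in>tri K. if n = 0 then 0 else real (n * Suc m) * ?c n m)"
    by (subst sum_tri_shift') (auto intro!: sum.cong simp del: of_nat_Suc of_nat_mult)
  also have "(\<Sum>(n, m)\<in>tri K. real (n * Suc m) * ?c (n - 1) (Suc m)) = (\<Sum>(n, m)\<in>tri K. if m = 0 then 0 else real (Suc n * m) * ?c n m)"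
    by (subst sum_tri_shift) (auto intro!: sum.cong simp del: of_nat_Suc of_nat_mult)
  also have "(\<Sum>(n, m)\<in>tri K. if n = 0 then 0 else real (n * Suc m) * ?c n m)
      \<le> (\<Sum>(n, m)\<in>tri K. real (K * (\<mu> + 1)) * ?c n m)"
  proof (intro sum_mono, clarify)
    fix n m
    show "(if n = 0 then 0 else real (n * Suc m) * ?c n m) \<le> real (K * (\<mu> + 1)) * ?c n m"
    proof (cases "w n m = 0")
      case False
      then have "n * Suc m \<le> K * (\<mu> + 1)" using supp[of n m] by (intro mult_mono) auto
      then have "real (n * Suc m) \<le> real (K * (\<mu> + 1))" by (simp only: of_nat_le_iff)
      then show ?thesis by (auto intro!: mult_right_mono simp del: of_nat_Suc of_nat_mult)
    qed simp
  qed
  also have "(\<Sum>(n, m)\<in>tri K. if m = 0 then 0 else real (Suc n * m) * ?c n m)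
      \<le> (\<Sum>(n, m)\<in>tri K. real (K * (\<mu> + 1)) * ?c n m)"
  proof (intro sum_mono, clarify)
    fix n m
    show "(if m = 0 then 0 else real (Suc n * m) * ?c n m) \<le> real (K * (\<mu> + 1)) * ?c n m"
    proof (cases "w n m = 0 \<or> m = 0")
      case False
      then have "Suc n * m \<le> K * (\<mu> + 1)" using supp[of n m] by (intro mult_mono) auto
      then have "real (Suc n * m) \<le> real (K * (\<mu> + 1))" by (simp only: of_nat_le_iff)
      then show ?thesis by (auto intro!: mult_right_mono simp del: of_nat_Suc of_nat_mult)
    qed auto
  qed
  also have "(\<Sum>(n, m)\<in>tri K. real (K * (\<mu> + 1)) * ?c n m) = real K * (real \<mu> + 1) * tri_norm2 K w"
    by (simp only: sum_distrib_left case_prod_unfold of_nat_mult of_nat_add of_nat_1)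
  finally show ?thesis by simp
qed

text \<open>Every application of \<open>exchange\<close> absorbs one factor \<open>a - b\<close> and
  widens the support in \<open>m\<close> by one, which is why \<open>p\<close> is added to
  \<open>\<mu>\<close>.\<close>

lemma rot_sum_moment:
  assumes "\<And>n m. w n m \<noteq> 0 \<Longrightarrow> n + m \<le> K \<and> m \<le> \<mu>"
  shows "(\<Sum>(a, b)\<in>tri K. (real a - real b) ^ (2 * p) * (cmod (rot_sum K w a b))\<^sup>2)
    \<le> (4 * real K * (real \<mu> + real p)) ^ p * tri_norm2 K w"
  using assms
proof (induction p arbitrary: w \<mu>)
  case 0
  then show ?case using rot_sum_isometry[of K w] by simp
next
  case (Suc p)
  have supp: "n + m \<le> K \<and> m \<le> Suc \<mu>" if "exchange w n m \<noteq> 0" for n m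
  proof -
    have "m \<noteq> 0 \<and> w (Suc n) (m - 1) \<noteq> 0 \<or> n \<noteq> 0 \<and> w (n - 1) (Suc m) \<noteq> 0"
      using that by (cases m; cases n) (auto simp: exchange_def)
    then show ?thesis using Suc.prems[of "Suc n" "m - 1"] Suc.prems[of "n - 1" "Suc m"] by auto
  qed
  have pw: "(x::real) ^ (2 * Suc p) = x\<^sup>2 * x ^ (2 * p)" for x
    by (simp only: mult_Suc_right power_add)
  have "(real a - real b) ^ (2 * Suc p) * (cmod (rot_sum K w a b))\<^sup>2
      = (real a - real b) ^ (2 * p) * (cmod (rot_sum K (exchange w) a b))\<^sup>2" for a b
    unfolding pw
    by (simp only: rot_sum_exchange[symmetric] norm_mult norm_of_real power_mult_distrib power2_abs mult_ac)
  then have "(\<Sum>(a, b)\<in>tri K. (real a - real b) ^ (2 * Suc p) * (cmod (rot_sum K w a b))\<^sup>2)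
      = (\<Sum>(a, b)\<in>tri K. (real a - real b) ^ (2 * p) * (cmod (rot_sum K (exchange w) a b))\<^sup>2)"
    by (simp only:)
  also have "\<dots> \<le> (4 * real K * (real (Suc \<mu>) + real p)) ^ p * tri_norm2 K (exchange w)"
    using supp by (rule Suc.IH)
  also have "\<dots> \<le> (4 * real K * (real (Suc \<mu>) + real p)) ^ p * (4 * real K * (real \<mu> + 1) * tri_norm2 K w)"
    by (intro mult_left_mono exchange_norm_le Suc.prems) auto
  also have "\<dots> \<le> (4 * real K * (real \<mu> + real (Suc p))) ^ p * ((4 * real K * (real \<mu> + real (Suc p))) * tri_norm2 K w)"
    by (intro mult_mono mult_right_mono mult_left_mono power_mono mult_nonneg_nonneg sum_nonneg) auto
  finally show ?case by (simp only: power_Suc2 mult.assoc)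
qed

text \<open>A dichotomy on \<open>b\<close>. For \<open>b > n0/4\<close> the decay of
  \<open>h_b(0)^2\<close> gives the first term. Otherwise \<open>a + b >= n0\<close> forces
  \<open>a - b >= n0/2\<close>, and the \<open>2p\<close>-th moment controls this part in the manner
  of Chebyshev.\<close>

lemma rot_sum_trace_bound:
  assumes supp: "\<And>n m. w n m \<noteq> 0 \<Longrightarrow> n0 \<le> n \<and> n + m \<le> K \<and> m \<le> \<mu>"
    and n0: "n0 > 0" and small: "64 * real K * (real \<mu> + real p) \<le> (real n0)\<^sup>2"
  shows "(\<Sum>(a, b)\<in>tri K. (hermite_fun b 0)\<^sup>2 * (cmod (rot_sum K w a b))\<^sup>2)
    \<le> (2 / sqrt n0 + (1 / 4) ^ p) * tri_norm2 K w"
proof -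
  let ?c = "\<lambda>a b. (cmod (rot_sum K w a b))\<^sup>2"
  have pt: "(hermite_fun b 0)\<^sup>2 * ?c a b
      \<le> 2 / sqrt n0 * ?c a b + (4 / (real n0)\<^sup>2) ^ p * ((real a - real b) ^ (2 * p) * ?c a b)" for a b
  proof (cases "rot_sum K w a b = 0")
    case False
    have "\<exists>n m. w n m \<noteq> 0 \<and> rot_coeff n m a b \<noteq> 0"
    proof (rule ccontr)
      assume "\<not> ?thesis"
      then have "rot_sum K w a b = 0" unfolding rot_sum_def by (intro sum.neutral) auto
      with False show False by simp
    qed
    then obtain n m where "w n m \<noteq> 0" "rot_coeff n m a b \<noteq> 0" by blast
    then have ab: "n0 \<le> a + b" using supp[of n m] rot_support[of n m a b] by linarith
    show ?thesis
    proof (cases "4 * b \<le> n0")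
      case True
      have "real n0 / 2 \<le> real a - real b" using ab True by linarith
      then have "(real n0 / 2) ^ (2 * p) \<le> (real a - real b) ^ (2 * p)" by (intro power_mono) auto
      moreover have "(4 / (real n0)\<^sup>2) ^ p * (real n0 / 2) ^ (2 * p) = 1"
      proof -
        have "4 / (real n0)\<^sup>2 * (real n0 / 2)\<^sup>2 = 1" using n0 by (simp add: power_divide)
        then show ?thesis by (simp only: power_mult power_mult_distrib[symmetric] power_one)
      qed
      ultimately have "1 \<le> (4 / (real n0)\<^sup>2) ^ p * (real a - real b) ^ (2 * p)"
        using mult_left_mono[of "(real n0 / 2) ^ (2 * p)" "(real a - real b) ^ (2 * p)" "(4 / (real n0)\<^sup>2) ^ p"]
        by simp
      then have "1 * ?c a b \<le> (4 / (real n0)\<^sup>2) ^ p * (real a - real b) ^ (2 * p) * ?c a b"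
        by (intro mult_right_mono) auto
      moreover have "(hermite_fun b 0)\<^sup>2 * ?c a b \<le> 1 * ?c a b"
      proof (intro mult_right_mono)
        have "1 / sqrt (b + 1) \<le> 1" by simp
        then show "(hermite_fun b 0)\<^sup>2 \<le> 1" using hermite_fun_0_bound[of b] by linarith
      qed simp
      moreover have "0 \<le> 2 / sqrt n0 * ?c a b" by simp
      ultimately show ?thesis by (simp only: mult.assoc)
    next
      case False
      have "(hermite_fun b 0)\<^sup>2 \<le> 1 / sqrt (real b + 1)" using hermite_fun_0_bound[of b] by (simp add: add.commute)
      also have "\<dots> \<le> 1 / sqrt (real n0 / 4)"
        using False n0 by (intro divide_left_mono real_sqrt_le_mono) auto
      also have "\<dots> = 2 / sqrt n0" by (simp add: real_sqrt_divide)
      finally have "(hermite_fun b 0)\<^sup>2 * ?c a b \<le> 2 / sqrt n0 * ?c a b" by (rule mult_right_mono) simp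
      moreover have "0 \<le> (4 / (real n0)\<^sup>2) ^ p * ((real a - real b) ^ (2 * p) * ?c a b)" by simp
      ultimately show ?thesis by linarith
    qed
  qed simp
  have "(\<Sum>(a, b)\<in>tri K. (hermite_fun b 0)\<^sup>2 * ?c a b)
      \<le> (\<Sum>(a, b)\<in>tri K. 2 / sqrt n0 * ?c a b + (4 / (real n0)\<^sup>2) ^ p * ((real a - real b) ^ (2 * p) * ?c a b))"
    using pt by (intro sum_mono) (simp add: case_prod_unfold)
  also have "\<dots> = 2 / sqrt n0 * tri_norm2 K (rot_sum K w)
      + (4 / (real n0)\<^sup>2) ^ p * (\<Sum>(a, b)\<in>tri K. (real a - real b) ^ (2 * p) * ?c a b)"
    by (simp only: sum.distrib sum_distrib_left case_prod_unfold)
  also have "\<dots> \<le> 2 / sqrt n0 * tri_norm2 K w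
      + (4 / (real n0)\<^sup>2) ^ p * ((4 * real K * (real \<mu> + real p)) ^ p * tri_norm2 K w)"
    unfolding rot_sum_isometry using supp
    by (intro add_left_mono mult_left_mono rot_sum_moment) auto
  also have "\<dots> = (2 / sqrt n0 + (16 * real K * (real \<mu> + real p) / (real n0)\<^sup>2) ^ p) * tri_norm2 K w"
  proof -
    have "4 / (real n0)\<^sup>2 * (4 * real K * (real \<mu> + real p)) = 16 * real K * (real \<mu> + real p) / (real n0)\<^sup>2"
      by simp
    then show ?thesis by (simp only: ring_distribs mult.assoc[symmetric] power_mult_distrib[symmetric])
  qed
  \<comment> \<open>\<open>small\<close> says precisely that the base
    \<open>16 K (\<mu> + p) / n0^2\<close> is at most 1/4.\<close>
  also have "\<dots> \<le> (2 / sqrt n0 + (1 / 4) ^ p) * tri_norm2 K w"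
    using small n0 by (intro mult_right_mono add_left_mono power_mono sum_nonneg) (auto simp: field_simps)
  finally show ?thesis .
qed

section \<open>Sums of Hermite values at the origin\<close>

lemma sum_inverse_sqrt_le: "(\<Sum>j\<le>J. 1 / sqrt (real j + 1)) \<le> 2 * sqrt (real J + 1)"
proof (induction J)
  case (Suc J)
  define s t where "s = sqrt (real J + 1)" and "t = sqrt (real J + 2)"
  have st: "s > 0" "t > 0" "s\<^sup>2 + 1 = t\<^sup>2" by (auto simp: s_def t_def)
  \<comment> \<open>With \<open>t^2 = s^2 + 1\<close> this is the increment inequality
    \<open>1/t <= 2(t - s)\<close>.\<close>
  have "0 \<le> (t - s)\<^sup>2" by simp
  then have "2 * s * t + 1 \<le> 2 * t * t" using st by (simp add: power2_diff power2_eq_square algebra_simps)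
  then have "2 * s + 1 / t \<le> 2 * t" using st by (simp add: field_simps)
  then show ?case using Suc by (simp add: s_def t_def add.commute)
qed simp

text \<open>The discrete form of the Beta integral of \<open>j^(-1/2) (s-j)^(-1/2)\<close>, which is
  bounded in \<open>s\<close>. On the half \<open>2j <= s\<close> the second factor is at most
  \<open>2/sqrt(s+1)\<close> and the first sums to at most \<open>2 sqrt(s+1)\<close>, so each half
  gives 4. Two coordinates together thus cost only a constant.\<close>

lemma hermite_convolution_0_le: "(\<Sum>j\<le>s. (hermite_fun j 0)\<^sup>2 * (hermite_fun (s - j) 0)\<^sup>2) \<le> 8"
proof -
  have half: "(\<Sum>j\<in>{j. j \<le> s \<and> 2 * j \<le> s}. 1 / sqrt (real j + 1) * (1 / sqrt (real (s - j) + 1))) \<le> 4"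
  proof -
    have "(\<Sum>j\<in>{j. j \<le> s \<and> 2 * j \<le> s}. 1 / sqrt (real j + 1) * (1 / sqrt (real (s - j) + 1)))
        \<le> (\<Sum>j\<in>{j. j \<le> s \<and> 2 * j \<le> s}. 1 / sqrt (real j + 1) * (2 / sqrt (real s + 1)))"
    proof (intro sum_mono mult_left_mono)
      fix j assume j: "j \<in> {j. j \<le> s \<and> 2 * j \<le> s}"
      have "1 / sqrt (real (s - j) + 1) \<le> 1 / sqrt ((real s + 1) / 4)"
        using j by (intro divide_left_mono real_sqrt_le_mono) auto
      also have "\<dots> = 2 / sqrt (real s + 1)" by (simp add: real_sqrt_divide)
      finally show "1 / sqrt (real (s - j) + 1) \<le> 2 / sqrt (real s + 1)" .
    qed auto
    also have "\<dots> \<le> (\<Sum>j\<le>s. 1 / sqrt (real j + 1) * (2 / sqrt (real s + 1)))"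
      by (intro sum_mono2) auto
    also have "\<dots> = (\<Sum>j\<le>s. 1 / sqrt (real j + 1)) * (2 / sqrt (real s + 1))"
      by (simp only: sum_distrib_right)
    also have "\<dots> \<le> 2 * sqrt (real s + 1) * (2 / sqrt (real s + 1))"
      by (intro mult_right_mono sum_inverse_sqrt_le) auto
    finally show ?thesis by simp
  qed
  have "(\<Sum>j\<le>s. (hermite_fun j 0)\<^sup>2 * (hermite_fun (s - j) 0)\<^sup>2)
      \<le> (\<Sum>j\<le>s. 1 / sqrt (real j + 1) * (1 / sqrt (real (s - j) + 1)))"
  proof -
    have "(hermite_fun n 0)\<^sup>2 \<le> 1 / sqrt (real n + 1)" for n
      using hermite_fun_0_bound[of n] by (simp add: add.commute)
    then show ?thesis by (intro sum_mono mult_mono) (auto simp del: of_nat_diff)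
  qed
  also have "\<dots> = (\<Sum>j\<in>{j. j \<le> s \<and> 2 * j \<le> s}. 1 / sqrt (real j + 1) * (1 / sqrt (real (s - j) + 1)))
      + (\<Sum>j\<in>{j. j \<le> s \<and> \<not> 2 * j \<le> s}. 1 / sqrt (real j + 1) * (1 / sqrt (real (s - j) + 1)))"
    by (subst sum.union_disjoint[symmetric]) (auto intro!: sum.cong)
  also have "(\<Sum>j\<in>{j. j \<le> s \<and> \<not> 2 * j \<le> s}. 1 / sqrt (real j + 1) * (1 / sqrt (real (s - j) + 1)))
      = (\<Sum>j\<in>{j. j \<le> s \<and> 2 * j < s}. 1 / sqrt (real j + 1) * (1 / sqrt (real (s - j) + 1)))"
    by (rule sum.reindex_bij_witness[of _ "\<lambda>j. s - j" "\<lambda>j. s - j"]) auto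
  also have "\<dots> \<le> (\<Sum>j\<in>{j. j \<le> s \<and> 2 * j \<le> s}. 1 / sqrt (real j + 1) * (1 / sqrt (real (s - j) + 1)))"
    by (intro sum_mono2) auto
  finally show ?thesis using half by simp
qed

section \<open>Tensor products\<close>

lemma Basis_vec_real: "(Basis :: (real ^ 'n::finite) set) = range (\<lambda>i. axis i 1)"
  by (auto simp: Basis_vec_def)

lemma inj_axis_one: "inj (\<lambda>i::'n::finite. axis i (1::real))"
  by (auto simp: inj_on_def axis_eq_axis)

text \<open>Lebesgue measure on vectors is the image of a product measure indexed by basis vectors;
  \<open>?idx\<close> translates \<open>axis i 1\<close> back to the coordinate \<open>i\<close>,
  after which the product rule applies.\<close>

lemma lborel_prod_vec:
  fixes f :: "'n::finite \<Rightarrow> real \<Rightarrow> 'b::{real_normed_field, banach, second_countable_topology}"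
  assumes int: "\<And>i. integrable lborel (f i)"
  shows "integrable lborel (\<lambda>x::real ^ 'n. \<Prod>i\<in>UNIV. f i (x $ i))"
    and "(\<integral>x. (\<Prod>i\<in>UNIV. f i ((x :: real ^ 'n) $ i)) \<partial>lborel) = (\<Prod>i\<in>UNIV. \<integral>y. f i y \<partial>lborel)"
proof -
  interpret product_sigma_finite "\<lambda>_::real ^ 'n. lborel :: real measure" ..
  let ?idx = "the_inv (\<lambda>i::'n. axis i (1::real))"
  have idx: "?idx (axis i 1) = i" for i by (rule the_inv_f_f[OF inj_axis_one])
  have comp: "(\<Sum>b\<in>Basis. g b *\<^sub>R b) $ i = g (axis i 1)" for g and i :: 'n
    unfolding Basis_vec_real sum.reindex[OF inj_axis_one] by (simp add: axis_def if_distrib cong: if_cong)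
  have prod: "(\<Prod>i\<in>UNIV. F i (axis i 1)) = (\<Prod>b\<in>(Basis :: (real ^ 'n) set). F (?idx b) b)" for F :: "'n \<Rightarrow> real ^ 'n \<Rightarrow> 'b"
    unfolding Basis_vec_real prod.reindex[OF inj_axis_one] by (simp add: idx)
  have meas: "(\<lambda>x::real ^ 'n. \<Prod>i\<in>UNIV. f i (x $ i)) \<in> borel_measurable borel"
  proof (intro borel_measurable_prod)
    fix i
    have [measurable]: "f i \<in> borel_measurable borel" using int[of i] by simp
    show "(\<lambda>x::real ^ 'n. f i (x $ i)) \<in> borel_measurable borel" by measurable
  qed
  have eq: "(\<Prod>i\<in>UNIV. f i ((\<Sum>b\<in>Basis. g b *\<^sub>R b) $ i)) = (\<Prod>b\<in>(Basis :: (real ^ 'n) set). f (?idx b) (g b))" for g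
    unfolding comp by (rule prod[of "\<lambda>i b. f i (g b)"])
  have m: "(\<lambda>g. \<Sum>b\<in>Basis. g b *\<^sub>R b) \<in> Pi\<^sub>M (Basis :: (real ^ 'n) set) (\<lambda>_. lborel) \<rightarrow>\<^sub>M borel"
    by measurable
  show "integrable lborel (\<lambda>x::real ^ 'n. \<Prod>i\<in>UNIV. f i (x $ i))"
    unfolding lborel_eq[where 'a = "real ^ 'n"] integrable_distr_eq[OF m meas] eq
    by (intro product_integrable_prod int) auto
  show "(\<integral>x. (\<Prod>i\<in>UNIV. f i ((x :: real ^ 'n) $ i)) \<partial>lborel) = (\<Prod>i\<in>UNIV. \<integral>y. f i y \<partial>lborel)"
    unfolding lborel_eq[where 'a = "real ^ 'n"] integral_distr[OF m meas] eq
    using prod[of "\<lambda>i b. integral\<^sup>L lborel (f i)"] int by (subst product_integral_prod) auto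
qed

definition tensor :: "('k \<Rightarrow> real \<Rightarrow> real) \<Rightarrow> ('n::finite \<Rightarrow> 'k) \<Rightarrow> real ^ 'n \<Rightarrow> real" where
  "tensor f \<alpha> x = (\<Prod>i\<in>UNIV. f (\<alpha> i) (x $ i))"

lemma tensor_orthonormal:
  fixes \<alpha> \<beta> :: "'n::finite \<Rightarrow> 'k"
  assumes int: "\<And>a b. integrable lborel (\<lambda>x. f a x * f b x)"
    and orth: "\<And>a b. (\<integral>x. f a x * f b x \<partial>lborel) = (if a = b then 1 else 0)"
  shows "integrable lborel (\<lambda>x. tensor f \<alpha> x * tensor f \<beta> x)"
    and "(\<integral>x. tensor f \<alpha> x * tensor f \<beta> x \<partial>lborel) = (if \<alpha> = \<beta> then 1 else 0)"
proof -
  have eq: "tensor f \<alpha> x * tensor f \<beta> x = (\<Prod>i\<in>UNIV. f (\<alpha> i) (x $ i) * f (\<beta> i) (x $ i))" for x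
    by (simp add: tensor_def prod.distrib)
  show "integrable lborel (\<lambda>x. tensor f \<alpha> x * tensor f \<beta> x)"
    unfolding eq by (rule lborel_prod_vec(1)) (rule int)
  show "(\<integral>x. tensor f \<alpha> x * tensor f \<beta> x \<partial>lborel) = (if \<alpha> = \<beta> then 1 else 0)"
    unfolding eq by (subst lborel_prod_vec(2)) (auto simp: int orth fun_eq_iff)
qed

lemma tensor_measurable [measurable]:
  assumes [measurable]: "\<And>a. f a \<in> borel_measurable borel"
  shows "tensor f (\<alpha>::'n::finite \<Rightarrow> 'k) \<in> borel_measurable borel"
  unfolding tensor_def[abs_def] by measurable

section \<open>Space-time integrals of traces\<close>

abbreviation time_interval :: "real measure" where
  "time_interval \<equiv> restrict_space lborel {-1..1}"

lemma integral_cis_period: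
  fixes k :: int
  shows "(\<integral>t. indicator {- pi / 2..pi / 2} t *\<^sub>R cis (2 * t * real_of_int k) \<partial>lborel) = (if k = 0 then of_real pi else 0)"
proof (cases "k = 0")
  case True
  have "has_bochner_integral lborel (\<lambda>t. indicator {- pi / 2..pi / 2} t *\<^sub>R (1::complex))
      (measure lborel {- pi / 2..pi / 2} *\<^sub>R 1)"
    by (rule has_bochner_integral_indicator) auto
  then show ?thesis using True by (simp add: has_bochner_integral_iff scaleR_conv_of_real)
next
  case False
  let ?F = "\<lambda>t. cis (2 * t * real_of_int k) / (2 * \<i> * of_int k)"
  have "(\<integral>t. indicator {- pi / 2..pi / 2} t *\<^sub>R cis (2 * t * real_of_int k) \<partial>lborel) = ?F (pi / 2) - ?F (- pi / 2)"
  proof (rule integral_FTC_atLeastAtMost)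
    show "continuous_on {- pi / 2..pi / 2} (\<lambda>t. cis (2 * t * real_of_int k))"
      unfolding cis_conv_exp by (intro continuous_intros)
    fix t
    show "(?F has_vector_derivative cis (2 * t * real_of_int k)) (at t within {- pi / 2..pi / 2})"
    proof -
      have "((\<lambda>t. exp (\<i> * (2 * t * of_int k)) / (2 * \<i> * of_int k)) has_field_derivative exp (\<i> * (2 * of_real t * of_int k))) (at (complex_of_real t))"
        using False by (auto intro!: derivative_eq_intros simp: field_simps)
      from has_vector_derivative_real_field[OF this]
      show ?thesis unfolding cis_conv_exp by (simp add: mult_ac)
    qed
  qed simp
  also have "\<dots> = 0"
  proof -
    have "cis (pi * real_of_int k) = cis (- pi * real_of_int k)"
      by (simp add: complex_eq_iff sin_integer_2pi sin_zero_iff_int2)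
    then show ?thesis by simp
  qed
  finally show ?thesis using False by simp
qed

text \<open>Since \<open>pi > 3\<close>, the interval \<open>[-1, 1]\<close> lies in a full period
  \<open>[-pi/2, pi/2]\<close> of the functions \<open>exp(2itB)\<close>; there they are orthogonal
  with squared norm \<open>pi\<close>.\<close>

lemma nn_integral_cis_sum_le:
  fixes y :: "nat \<Rightarrow> complex"
  assumes "finite S"
  shows "(\<integral>\<^sup>+t. ennreal ((cmod (\<Sum>B\<in>S. y B * cis (2 * t * real B)))\<^sup>2) \<partial>time_interval)
    \<le> ennreal (pi * (\<Sum>B\<in>S. (cmod (y B))\<^sup>2))"
proof -
  let ?M = "restrict_space lborel {- pi / 2..pi / 2}"
  let ?\<phi> = "\<lambda>B t. cis (2 * t * real B) / of_real (sqrt pi)"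
  let ?f = "\<lambda>t. (cmod (\<Sum>B\<in>S. y B * cis (2 * t * real B)))\<^sup>2"
  have mult: "?\<phi> i t * cnj (?\<phi> j t) = cis (2 * t * of_int (int i - int j)) / of_real pi" for i j t
  proof -
    have "?\<phi> i t * cnj (?\<phi> j t) = cis (2 * t * real i - 2 * t * real j) / of_real (sqrt pi * sqrt pi)"
      by (simp add: cis_cnj cis_mult flip: of_real_mult)
    then show ?thesis by (simp only: real_sqrt_mult_self) (simp add: algebra_simps)
  qed
  have int: "integrable ?M (\<lambda>t. ?\<phi> i t * cnj (?\<phi> j t))" for i j
    unfolding mult
    by (subst integrable_restrict_space, simp, rule borel_integrable_atLeastAtMost'[unfolded set_integrable_def])
      (unfold cis_conv_exp, intro continuous_intros, simp)
  have orth: "(\<integral>t. ?\<phi> i t * cnj (?\<phi> j t) \<partial>?M) = (if i = j then 1 else 0)" for i j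
  proof -
    have "(\<integral>t. ?\<phi> i t * cnj (?\<phi> j t) \<partial>?M)
        = (\<integral>t. (indicator {- pi / 2..pi / 2} t *\<^sub>R cis (2 * t * of_int (int i - int j))) / of_real pi \<partial>lborel)"
      unfolding mult
      by (subst integral_restrict_space, simp, simp only: scaleR_conv_of_real times_divide_eq_right)
    also have "\<dots> = (\<integral>t. indicator {- pi / 2..pi / 2} t *\<^sub>R cis (2 * t * of_int (int i - int j)) \<partial>lborel) / of_real pi"
      by (rule integral_divide_zero)
    also have "\<dots> = (if i = j then 1 else 0)" by (subst integral_cis_period) auto
    finally show ?thesis .
  qed
  note * = integral_orthonormal_sum[of S ?M ?\<phi> "\<lambda>B. of_real (sqrt pi) * y B", OF assms int orth]
  have f: "(cmod (\<Sum>B\<in>S. of_real (sqrt pi) * y B * ?\<phi> B t))\<^sup>2 = ?f t" for t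
    by simp
  have [measurable]: "?f \<in> borel_measurable borel"
    unfolding cis_conv_exp by measurable
  have "(\<integral>\<^sup>+t. ennreal (?f t) \<partial>time_interval) = (\<integral>\<^sup>+t. ennreal (?f t) * indicator {-1..1} t \<partial>lborel)"
    by (subst nn_integral_restrict_space) simp_all
  also have "\<dots> \<le> (\<integral>\<^sup>+t. ennreal (?f t) * indicator {- pi / 2..pi / 2} t \<partial>lborel)"
    using pi_gt3 by (intro nn_integral_mono mult_left_mono) (auto simp: indicator_def)
  also have "\<dots> = (\<integral>\<^sup>+t. ennreal (?f t) \<partial>?M)"
    by (subst nn_integral_restrict_space) simp_all
  also have "\<dots> = ennreal (\<integral>t. ?f t \<partial>?M)"
    using *(1) unfolding f by (intro nn_integral_eq_integral) auto
  also have "(\<integral>t. ?f t \<partial>?M) = (\<Sum>B\<in>S. (cmod (of_real (sqrt pi) * y B))\<^sup>2)"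
    using *(2) unfolding f .
  also have "\<dots> = pi * (\<Sum>B\<in>S. (cmod (y B))\<^sup>2)"
    by (simp add: norm_mult power_mult_distrib sum_distrib_left)
  finally show ?thesis .
qed

text \<open>Parseval twice. In space, terms with the same label \<open>\<gamma> g\<close> are
  collected and orthonormality of \<open>\<psi>\<close> applies. In time, the frequency part
  \<open>\<sigma>\<close> depends on that label only and does not affect the modulus, so terms are
  further collected by \<open>\<tau> g\<close>. Only indices agreeing in both can interfere.\<close>

lemma trace_integral_le:
  fixes \<psi> :: "'i \<Rightarrow> 'x \<Rightarrow> complex" and \<tau> :: "'g \<Rightarrow> nat"
  assumes "finite G"
    and int: "\<And>i j. integrable M (\<lambda>x. \<psi> i x * cnj (\<psi> j x))"
    and orth: "\<And>i j. (\<integral>x. \<psi> i x * cnj (\<psi> j x) \<partial>M) = (if i = j then 1 else 0)"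
  shows "(\<integral>\<^sup>+t. \<integral>\<^sup>+x. ennreal ((cmod (\<Sum>g\<in>G. cis (2 * t * real (\<sigma> (\<gamma> g) + \<tau> g)) * z g * \<psi> (\<gamma> g) x))\<^sup>2) \<partial>M \<partial>time_interval)
    \<le> ennreal (pi * (\<Sum>i\<in>\<gamma> ` G. \<Sum>B\<in>\<tau> ` G. (cmod (\<Sum>g\<in>{g\<in>{g\<in>G. \<gamma> g = i}. \<tau> g = B}. z g))\<^sup>2))"
proof -
  let ?y = "\<lambda>i B. \<Sum>g\<in>{g\<in>{g\<in>G. \<gamma> g = i}. \<tau> g = B}. z g"
  have inner: "(\<integral>\<^sup>+x. ennreal ((cmod (\<Sum>g\<in>G. cis (2 * t * real (\<sigma> (\<gamma> g) + \<tau> g)) * z g * \<psi> (\<gamma> g) x))\<^sup>2) \<partial>M)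
      = (\<Sum>i\<in>\<gamma> ` G. ennreal ((cmod (\<Sum>B\<in>\<tau> ` G. ?y i B * cis (2 * t * real B)))\<^sup>2))" for t
  proof -
    let ?c = "\<lambda>i. \<Sum>g\<in>{g\<in>G. \<gamma> g = i}. cis (2 * t * real (\<sigma> i + \<tau> g)) * z g"
    have c: "cmod (?c i) = cmod (\<Sum>B\<in>\<tau> ` G. ?y i B * cis (2 * t * real B))" for i
    proof -
      have "?c i = cis (2 * t * real (\<sigma> i)) * (\<Sum>g\<in>{g\<in>G. \<gamma> g = i}. cis (2 * t * real (\<tau> g)) * z g)"
        by (simp add: sum_distrib_left mult.assoc[symmetric] cis_mult distrib_left)
      also have "(\<Sum>g\<in>{g\<in>G. \<gamma> g = i}. cis (2 * t * real (\<tau> g)) * z g)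
          = (\<Sum>B\<in>\<tau> ` G. \<Sum>g\<in>{g\<in>{g\<in>G. \<gamma> g = i}. \<tau> g = B}. cis (2 * t * real (\<tau> g)) * z g)"
        using \<open>finite G\<close> by (intro sum.group[symmetric]) auto
      also have "\<dots> = (\<Sum>B\<in>\<tau> ` G. ?y i B * cis (2 * t * real B))"
        by (intro sum.cong refl) (simp add: sum_distrib_left mult.commute)
      finally show ?thesis by (simp add: norm_mult)
    qed
    have e: "(\<Sum>g\<in>G. cis (2 * t * real (\<sigma> (\<gamma> g) + \<tau> g)) * z g * \<psi> (\<gamma> g) x) = (\<Sum>i\<in>\<gamma> ` G. ?c i * \<psi> i x)" for x
    proof -
      have "(\<Sum>g\<in>G. cis (2 * t * real (\<sigma> (\<gamma> g) + \<tau> g)) * z g * \<psi> (\<gamma> g) x)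
          = (\<Sum>i\<in>\<gamma> ` G. \<Sum>g\<in>{g\<in>G. \<gamma> g = i}. cis (2 * t * real (\<sigma> (\<gamma> g) + \<tau> g)) * z g * \<psi> (\<gamma> g) x)"
        using \<open>finite G\<close> by (intro sum.group[symmetric]) auto
      also have "\<dots> = (\<Sum>i\<in>\<gamma> ` G. ?c i * \<psi> i x)"
        by (intro sum.cong refl) (simp add: sum_distrib_right)
      finally show ?thesis .
    qed
    note * = integral_orthonormal_sum[of "\<gamma> ` G" M \<psi> ?c, OF finite_imageI[OF \<open>finite G\<close>] int orth]
    have "(\<integral>\<^sup>+x. ennreal ((cmod (\<Sum>i\<in>\<gamma> ` G. ?c i * \<psi> i x))\<^sup>2) \<partial>M) = ennreal (\<Sum>i\<in>\<gamma> ` G. (cmod (?c i))\<^sup>2)"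
      using * by (subst nn_integral_eq_integral) auto
    also have "\<dots> = (\<Sum>i\<in>\<gamma> ` G. ennreal ((cmod (?c i))\<^sup>2))" by (simp add: sum_ennreal)
    finally show ?thesis unfolding e c .
  qed
  have "(\<integral>\<^sup>+t. (\<Sum>i\<in>\<gamma> ` G. ennreal ((cmod (\<Sum>B\<in>\<tau> ` G. ?y i B * cis (2 * t * real B)))\<^sup>2)) \<partial>time_interval)
      = (\<Sum>i\<in>\<gamma> ` G. \<integral>\<^sup>+t. ennreal ((cmod (\<Sum>B\<in>\<tau> ` G. ?y i B * cis (2 * t * real B)))\<^sup>2) \<partial>time_interval)"
  proof (rule nn_integral_sum)
    fix i
    have "(\<lambda>t. ennreal ((cmod (\<Sum>B\<in>\<tau> ` G. ?y i B * cis (2 * t * real B)))\<^sup>2)) \<in> borel_measurable borel"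
      unfolding cis_conv_exp by measurable
    then show "(\<lambda>t. ennreal ((cmod (\<Sum>B\<in>\<tau> ` G. ?y i B * cis (2 * t * real B)))\<^sup>2)) \<in> borel_measurable time_interval"
      by (simp add: measurable_restrict_space1)
  qed
  also have "\<dots> \<le> (\<Sum>i\<in>\<gamma> ` G. ennreal (pi * (\<Sum>B\<in>\<tau> ` G. (cmod (?y i B))\<^sup>2)))"
    using \<open>finite G\<close> by (intro sum_mono nn_integral_cis_sum_le) auto
  also have "\<dots> = ennreal (pi * (\<Sum>i\<in>\<gamma> ` G. \<Sum>B\<in>\<tau> ` G. (cmod (?y i B))\<^sup>2))"
    by (subst sum_ennreal) (auto simp: sum_distrib_left intro!: mult_nonneg_nonneg sum_nonneg)
  finally show ?thesis unfolding inner .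
qed

text \<open>Dilation by \<open>sqrt 2\<close> changes the norm; the factor \<open>2^(1/4)\<close>
  restores it, and \<open>hermite_origin\<close> takes the inverse factor so that the product of
  both is unchanged.\<close>

definition hermite_scaled :: "nat \<Rightarrow> real \<Rightarrow> real" where
  "hermite_scaled a x = sqrt (sqrt 2) * hermite_fun a (sqrt 2 * x)"

definition hermite_origin :: "nat \<Rightarrow> real" where
  "hermite_origin b = hermite_fun b 0 / sqrt (sqrt 2)"

lemma hermite_origin_le: "(hermite_origin b)\<^sup>2 \<le> (hermite_fun b 0)\<^sup>2"
proof -
  have "(hermite_origin b)\<^sup>2 = (hermite_fun b 0)\<^sup>2 / sqrt 2" by (simp add: hermite_origin_def power_divide)
  also have "\<dots> \<le> (hermite_fun b 0)\<^sup>2 / 1" by (intro divide_left_mono) auto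
  finally show ?thesis by simp
qed

lemma hermite_scaled_orthonormal:
  "integrable lborel (\<lambda>x. hermite_scaled a x * hermite_scaled b x)"
  "(\<integral>x. hermite_scaled a x * hermite_scaled b x \<partial>lborel) = (if a = b then 1 else 0)"
proof -
  let ?f = "\<lambda>x. hermite_fun a x * hermite_fun b x"
  have eq: "hermite_scaled a x * hermite_scaled b x = sqrt 2 * ?f (0 + sqrt 2 * x)" for x
    unfolding hermite_scaled_def
    by (simp add: mult_ac)
  show "integrable lborel (\<lambda>x. hermite_scaled a x * hermite_scaled b x)"
    unfolding eq using integrable_hermite_mult[of a b]
    by (intro integrable_mult_right lborel_integrable_real_affine[where f = ?f]) auto
  have "(\<integral>x. ?f x \<partial>lborel) = sqrt 2 * (\<integral>x. ?f (0 + sqrt 2 * x) \<partial>lborel)"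
    by (subst lborel_integral_real_affine[of "sqrt 2" ?f 0]) auto
  then show "(\<integral>x. hermite_scaled a x * hermite_scaled b x \<partial>lborel) = (if a = b then 1 else 0)"
    unfolding eq by (subst integral_mult_right_zero) (simp add: hermite_orthonormal)
qed

lemma hermite_mult_scaled:
  assumes "n + m \<le> K"
  shows "hermite_fun n x * hermite_fun m x
    = (\<Sum>(a, b)\<in>tri K. rot_coeff n m a b * (hermite_scaled a x * hermite_origin b))"
  using hermite_mult_expansion[OF assms, of x]
  by (simp add: hermite_scaled_def hermite_origin_def)

text \<open>\<open>trace_integral_le\<close> in one dimension: the first rotated index labels the
  space function, the second is the residual time frequency.\<close>

lemma hermite_trace_bound:
  fixes w :: "nat \<Rightarrow> nat \<Rightarrow> complex"
  shows "(\<integral>\<^sup>+t. \<integral>\<^sup>+x. ennreal ((cmod (\<Sum>(n, m)\<in>tri K. w n m * cis (2 * t * real (n + m))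
              * of_real (hermite_fun n x * hermite_fun m x)))\<^sup>2) \<partial>lborel \<partial>time_interval)
    \<le> ennreal (pi * (\<Sum>(a, b)\<in>tri K. (hermite_fun b 0)\<^sup>2 * (cmod (rot_sum K w a b))\<^sup>2))"
proof -
  let ?z = "\<lambda>g. rot_sum K w (fst g) (snd g) * of_real (hermite_origin (snd g))"
  let ?\<psi> = "\<lambda>a x. complex_of_real (hermite_scaled a x)"
  have expand: "(\<Sum>(n, m)\<in>tri K. w n m * cis (2 * t * real (n + m)) * of_real (hermite_fun n x * hermite_fun m x))
      = (\<Sum>g\<in>tri K. cis (2 * t * real (id (fst g) + snd g)) * ?z g * ?\<psi> (fst g) x)" for t x
  proof -
    have "(\<Sum>(n, m)\<in>tri K. w n m * cis (2 * t * real (n + m)) * of_real (hermite_fun n x * hermite_fun m x))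
        = (\<Sum>(n, m)\<in>tri K. \<Sum>(a, b)\<in>tri K. w n m * cis (2 * t * real (n + m)) * of_real (rot_coeff n m a b)
             * of_real (hermite_scaled a x * hermite_origin b))"
    proof (intro sum.cong refl, clarify)
      fix n m assume "(n, m) \<in> tri K"
      then have nm: "n + m \<le> K" by simp
      show "w n m * cis (2 * t * real (n + m)) * of_real (hermite_fun n x * hermite_fun m x)
          = (\<Sum>(a, b)\<in>tri K. w n m * cis (2 * t * real (n + m)) * of_real (rot_coeff n m a b)
             * of_real (hermite_scaled a x * hermite_origin b))"
        unfolding hermite_mult_scaled[OF nm]
        by (simp add: sum_distrib_left case_prod_unfold mult.assoc)
    qed
    \<comment> \<open>Where the rotated coefficient is nonzero, \<open>rot_support\<close> allows
      the phase of \<open>n + m\<close> to be written with \<open>a + b\<close>, so that it can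
      leave the sum over \<open>(n, m)\<close>.\<close>
    also have "\<dots> = (\<Sum>(n, m)\<in>tri K. \<Sum>(a, b)\<in>tri K. w n m * cis (2 * t * real (a + b)) * of_real (rot_coeff n m a b)
             * of_real (hermite_scaled a x * hermite_origin b))"
    proof (intro sum.cong refl, clarify, intro sum.cong refl, clarify)
      fix n m a b
      show "w n m * cis (2 * t * real (n + m)) * of_real (rot_coeff n m a b) * of_real (hermite_scaled a x * hermite_origin b)
          = w n m * cis (2 * t * real (a + b)) * of_real (rot_coeff n m a b) * of_real (hermite_scaled a x * hermite_origin b)"
        using rot_support[of n m a b] by (cases "rot_coeff n m a b = 0") auto
    qed
    also have "\<dots> = (\<Sum>g\<in>tri K. cis (2 * t * real (id (fst g) + snd g)) * ?z g * ?\<psi> (fst g) x)"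
      unfolding rot_sum_def case_prod_unfold
      by (subst sum.swap) (simp add: sum_distrib_left sum_distrib_right mult_ac)
    finally show ?thesis .
  qed
  have "(\<integral>\<^sup>+t. \<integral>\<^sup>+x. ennreal ((cmod (\<Sum>g\<in>tri K. cis (2 * t * real (id (fst g) + snd g)) * ?z g * ?\<psi> (fst g) x))\<^sup>2) \<partial>lborel \<partial>time_interval)
      \<le> ennreal (pi * (\<Sum>i\<in>fst ` tri K. \<Sum>B\<in>snd ` tri K. (cmod (\<Sum>g\<in>{g\<in>{g\<in>tri K. fst g = i}. snd g = B}. ?z g))\<^sup>2))"
  proof (rule trace_integral_le)
    fix i j
    have c: "?\<psi> i x * cnj (?\<psi> j x) = complex_of_real (hermite_scaled i x * hermite_scaled j x)" for x by simp
    show "integrable lborel (\<lambda>x. ?\<psi> i x * cnj (?\<psi> j x))"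
      unfolding c by (intro integrable_of_real hermite_scaled_orthonormal(1))
    show "(\<integral>x. ?\<psi> i x * cnj (?\<psi> j x) \<partial>lborel) = (if i = j then 1 else 0)"
      unfolding c integral_complex_of_real hermite_scaled_orthonormal(2) by simp
  qed simp
  \<comment> \<open>A fibre of equal \<open>a\<close> and \<open>b\<close> holds at most one pair,
    so in one dimension no Cauchy-Schwarz is spent on it.\<close>
  also have "(\<Sum>i\<in>fst ` tri K. \<Sum>B\<in>snd ` tri K. (cmod (\<Sum>g\<in>{g\<in>{g\<in>tri K. fst g = i}. snd g = B}. ?z g))\<^sup>2)
      = (\<Sum>g\<in>fst ` tri K \<times> snd ` tri K. if g \<in> tri K then (cmod (?z g))\<^sup>2 else 0)"
  proof -
    have "(cmod (\<Sum>g\<in>{g\<in>{g\<in>tri K. fst g = i}. snd g = B}. ?z g))\<^sup>2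
        = (if (i, B) \<in> tri K then (cmod (?z (i, B)))\<^sup>2 else 0)" for i B
    proof -
      have "{g\<in>{g\<in>tri K. fst g = i}. snd g = B} = (if (i, B) \<in> tri K then {(i, B)} else {})" by auto
      then show ?thesis by simp
    qed
    then show ?thesis by (simp only: sum.cartesian_product case_prod_unfold prod.collapse)
  qed
  also have "\<dots> = (\<Sum>g\<in>tri K. (cmod (?z g))\<^sup>2)"
    by (intro sum.mono_neutral_cong_right) (auto intro: rev_image_eqI)
  also have "\<dots> = (\<Sum>(a, b)\<in>tri K. (hermite_origin b)\<^sup>2 * (cmod (rot_sum K w a b))\<^sup>2)"
    by (simp add: norm_mult power_mult_distrib case_prod_unfold mult.commute)
  also have "ennreal (pi * \<dots>) \<le> ennreal (pi * (\<Sum>(a, b)\<in>tri K. (hermite_fun b 0)\<^sup>2 * (cmod (rot_sum K w a b))\<^sup>2))"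
    by (intro ennreal_leI mult_left_mono sum_mono) (auto intro!: mult_right_mono hermite_origin_le)
  finally show ?thesis unfolding expand .
qed

section \<open>Bilinear estimates for finite Hermite expansions\<close>

definition multi_total :: "('n::finite \<Rightarrow> nat) \<Rightarrow> nat" where
  "multi_total \<alpha> = (\<Sum>i\<in>UNIV. \<alpha> i)"

definition multi_box :: "nat \<Rightarrow> ('n::finite \<Rightarrow> nat) set" where
  "multi_box L = {\<alpha>. \<forall>i. \<alpha> i \<le> L}"

lemma multi_box_PiE: "multi_box L = PiE UNIV (\<lambda>_. {..L})"
  by (auto simp: multi_box_def PiE_def)

lemma finite_multi_box [simp]: "finite (multi_box L)"
  unfolding multi_box_PiE by (rule finite_PiE) auto

text \<open>The common phase \<open>cis(t d)\<close> of the ground energy is left out, since it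
  drops out of all moduli; \<open>flow_freq_localization\<close> restores it.\<close>

definition wave :: "nat \<Rightarrow> (('n::finite \<Rightarrow> nat) \<Rightarrow> complex) \<Rightarrow> real \<Rightarrow> real ^ 'n \<Rightarrow> complex" where
  "wave L c t x = (\<Sum>\<alpha>\<in>multi_box L. c \<alpha> * cis (2 * t * real (multi_total \<alpha>)) * of_real (tensor hermite_fun \<alpha> x))"

abbreviation coeff_norm2 :: "nat \<Rightarrow> (('n::finite \<Rightarrow> nat) \<Rightarrow> complex) \<Rightarrow> real" where
  "coeff_norm2 L c \<equiv> (\<Sum>\<alpha>\<in>multi_box L. (cmod (c \<alpha>))\<^sup>2)"

lemma cmod_sum_mult_le: "(cmod (\<Sum>g\<in>S. w g * of_real (v g)))\<^sup>2 \<le> (\<Sum>g\<in>S. (v g)\<^sup>2) * (\<Sum>g\<in>S. (cmod (w g))\<^sup>2)"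
proof -
  have "cmod (\<Sum>g\<in>S. w g * of_real (v g)) \<le> (\<Sum>g\<in>S. \<bar>v g\<bar> * cmod (w g))"
    by (rule order_trans[OF norm_sum]) (simp add: norm_mult mult.commute)
  then have "(cmod (\<Sum>g\<in>S. w g * of_real (v g)))\<^sup>2 \<le> (\<Sum>g\<in>S. \<bar>v g\<bar> * cmod (w g))\<^sup>2"
    by (rule power_mono) simp
  also have "\<dots> \<le> (\<Sum>g\<in>S. \<bar>v g\<bar>\<^sup>2) * (\<Sum>g\<in>S. (cmod (w g))\<^sup>2)" by (rule Cauchy_Schwarz_ineq_sum)
  finally show ?thesis by simp
qed

section \<open>Comparable frequencies: rotation in all coordinates\<close>

lemma sum_PiE_prod:
  fixes f :: "'n::finite \<Rightarrow> 'k \<Rightarrow> 'b::comm_semiring_1"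
  assumes "\<And>i. finite (A i)"
  shows "(\<Sum>g\<in>PiE UNIV A. \<Prod>i\<in>UNIV. f i (g i)) = (\<Prod>i\<in>UNIV. \<Sum>a\<in>A i. f i a)"
  by (rule prod_sum_PiE[symmetric]) (use assms in auto)

text \<open>Two coordinates are set aside. Given the others, \<open>b i + b j\<close> is fixed and
  this pair contributes at most 8 by the convolution bound; each of the other \<open>d - 2\<close>
  coordinates contributes a Christoffel sum at the origin. This is the source of the exponent
  \<open>d - 2\<close>.\<close>

lemma hermite_origin_simplex_sum:
  assumes "2 \<le> CARD('n::finite)"
  shows "(\<Sum>b\<in>{b \<in> multi_box K. multi_total b = B}. \<Prod>i\<in>(UNIV :: 'n set). (hermite_fun (b i) 0)\<^sup>2)
    \<le> 8 * sqrt (2 * Suc K) ^ (CARD('n) - 2)"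
proof -
  obtain S :: "'n set" where "card S = 2" using assms by (meson obtain_subset_with_card_n)
  then obtain i j :: 'n where ij: "i \<noteq> j" by (metis card_2_iff)
  let ?h = "\<lambda>n. (hermite_fun n 0)\<^sup>2"
  let ?R = "- {i, j}"
  let ?T = "{b :: 'n \<Rightarrow> nat. b \<in> multi_box K \<and> multi_total b = B}"
  \<comment> \<open>Erasing the entries \<open>i\<close> and \<open>j\<close> labels the fibres by
    the remaining coordinates.\<close>
  let ?r = "\<lambda>b. b(i := 0, j := 0) :: 'n \<Rightarrow> nat"
  let ?M = "\<lambda>k. if k \<in> {i, j} then {0} else {..K}"
  have split: "(\<Prod>k\<in>UNIV. f k) = f i * f j * (\<Prod>k\<in>?R. f k)" for f :: "'n \<Rightarrow> real"
  proof -
    have "(\<Prod>k\<in>UNIV. f k) = (\<Prod>k\<in>{i, j} \<union> ?R. f k)" by (rule prod.cong) auto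
    also have "\<dots> = (\<Prod>k\<in>{i, j}. f k) * (\<Prod>k\<in>?R. f k)" by (rule prod.union_disjoint) auto
    finally show ?thesis using ij by simp
  qed
  have tot: "multi_total b = b i + b j + (\<Sum>k\<in>?R. b k)" for b :: "'n \<Rightarrow> nat"
  proof -
    have "multi_total b = (\<Sum>k\<in>{i, j} \<union> ?R. b k)" unfolding multi_total_def by (rule sum.cong) auto
    also have "\<dots> = (\<Sum>k\<in>{i, j}. b k) + (\<Sum>k\<in>?R. b k)" by (rule sum.union_disjoint) auto
    finally show ?thesis using ij by simp
  qed
  have fibre: "(\<Sum>b\<in>{b \<in> ?T. ?r b = r}. \<Prod>k\<in>UNIV. ?h (b k)) \<le> 8 * (\<Prod>k\<in>?R. ?h (r k))" for r
  proof -
    \<comment> \<open>The subtraction of natural numbers truncates only if the fibre is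
      empty.\<close>
    let ?s = "B - (\<Sum>k\<in>?R. r k)"
    let ?F = "{b \<in> ?T. ?r b = r}"
    have rk: "b k = r k" if "b \<in> ?F" "k \<in> ?R" for b k
      using that by (auto simp: fun_eq_iff split: if_splits)
    have bs: "b i \<le> ?s \<and> b j = ?s - b i" if "b \<in> ?F" for b
    proof -
      have "(\<Sum>k\<in>?R. b k) = (\<Sum>k\<in>?R. r k)" by (rule sum.cong) (use rk[OF that] in auto)
      then have "b i + b j + (\<Sum>k\<in>?R. r k) = B" using that tot[of b] by simp
      then show ?thesis by (intro conjI; linarith)
    qed
    have "(\<Sum>b\<in>?F. \<Prod>k\<in>UNIV. ?h (b k)) = (\<Sum>b\<in>?F. (?h (b i) * ?h (?s - b i)) * (\<Prod>k\<in>?R. ?h (r k)))"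
    proof (rule sum.cong[OF refl])
      fix b assume b: "b \<in> ?F"
      have "(\<Prod>k\<in>?R. ?h (b k)) = (\<Prod>k\<in>?R. ?h (r k))" by (rule prod.cong) (use rk[OF b] in auto)
      then show "(\<Prod>k\<in>UNIV. ?h (b k)) = (?h (b i) * ?h (?s - b i)) * (\<Prod>k\<in>?R. ?h (r k))"
        unfolding split using bs[OF b] by simp
    qed
    also have "\<dots> = (\<Sum>b\<in>?F. ?h (b i) * ?h (?s - b i)) * (\<Prod>k\<in>?R. ?h (r k))"
      by (rule sum_distrib_right[symmetric])
    also have "\<dots> \<le> (\<Sum>n\<le>?s. ?h n * ?h (?s - n)) * (\<Prod>k\<in>?R. ?h (r k))"
    proof (intro mult_right_mono prod_nonneg)
      have inj: "inj_on (\<lambda>b. b i) ?F"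
      proof (rule inj_onI)
        fix b b' assume b: "b \<in> ?F" "b' \<in> ?F" and e: "b i = b' i"
        show "b = b'"
        proof
          fix k
          show "b k = b' k"
            using bs[OF b(1)] bs[OF b(2)] e rk[OF b(1), of k] rk[OF b(2), of k] by (cases "k \<in> {i, j}") auto
        qed
      qed
      have "(\<Sum>b\<in>?F. ?h (b i) * ?h (?s - b i)) = (\<Sum>n\<in>(\<lambda>b. b i) ` ?F. ?h n * ?h (?s - n))"
        unfolding sum.reindex[OF inj] by simp
      also have "\<dots> \<le> (\<Sum>n\<le>?s. ?h n * ?h (?s - n))"
        using bs by (intro sum_mono2) auto
      finally show "(\<Sum>b\<in>?F. ?h (b i) * ?h (?s - b i)) \<le> (\<Sum>n\<le>?s. ?h n * ?h (?s - n))" .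
    qed auto
    also have "\<dots> \<le> 8 * (\<Prod>k\<in>?R. ?h (r k))"
      by (intro mult_right_mono hermite_convolution_0_le prod_nonneg) auto
    finally show ?thesis .
  qed
  have fin: "finite (PiE UNIV ?M)" by (rule finite_PiE) auto
  have "(\<Sum>b\<in>?T. \<Prod>k\<in>UNIV. ?h (b k)) = (\<Sum>r\<in>PiE UNIV ?M. \<Sum>b\<in>{b \<in> ?T. ?r b = r}. \<Prod>k\<in>UNIV. ?h (b k))"
  proof (rule sum.group[symmetric])
    show "?r ` ?T \<subseteq> PiE UNIV ?M" by (auto simp: multi_box_def)
  qed (use fin in auto)
  also have "\<dots> \<le> (\<Sum>r\<in>PiE UNIV ?M. 8 * (\<Prod>k\<in>?R. ?h (r k)))"
    by (intro sum_mono fibre)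
  also have "\<dots> = 8 * (\<Sum>r\<in>PiE UNIV ?M. \<Prod>k\<in>UNIV. if k \<in> {i, j} then 1 else ?h (r k))"
    unfolding split by (simp add: sum_distrib_left)
  also have "\<dots> = 8 * (\<Prod>k\<in>UNIV. \<Sum>n\<in>?M k. if k \<in> {i, j} then 1 else ?h n)"
    by (subst sum_PiE_prod) auto
  also have "\<dots> = 8 * (\<Prod>k\<in>?R. \<Sum>n\<le>K. ?h n)"
    unfolding split using ij by simp
  also have "\<dots> \<le> 8 * (\<Prod>k\<in>?R. sqrt (2 * Suc K))"
    using hermite_christoffel_le[where x = 0]
    by (intro mult_left_mono prod_mono) (auto intro!: sum_nonneg simp del: of_nat_Suc)
  also have "\<dots> = 8 * sqrt (2 * Suc K) ^ (CARD('n) - 2)"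
    using ij by (simp add: Compl_eq_Diff_UNIV card_Diff_subset del: of_nat_Suc)
  finally show ?thesis .
qed

text \<open>Each coordinate is rotated separately; multiplying out gives a sum over all choices
  \<open>g\<close> of one rotated pair per coordinate.\<close>

lemma tensor_hermite_mult:
  assumes "\<alpha> \<in> multi_box L" "\<beta> \<in> multi_box L"
  shows "tensor hermite_fun \<alpha> x * tensor hermite_fun \<beta> x
    = (\<Sum>g\<in>PiE UNIV (\<lambda>_. tri (2 * L)).
        (\<Prod>i\<in>UNIV. rot_coeff (\<alpha> i) (\<beta> i) (fst (g i)) (snd (g i)))
        * ((\<Prod>i\<in>UNIV. hermite_origin (snd (g i))) * tensor hermite_scaled (fst \<circ> g) x))"
proof -
  have le: "\<alpha> i + \<beta> i \<le> 2 * L" for i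
  proof -
    have "\<alpha> i \<le> L" "\<beta> i \<le> L" using assms by (auto simp: multi_box_def)
    then show ?thesis by linarith
  qed
  have "tensor hermite_fun \<alpha> x * tensor hermite_fun \<beta> x
      = (\<Prod>i\<in>UNIV. hermite_fun (\<alpha> i) (x $ i) * hermite_fun (\<beta> i) (x $ i))"
    by (simp add: tensor_def prod.distrib)
  also have "\<dots> = (\<Prod>i\<in>UNIV. \<Sum>p\<in>tri (2 * L). rot_coeff (\<alpha> i) (\<beta> i) (fst p) (snd p)
      * (hermite_scaled (fst p) (x $ i) * hermite_origin (snd p)))"
    by (intro prod.cong refl) (subst hermite_mult_scaled[OF le], simp add: case_prod_unfold)
  also have "\<dots> = (\<Sum>g\<in>PiE UNIV (\<lambda>_. tri (2 * L)). \<Prod>i\<in>UNIV. rot_coeff (\<alpha> i) (\<beta> i) (fst (g i)) (snd (g i))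
      * (hermite_scaled (fst (g i)) (x $ i) * hermite_origin (snd (g i))))"
    by (subst sum_PiE_prod) auto
  finally show ?thesis by (simp add: tensor_def prod.distrib mult_ac)
qed

text \<open>\<open>trace_integral_le\<close> with the first rotated indices as space label and the
  total of the second ones as time frequency. Several \<open>g\<close> share a fibre, so
  Cauchy-Schwarz separates the values at the origin, whose squares
  \<open>hermite_origin_simplex_sum\<close> controls; the remaining coefficients are an isometric
  image of the products \<open>c \<alpha> * d \<beta>\<close>.\<close>

lemma wave_mult_bound_near:
  fixes c d :: "('n::finite \<Rightarrow> nat) \<Rightarrow> complex"
  assumes card: "2 \<le> CARD('n)"
  shows "(\<integral>\<^sup>+t. \<integral>\<^sup>+x. ennreal ((cmod (wave L c t x * wave L d t x))\<^sup>2) \<partial>lborel \<partial>time_interval)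
    \<le> ennreal (pi * (8 * sqrt (2 * Suc (2 * L)) ^ (CARD('n) - 2)) * coeff_norm2 L c * coeff_norm2 L d)"
proof -
  let ?G = "PiE UNIV (\<lambda>_. tri (2 * L)) :: ('n \<Rightarrow> nat \<times> nat) set"
  let ?Bx = "multi_box L :: ('n \<Rightarrow> nat) set"
  let ?\<gamma> = "\<lambda>g :: 'n \<Rightarrow> nat \<times> nat. fst \<circ> g" and ?\<tau> = "\<lambda>g :: 'n \<Rightarrow> nat \<times> nat. multi_total (snd \<circ> g)"
  let ?r = "\<lambda>(p :: ('n \<Rightarrow> nat) \<times> ('n \<Rightarrow> nat)) g. \<Prod>i\<in>UNIV. rot_coeff (fst p i) (snd p i) (fst (g i)) (snd (g i))"
  let ?o = "\<lambda>g :: 'n \<Rightarrow> nat \<times> nat. \<Prod>i\<in>UNIV. hermite_origin (snd (g i))"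
  let ?W = "\<lambda>g. \<Sum>p\<in>?Bx \<times> ?Bx. (c (fst p) * d (snd p)) * of_real (?r p g)"
  let ?\<psi> = "\<lambda>\<alpha> x. complex_of_real (tensor hermite_scaled \<alpha> x) :: complex"
  let ?Z = "8 * sqrt (2 * Suc (2 * L)) ^ (CARD('n) - 2)"
  have finG: "finite ?G" by (rule finite_PiE) auto
  have phase: "?r p g \<noteq> 0 \<Longrightarrow> multi_total (?\<gamma> g) + ?\<tau> g = multi_total (fst p) + multi_total (snd p)" for p g
  proof -
    assume "?r p g \<noteq> 0"
    then have "fst (g i) + snd (g i) = fst p i + snd p i" for i
      using rot_support[of "fst p i" "snd p i" "fst (g i)" "snd (g i)"] by (simp add: prod_zero_iff)
    then show ?thesis by (simp add: multi_total_def sum.distrib[symmetric])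
  qed
  have expand: "wave L c t x * wave L d t x
      = (\<Sum>g\<in>?G. cis (2 * t * real (multi_total (?\<gamma> g) + ?\<tau> g)) * (?W g * of_real (?o g)) * ?\<psi> (?\<gamma> g) x)" for t x
  proof -
    have "wave L c t x * wave L d t x
        = (\<Sum>p\<in>?Bx \<times> ?Bx. (c (fst p) * d (snd p)) * cis (2 * t * real (multi_total (fst p) + multi_total (snd p)))
            * of_real (tensor hermite_fun (fst p) x * tensor hermite_fun (snd p) x))"
      unfolding wave_def sum_product sum.cartesian_product
      by (intro sum.cong refl) (auto simp: cis_mult distrib_left mult_ac)
    also have "\<dots> = (\<Sum>p\<in>?Bx \<times> ?Bx. \<Sum>g\<in>?G. (c (fst p) * d (snd p)) * cis (2 * t * real (multi_total (fst p) + multi_total (snd p)))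
            * (of_real (?r p g) * (of_real (?o g) * ?\<psi> (?\<gamma> g) x)))"
    proof (intro sum.cong refl)
      fix p assume "p \<in> ?Bx \<times> ?Bx"
      then have p: "fst p \<in> ?Bx" "snd p \<in> ?Bx" by auto
      show "(c (fst p) * d (snd p)) * cis (2 * t * real (multi_total (fst p) + multi_total (snd p)))
            * of_real (tensor hermite_fun (fst p) x * tensor hermite_fun (snd p) x)
          = (\<Sum>g\<in>?G. (c (fst p) * d (snd p)) * cis (2 * t * real (multi_total (fst p) + multi_total (snd p)))
            * (of_real (?r p g) * (of_real (?o g) * ?\<psi> (?\<gamma> g) x)))"
        unfolding tensor_hermite_mult[OF p] of_real_sum of_real_mult sum_distrib_left ..
    qed
    also have "\<dots> = (\<Sum>p\<in>?Bx \<times> ?Bx. \<Sum>g\<in>?G. (c (fst p) * d (snd p)) * cis (2 * t * real (multi_total (?\<gamma> g) + ?\<tau> g))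
            * (of_real (?r p g) * (of_real (?o g) * ?\<psi> (?\<gamma> g) x)))"
    proof (intro sum.cong refl)
      fix p g
      show "(c (fst p) * d (snd p)) * cis (2 * t * real (multi_total (fst p) + multi_total (snd p)))
            * (of_real (?r p g) * (of_real (?o g) * ?\<psi> (?\<gamma> g) x))
          = (c (fst p) * d (snd p)) * cis (2 * t * real (multi_total (?\<gamma> g) + ?\<tau> g))
            * (of_real (?r p g) * (of_real (?o g) * ?\<psi> (?\<gamma> g) x))"
      proof (cases "?r p g = 0")
        case True
        show ?thesis unfolding True by simp
      next
        case False
        show ?thesis unfolding phase[OF False] ..
      qed
    qed
    also have "\<dots> = (\<Sum>g\<in>?G. \<Sum>p\<in>?Bx \<times> ?Bx. (c (fst p) * d (snd p)) * cis (2 * t * real (multi_total (?\<gamma> g) + ?\<tau> g))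
            * (of_real (?r p g) * (of_real (?o g) * ?\<psi> (?\<gamma> g) x)))"
      by (rule sum.swap)
    also have "\<dots> = (\<Sum>g\<in>?G. cis (2 * t * real (multi_total (?\<gamma> g) + ?\<tau> g)) * (?W g * of_real (?o g)) * ?\<psi> (?\<gamma> g) x)"
      unfolding sum_distrib_left sum_distrib_right by (intro sum.cong refl) (simp only: mult_ac)
    finally show ?thesis .
  qed
  have "(\<integral>\<^sup>+t. \<integral>\<^sup>+x. ennreal ((cmod (\<Sum>g\<in>?G. cis (2 * t * real (multi_total (?\<gamma> g) + ?\<tau> g)) * (?W g * of_real (?o g)) * ?\<psi> (?\<gamma> g) x))\<^sup>2) \<partial>lborel \<partial>time_interval)
      \<le> ennreal (pi * (\<Sum>i\<in>?\<gamma> ` ?G. \<Sum>B\<in>?\<tau> ` ?G. (cmod (\<Sum>g\<in>{g\<in>{g\<in>?G. ?\<gamma> g = i}. ?\<tau> g = B}. ?W g * of_real (?o g)))\<^sup>2))"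
  proof (rule trace_integral_le[OF finG])
    fix i j :: "'n \<Rightarrow> nat"
    have e: "?\<psi> i x * cnj (?\<psi> j x) = complex_of_real (tensor hermite_scaled i x * tensor hermite_scaled j x)" for x by simp
    note o = tensor_orthonormal[of hermite_scaled, OF hermite_scaled_orthonormal]
    show "integrable lborel (\<lambda>x. ?\<psi> i x * cnj (?\<psi> j x))"
      unfolding e by (intro integrable_of_real o)
    show "(\<integral>x. ?\<psi> i x * cnj (?\<psi> j x) \<partial>lborel) = (if i = j then 1 else 0)"
      unfolding e integral_complex_of_real o(2) by simp
  qed
  also have "\<dots> \<le> ennreal (pi * (\<Sum>i\<in>?\<gamma> ` ?G. \<Sum>B\<in>?\<tau> ` ?G. ?Z * (\<Sum>g\<in>{g\<in>{g\<in>?G. ?\<gamma> g = i}. ?\<tau> g = B}. (cmod (?W g))\<^sup>2)))"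
  proof (intro ennreal_leI mult_left_mono sum_mono)
    fix i B
    let ?S = "{g\<in>{g\<in>?G. ?\<gamma> g = i}. ?\<tau> g = B}"
    have finS: "finite ?S" using finG by simp
    have inj: "inj_on (\<lambda>g. snd \<circ> g) ?S"
    proof (rule inj_onI)
      fix g g' :: "'n \<Rightarrow> nat \<times> nat" assume g: "g \<in> ?S" "g' \<in> ?S" and e: "snd \<circ> g = snd \<circ> g'"
      have "fst \<circ> g = fst \<circ> g'" using g by simp
      with e show "g = g'" by (auto simp: fun_eq_iff prod_eq_iff)
    qed
    have "(\<Sum>g\<in>?S. (?o g)\<^sup>2) = (\<Sum>b\<in>(\<lambda>g. snd \<circ> g) ` ?S. \<Prod>k\<in>UNIV. (hermite_origin (b k))\<^sup>2)"
      unfolding sum.reindex[OF inj] by (simp add: prod_power_distrib)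
    also have "\<dots> \<le> (\<Sum>b\<in>{b \<in> multi_box (2 * L). multi_total b = B}. \<Prod>k\<in>(UNIV :: 'n set). (hermite_origin (b k))\<^sup>2)"
    proof (intro sum_mono2)
      show "(\<lambda>g. snd \<circ> g) ` ?S \<subseteq> {b \<in> multi_box (2 * L). multi_total b = B}"
      proof (clarsimp simp: multi_box_def)
        fix g :: "'n \<Rightarrow> nat \<times> nat" and k assume "g \<in> ?G"
        then have "g k \<in> tri (2 * L)" by auto
        then show "snd (g k) \<le> 2 * L" by (cases "g k") auto
      qed
    qed (auto intro!: prod_nonneg)
    also have "\<dots> \<le> (\<Sum>b\<in>{b \<in> multi_box (2 * L). multi_total b = B}. \<Prod>k\<in>(UNIV::'n set). (hermite_fun (b k) 0)\<^sup>2)"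
      by (intro sum_mono prod_mono) (auto intro: hermite_origin_le)
    also have "\<dots> \<le> ?Z" by (rule hermite_origin_simplex_sum[OF card])
    finally have Z: "(\<Sum>g\<in>?S. (?o g)\<^sup>2) \<le> ?Z" .
    have "(cmod (\<Sum>g\<in>?S. ?W g * of_real (?o g)))\<^sup>2 \<le> (\<Sum>g\<in>?S. (?o g)\<^sup>2) * (\<Sum>g\<in>?S. (cmod (?W g))\<^sup>2)"
      by (rule cmod_sum_mult_le)
    also have "\<dots> \<le> ?Z * (\<Sum>g\<in>?S. (cmod (?W g))\<^sup>2)"
      by (intro mult_right_mono Z sum_nonneg) auto
    finally show "(cmod (\<Sum>g\<in>?S. ?W g * of_real (?o g)))\<^sup>2 \<le> ?Z * (\<Sum>g\<in>?S. (cmod (?W g))\<^sup>2)" .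
  qed simp
  also have "(\<Sum>i\<in>?\<gamma> ` ?G. \<Sum>B\<in>?\<tau> ` ?G. ?Z * (\<Sum>g\<in>{g\<in>{g\<in>?G. ?\<gamma> g = i}. ?\<tau> g = B}. (cmod (?W g))\<^sup>2))
      = ?Z * (\<Sum>g\<in>?G. (cmod (?W g))\<^sup>2)"
  proof -
    have "(\<Sum>B\<in>?\<tau> ` ?G. \<Sum>g\<in>{g\<in>{g\<in>?G. ?\<gamma> g = i}. ?\<tau> g = B}. (cmod (?W g))\<^sup>2) = (\<Sum>g\<in>{g\<in>?G. ?\<gamma> g = i}. (cmod (?W g))\<^sup>2)" for i
      using finG by (intro sum.group) auto
    moreover have "(\<Sum>i\<in>?\<gamma> ` ?G. \<Sum>g\<in>{g\<in>?G. ?\<gamma> g = i}. (cmod (?W g))\<^sup>2) = (\<Sum>g\<in>?G. (cmod (?W g))\<^sup>2)"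
      using finG by (intro sum.group) auto
    ultimately show ?thesis by (simp only: sum_distrib_left[symmetric])
  qed
  also have "(\<Sum>g\<in>?G. (cmod (?W g))\<^sup>2) = (\<Sum>p\<in>?Bx \<times> ?Bx. (cmod (c (fst p) * d (snd p)))\<^sup>2)"
  proof (rule sum_orthonormal_sum)
    fix p q assume p: "p \<in> ?Bx \<times> ?Bx" and q: "q \<in> ?Bx \<times> ?Bx"
    have le: "fst p i + snd p i \<le> 2 * L" for i
    proof -
      have "fst p i \<le> L" "snd p i \<le> L" using p by (auto simp: multi_box_def)
      then show ?thesis by linarith
    qed
    have "(\<Sum>g\<in>?G. ?r p g * ?r q g)
        = (\<Sum>g\<in>?G. \<Prod>i\<in>UNIV. rot_coeff (fst p i) (snd p i) (fst (g i)) (snd (g i)) * rot_coeff (fst q i) (snd q i) (fst (g i)) (snd (g i)))"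
      by (simp only: prod.distrib)
    also have "\<dots> = (\<Prod>i\<in>UNIV. \<Sum>u\<in>tri (2 * L). rot_coeff (fst p i) (snd p i) (fst u) (snd u) * rot_coeff (fst q i) (snd q i) (fst u) (snd u))"
      by (subst sum_PiE_prod) auto
    also have "\<dots> = (\<Prod>i\<in>UNIV. if fst p i = fst q i \<and> snd p i = snd q i then 1 else 0)"
      using rot_orthonormal[OF le] by (simp add: case_prod_unfold)
    also have "\<dots> = (if p = q then 1 else 0)"
      by (auto simp: prod_eq_iff fun_eq_iff)
    finally show "(\<Sum>g\<in>?G. ?r p g * ?r q g) = (if p = q then 1 else 0)" .
  qed (use finG in auto)
  also have "\<dots> = coeff_norm2 L c * coeff_norm2 L d"
    by (simp add: sum_product sum.cartesian_product norm_mult power_mult_distrib case_prod_unfold)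
  finally show ?thesis unfolding expand by (simp only: mult.assoc)
qed

section \<open>Separated frequencies: splitting off one coordinate\<close>

definition multi_slice :: "'n::finite \<Rightarrow> nat \<Rightarrow> ('n \<Rightarrow> nat) set" where
  "multi_slice i L = {\<gamma> \<in> multi_box L. \<gamma> i = 0}"

lemma finite_multi_slice [simp]: "finite (multi_slice i L)"
  by (simp add: multi_slice_def)

text \<open>The index with entry \<open>i\<close> set to 0 stands for the other \<open>d - 1\<close>
  entries, which avoids a separate type of shorter multi-indices.\<close>

lemma sum_multi_box_slice:
  "(\<Sum>\<alpha>\<in>multi_box L. F \<alpha>) = (\<Sum>\<gamma>\<in>multi_slice i L. \<Sum>n\<le>L. F (\<gamma>(i := n)))"
  unfolding sum.cartesian_product
  by (rule sum.reindex_bij_witness[of _ "\<lambda>(\<gamma>, n). \<gamma>(i := n)" "\<lambda>\<alpha>. (\<alpha>(i := 0), \<alpha> i)"])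
    (auto simp: multi_slice_def multi_box_def)

definition partial_tensor :: "'n::finite \<Rightarrow> ('n \<Rightarrow> nat) \<Rightarrow> real ^ 'n \<Rightarrow> real" where
  "partial_tensor i \<gamma> x = (\<Prod>j\<in>- {i}. hermite_fun (\<gamma> j) (x $ j))"

lemma prod_UNIV_split: "(\<Prod>j\<in>UNIV. f j) = f i * (\<Prod>j\<in>- {i::'n::finite}. f j)"
  by (subst prod.remove[of UNIV i]) (auto simp: Compl_eq_Diff_UNIV)

lemma tensor_fun_upd: "tensor hermite_fun (\<gamma>(i := n)) x = hermite_fun n (x $ i) * partial_tensor i \<gamma> x"
  unfolding tensor_def partial_tensor_def by (subst prod_UNIV_split[of _ i]) simp

lemma multi_total_fun_upd: "\<gamma> i = 0 \<Longrightarrow> multi_total (\<gamma>(i := n)) = n + multi_total \<gamma>"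
  unfolding multi_total_def by (simp add: sum.remove[of UNIV i])

definition coord_wave :: "'n::finite \<Rightarrow> nat \<Rightarrow> (('n \<Rightarrow> nat) \<Rightarrow> complex) \<Rightarrow> ('n \<Rightarrow> nat) \<Rightarrow> real \<Rightarrow> real \<Rightarrow> complex" where
  "coord_wave i L c \<gamma> t y = (\<Sum>n\<le>L. c (\<gamma>(i := n)) * cis (2 * t * real n) * of_real (hermite_fun n y))"

text \<open>Grouping by the other entries. The phase splits because the total is additive, leaving a
  one-variable wave in \<open>x $ i\<close> as coefficient of each partial tensor.\<close>

lemma wave_slice:
  "wave L c t x = (\<Sum>\<gamma>\<in>multi_slice i L.
     cis (2 * t * real (multi_total \<gamma>)) * coord_wave i L c \<gamma> t (x $ i) * of_real (partial_tensor i \<gamma> x))"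
proof -
  have "wave L c t x = (\<Sum>\<gamma>\<in>multi_slice i L. \<Sum>n\<le>L. c (\<gamma>(i := n)) * cis (2 * t * real (multi_total (\<gamma>(i := n))))
      * of_real (tensor hermite_fun (\<gamma>(i := n)) x))"
    unfolding wave_def by (rule sum_multi_box_slice)
  also have "\<dots> = (\<Sum>\<gamma>\<in>multi_slice i L.
     cis (2 * t * real (multi_total \<gamma>)) * coord_wave i L c \<gamma> t (x $ i) * of_real (partial_tensor i \<gamma> x))"
  proof (rule sum.cong[OF refl])
    fix \<gamma> :: "'a \<Rightarrow> nat" assume "\<gamma> \<in> multi_slice i L"
    then have "cis (2 * t * real (multi_total (\<gamma>(i := n)))) = cis (2 * t * real n) * cis (2 * t * real (multi_total \<gamma>))" for n
      by (simp add: multi_slice_def multi_total_fun_upd cis_mult distrib_left)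
    then show "(\<Sum>n\<le>L. c (\<gamma>(i := n)) * cis (2 * t * real (multi_total (\<gamma>(i := n)))) * of_real (tensor hermite_fun (\<gamma>(i := n)) x))
        = cis (2 * t * real (multi_total \<gamma>)) * coord_wave i L c \<gamma> t (x $ i) * of_real (partial_tensor i \<gamma> x)"
      unfolding coord_wave_def tensor_fun_upd sum_distrib_left sum_distrib_right
      by (intro sum.cong refl) (simp add: mult_ac)
  qed
  finally show ?thesis .
qed

lemma cis_measurable [measurable]: "cis \<in> borel_measurable borel"
  unfolding cis_conv_exp by measurable

lemma coord_wave_measurable: "coord_wave i L c \<gamma> t \<in> borel_measurable borel"
  unfolding coord_wave_def[abs_def] by measurable

lemma coord_wave_bounded: "\<exists>C\<ge>0. \<forall>y. cmod (coord_wave i L c \<gamma> t y) \<le> C * exp (- (y\<^sup>2) / 4)"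
proof -
  have "\<exists>C. \<forall>n. C n \<ge> 0 \<and> (\<forall>y. \<bar>hermite_fun n y\<bar> \<le> C n * exp (- (y\<^sup>2) / 4))"
    by (intro choice) (metis gauss_poly_bounded hermite_fun_gauss_poly)
  then obtain C where C: "\<And>n. C n \<ge> 0" "\<And>n y. \<bar>hermite_fun n y\<bar> \<le> C n * exp (- (y\<^sup>2) / 4)" by blast
  have "cmod (coord_wave i L c \<gamma> t y) \<le> (\<Sum>n\<le>L. cmod (c (\<gamma>(i := n))) * C n) * exp (- (y\<^sup>2) / 4)" for y
  proof -
    have "cmod (coord_wave i L c \<gamma> t y) \<le> (\<Sum>n\<le>L. cmod (c (\<gamma>(i := n))) * \<bar>hermite_fun n y\<bar>)"
      unfolding coord_wave_def by (rule order_trans[OF norm_sum]) (simp add: norm_mult)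
    also have "\<dots> \<le> (\<Sum>n\<le>L. cmod (c (\<gamma>(i := n))) * (C n * exp (- (y\<^sup>2) / 4)))"
      by (intro sum_mono mult_left_mono C) auto
    finally show ?thesis by (simp add: sum_distrib_right mult.assoc)
  qed
  moreover have "0 \<le> (\<Sum>n\<le>L. cmod (c (\<gamma>(i := n))) * C n)" by (intro sum_nonneg mult_nonneg_nonneg C) auto
  ultimately show ?thesis by blast
qed

text \<open>Orthogonality in the coordinates other than \<open>i\<close>, with functions of
  \<open>x $ i\<close> as coefficients. Fixing \<open>\<gamma> i = 0\<close> ensures that distinct
  indices differ in one of those coordinates.\<close>

lemma nn_integral_partial_parseval:
  fixes F :: "('n::finite \<Rightarrow> nat) \<Rightarrow> real \<Rightarrow> complex"
  assumes fin: "finite A" and A: "\<And>\<gamma>. \<gamma> \<in> A \<Longrightarrow> \<gamma> i = 0"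
    and int: "\<And>\<gamma> \<gamma>'. \<gamma> \<in> A \<Longrightarrow> \<gamma>' \<in> A \<Longrightarrow> integrable lborel (\<lambda>y. F \<gamma> y * cnj (F \<gamma>' y))"
  shows "(\<integral>\<^sup>+x. ennreal ((cmod (\<Sum>\<gamma>\<in>A. F \<gamma> (x $ i) * of_real (partial_tensor i \<gamma> x)))\<^sup>2) \<partial>lborel)
    = (\<Sum>\<gamma>\<in>A. \<integral>\<^sup>+y. ennreal ((cmod (F \<gamma> y))\<^sup>2) \<partial>lborel)"
proof -
  let ?\<phi> = "\<lambda>\<gamma> (x :: real ^ 'n). F \<gamma> (x $ i) * complex_of_real (partial_tensor i \<gamma> x)"
  let ?k = "\<lambda>\<gamma> \<gamma>' j y. if j = i then F \<gamma> y * cnj (F \<gamma>' y) else complex_of_real (hermite_fun (\<gamma> j) y * hermite_fun (\<gamma>' j) y)"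
  have eq: "?\<phi> \<gamma> x * cnj (?\<phi> \<gamma>' x) = (\<Prod>j\<in>UNIV. ?k \<gamma> \<gamma>' j (x $ j))" for \<gamma> \<gamma>' x
    by (subst prod_UNIV_split[of _ i]) (simp add: partial_tensor_def prod.distrib mult_ac)
  have kint: "integrable lborel (?k \<gamma> \<gamma>' j)" if "\<gamma> \<in> A" "\<gamma>' \<in> A" for \<gamma> \<gamma>' j
    using int[OF that] integrable_of_real[OF integrable_hermite_mult, where 'a = complex] by (cases "j = i") auto
  have 1: "integrable lborel (\<lambda>x. ?\<phi> \<gamma> x * cnj (?\<phi> \<gamma>' x))" if "\<gamma> \<in> A" "\<gamma>' \<in> A" for \<gamma> \<gamma>'
    unfolding eq by (rule lborel_prod_vec(1)) (rule kint[OF that])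
  have sq: "F \<gamma> y * cnj (F \<gamma> y) = of_real ((cmod (F \<gamma> y))\<^sup>2)" for \<gamma> y
    by (rule complex_norm_square[symmetric])
  have 2: "(\<integral>x. ?\<phi> \<gamma> x * cnj (?\<phi> \<gamma>' x) \<partial>lborel)
      = (if \<gamma> = \<gamma>' then of_real (\<integral>y. (cmod (F \<gamma> y))\<^sup>2 \<partial>lborel) else 0)" if g: "\<gamma> \<in> A" "\<gamma>' \<in> A" for \<gamma> \<gamma>'
  proof -
    have "(\<integral>x. ?\<phi> \<gamma> x * cnj (?\<phi> \<gamma>' x) \<partial>lborel) = (\<Prod>j\<in>UNIV. \<integral>y. ?k \<gamma> \<gamma>' j y \<partial>lborel)"
      unfolding eq by (rule lborel_prod_vec(2)) (rule kint[OF g])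
    also have "\<dots> = (\<integral>y. F \<gamma> y * cnj (F \<gamma>' y) \<partial>lborel) * (\<Prod>j\<in>- {i}. if \<gamma> j = \<gamma>' j then 1 else 0)"
    proof -
      have "(\<Prod>j\<in>- {i}. \<integral>y. ?k \<gamma> \<gamma>' j y \<partial>lborel) = (\<Prod>j\<in>- {i}. if \<gamma> j = \<gamma>' j then 1 else 0)"
        by (intro prod.cong refl) (auto simp: integral_complex_of_real hermite_orthonormal simp del: of_real_mult)
      then show ?thesis by (subst prod_UNIV_split[of _ i]) simp
    qed
    also have "\<dots> = (if \<gamma> = \<gamma>' then \<integral>y. F \<gamma> y * cnj (F \<gamma> y) \<partial>lborel else 0)"
    proof (cases "\<gamma> = \<gamma>'")
      case False
      then obtain j where j: "\<gamma> j \<noteq> \<gamma>' j" by auto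
      then have "j \<in> - {i}" using A[OF g(1)] A[OF g(2)] by auto
      then have "(\<Prod>j\<in>- {i}. if \<gamma> j = \<gamma>' j then 1 else 0) = (0::complex)" using j by (intro prod_zero) auto
      then show ?thesis using False by simp
    qed simp
    finally show ?thesis unfolding sq integral_complex_of_real .
  qed
  note * = integral_orthogonal_sum[of A lborel ?\<phi> "\<lambda>\<gamma>. \<integral>y. (cmod (F \<gamma> y))\<^sup>2 \<partial>lborel", OF fin 1 2]
  have i2: "integrable lborel (\<lambda>y. (cmod (F \<gamma> y))\<^sup>2)" if "\<gamma> \<in> A" for \<gamma>
    using integrable_Re[OF int[OF that that]] unfolding sq by simp
  have "(\<integral>\<^sup>+x. ennreal ((cmod (\<Sum>\<gamma>\<in>A. ?\<phi> \<gamma> x))\<^sup>2) \<partial>lborel) = ennreal (\<Sum>\<gamma>\<in>A. \<integral>y. (cmod (F \<gamma> y))\<^sup>2 \<partial>lborel)"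
    using * by (subst nn_integral_eq_integral) auto
  also have "\<dots> = (\<Sum>\<gamma>\<in>A. ennreal (\<integral>y. (cmod (F \<gamma> y))\<^sup>2 \<partial>lborel))" by (subst sum_ennreal) auto
  also have "\<dots> = (\<Sum>\<gamma>\<in>A. \<integral>\<^sup>+y. ennreal ((cmod (F \<gamma> y))\<^sup>2) \<partial>lborel)"
    using i2 by (intro sum.cong refl nn_integral_eq_integral[symmetric]) auto
  finally show ?thesis .
qed

text \<open>The sum of products factors into \<open>d - 1\<close> one-variable Christoffel sums,
  each bounded uniformly in \<open>x\<close>.\<close>

lemma partial_tensor_sum_le:
  "(\<Sum>\<gamma>\<in>multi_slice i L. (partial_tensor (i::'n::finite) \<gamma> x)\<^sup>2) \<le> sqrt (2 * Suc L) ^ (CARD('n) - 1)"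
proof -
  let ?A = "\<lambda>j. if j = i then {0} else {..L}"
  let ?f = "\<lambda>j n. if j = i then 1 else (hermite_fun n (x $ j))\<^sup>2"
  have slice: "multi_slice i L = PiE UNIV ?A"
  proof -
    have "\<gamma> \<in> multi_slice i L \<longleftrightarrow> (\<forall>j. \<gamma> j \<in> ?A j)" for \<gamma>
    proof
      assume h: "\<forall>j. \<gamma> j \<in> ?A j"
      have "\<gamma> i = 0" using h[rule_format, of i] by simp
      moreover have "\<gamma> j \<le> L" for j using h[rule_format, of j] by (cases "j = i") auto
      ultimately show "\<gamma> \<in> multi_slice i L" by (simp add: multi_slice_def multi_box_def)
    qed (simp add: multi_slice_def multi_box_def)
    then show ?thesis by (simp add: set_eq_iff PiE_UNIV_domain Pi_iff)
  qed
  have "(\<Sum>\<gamma>\<in>multi_slice i L. (partial_tensor i \<gamma> x)\<^sup>2) = (\<Sum>\<gamma>\<in>PiE UNIV ?A. \<Prod>j\<in>UNIV. ?f j (\<gamma> j))"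
    unfolding slice partial_tensor_def prod_power_distrib
    by (intro sum.cong refl, subst prod_UNIV_split[of _ i]) simp
  also have "\<dots> = (\<Prod>j\<in>UNIV. \<Sum>n\<in>?A j. ?f j n)" by (rule sum_PiE_prod) auto
  also have "\<dots> = (\<Prod>j\<in>- {i}. \<Sum>n\<le>L. (hermite_fun n (x $ j))\<^sup>2)"
    by (subst prod_UNIV_split[of _ i]) simp
  also have "\<dots> \<le> (\<Prod>j\<in>- {i}. sqrt (2 * Suc L))"
    by (intro prod_mono conjI sum_nonneg hermite_christoffel_le) auto
  also have "\<dots> = sqrt (2 * Suc L) ^ (CARD('n) - 1)" by (simp add: Compl_eq_Diff_UNIV card_Diff_subset del: of_nat_Suc)
  finally show ?thesis .
qed

text \<open>\<open>hermite_trace_bound\<close> followed by the concentration estimate, for the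
  product array of the two coefficient families at level \<open>L + \<mu>\<close>.\<close>

lemma coord_wave_mult_bound:
  assumes supp: "\<And>n. n \<le> L \<Longrightarrow> c (\<gamma>(i := n)) \<noteq> 0 \<Longrightarrow> n0 \<le> n"
    and n0: "n0 > 0" and small: "64 * real (L + \<mu>) * (real \<mu> + real p) \<le> (real n0)\<^sup>2"
  shows "(\<integral>\<^sup>+t. \<integral>\<^sup>+y. ennreal ((cmod (coord_wave i L c \<gamma> t y * coord_wave i \<mu> d \<gamma>' t y))\<^sup>2) \<partial>lborel \<partial>time_interval)
    \<le> ennreal (pi * (2 / sqrt n0 + (1 / 4) ^ p)
        * ((\<Sum>n\<le>L. (cmod (c (\<gamma>(i := n))))\<^sup>2) * (\<Sum>m\<le>\<mu>. (cmod (d (\<gamma>'(i := m))))\<^sup>2)))"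
proof -
  define w where "w n m = (if n \<le> L \<and> m \<le> \<mu> then c (\<gamma>(i := n)) * d (\<gamma>'(i := m)) else 0)" for n m
  let ?K = "L + \<mu>"
  have tri: "(\<Sum>(n, m)\<in>tri ?K. G n m) = (\<Sum>n\<le>L. \<Sum>m\<le>\<mu>. G n m)"
    if "\<And>n m. \<not> (n \<le> L \<and> m \<le> \<mu>) \<Longrightarrow> G n m = 0" for G :: "nat \<Rightarrow> nat \<Rightarrow> 'z::comm_monoid_add"
    unfolding sum.cartesian_product by (intro sum.mono_neutral_right) (use that in auto)
  have prod: "coord_wave i L c \<gamma> t y * coord_wave i \<mu> d \<gamma>' t y
      = (\<Sum>(n, m)\<in>tri ?K. w n m * cis (2 * t * real (n + m)) * of_real (hermite_fun n y * hermite_fun m y))" for t y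
  proof -
    have "(\<Sum>(n, m)\<in>tri ?K. w n m * cis (2 * t * real (n + m)) * of_real (hermite_fun n y * hermite_fun m y))
        = (\<Sum>n\<le>L. \<Sum>m\<le>\<mu>. w n m * cis (2 * t * real (n + m)) * of_real (hermite_fun n y * hermite_fun m y))"
      by (rule tri) (auto simp: w_def)
    also have "\<dots> = coord_wave i L c \<gamma> t y * coord_wave i \<mu> d \<gamma>' t y"
      unfolding coord_wave_def sum_product
      by (intro sum.cong refl) (simp add: w_def cis_mult[symmetric] distrib_left mult_ac)
    finally show ?thesis by simp
  qed
  have "(\<integral>\<^sup>+t. \<integral>\<^sup>+y. ennreal ((cmod (coord_wave i L c \<gamma> t y * coord_wave i \<mu> d \<gamma>' t y))\<^sup>2) \<partial>lborel \<partial>time_interval)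
      \<le> ennreal (pi * (\<Sum>(a, b)\<in>tri ?K. (hermite_fun b 0)\<^sup>2 * (cmod (rot_sum ?K w a b))\<^sup>2))"
    unfolding prod by (rule hermite_trace_bound)
  also have "\<dots> \<le> ennreal (pi * ((2 / sqrt n0 + (1 / 4) ^ p) * tri_norm2 ?K w))"
  proof (intro ennreal_leI mult_left_mono rot_sum_trace_bound[OF _ n0 small])
    fix n m assume "w n m \<noteq> 0"
    then show "n0 \<le> n \<and> n + m \<le> ?K \<and> m \<le> \<mu>" using supp[of n] by (auto simp: w_def split: if_splits)
  qed simp
  also have "tri_norm2 ?K w = (\<Sum>n\<le>L. \<Sum>m\<le>\<mu>. (cmod (w n m))\<^sup>2)"
    by (rule tri) (auto simp: w_def)
  also have "\<dots> = (\<Sum>n\<le>L. (cmod (c (\<gamma>(i := n))))\<^sup>2) * (\<Sum>m\<le>\<mu>. (cmod (d (\<gamma>'(i := m))))\<^sup>2)"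
    unfolding sum_product by (intro sum.cong refl) (simp add: w_def norm_mult power_mult_distrib)
  finally show ?thesis by (simp only: mult.assoc)
qed

text \<open>The interaction is exploited in coordinate \<open>i\<close> alone. In the other
  \<open>d - 1\<close> coordinates the low-frequency factor is bounded pointwise by Cauchy-Schwarz
  and the Christoffel bound, at a cost of order \<open>\<mu>^((d-1)/2)\<close>; Parseval in those
  coordinates for the high-frequency factor then leaves a problem in one variable.\<close>

lemma wave_mult_bound_far:
  fixes c d :: "('n::finite \<Rightarrow> nat) \<Rightarrow> complex"
  assumes supp: "\<And>\<alpha>. \<alpha> \<in> multi_box L \<Longrightarrow> c \<alpha> \<noteq> 0 \<Longrightarrow> n0 \<le> \<alpha> i"
    and n0: "n0 > 0" and small: "64 * real (L + \<mu>) * (real \<mu> + real p) \<le> (real n0)\<^sup>2"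
  shows "(\<integral>\<^sup>+t. \<integral>\<^sup>+x. ennreal ((cmod (wave L c t x * wave \<mu> d t x))\<^sup>2) \<partial>lborel \<partial>time_interval)
    \<le> ennreal (sqrt (2 * Suc \<mu>) ^ (CARD('n) - 1) * (pi * (2 / sqrt n0 + (1 / 4) ^ p))
        * (coeff_norm2 L c * coeff_norm2 \<mu> d))"
proof -
  let ?S = "sqrt (2 * Suc \<mu>) ^ (CARD('n) - 1)"
  let ?E = "pi * (2 / sqrt n0 + (1 / 4) ^ p)"
  let ?f = "coord_wave i L c" and ?g = "coord_wave i \<mu> d"
  have S: "0 \<le> ?S" by simp
  have E: "0 \<le> ?E" by simp
  have pw: "(cmod (wave L c t x * wave \<mu> d t x))\<^sup>2
      \<le> ?S * (\<Sum>\<gamma>'\<in>multi_slice i \<mu>. (cmod (wave L c t x * ?g \<gamma>' t (x $ i)))\<^sup>2)" for t x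
  proof -
    have "(cmod (wave \<mu> d t x))\<^sup>2 \<le> (\<Sum>\<gamma>'\<in>multi_slice i \<mu>. (partial_tensor i \<gamma>' x)\<^sup>2)
        * (\<Sum>\<gamma>'\<in>multi_slice i \<mu>. (cmod (cis (2 * t * real (multi_total \<gamma>')) * ?g \<gamma>' t (x $ i)))\<^sup>2)"
      unfolding wave_slice[of \<mu> d t x i] by (rule cmod_sum_mult_le)
    also have "\<dots> \<le> ?S * (\<Sum>\<gamma>'\<in>multi_slice i \<mu>. (cmod (?g \<gamma>' t (x $ i)))\<^sup>2)"
    proof -
      have "(cmod (cis (2 * t * real (multi_total \<gamma>')) * ?g \<gamma>' t (x $ i)))\<^sup>2 = (cmod (?g \<gamma>' t (x $ i)))\<^sup>2" for \<gamma>'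
        by (simp add: norm_mult)
      then show ?thesis
        by (simp only:) (intro mult_right_mono partial_tensor_sum_le sum_nonneg zero_le_power2)
    qed
    finally have "(cmod (wave L c t x))\<^sup>2 * (cmod (wave \<mu> d t x))\<^sup>2
        \<le> (cmod (wave L c t x))\<^sup>2 * (?S * (\<Sum>\<gamma>'\<in>multi_slice i \<mu>. (cmod (?g \<gamma>' t (x $ i)))\<^sup>2))"
      by (rule mult_left_mono) simp
    then show ?thesis
      by (simp add: norm_mult power_mult_distrib sum_distrib_left mult.left_commute del: of_nat_Suc)
  qed
  have meas_x: "(\<lambda>x. ennreal ((cmod (wave L c t x * ?g \<gamma>' t (x $ i)))\<^sup>2)) \<in> borel_measurable borel" for t \<gamma>'
    unfolding wave_def coord_wave_def by measurable
  \<comment> \<open>The low-frequency factor now depends on \<open>x $ i\<close> only, so it is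
    absorbed into the coefficient functions of the Parseval identity.\<close>
  have inner: "(\<integral>\<^sup>+x. ennreal ((cmod (wave L c t x * ?g \<gamma>' t (x $ i)))\<^sup>2) \<partial>lborel)
      = (\<Sum>\<gamma>\<in>multi_slice i L. \<integral>\<^sup>+y. ennreal ((cmod (?f \<gamma> t y * ?g \<gamma>' t y))\<^sup>2) \<partial>lborel)" for t \<gamma>'
  proof -
    let ?F = "\<lambda>\<gamma> y. cis (2 * t * real (multi_total \<gamma>)) * (?f \<gamma> t y * ?g \<gamma>' t y)"
    have "(\<integral>\<^sup>+x. ennreal ((cmod (\<Sum>\<gamma>\<in>multi_slice i L. ?F \<gamma> (x $ i) * of_real (partial_tensor i \<gamma> x)))\<^sup>2) \<partial>lborel)
        = (\<Sum>\<gamma>\<in>multi_slice i L. \<integral>\<^sup>+y. ennreal ((cmod (?F \<gamma> y))\<^sup>2) \<partial>lborel)"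
    proof (rule nn_integral_partial_parseval)
      show "\<gamma> i = 0" if "\<gamma> \<in> multi_slice i L" for \<gamma> using that by (simp add: multi_slice_def)
      fix \<gamma>1 \<gamma>2
      obtain C1 where C1: "C1 \<ge> 0" "\<And>y. cmod (?f \<gamma>1 t y) \<le> C1 * exp (- (y\<^sup>2) / 4)"
        using coord_wave_bounded[of i L c \<gamma>1 t] by auto
      obtain C2 where C2: "C2 \<ge> 0" "\<And>y. cmod (?f \<gamma>2 t y) \<le> C2 * exp (- (y\<^sup>2) / 4)"
        using coord_wave_bounded[of i L c \<gamma>2 t] by auto
      obtain D where D: "D \<ge> 0" "\<And>y. cmod (?g \<gamma>' t y) \<le> D * exp (- (y\<^sup>2) / 4)"
        using coord_wave_bounded[of i \<mu> d \<gamma>' t] by auto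
      have D': "cmod (?g \<gamma>' t y) \<le> D" for y
      proof -
        have "D * exp (- (y\<^sup>2) / 4) \<le> D * 1" using D(1) by (intro mult_left_mono) auto
        then show ?thesis using D(2)[of y] by simp
      qed
      show "integrable lborel (\<lambda>y. ?F \<gamma>1 y * cnj (?F \<gamma>2 y))"
      proof (rule Bochner_Integration.integrable_bound[OF integrable_mult_right[OF integrable_exp_square, of "C1 * D * (C2 * D)"]])
        have [measurable]: "?f \<gamma>1 t \<in> borel_measurable borel" "?f \<gamma>2 t \<in> borel_measurable borel" "?g \<gamma>' t \<in> borel_measurable borel"
          by (rule coord_wave_measurable)+
        have [measurable]: "cnj \<in> borel_measurable borel"
          by (intro borel_measurable_continuous_onI continuous_intros)
        show "(\<lambda>y. ?F \<gamma>1 y * cnj (?F \<gamma>2 y)) \<in> borel_measurable lborel" by measurable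
        show "AE y in lborel. norm (?F \<gamma>1 y * cnj (?F \<gamma>2 y)) \<le> norm (C1 * D * (C2 * D) * exp (- y\<^sup>2 / 2))"
        proof (intro AE_I2)
          fix y
          have "norm (?F \<gamma>1 y * cnj (?F \<gamma>2 y)) = cmod (?f \<gamma>1 t y) * cmod (?g \<gamma>' t y) * (cmod (?f \<gamma>2 t y) * cmod (?g \<gamma>' t y))"
            by (simp add: norm_mult)
          also have "\<dots> \<le> C1 * exp (- (y\<^sup>2) / 4) * D * (C2 * exp (- (y\<^sup>2) / 4) * D)"
            using C1 C2 D D' by (intro mult_mono mult_nonneg_nonneg) auto
          also have "\<dots> = C1 * D * (C2 * D) * exp (- y\<^sup>2 / 2)"
          proof -
            have "exp (- (y\<^sup>2) / 4) * exp (- (y\<^sup>2) / 4) = exp (- y\<^sup>2 / 2)" by (simp add: exp_add[symmetric])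
            moreover have "C1 * exp (- (y\<^sup>2) / 4) * D * (C2 * exp (- (y\<^sup>2) / 4) * D)
                = C1 * D * (C2 * D) * (exp (- (y\<^sup>2) / 4) * exp (- (y\<^sup>2) / 4))"
              by (simp only: mult_ac)
            ultimately show ?thesis by (simp only:)
          qed
          finally show "norm (?F \<gamma>1 y * cnj (?F \<gamma>2 y)) \<le> norm (C1 * D * (C2 * D) * exp (- y\<^sup>2 / 2))"
            using C1 C2 D by simp
        qed
      qed
    qed simp
    moreover have "wave L c t x * ?g \<gamma>' t (x $ i) = (\<Sum>\<gamma>\<in>multi_slice i L. ?F \<gamma> (x $ i) * of_real (partial_tensor i \<gamma> x))" for x
      unfolding wave_slice[of L c t x i] sum_distrib_right by (intro sum.cong refl) (simp add: mult_ac)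
    ultimately show ?thesis by (simp add: norm_mult)
  qed
  have meas_t: "(\<lambda>t. \<integral>\<^sup>+y. ennreal ((cmod (?f \<gamma> t y * ?g \<gamma>' t y))\<^sup>2) \<partial>lborel) \<in> borel_measurable time_interval" for \<gamma> \<gamma>'
  proof -
    have "(\<lambda>t. \<integral>\<^sup>+y. ennreal ((cmod (?f \<gamma> t y * ?g \<gamma>' t y))\<^sup>2) \<partial>lborel) \<in> borel_measurable lborel"
      unfolding coord_wave_def by measurable
    then show ?thesis by (rule measurable_restrict_space1)
  qed
  have "(\<integral>\<^sup>+t. \<integral>\<^sup>+x. ennreal ((cmod (wave L c t x * wave \<mu> d t x))\<^sup>2) \<partial>lborel \<partial>time_interval)
      \<le> (\<integral>\<^sup>+t. ennreal ?S * (\<Sum>\<gamma>'\<in>multi_slice i \<mu>. \<Sum>\<gamma>\<in>multi_slice i L.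
          \<integral>\<^sup>+y. ennreal ((cmod (?f \<gamma> t y * ?g \<gamma>' t y))\<^sup>2) \<partial>lborel) \<partial>time_interval)"
  proof (rule nn_integral_mono)
    fix t
    have "(\<integral>\<^sup>+x. ennreal ((cmod (wave L c t x * wave \<mu> d t x))\<^sup>2) \<partial>lborel)
        \<le> (\<integral>\<^sup>+x. ennreal ?S * (\<Sum>\<gamma>'\<in>multi_slice i \<mu>. ennreal ((cmod (wave L c t x * ?g \<gamma>' t (x $ i)))\<^sup>2)) \<partial>lborel)"
    proof (rule nn_integral_mono)
      fix x
      have "ennreal ((cmod (wave L c t x * wave \<mu> d t x))\<^sup>2)
          \<le> ennreal (?S * (\<Sum>\<gamma>'\<in>multi_slice i \<mu>. (cmod (wave L c t x * ?g \<gamma>' t (x $ i)))\<^sup>2))"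
        by (rule ennreal_leI[OF pw])
      also have "\<dots> = ennreal ?S * (\<Sum>\<gamma>'\<in>multi_slice i \<mu>. ennreal ((cmod (wave L c t x * ?g \<gamma>' t (x $ i)))\<^sup>2))"
        using S by (subst ennreal_mult, simp, simp add: sum_nonneg, subst sum_ennreal) auto
      finally show "ennreal ((cmod (wave L c t x * wave \<mu> d t x))\<^sup>2)
          \<le> ennreal ?S * (\<Sum>\<gamma>'\<in>multi_slice i \<mu>. ennreal ((cmod (wave L c t x * ?g \<gamma>' t (x $ i)))\<^sup>2))" .
    qed
    also have "\<dots> = ennreal ?S * (\<Sum>\<gamma>'\<in>multi_slice i \<mu>. \<integral>\<^sup>+x. ennreal ((cmod (wave L c t x * ?g \<gamma>' t (x $ i)))\<^sup>2) \<partial>lborel)"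
      using meas_x by (subst nn_integral_cmult, simp add: borel_measurable_sum, subst nn_integral_sum) auto
    finally show "(\<integral>\<^sup>+x. ennreal ((cmod (wave L c t x * wave \<mu> d t x))\<^sup>2) \<partial>lborel)
        \<le> ennreal ?S * (\<Sum>\<gamma>'\<in>multi_slice i \<mu>. \<Sum>\<gamma>\<in>multi_slice i L.
          \<integral>\<^sup>+y. ennreal ((cmod (?f \<gamma> t y * ?g \<gamma>' t y))\<^sup>2) \<partial>lborel)"
      unfolding inner .
  qed
  also have "\<dots> = ennreal ?S * (\<Sum>\<gamma>'\<in>multi_slice i \<mu>. \<Sum>\<gamma>\<in>multi_slice i L.
      \<integral>\<^sup>+t. \<integral>\<^sup>+y. ennreal ((cmod (?f \<gamma> t y * ?g \<gamma>' t y))\<^sup>2) \<partial>lborel \<partial>time_interval)"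
    using meas_t by (simp add: nn_integral_cmult nn_integral_sum borel_measurable_sum)
  also have "\<dots> \<le> ennreal ?S * (\<Sum>\<gamma>'\<in>multi_slice i \<mu>. \<Sum>\<gamma>\<in>multi_slice i L.
      ennreal (?E * ((\<Sum>n\<le>L. (cmod (c (\<gamma>(i := n))))\<^sup>2) * (\<Sum>m\<le>\<mu>. (cmod (d (\<gamma>'(i := m))))\<^sup>2))))"
  proof (intro mult_left_mono sum_mono coord_wave_mult_bound[OF _ n0 small])
    fix \<gamma>' \<gamma> n assume "\<gamma> \<in> multi_slice i L" "n \<le> L" "c (\<gamma>(i := n)) \<noteq> 0"
    then show "n0 \<le> n" using supp[of "\<gamma>(i := n)"] by (auto simp: multi_slice_def multi_box_def)
  qed simp
  also have "\<dots> = ennreal (?S * (\<Sum>\<gamma>'\<in>multi_slice i \<mu>. \<Sum>\<gamma>\<in>multi_slice i L.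
      ?E * ((\<Sum>n\<le>L. (cmod (c (\<gamma>(i := n))))\<^sup>2) * (\<Sum>m\<le>\<mu>. (cmod (d (\<gamma>'(i := m))))\<^sup>2))))"
  proof -
    have nn: "0 \<le> ?E * ((\<Sum>n\<le>L. (cmod (c (\<gamma>(i := n))))\<^sup>2) * (\<Sum>m\<le>\<mu>. (cmod (d (\<gamma>'(i := m))))\<^sup>2))" for \<gamma> \<gamma>'
      using E by (intro mult_nonneg_nonneg sum_nonneg) auto
    show ?thesis
      by (simp only: ennreal_mult[OF S sum_nonneg[OF sum_nonneg[OF nn]]] sum_ennreal[OF nn] sum_ennreal[OF sum_nonneg[OF nn]])
  qed
  also have "?S * (\<Sum>\<gamma>'\<in>multi_slice i \<mu>. \<Sum>\<gamma>\<in>multi_slice i L.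
      ?E * ((\<Sum>n\<le>L. (cmod (c (\<gamma>(i := n))))\<^sup>2) * (\<Sum>m\<le>\<mu>. (cmod (d (\<gamma>'(i := m))))\<^sup>2)))
      = ?S * ?E * (coeff_norm2 L c * coeff_norm2 \<mu> d)"
    unfolding sum_multi_box_slice[of _ L i] sum_multi_box_slice[of _ \<mu> i]
    by (simp only: sum_distrib_left[symmetric] sum_distrib_right[symmetric] mult.assoc)
  finally show ?thesis .
qed

section \<open>Assembling the two frequency regimes\<close>

lemma sum_multi_box_extend:
  fixes F :: "('n::finite \<Rightarrow> nat) \<Rightarrow> 'b::comm_monoid_add"
  assumes "\<mu> \<le> L" and "\<And>\<alpha>. \<alpha> \<notin> multi_box \<mu> \<Longrightarrow> G \<alpha> = 0" and "\<And>\<alpha>. \<alpha> \<in> multi_box \<mu> \<Longrightarrow> F \<alpha> = G \<alpha>"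
  shows "(\<Sum>\<alpha>\<in>multi_box \<mu>. F \<alpha>) = (\<Sum>\<alpha>\<in>multi_box L. G \<alpha>)"
proof (rule sum.mono_neutral_cong_left)
  show "multi_box \<mu> \<subseteq> multi_box L" using assms(1) by (auto simp: multi_box_def intro: order_trans)
qed (use assms in auto)

text \<open>Cauchy-Schwarz over the pieces costs their number; it is applied with one piece per
  coordinate.\<close>

lemma nn_integral_sum_le:
  fixes V :: "'i::finite \<Rightarrow> real \<Rightarrow> 'a::euclidean_space \<Rightarrow> complex"
  assumes meas: "\<And>i. (\<lambda>(t, x). V i t x) \<in> borel_measurable (lborel \<Otimes>\<^sub>M lborel)"
    and le: "\<And>i. (\<integral>\<^sup>+t. \<integral>\<^sup>+x. ennreal ((cmod (V i t x))\<^sup>2) \<partial>lborel \<partial>time_interval) \<le> ennreal (B i)"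
    and B: "\<And>i. 0 \<le> B i"
  shows "(\<integral>\<^sup>+t. \<integral>\<^sup>+x. ennreal ((cmod (\<Sum>i\<in>UNIV. V i t x))\<^sup>2) \<partial>lborel \<partial>time_interval)
    \<le> ennreal (real CARD('i) * (\<Sum>i\<in>UNIV. B i))"
proof -
  let ?D = "real CARD('i)"
  note [measurable] = meas
  have mx: "(\<lambda>x. ennreal ((cmod (V i t x))\<^sup>2)) \<in> borel_measurable lborel" for i t
    by measurable
  have "(\<lambda>t. \<integral>\<^sup>+x. ennreal ((cmod (V i t x))\<^sup>2) \<partial>lborel) \<in> borel_measurable lborel" for i
    by measurable
  then have mt: "(\<lambda>t. \<integral>\<^sup>+x. ennreal ((cmod (V i t x))\<^sup>2) \<partial>lborel) \<in> borel_measurable time_interval" for i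
    by (rule measurable_restrict_space1)
  have "(\<integral>\<^sup>+t. \<integral>\<^sup>+x. ennreal ((cmod (\<Sum>i\<in>UNIV. V i t x))\<^sup>2) \<partial>lborel \<partial>time_interval)
      \<le> (\<integral>\<^sup>+t. \<integral>\<^sup>+x. ennreal ?D * (\<Sum>i\<in>UNIV. ennreal ((cmod (V i t x))\<^sup>2)) \<partial>lborel \<partial>time_interval)"
  proof (intro nn_integral_mono)
    fix t x
    have "(cmod (\<Sum>i\<in>UNIV. V i t x))\<^sup>2 \<le> ?D * (\<Sum>i\<in>UNIV. (cmod (V i t x))\<^sup>2)"
      using cmod_sum_mult_le[of "\<lambda>i. V i t x" "\<lambda>_. 1" UNIV] by simp
    then have "ennreal ((cmod (\<Sum>i\<in>UNIV. V i t x))\<^sup>2) \<le> ennreal (?D * (\<Sum>i\<in>UNIV. (cmod (V i t x))\<^sup>2))"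
      by (rule ennreal_leI)
    also have "\<dots> = ennreal ?D * (\<Sum>i\<in>UNIV. ennreal ((cmod (V i t x))\<^sup>2))"
      by (subst ennreal_mult) (auto simp: sum_nonneg)
    finally show "ennreal ((cmod (\<Sum>i\<in>UNIV. V i t x))\<^sup>2) \<le> ennreal ?D * (\<Sum>i\<in>UNIV. ennreal ((cmod (V i t x))\<^sup>2))" .
  qed
  also have "\<dots> = ennreal ?D * (\<Sum>i\<in>UNIV. \<integral>\<^sup>+t. \<integral>\<^sup>+x. ennreal ((cmod (V i t x))\<^sup>2) \<partial>lborel \<partial>time_interval)"
    using mx mt by (simp add: nn_integral_cmult nn_integral_sum borel_measurable_sum del: sum_ennreal)
  also have "\<dots> \<le> ennreal ?D * (\<Sum>i\<in>UNIV. ennreal (B i))"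
    by (intro mult_left_mono sum_mono le) auto
  also have "\<dots> = ennreal (?D * (\<Sum>i\<in>UNIV. B i))"
    using B by (subst ennreal_mult) (auto simp: sum_nonneg)
  finally show ?thesis .
qed

text \<open>The total of \<open>\<alpha>\<close> exceeds a multiple of \<open>N^2\<close>, so some
  entry does too. Assigning each \<open>\<alpha>\<close> to one such coordinate splits
  \<open>c\<close> into \<open>d\<close> pieces with disjoint supports, and the one-coordinate
  estimate applies to each.\<close>

lemma wave_mult_bound_separated:
  fixes c d :: "('n::finite \<Rightarrow> nat) \<Rightarrow> complex"
  assumes M: "1 \<le> M" and sep: "512 * CARD('n) * M \<le> N"
    and supp: "\<And>\<alpha>. c \<alpha> \<noteq> 0 \<Longrightarrow> (real N)\<^sup>2 / 4 < 2 * real (multi_total \<alpha>) + real CARD('n)"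
  defines "D \<equiv> real CARD('n)"
  shows "(\<integral>\<^sup>+t. \<integral>\<^sup>+x. ennreal ((cmod (wave (N\<^sup>2) c t x * wave (M\<^sup>2) d t x))\<^sup>2) \<partial>lborel \<partial>time_interval)
    \<le> ennreal (D * (2 ^ (CARD('n) - 1) * pi * (2 * sqrt (32 * D) + (512 * D)\<^sup>2))
        * (real M ^ (CARD('n) - 1) / real N) * coeff_norm2 (N\<^sup>2) c * coeff_norm2 (M\<^sup>2) d)"
proof -
  \<comment> \<open>Chosen so that \<open>64 * (2 N^2) * (2 N^2/A^2) = (N^2/(32 d))^2\<close>, the
    lower bound available for \<open>n0^2\<close>.\<close>
  define A where "A = 512 * CARD('n)"
  \<comment> \<open>If all entries were below \<open>n0 <= N^2/(16 d)\<close>, twice the total would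
    stay below \<open>N^2/8\<close>, too small for the lower spectral bound.\<close>
  define n0 where "n0 = N\<^sup>2 div (16 * CARD('n))"
  \<comment> \<open>The order of the moment grows like \<open>N^2\<close>, which up to constants is
    as much as the smallness condition permits.\<close>
  define p where "p = N\<^sup>2 div A\<^sup>2"
  have D1: "D \<ge> 1" unfolding D_def by (simp add: Suc_leI)
  have A: "real A = 512 * D" by (simp add: A_def D_def)
  have NA: "real A * real M \<le> real N" using sep by (simp add: A_def flip: of_nat_mult)
  have "real A * 1 \<le> real A * real M" using M by (intro mult_left_mono) auto
  then have "real A \<le> real N" using NA by linarith
  then have NA1: "512 * D \<le> real N" using A by simp
  have N0: "real N > 0" using NA1 D1 by linarith
  have "(512 * D)\<^sup>2 \<le> (real N)\<^sup>2" using NA1 D1 by (intro power_mono) auto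
  moreover have "D * 1 \<le> D * D" using D1 by (intro mult_left_mono) auto
  ultimately have N2: "32 * D \<le> (real N)\<^sup>2" using D1 unfolding power2_eq_square by linarith
  have n0_gt: "(real N)\<^sup>2 / (16 * D) - 1 < real n0"
  proof -
    have "real (N\<^sup>2) / real (16 * CARD('n)) - 1 < real (N\<^sup>2 div (16 * CARD('n)))"
      by (metis div_le_dividend diff_less_eq floor_divide_of_nat_eq less_floor_iff floor_less_cancel lessI of_int_of_nat_eq real_of_int_floor_gt_diff_one)
    then show ?thesis by (simp add: n0_def D_def)
  qed
  have n0_le: "real n0 \<le> (real N)\<^sup>2 / (16 * D)"
    using of_nat_div_le_of_nat[where ?'a = real, of "N\<^sup>2" "16 * CARD('n)"] by (simp add: n0_def D_def)
  have "1 \<le> (real N)\<^sup>2 / (32 * D)" using N2 D1 by simp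
  then have n0_ge: "(real N)\<^sup>2 / (32 * D) \<le> real n0" using n0_gt by (simp add: field_simps)
  then have n0_pos: "n0 > 0" using \<open>1 \<le> (real N)\<^sup>2 / (32 * D)\<close> by (cases "n0 = 0") auto
  have p_le: "real p \<le> (real N)\<^sup>2 / (512 * D)\<^sup>2"
    using of_nat_div_le_of_nat[where ?'a = real, of "N\<^sup>2" "A\<^sup>2"] by (simp add: p_def A)
  have p_gt: "(real N)\<^sup>2 / (512 * D)\<^sup>2 < real p + 1"
  proof -
    have "real (N\<^sup>2) / real (A\<^sup>2) - 1 < real (N\<^sup>2 div A\<^sup>2)"
      by (metis floor_divide_of_nat_eq of_int_of_nat_eq real_of_int_floor_gt_diff_one)
    then show ?thesis by (simp add: p_def A)
  qed
  have M2: "(real M)\<^sup>2 \<le> (real N)\<^sup>2 / (512 * D)\<^sup>2"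
  proof -
    have "(real A * real M)\<^sup>2 \<le> (real N)\<^sup>2" using NA by (intro power_mono) auto
    then show ?thesis using D1 by (simp add: A power_mult_distrib field_simps)
  qed
  have small: "64 * real (N\<^sup>2 + M\<^sup>2) * (real (M\<^sup>2) + real p) \<le> (real n0)\<^sup>2"
  proof -
    have "1 \<le> (512 * D)\<^sup>2" using D1 by (intro one_le_power) auto
    then have "(real N)\<^sup>2 / (512 * D)\<^sup>2 \<le> (real N)\<^sup>2 / 1" by (intro divide_left_mono) auto
    from order_trans[OF M2 this] have "real (N\<^sup>2 + M\<^sup>2) \<le> 2 * (real N)\<^sup>2" by simp
    moreover have "real (M\<^sup>2) + real p \<le> 2 * ((real N)\<^sup>2 / (512 * D)\<^sup>2)" using M2 p_le by simp
    ultimately have "64 * real (N\<^sup>2 + M\<^sup>2) * (real (M\<^sup>2) + real p)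
        \<le> 64 * (2 * (real N)\<^sup>2) * (2 * ((real N)\<^sup>2 / (512 * D)\<^sup>2))"
      by (intro mult_mono) auto
    also have "\<dots> = ((real N)\<^sup>2 / (32 * D))\<^sup>2" by (simp add: power2_eq_square)
    also have "\<dots> \<le> (real n0)\<^sup>2" using n0_ge D1 by (intro power_mono) auto
    finally show ?thesis .
  qed
  define \<iota> where "\<iota> \<alpha> = (SOME i. n0 \<le> \<alpha> i)" for \<alpha> :: "'n \<Rightarrow> nat"
  have \<iota>: "n0 \<le> \<alpha> (\<iota> \<alpha>)" if "c \<alpha> \<noteq> 0" for \<alpha>
  proof -
    have "\<exists>i. n0 \<le> \<alpha> i"
    proof (rule ccontr)
      assume neg: "\<not> ?thesis"
      have "2 * real (multi_total \<alpha>) = (\<Sum>i\<in>UNIV. 2 * real (\<alpha> i))"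
        by (simp add: multi_total_def sum_distrib_left)
      also have "\<dots> \<le> (\<Sum>i\<in>(UNIV::'n set). 2 * (real n0 - 1))"
      proof (intro sum_mono mult_left_mono)
        fix i
        have "\<not> n0 \<le> \<alpha> i" using neg by blast
        then have "Suc (\<alpha> i) \<le> n0" by simp
        then have "real (Suc (\<alpha> i)) \<le> real n0" by (simp only: of_nat_le_iff)
        then show "real (\<alpha> i) \<le> real n0 - 1" by simp
      qed simp
      also have "\<dots> = D * (2 * (real n0 - 1))" by (simp add: D_def)
      also have "\<dots> \<le> D * (2 * ((real N)\<^sup>2 / (16 * D) - 1))"
        using n0_le D1 by (intro mult_left_mono) auto
      also have "\<dots> = (real N)\<^sup>2 / 8 - 2 * D" using D1 by (simp add: field_simps)
      finally show False using supp[OF that] D1 zero_le_power2[of "real N"] unfolding D_def by linarith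
    qed
    then show ?thesis unfolding \<iota>_def by (rule someI_ex)
  qed
  let ?c = "\<lambda>i \<alpha>. if \<iota> \<alpha> = i then c \<alpha> else 0"
  let ?E = "2 ^ (CARD('n) - 1) * pi * (2 * sqrt (32 * D) + (512 * D)\<^sup>2) * (real M ^ (CARD('n) - 1) / real N)"
  have split: "wave (N\<^sup>2) c t x = (\<Sum>i\<in>UNIV. wave (N\<^sup>2) (?c i) t x)" for t x
    unfolding wave_def by (subst sum.swap, intro sum.cong refl) (simp add: sum_distrib_right[symmetric] sum.delta)
  have split_mult: "wave (N\<^sup>2) c t x * wave (M\<^sup>2) d t x
      = (\<Sum>i\<in>UNIV. wave (N\<^sup>2) (?c i) t x * wave (M\<^sup>2) d t x)" for t x
    by (subst split, rule sum_distrib_right)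
  have norms: "(\<Sum>i\<in>UNIV. coeff_norm2 (N\<^sup>2) (?c i)) = coeff_norm2 (N\<^sup>2) c"
  proof -
    have "(\<Sum>i\<in>UNIV. (cmod (?c i \<alpha>))\<^sup>2) = (cmod (c \<alpha>))\<^sup>2" for \<alpha>
      by (simp add: if_distrib[of cmod] if_distrib[of "\<lambda>x. x\<^sup>2"] sum.delta cong: if_cong)
    then show ?thesis by (subst sum.swap) simp
  qed
  have E: "0 \<le> ?E" using D1 N0 by (intro mult_nonneg_nonneg) auto
  have "(\<integral>\<^sup>+t. \<integral>\<^sup>+x. ennreal ((cmod (\<Sum>i\<in>UNIV. wave (N\<^sup>2) (?c i) t x * wave (M\<^sup>2) d t x))\<^sup>2) \<partial>lborel \<partial>time_interval)
      \<le> ennreal (real CARD('n) * (\<Sum>i\<in>UNIV. ?E * (coeff_norm2 (N\<^sup>2) (?c i) * coeff_norm2 (M\<^sup>2) d)))"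
  proof (rule nn_integral_sum_le)
    fix i
    show "0 \<le> ?E * (coeff_norm2 (N\<^sup>2) (?c i) * coeff_norm2 (M\<^sup>2) d)"
      by (intro mult_nonneg_nonneg[OF E] mult_nonneg_nonneg sum_nonneg) auto
    show "(\<lambda>(t, x). wave (N\<^sup>2) (?c i) t x * wave (M\<^sup>2) d t x) \<in> borel_measurable (lborel \<Otimes>\<^sub>M lborel)"
      unfolding wave_def by measurable
    have "(\<integral>\<^sup>+t. \<integral>\<^sup>+x. ennreal ((cmod (wave (N\<^sup>2) (?c i) t x * wave (M\<^sup>2) d t x))\<^sup>2) \<partial>lborel \<partial>time_interval)
        \<le> ennreal (sqrt (2 * Suc (M\<^sup>2)) ^ (CARD('n) - 1) * (pi * (2 / sqrt n0 + (1 / 4) ^ p))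
            * (coeff_norm2 (N\<^sup>2) (?c i) * coeff_norm2 (M\<^sup>2) d))"
    proof (rule wave_mult_bound_far[where i = i, OF _ n0_pos small])
      fix \<alpha> assume "?c i \<alpha> \<noteq> 0"
      then show "n0 \<le> \<alpha> i" using \<iota>[of \<alpha>] by (auto split: if_splits)
    qed
    also have "\<dots> \<le> ennreal (?E * (coeff_norm2 (N\<^sup>2) (?c i) * coeff_norm2 (M\<^sup>2) d))"
    proof (intro ennreal_leI mult_right_mono mult_nonneg_nonneg sum_nonneg)
      have "sqrt (2 * Suc (M\<^sup>2)) \<le> sqrt ((2 * real M)\<^sup>2)"
      proof (rule real_sqrt_le_mono)
        have "1 \<le> (real M)\<^sup>2" using M by simp
        then show "real (2 * Suc (M\<^sup>2)) \<le> (2 * real M)\<^sup>2" by (simp add: power_mult_distrib)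
      qed
      then have s: "sqrt (2 * Suc (M\<^sup>2)) \<le> 2 * real M" unfolding real_sqrt_abs by simp
      have "sqrt ((real N)\<^sup>2 / (32 * D)) \<le> sqrt n0" using n0_ge by (rule real_sqrt_le_mono)
      then have "real N / sqrt (32 * D) \<le> sqrt n0" by (simp add: real_sqrt_divide)
      then have "2 / sqrt n0 \<le> 2 / (real N / sqrt (32 * D))"
        using N0 D1 n0_pos by (intro divide_left_mono) auto
      then have e1: "2 / sqrt n0 \<le> 2 * sqrt (32 * D) / real N" by simp
      \<comment> \<open>This crude bound on the exponential is enough: it gives
        \<open>(1/4)^p <= A^2/N^2\<close>, while only order \<open>1/N\<close> is required.\<close>
      have "real p + 1 \<le> 4 ^ p"
        by (induction p) auto
      then have "(1 / 4) ^ p \<le> 1 / (real p + 1)" by (simp add: power_one_over field_simps)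
      also have "\<dots> \<le> 1 / ((real N)\<^sup>2 / (512 * D)\<^sup>2)"
        using p_gt N0 D1 by (intro divide_left_mono) auto
      also have "\<dots> = (512 * D)\<^sup>2 / real N / real N" by (simp add: power2_eq_square)
      also have "\<dots> \<le> (512 * D)\<^sup>2 / real N / 1"
        using NA1 D1 N0 by (intro divide_left_mono divide_nonneg_pos) auto
      finally have "2 / sqrt n0 + (1 / 4) ^ p \<le> (2 * sqrt (32 * D) + (512 * D)\<^sup>2) / real N"
        using e1 by (simp add: add_divide_distrib)
      then have "sqrt (2 * Suc (M\<^sup>2)) ^ (CARD('n) - 1) * (pi * (2 / sqrt n0 + (1 / 4) ^ p))
          \<le> (2 * real M) ^ (CARD('n) - 1) * (pi * ((2 * sqrt (32 * D) + (512 * D)\<^sup>2) / real N))"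
        using s by (intro mult_mono power_mono mult_left_mono) (auto simp del: of_nat_Suc of_nat_mult)
      then show "sqrt (2 * Suc (M\<^sup>2)) ^ (CARD('n) - 1) * (pi * (2 / sqrt n0 + (1 / 4) ^ p)) \<le> ?E"
        by (simp add: power_mult_distrib mult_ac del: of_nat_Suc of_nat_mult)
    qed auto
    finally show "(\<integral>\<^sup>+t. \<integral>\<^sup>+x. ennreal ((cmod (wave (N\<^sup>2) (?c i) t x * wave (M\<^sup>2) d t x))\<^sup>2) \<partial>lborel \<partial>time_interval)
        \<le> ennreal (?E * (coeff_norm2 (N\<^sup>2) (?c i) * coeff_norm2 (M\<^sup>2) d))" .
  qed
  also have "real CARD('n) * (\<Sum>i\<in>UNIV. ?E * (coeff_norm2 (N\<^sup>2) (?c i) * coeff_norm2 (M\<^sup>2) d))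
      = D * (?E * (coeff_norm2 (N\<^sup>2) c * coeff_norm2 (M\<^sup>2) d))"
    by (simp only: sum_distrib_left[symmetric] sum_distrib_right[symmetric] norms D_def)
  finally show ?thesis by (simp only: split_mult mult.assoc)
qed

text \<open>For \<open>512 d M <= N\<close> the separated estimate applies. Otherwise
  \<open>N\<close> is below a fixed multiple of \<open>M\<close>, so the powers of \<open>N\<close>
  in the near estimate become powers of \<open>M\<close>, and the factor \<open>M/N\<close> can be
  inserted at bounded cost.\<close>

lemma wave_mult_bound:
  assumes card: "2 \<le> CARD('n::finite)"
  obtains C where "C > 0"
    "\<And>N M (c :: ('n \<Rightarrow> nat) \<Rightarrow> complex) d. 1 \<le> M \<Longrightarrow> M \<le> N
      \<Longrightarrow> (\<And>\<alpha>. c \<alpha> \<noteq> 0 \<Longrightarrow> (real N)\<^sup>2 / 4 < 2 * real (multi_total \<alpha>) + real CARD('n))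
      \<Longrightarrow> (\<integral>\<^sup>+t. \<integral>\<^sup>+x. ennreal ((cmod (wave (N\<^sup>2) c t x * wave (M\<^sup>2) d t x))\<^sup>2) \<partial>lborel \<partial>time_interval)
        \<le> ennreal (C * (real M ^ (CARD('n) - 2) * (real M / real N)) * coeff_norm2 (N\<^sup>2) c * coeff_norm2 (M\<^sup>2) d)"
proof -
  let ?d = "CARD('n)"
  let ?D = "real CARD('n)"
  let ?A = "512 * ?D"
  define C1 where "C1 = ?D * (2 ^ (?d - 1) * pi * (2 * sqrt (32 * ?D) + (512 * ?D)\<^sup>2))"
  define C2 where "C2 = pi * (8 * (3 * ?A) ^ (?d - 2)) * ?A"
  have C: "C1 > 0" "C2 > 0" using card by (auto simp: C1_def C2_def intro!: mult_pos_pos add_pos_pos)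
  show ?thesis
  proof (rule that[of "max C1 C2"])
    show "max C1 C2 > 0" using C by simp
    fix N M and c d :: "('n \<Rightarrow> nat) \<Rightarrow> complex"
    assume M: "1 \<le> M" and MN: "M \<le> N"
      and supp: "\<And>\<alpha>. c \<alpha> \<noteq> 0 \<Longrightarrow> (real N)\<^sup>2 / 4 < 2 * real (multi_total \<alpha>) + ?D"
    let ?R = "real M ^ (?d - 2) * (real M / real N)"
    let ?cc = "coeff_norm2 (N\<^sup>2) c" and ?dd = "coeff_norm2 (M\<^sup>2) d"
    have nn: "0 \<le> ?cc" "0 \<le> ?dd" "0 \<le> ?R" by (auto intro!: sum_nonneg)
    have R: "real M ^ (?d - 1) / real N = ?R"
    proof -
      have "?d - 1 = Suc (?d - 2)" using card by simp
      then show ?thesis by simp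
    qed
    have "\<exists>C\<le>max C1 C2. (\<integral>\<^sup>+t. \<integral>\<^sup>+x. ennreal ((cmod (wave (N\<^sup>2) c t x * wave (M\<^sup>2) d t x))\<^sup>2) \<partial>lborel \<partial>time_interval)
        \<le> ennreal (C * ?R * ?cc * ?dd)"
    proof (cases "512 * ?d * M \<le> N")
      case True
      show ?thesis
        using wave_mult_bound_separated[where c = c and d = d, OF M True supp]
        unfolding R C1_def[symmetric] by (intro exI[of _ C1] conjI) auto
    next
      case False
      \<comment> \<open>The near estimate takes both waves on one box. Since \<open>d\<close> is
        arbitrary outside its own box, it is cut off before that box is enlarged.\<close>
      let ?d' = "\<lambda>\<alpha>. if \<alpha> \<in> multi_box (M\<^sup>2) then d \<alpha> else 0"
      have le: "M\<^sup>2 \<le> N\<^sup>2" using MN by simp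
      have w: "wave (M\<^sup>2) d t x = wave (N\<^sup>2) ?d' t x" for t x
        unfolding wave_def by (rule sum_multi_box_extend[OF le]) auto
      have n: "?dd = coeff_norm2 (N\<^sup>2) ?d'"
        by (rule sum_multi_box_extend[OF le]) auto
      have "real N \<le> real (512 * ?d * M)" using False by (simp only: of_nat_le_iff)
      then have NM: "real N \<le> ?A * real M" by simp
      have "sqrt (2 * Suc (2 * N\<^sup>2)) \<le> sqrt ((3 * real N)\<^sup>2)"
      proof (rule real_sqrt_le_mono)
        have "1 \<le> (real N)\<^sup>2" using M MN by simp
        then show "real (2 * Suc (2 * N\<^sup>2)) \<le> (3 * real N)\<^sup>2" by (simp add: power_mult_distrib)
      qed
      then have "sqrt (2 * Suc (2 * N\<^sup>2)) \<le> 3 * real N" unfolding real_sqrt_abs by simp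
      also have "\<dots> \<le> 3 * ?A * real M" using NM by linarith
      finally have s: "sqrt (2 * Suc (2 * N\<^sup>2)) \<le> 3 * ?A * real M" .
      have one: "1 \<le> ?A * (real M / real N)" using NM M MN by (simp add: field_simps)
      have "pi * (8 * sqrt (2 * Suc (2 * N\<^sup>2)) ^ (?d - 2)) \<le> pi * (8 * (3 * ?A * real M) ^ (?d - 2)) * 1"
        using s by (simp del: of_nat_Suc of_nat_mult) (intro power_mono, auto)
      also have "\<dots> \<le> pi * (8 * (3 * ?A * real M) ^ (?d - 2)) * (?A * (real M / real N))"
        by (intro mult_left_mono one) auto
      also have "\<dots> = C2 * ?R" unfolding C2_def power_mult_distrib[of "3 * ?A" "real M"] by (simp only: mult_ac)
      finally have "pi * (8 * sqrt (2 * Suc (2 * N\<^sup>2)) ^ (?d - 2)) * ?cc * ?dd \<le> C2 * ?R * ?cc * ?dd"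
        by (intro mult_right_mono nn)
      then have "ennreal (pi * (8 * sqrt (2 * Suc (2 * N\<^sup>2)) ^ (?d - 2)) * ?cc * ?dd) \<le> ennreal (C2 * ?R * ?cc * ?dd)"
        by (rule ennreal_leI)
      with wave_mult_bound_near[OF card, of "N\<^sup>2" c ?d'] show ?thesis
        unfolding w n by (intro exI[of _ C2]) auto
    qed
    then obtain C where C: "C \<le> max C1 C2"
      and le: "(\<integral>\<^sup>+t. \<integral>\<^sup>+x. ennreal ((cmod (wave (N\<^sup>2) c t x * wave (M\<^sup>2) d t x))\<^sup>2) \<partial>lborel \<partial>time_interval)
        \<le> ennreal (C * ?R * ?cc * ?dd)" by blast
    note le
    also have "ennreal (C * ?R * ?cc * ?dd) \<le> ennreal (max C1 C2 * ?R * ?cc * ?dd)"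
      using C by (intro ennreal_leI mult_right_mono nn) auto
    finally show "(\<integral>\<^sup>+t. \<integral>\<^sup>+x. ennreal ((cmod (wave (N\<^sup>2) c t x * wave (M\<^sup>2) d t x))\<^sup>2) \<partial>lborel \<partial>time_interval)
        \<le> ennreal (max C1 C2 * ?R * ?cc * ?dd)" .
  qed
qed

section \<open>The Hilbert space \<open>L\<^sup>2\<close>\<close>

text \<open>A real squared norm for algebra, linked to the extended norm by
  \<open>L2_norm_eq\<close>. A square that is not integrable gets the default integral 0, so the
  value is meaningful only on \<open>L2\<close>.\<close>

definition L2_sq :: "('a::euclidean_space \<Rightarrow> complex) \<Rightarrow> real" where
  "L2_sq f = (\<integral>x. (cmod (f x))\<^sup>2 \<partial>lborel)"

lemma L2_norm_on_le:
  assumes "(\<integral>\<^sup>+x. (g x)\<^sup>2 \<partial>M) \<le> ennreal (c\<^sup>2)" "0 \<le> c"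
  shows "L2_norm_on M g \<le> ennreal c"
proof -
  have fin: "(\<integral>\<^sup>+x. (g x)\<^sup>2 \<partial>M) \<noteq> \<infinity>" using assms(1) by (metis ennreal_less_top infinity_ennreal_def leD)
  have "enn2real (\<integral>\<^sup>+x. (g x)\<^sup>2 \<partial>M) \<le> c\<^sup>2"
    using enn2real_mono[OF assms(1)] by simp
  then have "sqrt (enn2real (\<integral>\<^sup>+x. (g x)\<^sup>2 \<partial>M)) \<le> c"
    using assms(2) by (simp add: real_le_lsqrt)
  then show ?thesis using fin by (simp add: L2_norm_on_def Let_def ennreal_leI)
qed

lemma L2_norm_on_square:
  "(\<integral>\<^sup>+x. (g x)\<^sup>2 \<partial>M) = (L2_norm_on M g)\<^sup>2"
proof (cases "(\<integral>\<^sup>+x. (g x)\<^sup>2 \<partial>M) = \<infinity>")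
  case False
  then show ?thesis
    by (simp add: L2_norm_on_def Let_def ennreal_power ennreal_enn2real less_top)
qed (simp add: L2_norm_on_def power2_eq_square ennreal_top_mult)

lemma L2_iff:
  "f \<in> L2 \<longleftrightarrow> f \<in> borel_measurable borel \<and> integrable lborel (\<lambda>x. (cmod (f x))\<^sup>2)"
  unfolding L2_def L2_norm_def L2_norm_on_def Let_def
  by (auto simp: integrable_iff_bounded ennreal_power less_top)

lemma L2_norm_eq: "f \<in> L2 \<Longrightarrow> L2_norm f = ennreal (sqrt (L2_sq f))"
  unfolding L2_iff L2_norm_def L2_norm_on_def Let_def L2_sq_def
  by (simp add: ennreal_power nn_integral_eq_integral)

lemma L2_norm_square: "(L2_norm f)\<^sup>2 = (\<integral>\<^sup>+x. ennreal ((cmod (f x))\<^sup>2) \<partial>lborel)"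
  unfolding L2_norm_def L2_norm_on_square[symmetric] by (simp add: ennreal_power)

lemma L2_sq_nonneg [simp]: "0 \<le> L2_sq f"
  by (simp add: L2_sq_def)

lemma cmod_add_square_le: "(cmod (a + b))\<^sup>2 \<le> 2 * (cmod a)\<^sup>2 + 2 * (cmod b)\<^sup>2"
proof -
  have "(cmod (a + b))\<^sup>2 \<le> (cmod a + cmod b)\<^sup>2" by (intro power_mono norm_triangle_ineq) auto
  also have "\<dots> \<le> 2 * (cmod a)\<^sup>2 + 2 * (cmod b)\<^sup>2"
    using zero_le_power2[of "cmod a - cmod b"] by (simp add: power2_sum power2_diff)
  finally show ?thesis .
qed

lemma L2_add [intro]:
  assumes "f \<in> L2" "g \<in> L2"
  shows "(\<lambda>x. f x + g x) \<in> L2"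
proof -
  have [measurable]: "f \<in> borel_measurable borel" "g \<in> borel_measurable borel"
    using assms by (auto simp: L2_iff)
  have "integrable lborel (\<lambda>x. 2 * (cmod (f x))\<^sup>2 + 2 * (cmod (g x))\<^sup>2)"
    using assms by (auto simp: L2_iff)
  then have "integrable lborel (\<lambda>x. (cmod (f x + g x))\<^sup>2)"
    by (rule Bochner_Integration.integrable_bound) (auto intro: order_trans[OF cmod_add_square_le])
  then show ?thesis by (simp add: L2_iff)
qed

lemma L2_cmult [intro]: "f \<in> L2 \<Longrightarrow> (\<lambda>x. c * f x) \<in> L2"
  unfolding L2_iff by (auto simp: norm_mult power_mult_distrib)

lemma L2_diff [intro]: "f \<in> L2 \<Longrightarrow> g \<in> L2 \<Longrightarrow> (\<lambda>x. f x - g x) \<in> L2"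
  using L2_add[OF _ L2_cmult[of g "-1"], of f] by simp

lemma L2_zero [simp, intro]: "(\<lambda>x. 0) \<in> L2"
  by (simp add: L2_iff)

lemma L2_sum [intro]: "(\<And>j. j \<in> J \<Longrightarrow> f j \<in> L2) \<Longrightarrow> (\<lambda>x. \<Sum>j\<in>J. f j x) \<in> L2"
  by (induction J rule: infinite_finite_induct) auto

lemma L2_mult_integrable:
  assumes "f \<in> L2" "g \<in> L2"
  shows "integrable lborel (\<lambda>x. f x * cnj (g x))"
proof -
  have [measurable]: "f \<in> borel_measurable borel" "g \<in> borel_measurable borel"
    using assms by (auto simp: L2_iff)
  have [measurable]: "cnj \<in> borel_measurable borel"
    by (intro borel_measurable_continuous_onI continuous_intros)
  have "integrable lborel (\<lambda>x. (cmod (f x))\<^sup>2 + (cmod (g x))\<^sup>2)"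
    using assms by (auto simp: L2_iff)
  then show ?thesis
  proof (rule Bochner_Integration.integrable_bound)
    show "AE x in lborel. norm (f x * cnj (g x)) \<le> norm ((cmod (f x))\<^sup>2 + (cmod (g x))\<^sup>2)"
    proof (intro AE_I2)
      fix x
      have "2 * (cmod (f x) * cmod (g x)) \<le> (cmod (f x))\<^sup>2 + (cmod (g x))\<^sup>2"
        using zero_le_power2[of "cmod (f x) - cmod (g x)"] by (simp add: power2_diff)
      moreover have "0 \<le> cmod (f x) * cmod (g x)" by simp
      ultimately have "cmod (f x) * cmod (g x) \<le> (cmod (f x))\<^sup>2 + (cmod (g x))\<^sup>2" by linarith
      then show "norm (f x * cnj (g x)) \<le> norm ((cmod (f x))\<^sup>2 + (cmod (g x))\<^sup>2)"
        by (simp add: norm_mult)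
    qed
  qed measurable
qed

lemma L2_inner_add: "u \<in> L2 \<Longrightarrow> v \<in> L2 \<Longrightarrow> w \<in> L2 \<Longrightarrow> L2_inner (\<lambda>x. u x + v x) w = L2_inner u w + L2_inner v w"
  unfolding L2_inner_def by (simp add: L2_mult_integrable distrib_right)

lemma L2_inner_cmult: "L2_inner (\<lambda>x. c * u x) w = c * L2_inner u w"
  unfolding L2_inner_def by (simp add: mult.assoc)

lemma L2_inner_diff: "u \<in> L2 \<Longrightarrow> v \<in> L2 \<Longrightarrow> w \<in> L2 \<Longrightarrow> L2_inner (\<lambda>x. u x - v x) w = L2_inner u w - L2_inner v w"
  unfolding L2_inner_def by (simp add: L2_mult_integrable left_diff_distrib)

lemma L2_inner_sum:
  "(\<And>j. j \<in> J \<Longrightarrow> f j \<in> L2) \<Longrightarrow> w \<in> L2 \<Longrightarrow> L2_inner (\<lambda>x. \<Sum>j\<in>J. f j x) w = (\<Sum>j\<in>J. L2_inner (f j) w)"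
  unfolding L2_inner_def by (simp add: L2_mult_integrable sum_distrib_right)

lemma L2_inner_cnj: "L2_inner v u = cnj (L2_inner u v)"
  using Bochner_Integration.integral_cnj[of lborel "\<lambda>x. u x * cnj (v x)"] by (simp add: L2_inner_def mult.commute)

lemma L2_inner_self: "L2_inner u u = of_real (L2_sq u)"
  unfolding L2_inner_def L2_sq_def integral_complex_of_real[symmetric]
  by (simp only: complex_norm_square)

lemma L2_sq_diff:
  assumes "u \<in> L2" "v \<in> L2"
  shows "L2_sq (\<lambda>x. u x - a * v x) = L2_sq u - 2 * Re (cnj a * L2_inner u v) + (cmod a)\<^sup>2 * L2_sq v"
proof -
  have av: "(\<lambda>x. a * v x) \<in> L2" using assms by auto
  have "of_real (L2_sq (\<lambda>x. u x - a * v x)) = L2_inner (\<lambda>x. u x - a * v x) (\<lambda>x. u x - a * v x)"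
    by (rule L2_inner_self[symmetric])
  also have "\<dots> = L2_inner u (\<lambda>x. u x - a * v x) - L2_inner (\<lambda>x. a * v x) (\<lambda>x. u x - a * v x)"
    using assms av by (intro L2_inner_diff) auto
  also have "L2_inner u (\<lambda>x. u x - a * v x) = cnj (L2_inner u u - L2_inner (\<lambda>x. a * v x) u)"
    by (subst L2_inner_cnj, subst L2_inner_diff) (use assms av in auto)
  also have "\<dots> = L2_inner u u - cnj a * L2_inner u v"
    by (simp add: L2_inner_cmult L2_inner_cnj[of v u] L2_inner_self)
  also have "L2_inner (\<lambda>x. a * v x) (\<lambda>x. u x - a * v x) = a * cnj (L2_inner u v - L2_inner (\<lambda>x. a * v x) v)"
    by (subst L2_inner_cmult, subst L2_inner_cnj, subst L2_inner_diff) (use assms av in auto)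
  also have "\<dots> = a * cnj (L2_inner u v) - of_real ((cmod a)\<^sup>2) * of_real (L2_sq v)"
    by (simp add: L2_inner_cmult L2_inner_self complex_norm_square right_diff_distrib mult.assoc del: of_real_power)
  finally have "complex_of_real (L2_sq (\<lambda>x. u x - a * v x))
      = of_real (L2_sq u) - cnj a * L2_inner u v - (a * cnj (L2_inner u v) - of_real ((cmod a)\<^sup>2) * of_real (L2_sq v))"
    by (simp add: L2_inner_self)
  from arg_cong[OF this, of Re] show ?thesis by (simp del: of_real_power)
qed

lemma L2_sq_eq_0_iff: "u \<in> L2 \<Longrightarrow> L2_sq u = 0 \<longleftrightarrow> ae_eq u (\<lambda>x. 0)"
  unfolding L2_sq_def ae_eq_def by (subst integral_nonneg_eq_0_iff_AE) (auto simp: L2_iff)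

lemma ae_eq_sym: "ae_eq f g \<Longrightarrow> ae_eq g f" unfolding ae_eq_def by (auto elim: eventually_mono)

lemma ae_eq_trans: "ae_eq f g \<Longrightarrow> ae_eq g h \<Longrightarrow> ae_eq f h"
  unfolding ae_eq_def by (auto elim: eventually_elim2)

lemma L2_sq_cong: "ae_eq f g \<Longrightarrow> f \<in> L2 \<Longrightarrow> g \<in> L2 \<Longrightarrow> L2_sq f = L2_sq g"
  unfolding L2_sq_def ae_eq_def by (intro integral_cong_AE) (auto simp: L2_iff elim: eventually_mono)

lemma L2_norm_cong: "ae_eq f g \<Longrightarrow> L2_norm f = L2_norm g"
proof -
  assume "ae_eq f g"
  then have "(\<integral>\<^sup>+x. (ennreal (cmod (f x)))\<^sup>2 \<partial>lborel) = (\<integral>\<^sup>+x. (ennreal (cmod (g x)))\<^sup>2 \<partial>lborel)"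
    unfolding ae_eq_def by (intro nn_integral_cong_AE) (auto elim: eventually_mono)
  then show ?thesis by (simp add: L2_norm_def L2_norm_on_def)
qed

lemma L2_inner_cong:
  assumes "ae_eq f g" "f \<in> L2" "g \<in> L2" "w \<in> L2"
  shows "L2_inner f w = L2_inner g w"
  unfolding L2_inner_def
proof (rule integral_cong_AE)
  show "(\<lambda>x. f x * cnj (w x)) \<in> borel_measurable lborel" "(\<lambda>x. g x * cnj (w x)) \<in> borel_measurable lborel"
    using assms L2_mult_integrable by (blast intro: borel_measurable_integrable)+
  show "AE x in lborel. f x * cnj (w x) = g x * cnj (w x)"
    using assms(1) unfolding ae_eq_def by (auto elim: eventually_mono)
qed

text \<open>Subtracting from \<open>u\<close> its projection on \<open>v\<close> leaves a
  nonnegative square. A null \<open>v\<close> is treated apart, as the coefficient divides by its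
  squared norm.\<close>

lemma L2_Cauchy_Schwarz:
  assumes "u \<in> L2" "v \<in> L2"
  shows "(cmod (L2_inner u v))\<^sup>2 \<le> L2_sq u * L2_sq v"
proof (cases "L2_sq v = 0")
  case True
  then have "ae_eq v (\<lambda>x. 0)" using L2_sq_eq_0_iff assms by blast
  then have "L2_inner v u = L2_inner (\<lambda>x. 0) u" using assms by (intro L2_inner_cong) auto
  then have "L2_inner u v = 0" by (subst L2_inner_cnj) (simp add: L2_inner_def)
  then show ?thesis by simp
next
  case False
  then have pos: "L2_sq v > 0" using L2_sq_nonneg[of v] by linarith
  let ?z = "L2_inner u v"
  let ?a = "?z / of_real (L2_sq v)"
  have 1: "Re (cnj ?a * ?z) = (cmod ?z)\<^sup>2 / L2_sq v"
  proof -
    have "cnj ?a * ?z = of_real ((cmod ?z)\<^sup>2) / of_real (L2_sq v)"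
      by (simp add: complex_norm_square mult.commute del: of_real_power)
    then show ?thesis by (metis Re_complex_of_real of_real_divide)
  qed
  have 2: "(cmod ?a)\<^sup>2 * L2_sq v = (cmod ?z)\<^sup>2 / L2_sq v"
    using pos by (simp add: norm_divide power_divide power2_eq_square)
  have "0 \<le> L2_sq (\<lambda>x. u x - ?a * v x)" by simp
  also have "\<dots> = L2_sq u - (cmod ?z)\<^sup>2 / L2_sq v"
    unfolding L2_sq_diff[OF assms] 1 2 by simp
  finally show ?thesis using pos by (simp add: field_simps)
qed

lemma L2_inner_tendsto:
  assumes w: "\<And>n. w n \<in> L2" and u: "u \<in> L2" and v: "v \<in> L2"
    and lim: "(\<lambda>n. L2_sq (\<lambda>x. w n x - u x)) \<longlonglongrightarrow> 0"
  shows "(\<lambda>n. L2_inner (w n) v) \<longlonglongrightarrow> L2_inner u v"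
proof -
  have "norm (L2_inner (w n) v - L2_inner u v) \<le> sqrt (L2_sq (\<lambda>x. w n x - u x) * L2_sq v)" for n
    unfolding L2_inner_diff[OF w u v, symmetric]
    by (rule real_le_rsqrt[OF L2_Cauchy_Schwarz[OF L2_diff[OF w u] v]])
  moreover have "(\<lambda>n. sqrt (L2_sq (\<lambda>x. w n x - u x) * L2_sq v)) \<longlonglongrightarrow> 0"
    using tendsto_real_sqrt[OF tendsto_mult_right[OF lim, of "L2_sq v"]] by simp
  ultimately have "(\<lambda>n. L2_inner (w n) v - L2_inner u v) \<longlonglongrightarrow> 0"
    by (rule Lim_null_comparison[OF always_eventually[OF allI]])
  then show ?thesis by (rule LIM_zero_cancel)
qed

lemma L2_lim_iff:
  assumes "\<And>n. w n \<in> L2" "v \<in> L2"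
  shows "L2_lim w v \<longleftrightarrow> (\<lambda>n. L2_sq (\<lambda>x. w n x - v x)) \<longlonglongrightarrow> 0"
proof -
  have "L2_lim w v \<longleftrightarrow> (\<lambda>n. ennreal (sqrt (L2_sq (\<lambda>x. w n x - v x)))) \<longlonglongrightarrow> ennreal 0"
    unfolding L2_lim_def using assms by (simp add: L2_norm_eq L2_diff)
  also have "\<dots> \<longleftrightarrow> (\<lambda>n. sqrt (L2_sq (\<lambda>x. w n x - v x))) \<longlonglongrightarrow> 0"
    by (rule tendsto_ennreal_iff) auto
  also have "\<dots> \<longleftrightarrow> (\<lambda>n. L2_sq (\<lambda>x. w n x - v x)) \<longlonglongrightarrow> 0"
  proof
    assume "(\<lambda>n. sqrt (L2_sq (\<lambda>x. w n x - v x))) \<longlonglongrightarrow> 0"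
    from tendsto_power[OF this, of 2] show "(\<lambda>n. L2_sq (\<lambda>x. w n x - v x)) \<longlonglongrightarrow> 0" by simp
  next
    assume "(\<lambda>n. L2_sq (\<lambda>x. w n x - v x)) \<longlonglongrightarrow> 0"
    from tendsto_real_sqrt[OF this] show "(\<lambda>n. sqrt (L2_sq (\<lambda>x. w n x - v x))) \<longlonglongrightarrow> 0" by simp
  qed
  finally show ?thesis .
qed

text \<open>Both limits have the same inner product with \<open>u - v\<close>, so
  \<open>u - v\<close> is orthogonal to itself.\<close>

lemma L2_lim_unique:
  assumes "\<And>n. w n \<in> L2" "u \<in> L2" "v \<in> L2" "L2_lim w u" "L2_lim w v"
  shows "ae_eq u v"
proof -
  have lim: "(\<lambda>n. L2_sq (\<lambda>x. w n x - u x)) \<longlonglongrightarrow> 0" "(\<lambda>n. L2_sq (\<lambda>x. w n x - v x)) \<longlonglongrightarrow> 0"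
    using assms L2_lim_iff by blast+
  have uv: "(\<lambda>x. u x - v x) \<in> L2" using assms by auto
  have "L2_inner u (\<lambda>x. u x - v x) = L2_inner v (\<lambda>x. u x - v x)"
    by (rule LIMSEQ_unique[OF L2_inner_tendsto L2_inner_tendsto]) (use assms lim uv in auto)
  then have "L2_inner (\<lambda>x. u x - v x) (\<lambda>x. u x - v x) = 0"
    using assms uv by (simp add: L2_inner_diff)
  then have "L2_sq (\<lambda>x. u x - v x) = 0" by (simp add: L2_inner_self)
  then show ?thesis using L2_sq_eq_0_iff[OF uv] by (auto simp: ae_eq_def)
qed

text \<open>Riesz--Fischer: a subsequence with geometrically decreasing increments converges almost
  everywhere, and Fatou's lemma identifies its limit as the limit in the mean.\<close>

lemma L2_complete:
  assumes f: "\<And>n. f n \<in> L2"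
    and cauchy: "\<And>n m. n \<le> m \<Longrightarrow> L2_sq (\<lambda>x. f m x - f n x) \<le> T n" and T: "T \<longlonglongrightarrow> 0"
  shows "\<exists>w\<in>L2. (\<lambda>n. L2_sq (\<lambda>x. f n x - w x)) \<longlonglongrightarrow> 0"
proof -
  have [measurable]: "f n \<in> borel_measurable borel" for n using f by (simp add: L2_iff)
  have "\<exists>r. T r \<le> (1 / 4) ^ k \<and> k \<le> r" for k
  proof -
    have "eventually (\<lambda>r. T r < (1 / 4) ^ k) sequentially" by (intro order_tendstoD[OF T]) simp
    then have "eventually (\<lambda>r. T r < (1 / 4) ^ k \<and> k \<le> r) sequentially"
      using eventually_ge_at_top[of k] by (rule eventually_conj)
    then show ?thesis by (auto simp: eventually_sequentially intro: less_imp_le)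
  qed
  then obtain r0 where r0: "\<And>k. T (r0 k) \<le> (1 / 4) ^ k" "\<And>k. k \<le> r0 k" by metis
  \<comment> \<open>The running maximum makes the indices monotone while staying above
    \<open>r0\<close>.\<close>
  define r where "r k = Max (r0 ` {..k})" for k
  have r_mono: "r k \<le> r (Suc k)" for k unfolding r_def by (intro Max_mono) auto
  have r_ge: "r0 k \<le> r k" for k unfolding r_def by (intro Max_ge) auto
  have r_k: "k \<le> r k" for k using r_ge r0(2) order_trans by blast
  \<comment> \<open>\<open>T\<close> is not assumed monotone, so \<open>T (r k)\<close> need not be
    small. Both elements are compared with \<open>f (r0 k)\<close> instead, at the cost of a factor
    4.\<close>
  have inc: "L2_sq (\<lambda>x. f (r (Suc k)) x - f (r k) x) \<le> 4 * (1 / 4) ^ k" for k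
  proof -
    have "(cmod (f (r (Suc k)) x - f (r k) x))\<^sup>2
        \<le> 2 * (cmod (f (r (Suc k)) x - f (r0 k) x))\<^sup>2 + 2 * (cmod (f (r k) x - f (r0 k) x))\<^sup>2" for x
      using cmod_add_square_le[of "f (r (Suc k)) x - f (r0 k) x" "- (f (r k) x - f (r0 k) x)"]
      by (simp only: norm_minus_cancel) simp
    then have "L2_sq (\<lambda>x. f (r (Suc k)) x - f (r k) x)
        \<le> (\<integral>x. 2 * (cmod (f (r (Suc k)) x - f (r0 k) x))\<^sup>2 + 2 * (cmod (f (r k) x - f (r0 k) x))\<^sup>2 \<partial>lborel)"
      unfolding L2_sq_def using L2_diff[OF f f]
      by (intro integral_mono) (auto simp: L2_iff)
    also have "\<dots> = 2 * L2_sq (\<lambda>x. f (r (Suc k)) x - f (r0 k) x) + 2 * L2_sq (\<lambda>x. f (r k) x - f (r0 k) x)"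
      unfolding L2_sq_def using L2_diff[OF f f] by (simp add: L2_iff)
    also have "\<dots> \<le> 2 * T (r0 k) + 2 * T (r0 k)"
      using r_ge[of k] r_mono[of k] by (intro add_mono mult_left_mono cauchy) auto
    finally show ?thesis using r0(1)[of k] by linarith
  qed
  \<comment> \<open>The weight \<open>2^k\<close> leaves integrals of size
    \<open>4 * 2^(-k)\<close>, still summable, and where the weighted sum is finite the increments
    decay like \<open>2^(-k/2)\<close>.\<close>
  let ?g = "\<lambda>k x. ennreal (2 ^ k * (cmod (f (r (Suc k)) x - f (r k) x))\<^sup>2)"
  have "(\<integral>\<^sup>+x. (\<Sum>k. ?g k x) \<partial>lborel) = (\<Sum>k. \<integral>\<^sup>+x. ?g k x \<partial>lborel)"
    by (rule nn_integral_suminf) simp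
  also have "\<dots> \<le> (\<Sum>k. ennreal (4 * (1 / 2) ^ k))"
  proof (intro suminf_le allI)
    fix k
    have "(\<integral>\<^sup>+x. ?g k x \<partial>lborel) = ennreal (2 ^ k * L2_sq (\<lambda>x. f (r (Suc k)) x - f (r k) x))"
      unfolding L2_sq_def using L2_diff[OF f f]
      by (subst nn_integral_eq_integral) (auto simp: L2_iff)
    also have "\<dots> \<le> ennreal (2 ^ k * (4 * (1 / 4) ^ k))"
      by (intro ennreal_leI mult_left_mono inc) auto
    also have "2 ^ k * (4 * (1 / 4) ^ k) = 4 * ((2 * (1 / 4)) ^ k :: real)"
      by (subst power_mult_distrib) simp
    finally show "(\<integral>\<^sup>+x. ?g k x \<partial>lborel) \<le> ennreal (4 * (1 / 2) ^ k)" by simp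
  qed auto
  also have "\<dots> = ennreal (\<Sum>k. 4 * (1 / 2) ^ k)"
    by (intro suminf_ennreal2 summable_mult summable_geometric) auto
  also have "\<dots> < \<infinity>" by simp
  finally have fin: "(\<integral>\<^sup>+x. (\<Sum>k. ?g k x) \<partial>lborel) \<noteq> \<infinity>" by simp
  have "AE x in lborel. (\<Sum>k. ?g k x) \<noteq> \<infinity>"
    by (rule nn_integral_noteq_infinite[OF _ fin]) simp
  then have conv: "AE x in lborel. convergent (\<lambda>k. f (r k) x)"
  proof (rule eventually_mono)
    fix x assume x: "(\<Sum>k. ?g k x) \<noteq> \<infinity>"
    define C where "C = enn2real (\<Sum>k. ?g k x)"
    have le: "2 ^ k * (cmod (f (r (Suc k)) x - f (r k) x))\<^sup>2 \<le> C" for k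
    proof -
      have "?g k x = (\<Sum>j\<in>{k}. ?g j x)" by (simp only: sum.insert sum.empty finite.emptyI empty_iff not_False_eq_True add_0_right)
      also have "\<dots> \<le> (\<Sum>j. ?g j x)" by (rule sum_le_suminf) auto
      also have "\<dots> = ennreal C" unfolding C_def using x by (simp add: ennreal_enn2real_if)
      finally show ?thesis by (subst (asm) ennreal_le_iff) (simp_all add: C_def)
    qed
    have b: "cmod (f (r (Suc k)) x - f (r k) x) \<le> sqrt C * (1 / sqrt 2) ^ k" for k
    proof -
      have "(cmod (f (r (Suc k)) x - f (r k) x))\<^sup>2 \<le> C / 2 ^ k" using le[of k] by (simp add: field_simps)
      then have "cmod (f (r (Suc k)) x - f (r k) x) \<le> sqrt (C / 2 ^ k)" by (rule real_le_rsqrt)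
      then show ?thesis by (simp add: real_sqrt_divide real_sqrt_power power_one_over)
    qed
    have "summable (\<lambda>k. f (r (Suc k)) x - f (r k) x)"
    proof (rule summable_comparison_test'[of _ 0])
      show "summable (\<lambda>k. sqrt C * (1 / sqrt 2) ^ k)" by (intro summable_mult summable_geometric) simp
    qed (rule b)
    then have "convergent (\<lambda>n. \<Sum>k<n. f (r (Suc k)) x - f (r k) x)" by (simp add: summable_iff_convergent)
    then have "convergent (\<lambda>n. f (r n) x - f (r 0) x)" by (simp only: sum_lessThan_telescope[of "\<lambda>k. f (r k) x"])
    then have "convergent (\<lambda>n. (f (r n) x - f (r 0) x) + f (r 0) x)" by (intro convergent_add) (auto simp: convergent_const)
    then show "convergent (\<lambda>k. f (r k) x)" by simp
  qed
  define w where "w x = lim (\<lambda>k. f (r k) x)" for x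
  have w_meas [measurable]: "w \<in> borel_measurable borel"
    unfolding w_def[abs_def] by (rule borel_measurable_lim_metric) simp
  have bound: "(\<integral>\<^sup>+x. ennreal ((cmod (f n x - w x))\<^sup>2) \<partial>lborel) \<le> ennreal (T n)" for n
  proof -
    have "(\<integral>\<^sup>+x. ennreal ((cmod (f n x - w x))\<^sup>2) \<partial>lborel)
        = (\<integral>\<^sup>+x. liminf (\<lambda>k. ennreal ((cmod (f (r k) x - f n x))\<^sup>2)) \<partial>lborel)"
    proof (rule nn_integral_cong_AE)
      show "AE x in lborel. ennreal ((cmod (f n x - w x))\<^sup>2) = liminf (\<lambda>k. ennreal ((cmod (f (r k) x - f n x))\<^sup>2))"
        using conv
      proof (rule eventually_mono)
        fix x assume "convergent (\<lambda>k. f (r k) x)"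
        then have "(\<lambda>k. f (r k) x) \<longlonglongrightarrow> w x" by (simp add: w_def convergent_LIMSEQ_iff)
        then have "(\<lambda>k. ennreal ((cmod (f (r k) x - f n x))\<^sup>2)) \<longlonglongrightarrow> ennreal ((cmod (w x - f n x))\<^sup>2)"
          by (intro tendsto_intros)
        then have "liminf (\<lambda>k. ennreal ((cmod (f (r k) x - f n x))\<^sup>2)) = ennreal ((cmod (w x - f n x))\<^sup>2)"
          by (rule lim_imp_Liminf[rotated]) simp
        then show "ennreal ((cmod (f n x - w x))\<^sup>2) = liminf (\<lambda>k. ennreal ((cmod (f (r k) x - f n x))\<^sup>2))"
          by (simp only: norm_minus_commute[of "f n x" "w x"])
      qed
    qed
    also have "\<dots> \<le> liminf (\<lambda>k. \<integral>\<^sup>+x. ennreal ((cmod (f (r k) x - f n x))\<^sup>2) \<partial>lborel)"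
      by (rule nn_integral_liminf) simp
    also have "\<dots> \<le> ennreal (T n)"
    proof (rule Liminf_le)
      show "\<forall>\<^sub>F k in sequentially. (\<integral>\<^sup>+x. ennreal ((cmod (f (r k) x - f n x))\<^sup>2) \<partial>lborel) \<le> ennreal (T n)"
        using eventually_ge_at_top[of n]
      proof (rule eventually_mono)
        fix k assume "n \<le> k"
        then have "n \<le> r k" using r_k[of k] by simp
        then have "L2_sq (\<lambda>x. f (r k) x - f n x) \<le> T n" by (rule cauchy)
        then show "(\<integral>\<^sup>+x. ennreal ((cmod (f (r k) x - f n x))\<^sup>2) \<partial>lborel) \<le> ennreal (T n)"
          unfolding L2_sq_def using L2_diff[OF f f]
          by (subst nn_integral_eq_integral) (auto simp: L2_iff ennreal_leI)
      qed
    qed simp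
    finally show ?thesis .
  qed
  have T0: "0 \<le> T n" for n using cauchy[of n n] L2_sq_nonneg[of "\<lambda>x. f n x - f n x"] by linarith
  have diff: "(\<lambda>x. f n x - w x) \<in> L2" for n
    unfolding L2_iff integrable_iff_bounded using bound[of n] by (auto intro: order_le_less_trans)
  have "(\<lambda>x. f 0 x - (f 0 x - w x)) \<in> L2" by (rule L2_diff[OF f diff])
  then have w: "w \<in> L2" by simp
  have "L2_sq (\<lambda>x. f n x - w x) \<le> T n" for n
  proof -
    have "ennreal (L2_sq (\<lambda>x. f n x - w x)) = (\<integral>\<^sup>+x. ennreal ((cmod (f n x - w x))\<^sup>2) \<partial>lborel)"
      unfolding L2_sq_def using diff[of n] by (subst nn_integral_eq_integral) (auto simp: L2_iff)
    with bound[of n] have "ennreal (L2_sq (\<lambda>x. f n x - w x)) \<le> ennreal (T n)" by (simp only:)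
    then show ?thesis by (simp only: ennreal_le_iff[OF T0])
  qed
  then have "(\<lambda>n. L2_sq (\<lambda>x. f n x - w x)) \<longlonglongrightarrow> 0"
    by (intro tendsto_sandwich[OF _ _ tendsto_const T]) auto
  then show ?thesis using w by blast
qed

section \<open>Orthonormal bases and functional calculus\<close>

text \<open>Completeness is required as triviality of the orthogonal complement, the form that is
  verified for Hermite functions; convergence of expansions follows in
  \<open>psum_tendsto\<close>.\<close>

locale L2_basis =
  fixes \<phi> :: "nat \<Rightarrow> 'a::euclidean_space \<Rightarrow> complex"
  assumes basis_L2: "\<phi> j \<in> L2"
    and orthonormal: "L2_inner (\<phi> i) (\<phi> j) = (if i = j then 1 else 0)"
    and complete: "u \<in> L2 \<Longrightarrow> (\<And>j. L2_inner u (\<phi> j) = 0) \<Longrightarrow> ae_eq u (\<lambda>x. 0)"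
begin

definition coef :: "('a \<Rightarrow> complex) \<Rightarrow> nat \<Rightarrow> complex" where
  "coef u j = L2_inner u (\<phi> j)"

definition psum :: "(nat \<Rightarrow> complex) \<Rightarrow> nat \<Rightarrow> 'a \<Rightarrow> complex" where
  "psum a n x = (\<Sum>j<n. a j * \<phi> j x)"

lemma psum_L2: "psum a n \<in> L2"
  unfolding psum_def[abs_def] by (intro L2_sum L2_cmult basis_L2)

lemma coef_lincomb:
  "u \<in> L2 \<Longrightarrow> v \<in> L2 \<Longrightarrow> coef (\<lambda>x. a * u x + b * v x) j = a * coef u j + b * coef v j"
  unfolding coef_def using L2_inner_add[OF L2_cmult L2_cmult basis_L2] by (simp add: L2_inner_cmult)

lemma coef_diff: "u \<in> L2 \<Longrightarrow> v \<in> L2 \<Longrightarrow> coef (\<lambda>x. u x - v x) j = coef u j - coef v j"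
  unfolding coef_def by (intro L2_inner_diff basis_L2)

lemma coef_psum: "coef (psum a n) j = (if j < n then a j else 0)"
proof -
  have "coef (psum a n) j = (\<Sum>k<n. a k * L2_inner (\<phi> k) (\<phi> j))"
    unfolding coef_def psum_def[abs_def]
    by (subst L2_inner_sum) (auto simp: L2_inner_cmult basis_L2)
  then show ?thesis by (simp add: orthonormal if_distrib cong: if_cong)
qed

lemma inner_psum: "v \<in> L2 \<Longrightarrow> L2_inner (psum a n) v = (\<Sum>j<n. a j * cnj (coef v j))"
  unfolding psum_def[abs_def] coef_def
  by (subst L2_inner_sum) (auto simp: L2_inner_cmult basis_L2 L2_inner_cnj[of "\<phi> _" v])

lemma L2_sq_psum: "L2_sq (psum a n) = (\<Sum>j<n. (cmod (a j))\<^sup>2)"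
proof -
  have "complex_of_real (L2_sq (psum a n)) = (\<Sum>j<n. a j * cnj (a j))"
    unfolding L2_inner_self[symmetric] inner_psum[OF psum_L2] by (simp add: coef_psum)
  also have "\<dots> = of_real (\<Sum>j<n. (cmod (a j))\<^sup>2)" by (simp only: of_real_sum complex_norm_square)
  finally show ?thesis by (simp only: of_real_eq_iff)
qed

lemma L2_sq_minus_psum:
  assumes "u \<in> L2"
  shows "L2_sq (\<lambda>x. u x - psum (coef u) n x) = L2_sq u - (\<Sum>j<n. (cmod (coef u j))\<^sup>2)"
proof -
  have "L2_inner u (psum (coef u) n) = of_real (\<Sum>j<n. (cmod (coef u j))\<^sup>2)"
    by (subst L2_inner_cnj) (simp add: inner_psum[OF assms] complex_norm_square[symmetric] del: of_real_power)
  then show ?thesis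
    using L2_sq_diff[OF assms psum_L2, of 1 "coef u" n] by (simp add: L2_sq_psum)
qed

lemma bessel: "u \<in> L2 \<Longrightarrow> summable (\<lambda>j. (cmod (coef u j))\<^sup>2)"
proof (rule summableI_nonneg_bounded[of _ "L2_sq u"])
  fix n assume "u \<in> L2"
  from L2_sq_minus_psum[OF this, of n] show "(\<Sum>j<n. (cmod (coef u j))\<^sup>2) \<le> L2_sq u"
    using L2_sq_nonneg[of "\<lambda>x. u x - psum (coef u) n x"] by linarith
qed simp

text \<open>Tails of the coefficient series bound the distances of partial sums, so
  \<open>L2_complete\<close> applies; the coefficients pass to the limit by continuity of the inner
  product.\<close>

lemma riesz_fischer:
  assumes a: "summable (\<lambda>j. (cmod (a j))\<^sup>2)"
  shows "\<exists>w\<in>L2. (\<forall>j. coef w j = a j) \<and> (\<lambda>n. L2_sq (\<lambda>x. psum a n x - w x)) \<longlonglongrightarrow> 0"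
proof -
  let ?b = "\<lambda>j. (cmod (a j))\<^sup>2"
  let ?T = "\<lambda>n. suminf ?b - (\<Sum>j<n. ?b j)"
  have "\<exists>w\<in>L2. (\<lambda>n. L2_sq (\<lambda>x. psum a n x - w x)) \<longlonglongrightarrow> 0"
  proof (rule L2_complete[of _ ?T])
    show "psum a n \<in> L2" for n by (rule psum_L2)
    have "?T \<longlonglongrightarrow> suminf ?b - suminf ?b" by (intro tendsto_intros summable_LIMSEQ a)
    then show "?T \<longlonglongrightarrow> 0" by simp
    fix n m :: nat assume "n \<le> m"
    have "(\<lambda>x. psum a m x - psum a n x) = psum (\<lambda>j. if n \<le> j then a j else 0) m"
    proof
      fix x
      have "psum a m x = psum a n x + (\<Sum>j\<in>{n..<m}. a j * \<phi> j x)"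
        unfolding psum_def using \<open>n \<le> m\<close> sum.atLeastLessThan_concat[of 0 n m "\<lambda>j. a j * \<phi> j x"]
        by (simp add: atLeast0LessThan)
      moreover have "psum (\<lambda>j. if n \<le> j then a j else 0) m x = (\<Sum>j\<in>{n..<m}. a j * \<phi> j x)"
        unfolding psum_def by (intro sum.mono_neutral_cong_right) auto
      ultimately show "psum a m x - psum a n x = psum (\<lambda>j. if n \<le> j then a j else 0) m x" by simp
    qed
    then have "L2_sq (\<lambda>x. psum a m x - psum a n x) = (\<Sum>j<m. (cmod (if n \<le> j then a j else 0))\<^sup>2)"
      by (simp add: L2_sq_psum)
    also have "\<dots> = (\<Sum>j\<in>{n..<m}. ?b j)"
      by (intro sum.mono_neutral_cong_right) auto
    also have "\<dots> = (\<Sum>j<m. ?b j) - (\<Sum>j<n. ?b j)"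
      using \<open>n \<le> m\<close> sum.atLeastLessThan_concat[of 0 n m ?b] by (simp add: atLeast0LessThan)
    also have "\<dots> \<le> ?T n" using sum_le_suminf[OF a, of "{..<m}"] by simp
    finally show "L2_sq (\<lambda>x. psum a m x - psum a n x) \<le> ?T n" .
  qed
  then obtain w where w: "w \<in> L2" and lim: "(\<lambda>n. L2_sq (\<lambda>x. psum a n x - w x)) \<longlonglongrightarrow> 0" by blast
  have "coef w j = a j" for j
  proof -
    have "(\<lambda>n. coef (psum a n) j) \<longlonglongrightarrow> coef w j"
      unfolding coef_def by (intro L2_inner_tendsto psum_L2 w basis_L2 lim)
    moreover have "(\<lambda>n. coef (psum a n) j) \<longlonglongrightarrow> a j"
      by (rule tendsto_eventually, rule eventually_mono[OF eventually_gt_at_top[of j]]) (simp add: coef_psum)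
    ultimately show ?thesis by (rule LIMSEQ_unique)
  qed
  with w lim show ?thesis by blast
qed

lemma ae_eq_iff_coef:
  assumes "u \<in> L2" "v \<in> L2"
  shows "ae_eq u v \<longleftrightarrow> (\<forall>j. coef u j = coef v j)"
proof
  assume "ae_eq u v"
  then show "\<forall>j. coef u j = coef v j" unfolding coef_def using assms basis_L2 by (auto intro: L2_inner_cong)
next
  assume "\<forall>j. coef u j = coef v j"
  then have "ae_eq (\<lambda>x. u x - v x) (\<lambda>x. 0)"
    using assms coef_diff[OF assms] by (intro complete) (auto simp: coef_def)
  then show "ae_eq u v" by (simp add: ae_eq_def)
qed

text \<open>The limit supplied by \<open>riesz_fischer\<close> has the coefficients of
  \<open>u\<close>, hence equals \<open>u\<close> almost everywhere by completeness.\<close>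

lemma psum_tendsto:
  assumes "u \<in> L2"
  shows "(\<lambda>n. L2_sq (\<lambda>x. psum (coef u) n x - u x)) \<longlonglongrightarrow> 0"
proof -
  obtain w where w: "w \<in> L2" "\<And>j. coef w j = coef u j" "(\<lambda>n. L2_sq (\<lambda>x. psum (coef u) n x - w x)) \<longlonglongrightarrow> 0"
    using riesz_fischer[OF bessel[OF assms]] by blast
  have "ae_eq u w" using ae_eq_iff_coef assms w by simp
  have "L2_sq (\<lambda>x. psum (coef u) n x - w x) = L2_sq (\<lambda>x. psum (coef u) n x - u x)" for n
  proof (rule L2_sq_cong)
    show "ae_eq (\<lambda>x. psum (coef u) n x - w x) (\<lambda>x. psum (coef u) n x - u x)"
      using \<open>ae_eq u w\<close> unfolding ae_eq_def by (rule eventually_mono) simp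
  qed (intro L2_diff psum_L2 w assms)+
  with w(3) show ?thesis by simp
qed

lemma parseval: "u \<in> L2 \<Longrightarrow> (\<lambda>j. (cmod (coef u j))\<^sup>2) sums L2_sq u"
proof -
  assume u: "u \<in> L2"
  have "L2_sq (\<lambda>x. psum (coef u) n x - u x) = L2_sq u - (\<Sum>j<n. (cmod (coef u j))\<^sup>2)" for n
    using L2_sq_minus_psum[OF u, of n] by (simp add: L2_sq_def norm_minus_commute)
  then have "(\<lambda>n. L2_sq u - (\<Sum>j<n. (cmod (coef u j))\<^sup>2)) \<longlonglongrightarrow> 0" using psum_tendsto[OF u] by simp
  then have "(\<lambda>n. L2_sq u - (L2_sq u - (\<Sum>j<n. (cmod (coef u j))\<^sup>2))) \<longlonglongrightarrow> L2_sq u - 0"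
    by (intro tendsto_intros)
  then show ?thesis by (simp add: sums_def)
qed

lemma parseval_inner: "u \<in> L2 \<Longrightarrow> v \<in> L2 \<Longrightarrow> (\<lambda>j. coef u j * cnj (coef v j)) sums L2_inner u v"
  using L2_inner_tendsto[OF psum_L2 _ _ psum_tendsto, of u v] by (simp add: sums_def inner_psum)

text \<open>A choice of representative: for bounded \<open>h\<close> one exists by
  \<open>riesz_fischer\<close>, and its coefficients determine it up to null sets.\<close>

definition calculus :: "(nat \<Rightarrow> real) \<Rightarrow> (real \<Rightarrow> complex) \<Rightarrow> ('a \<Rightarrow> complex) \<Rightarrow> ('a \<Rightarrow> complex)" where
  "calculus l h u = (SOME w. w \<in> L2 \<and> (\<forall>j. coef w j = h (l j) * coef u j))"

lemma calculus:
  assumes u: "u \<in> L2" and K: "\<forall>s. cmod (h s) \<le> K"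
  shows "calculus l h u \<in> L2" "coef (calculus l h u) j = h (l j) * coef u j"
proof -
  have "summable (\<lambda>j. (cmod (h (l j) * coef u j))\<^sup>2)"
  proof (rule summable_comparison_test'[OF summable_mult[OF bessel[OF u]], of 0 _ "K\<^sup>2"])
    fix j
    have "(cmod (h (l j)))\<^sup>2 \<le> K\<^sup>2" using K by (intro power_mono) auto
    then show "norm ((cmod (h (l j) * coef u j))\<^sup>2) \<le> K\<^sup>2 * (cmod (coef u j))\<^sup>2"
      by (simp add: norm_mult power_mult_distrib mult_right_mono)
  qed
  then have "\<exists>w. w \<in> L2 \<and> (\<forall>j. coef w j = h (l j) * coef u j)"
    using riesz_fischer[of "\<lambda>j. h (l j) * coef u j"] by blast
  then have "calculus l h u \<in> L2 \<and> (\<forall>j. coef (calculus l h u) j = h (l j) * coef u j)"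
    unfolding calculus_def by (rule someI_ex)
  then show "calculus l h u \<in> L2" "coef (calculus l h u) j = h (l j) * coef u j" by auto
qed

lemma bounded_borelE:
  assumes "h \<in> bounded_borel"
  obtains K where "\<forall>s. cmod (h s) \<le> K"
  using assms unfolding bounded_borel_def bounded_iff by auto

text \<open>By Parseval the squared distance is a series in \<open>j\<close>; Tannery's theorem
  passes to the limit termwise under the majorant \<open>B\<close>.\<close>

lemma L2_sq_tendsto_coef:
  assumes w: "\<And>n. w n \<in> L2" and v: "v \<in> L2"
    and lim: "\<And>j. (\<lambda>n. coef (w n) j) \<longlonglongrightarrow> coef v j"
    and bound: "\<And>n j. (cmod (coef (w n) j - coef v j))\<^sup>2 \<le> B j" and B: "summable B"
  shows "L2_lim w v"
proof -
  have "((\<lambda>n. \<Sum>j. (cmod (coef (w n) j - coef v j))\<^sup>2) \<longlongrightarrow> (\<Sum>j. 0)) sequentially"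
  proof (rule tannerys_theorem[of "\<lambda>j n. (cmod (coef (w n) j - coef v j))\<^sup>2" "\<lambda>_. 0" sequentially B, THEN conjunct2, THEN conjunct2])
    fix j
    have "(\<lambda>n. (cmod (coef (w n) j - coef v j))\<^sup>2) \<longlonglongrightarrow> (cmod (coef v j - coef v j))\<^sup>2"
      by (intro tendsto_intros lim)
    then show "(\<lambda>n. (cmod (coef (w n) j - coef v j))\<^sup>2) \<longlonglongrightarrow> 0" by simp
    show "eventually (\<lambda>(k, n). norm ((cmod (coef (w n) k - coef v k))\<^sup>2) \<le> B k) (at_top \<times>\<^sub>F sequentially)"
      using bound by (intro always_eventually) auto
  qed (use B in auto)
  moreover have "L2_sq (\<lambda>x. w n x - v x) = (\<Sum>j. (cmod (coef (w n) j - coef v j))\<^sup>2)" for n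
    using sums_unique[OF parseval[OF L2_diff[OF w v]]] by (simp add: coef_diff w v)
  ultimately show ?thesis using L2_lim_iff[OF w v] by simp
qed

text \<open>Supplies the witness for the choice in \<open>functional_calculus\<close>. Every clause
  is checked on coefficients, where the calculus is multiplication by a sequence.\<close>

theorem is_functional_calculus_calculus:
  fixes A :: "(('a \<Rightarrow> complex) \<times> ('a \<Rightarrow> complex)) set"
  assumes A: "\<And>u w. (u, w) \<in> A \<Longrightarrow> u \<in> L2 \<and> w \<in> L2 \<and> (\<forall>j. coef w j = of_real (l j) * coef u j)"
  shows "is_functional_calculus A (calculus l)"
  unfolding is_functional_calculus_def
proof (intro conjI ballI allI impI)
  fix h and u :: "'a \<Rightarrow> complex" assume h: "h \<in> bounded_borel" and u: "u \<in> L2"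
  obtain K where K: "\<forall>s. cmod (h s) \<le> K" using bounded_borelE[OF h] by blast
  show "calculus l h u \<in> L2" by (rule calculus[OF u K])
  define S where "S = (SUP s. cmod (h s))"
  have S: "cmod (h s) \<le> S" for s unfolding S_def
    by (rule cSUP_upper) (use K in \<open>auto intro!: bdd_aboveI2\<close>)
  have S0: "0 \<le> S" using S[of 0] norm_ge_zero[of "h 0"] by linarith
  have "L2_sq (calculus l h u) \<le> S\<^sup>2 * L2_sq u"
  proof (rule sums_le[OF _ parseval[OF calculus(1)[OF u K]] sums_mult[OF parseval[OF u]]])
    fix j
    have "(cmod (h (l j)))\<^sup>2 \<le> S\<^sup>2" using S by (intro power_mono) auto
    then show "(cmod (coef (calculus l h u) j))\<^sup>2 \<le> S\<^sup>2 * (cmod (coef u j))\<^sup>2"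
      by (simp add: calculus(2)[OF u K] norm_mult power_mult_distrib mult_right_mono)
  qed
  then have "sqrt (L2_sq (calculus l h u)) \<le> sqrt (S\<^sup>2 * L2_sq u)" by simp
  also have "\<dots> = S * sqrt (L2_sq u)" using S0 by (simp add: real_sqrt_mult)
  finally show "L2_norm (calculus l h u) \<le> ennreal (SUP s. cmod (h s)) * L2_norm u"
    unfolding L2_norm_eq[OF calculus(1)[OF u K]] L2_norm_eq[OF u] S_def[symmetric]
    using S0 by (simp add: ennreal_mult[symmetric] ennreal_leI)
next
  fix h and u v :: "'a \<Rightarrow> complex" and a b assume h: "h \<in> bounded_borel" and u: "u \<in> L2" and v: "v \<in> L2"
  obtain K where K: "\<forall>s. cmod (h s) \<le> K" using bounded_borelE[OF h] by blast
  have uv: "(\<lambda>x. a * u x + b * v x) \<in> L2" using u v by auto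
  have r: "(\<lambda>x. a * calculus l h u x + b * calculus l h v x) \<in> L2"
    by (intro L2_add L2_cmult calculus(1)[OF u K] calculus(1)[OF v K])
  show "ae_eq (calculus l h (\<lambda>x. a * u x + b * v x)) (\<lambda>x. a * calculus l h u x + b * calculus l h v x)"
    by (subst ae_eq_iff_coef[OF calculus(1)[OF uv K] r])
      (simp add: calculus[OF uv K] calculus[OF u K] calculus[OF v K] coef_lincomb u v algebra_simps)
next
  fix u :: "'a \<Rightarrow> complex" assume u: "u \<in> L2"
  have K: "\<forall>s::real. cmod ((\<lambda>s. 1) s) \<le> 1" by simp
  show "ae_eq (calculus l (\<lambda>s. 1) u) u"
    by (subst ae_eq_iff_coef[OF calculus(1)[OF u K] u]) (simp add: calculus(2)[OF u K])
next
  fix g h and u :: "'a \<Rightarrow> complex" and a b assume g: "g \<in> bounded_borel" and h: "h \<in> bounded_borel" and u: "u \<in> L2"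
  obtain K where K: "\<forall>s. cmod (h s) \<le> K" using bounded_borelE[OF h] by blast
  obtain K' where K': "\<forall>s. cmod (g s) \<le> K'" using bounded_borelE[OF g] by blast
  have L: "\<forall>s. cmod (a * g s + b * h s) \<le> cmod a * K' + cmod b * K"
    using K K' by (intro allI order_trans[OF norm_triangle_ineq] add_mono) (auto simp: norm_mult intro!: mult_left_mono)
  have r: "(\<lambda>x. a * calculus l g u x + b * calculus l h u x) \<in> L2"
    by (intro L2_add L2_cmult calculus(1)[OF u K] calculus(1)[OF u K'])
  show "ae_eq (calculus l (\<lambda>s. a * g s + b * h s) u) (\<lambda>x. a * calculus l g u x + b * calculus l h u x)"
    by (subst ae_eq_iff_coef[OF calculus(1)[OF u L] r])
      (simp add: calculus(2)[OF u L] coef_lincomb calculus[OF u K] calculus[OF u K'] algebra_simps)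
next
  fix g h and u :: "'a \<Rightarrow> complex" assume g: "g \<in> bounded_borel" and h: "h \<in> bounded_borel" and u: "u \<in> L2"
  obtain K where K: "\<forall>s. cmod (h s) \<le> K" using bounded_borelE[OF h] by blast
  obtain K' where K': "\<forall>s. cmod (g s) \<le> K'" using bounded_borelE[OF g] by blast
  have L: "\<forall>s. cmod (g s * h s) \<le> K' * K"
  proof
    fix s
    have "0 \<le> K'" using K' norm_ge_zero[of "g s"] order_trans by blast
    then show "cmod (g s * h s) \<le> K' * K" using K K' by (simp add: norm_mult mult_mono)
  qed
  note hu = calculus(1)[OF u K, of l]
  show "ae_eq (calculus l (\<lambda>s. g s * h s) u) (calculus l g (calculus l h u))"
    by (subst ae_eq_iff_coef[OF calculus(1)[OF u L] calculus(1)[OF hu K']])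
      (simp add: calculus(2)[OF u L] calculus(2)[OF u K] calculus(2)[OF hu K'])
next
  fix h and u v :: "'a \<Rightarrow> complex" assume h: "h \<in> bounded_borel" and u: "u \<in> L2" and v: "v \<in> L2"
  obtain K where K: "\<forall>s. cmod (h s) \<le> K" using bounded_borelE[OF h] by blast
  then have K': "\<forall>s. cmod (cnj (h s)) \<le> K" by simp
  show "L2_inner (calculus l h u) v = L2_inner u (calculus l (\<lambda>s. cnj (h s)) v)"
    using parseval_inner[OF calculus(1)[OF u K] v] parseval_inner[OF u calculus(1)[OF v K']]
    by (simp add: calculus(2)[OF u K] calculus(2)[OF v K'] sums_iff mult_ac)
next
  fix h p assume h: "(\<forall>n. h n \<in> bounded_borel) \<and> (\<forall>s. (\<lambda>n. h n s) \<longlonglongrightarrow> complex_of_real s) \<and> (\<forall>n s. cmod (h n s) \<le> \<bar>s\<bar>)"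
    and p: "p \<in> A"
  obtain u w where uw: "p = (u, w)" by (cases p)
  with p A have u: "u \<in> L2" and w: "w \<in> L2" and cw: "\<And>j. coef w j = of_real (l j) * coef u j" by auto
  have "\<exists>K. \<forall>s. cmod (h n s) \<le> K" for n using h bounded_borelE[of "h n"] by metis
  then obtain K where K: "\<And>n. \<forall>s. cmod (h n s) \<le> K n" by metis
  have "L2_lim (\<lambda>n. calculus l (h n) u) w"
  proof (rule L2_sq_tendsto_coef[OF calculus(1)[OF u K] w])
    fix j
    show "(\<lambda>n. coef (calculus l (h n) u) j) \<longlonglongrightarrow> coef w j"
      unfolding calculus(2)[OF u K] cw using h by (intro tendsto_intros) auto
    fix n
    \<comment> \<open>The bound of \<open>h n s\<close> by the modulus of \<open>s\<close> becomes a
      bound by the coefficients of \<open>w\<close> itself, which are square summable.\<close>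
    have "cmod (h n (l j) * coef u j - of_real (l j) * coef u j) \<le> \<bar>l j\<bar> * cmod (coef u j) + \<bar>l j\<bar> * cmod (coef u j)"
      using h by (intro order_trans[OF norm_triangle_ineq4] add_mono) (auto simp: norm_mult intro!: mult_right_mono)
    then have "(cmod (h n (l j) * coef u j - of_real (l j) * coef u j))\<^sup>2 \<le> (2 * cmod (coef w j))\<^sup>2"
      by (intro power_mono) (auto simp: cw norm_mult)
    then show "(cmod (coef (calculus l (h n) u) j - coef w j))\<^sup>2 \<le> 4 * (cmod (coef w j))\<^sup>2"
      unfolding calculus(2)[OF u K] cw by (simp add: power_mult_distrib)
  next
    show "summable (\<lambda>j. 4 * (cmod (coef w j))\<^sup>2)" by (intro summable_mult bessel w)
  qed
  then show "case p of (u, w) \<Rightarrow> L2_lim (\<lambda>n. calculus l (h n) u) w" using uw by simp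
next
  fix h g and u :: "'a \<Rightarrow> complex"
  assume h: "(\<forall>n. h n \<in> bounded_borel) \<and> (\<forall>s. (\<lambda>n. h n s) \<longlonglongrightarrow> g s) \<and> (\<exists>K. \<forall>n s. cmod (h n s) \<le> K)"
    and u: "u \<in> L2"
  then obtain K where K: "\<And>n. \<forall>s. cmod (h n s) \<le> K" by blast
  have Kg: "\<forall>s. cmod (g s) \<le> K"
  proof
    fix s
    have "(\<lambda>n. cmod (h n s)) \<longlonglongrightarrow> cmod (g s)" using h by (intro tendsto_norm) auto
    then show "cmod (g s) \<le> K" by (rule Lim_bounded[of _ _ 0]) (use K in auto)
  qed
  show "L2_lim (\<lambda>n. calculus l (h n) u) (calculus l g u)"
  proof (rule L2_sq_tendsto_coef[OF calculus(1)[OF u K] calculus(1)[OF u Kg]])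
    fix j
    show "(\<lambda>n. coef (calculus l (h n) u) j) \<longlonglongrightarrow> coef (calculus l g u) j"
      unfolding calculus(2)[OF u K] calculus(2)[OF u Kg] using h by (intro tendsto_intros) auto
    fix n
    have "cmod (h n (l j) * coef u j - g (l j) * coef u j) \<le> K * cmod (coef u j) + K * cmod (coef u j)"
      by (intro order_trans[OF norm_triangle_ineq4] add_mono) (use K Kg in \<open>auto simp: norm_mult intro!: mult_right_mono\<close>)
    then have "(cmod (h n (l j) * coef u j - g (l j) * coef u j))\<^sup>2 \<le> (2 * K * cmod (coef u j))\<^sup>2"
      by (intro power_mono) auto
    then show "(cmod (coef (calculus l (h n) u) j - coef (calculus l g u) j))\<^sup>2 \<le> (2 * K)\<^sup>2 * (cmod (coef u j))\<^sup>2"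
      unfolding calculus(2)[OF u K] calculus(2)[OF u Kg] by (simp only: power_mult_distrib)
  next
    show "summable (\<lambda>j. (2 * K)\<^sup>2 * (cmod (coef u j))\<^sup>2)" by (intro summable_mult bessel u)
  qed
qed

end

section \<open>Eigenvectors under a functional calculus\<close>

lemma bounded_borelI:
  assumes "h \<in> borel_measurable borel" "\<And>s. cmod (h s) \<le> K"
  shows "h \<in> bounded_borel"
  unfolding bounded_borel_def bounded_iff using assms by auto

text \<open>The calculus picked by \<open>functional_calculus\<close> need not be the diagonal one
  just built, so its action is derived from the defining clauses for arbitrary
  \<open>\<Phi>\<close>.\<close>

locale abstract_calculus =
  fixes A :: "(('a::euclidean_space \<Rightarrow> complex) \<times> ('a \<Rightarrow> complex)) set"
    and \<Phi> :: "(real \<Rightarrow> complex) \<Rightarrow> ('a \<Rightarrow> complex) \<Rightarrow> ('a \<Rightarrow> complex)"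
  assumes calc: "is_functional_calculus A \<Phi>"
begin

lemma
  assumes h: "h \<in> bounded_borel" and u: "u \<in> L2"
  shows calc_L2: "\<Phi> h u \<in> L2"
    and calc_linear: "v \<in> L2 \<Longrightarrow> ae_eq (\<Phi> h (\<lambda>x. a * u x + b * v x)) (\<lambda>x. a * \<Phi> h u x + b * \<Phi> h v x)"
    and calc_norm: "L2_norm (\<Phi> h u) \<le> ennreal (SUP s. cmod (h s)) * L2_norm u"
    and calc_one: "ae_eq (\<Phi> (\<lambda>s. 1) u) u"
    and calc_add: "g \<in> bounded_borel \<Longrightarrow> ae_eq (\<Phi> (\<lambda>s. a * g s + b * h s) u) (\<lambda>x. a * \<Phi> g u x + b * \<Phi> h u x)"
    and calc_mult: "g \<in> bounded_borel \<Longrightarrow> ae_eq (\<Phi> (\<lambda>s. g s * h s) u) (\<Phi> g (\<Phi> h u))"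
    and calc_adjoint: "v \<in> L2 \<Longrightarrow> L2_inner (\<Phi> h u) v = L2_inner u (\<Phi> (\<lambda>s. cnj (h s)) v)"
proof -
  note D = calc[unfolded is_functional_calculus_def]
  show "\<Phi> h u \<in> L2"
    by (rule D[THEN conjunct1, rule_format, OF h u])
  show "ae_eq (\<Phi> h (\<lambda>x. a * u x + b * v x)) (\<lambda>x. a * \<Phi> h u x + b * \<Phi> h v x)" if "v \<in> L2"
    by (rule D[THEN conjunct2, THEN conjunct1, rule_format, OF h u that])
  show "L2_norm (\<Phi> h u) \<le> ennreal (SUP s. cmod (h s)) * L2_norm u"
    by (rule D[THEN conjunct2, THEN conjunct2, THEN conjunct1, rule_format, OF h u])
  show "ae_eq (\<Phi> (\<lambda>s. 1) u) u"
    by (rule D[THEN conjunct2, THEN conjunct2, THEN conjunct2, THEN conjunct1, rule_format, OF u])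
  show "ae_eq (\<Phi> (\<lambda>s. a * g s + b * h s) u) (\<lambda>x. a * \<Phi> g u x + b * \<Phi> h u x)" if "g \<in> bounded_borel"
    by (rule D[THEN conjunct2, THEN conjunct2, THEN conjunct2, THEN conjunct2, THEN conjunct1, rule_format, OF that h u])
  show "ae_eq (\<Phi> (\<lambda>s. g s * h s) u) (\<Phi> g (\<Phi> h u))" if "g \<in> bounded_borel"
    by (rule D[THEN conjunct2, THEN conjunct2, THEN conjunct2, THEN conjunct2, THEN conjunct2, THEN conjunct1, rule_format, OF that h u])
  show "L2_inner (\<Phi> h u) v = L2_inner u (\<Phi> (\<lambda>s. cnj (h s)) v)" if "v \<in> L2"
    by (rule D[THEN conjunct2, THEN conjunct2, THEN conjunct2, THEN conjunct2, THEN conjunct2, THEN conjunct2, THEN conjunct1, rule_format, OF h u that])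
qed

lemma calc_id:
  assumes "\<And>n. h n \<in> bounded_borel" "\<And>s. (\<lambda>n. h n s) \<longlonglongrightarrow> complex_of_real s" "\<And>n s. cmod (h n s) \<le> \<bar>s\<bar>" "(u, w) \<in> A"
  shows "L2_lim (\<lambda>n. \<Phi> (h n) u) w"
  using calc assms unfolding is_functional_calculus_def by blast

lemma calc_limit:
  assumes "\<And>n. h n \<in> bounded_borel" "\<And>s. (\<lambda>n. h n s) \<longlonglongrightarrow> g s" "\<And>n s. cmod (h n s) \<le> K" "u \<in> L2"
  shows "L2_lim (\<lambda>n. \<Phi> (h n) u) (\<Phi> g u)"
proof -
  have "(\<forall>n. h n \<in> bounded_borel) \<and> (\<forall>s. (\<lambda>n. h n s) \<longlonglongrightarrow> g s) \<and> (\<exists>K. \<forall>n s. cmod (h n s) \<le> K)"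
    using assms by blast
  then show ?thesis using calc \<open>u \<in> L2\<close> unfolding is_functional_calculus_def by blast
qed

lemma L2_norm_0_iff: "u \<in> L2 \<Longrightarrow> L2_norm u = 0 \<longleftrightarrow> ae_eq u (\<lambda>x. 0)"
  using L2_sq_nonneg[of u] by (simp add: L2_norm_eq L2_sq_eq_0_iff[symmetric])

lemma calc_null:
  assumes h: "h \<in> bounded_borel" and u: "u \<in> L2" and z: "ae_eq u (\<lambda>x. 0)"
  shows "ae_eq (\<Phi> h u) (\<lambda>x. 0)"
  using calc_norm[OF h u] L2_norm_0_iff[OF u] z L2_norm_0_iff[OF calc_L2[OF h u]] by simp

lemma calc_continuous:
  assumes h: "h \<in> bounded_borel" and w: "\<And>n. w n \<in> L2" and u: "u \<in> L2" and lim: "L2_lim w u"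
  shows "L2_lim (\<lambda>n. \<Phi> h (w n)) (\<Phi> h u)"
proof -
  let ?S = "ennreal (SUP s. cmod (h s))"
  have L: "L2_norm (\<lambda>x. \<Phi> h (w n) x - \<Phi> h u x) \<le> ?S * L2_norm (\<lambda>x. w n x - u x)" for n
  proof -
    have "ae_eq (\<Phi> h (\<lambda>x. 1 * w n x + (-1) * u x)) (\<lambda>x. 1 * \<Phi> h (w n) x + (-1) * \<Phi> h u x)"
      by (rule calc_linear[OF h w u])
    then have "L2_norm (\<lambda>x. \<Phi> h (w n) x - \<Phi> h u x) = L2_norm (\<Phi> h (\<lambda>x. w n x - u x))"
      using L2_norm_cong by fastforce
    then show ?thesis using calc_norm[OF h L2_diff[OF w u]] by simp
  qed
  have "(\<lambda>n. ?S * L2_norm (\<lambda>x. w n x - u x)) \<longlonglongrightarrow> ?S * 0"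
    by (rule ennreal_tendsto_cmult[OF _ lim[unfolded L2_lim_def]]) simp
  then have T: "(\<lambda>n. ?S * L2_norm (\<lambda>x. w n x - u x)) \<longlonglongrightarrow> 0" by simp
  show ?thesis unfolding L2_lim_def
    by (rule tendsto_sandwich[OF _ _ tendsto_const T]) (simp_all add: L)
qed

lemma L2_lim_eventually:
  assumes "\<And>n. n \<ge> n0 \<Longrightarrow> ae_eq (w n) u" "\<And>n. w n \<in> L2" "u \<in> L2"
  shows "L2_lim w u"
  unfolding L2_lim_def
proof (rule tendsto_eventually, rule eventually_mono[OF eventually_ge_at_top[of n0]])
  fix n assume "n0 \<le> n"
  then have "ae_eq (\<lambda>x. w n x - u x) (\<lambda>x. 0)" using assms(1)[of n] by (simp add: ae_eq_def)
  then show "L2_norm (\<lambda>x. w n x - u x) = 0" using L2_norm_0_iff[OF L2_diff[OF assms(2,3)]] by blast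
qed

text \<open>Away from \<open>l\<close> the function \<open>1 / (s - l)\<close> is bounded, so the part of the spectrum away from
  \<open>l\<close> does not see an eigenvector for \<open>l\<close>.\<close>

lemma eigenvector_off_spectrum:
  assumes \<phi>: "\<phi> \<in> L2" and A: "(\<phi>, \<lambda>x. of_real l * \<phi> x) \<in> A"
  shows "ae_eq (\<Phi> (\<lambda>s. if s = l then 0 else 1) \<phi>) (\<lambda>x. 0)"
proof -
  \<comment> \<open>\<open>d n\<close> cuts out a neighbourhood of \<open>l\<close> and the far
    spectrum, \<open>f n\<close> is the resolvent \<open>1/(s - l)\<close> on what is left, and
    \<open>m k\<close> is the truncated identity through which \<open>A\<close> enters by
    \<open>calc_id\<close>.\<close>
  define d where "d n s = (if 1 / real (Suc n) < \<bar>s - l\<bar> \<and> \<bar>s\<bar> \<le> real n then 1 else 0 :: complex)" for n s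
  define f where "f n s = d n s / of_real (s - l)" for n s
  define m where "m k s = (if \<bar>s\<bar> \<le> real k then of_real s else 0 :: complex)" for k s
  have [measurable]: "d n \<in> borel_measurable borel" "f n \<in> borel_measurable borel" "m n \<in> borel_measurable borel" for n
    unfolding d_def[abs_def] f_def[abs_def] m_def[abs_def] by measurable
  have d: "d n \<in> bounded_borel" for n by (rule bounded_borelI[where K = 1]) (auto simp: d_def)
  have f_le: "cmod (f n s) \<le> real (Suc n)" for n s
  proof (cases "1 / real (Suc n) < \<bar>s - l\<bar>")
    case True
    then have "0 < \<bar>s - l\<bar>" by (rule less_trans[rotated]) simp
    moreover have "1 < \<bar>s - l\<bar> * real (Suc n)" using True by (subst (asm) pos_divide_less_eq) auto
    ultimately have "1 / \<bar>s - l\<bar> \<le> real (Suc n)" by (simp add: pos_divide_le_eq mult.commute less_imp_le)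
    then show ?thesis by (auto simp: f_def d_def norm_divide simp flip: of_real_diff)
  qed (simp add: f_def d_def)
  then have f: "f n \<in> bounded_borel" for n by (intro bounded_borelI[where K = "real (Suc n)"]) auto
  have m: "m k \<in> bounded_borel" for k by (rule bounded_borelI[where K = "real k"]) (auto simp: m_def)
  have l\<phi>: "(\<lambda>x. of_real l * \<phi> x) \<in> L2" using \<phi> by auto
  have m_lim: "L2_lim (\<lambda>k. \<Phi> (m k) \<phi>) (\<lambda>x. of_real l * \<phi> x)"
  proof (rule calc_id[OF m _ _ A])
    fix s :: real
    obtain k where k: "\<bar>s\<bar> \<le> real k" using real_arch_simple by blast
    show "(\<lambda>n. m n s) \<longlonglongrightarrow> complex_of_real s"
      by (rule tendsto_eventually, rule eventually_mono[OF eventually_ge_at_top[of k]]) (use k in \<open>auto simp: m_def\<close>)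
  qed (auto simp: m_def)
  \<comment> \<open>Everywhere \<open>d = f * s - l * f\<close>. Truncation at \<open>k >= n\<close>
    is invisible to \<open>f n\<close>, so \<open>\<Phi>\<close> of \<open>f * s\<close> applied to
    \<open>\<phi>\<close> is the limit of \<open>\<Phi> f (\<Phi> (m k) \<phi>)\<close>, that is
    \<open>l * \<Phi> f \<phi>\<close>, and the two parts cancel.\<close>
  have zero: "ae_eq (\<Phi> (d n) \<phi>) (\<lambda>x. 0)" for n
  proof -
    have fs: "(\<lambda>s. f n s * of_real s) = (\<lambda>s. f n s * m k s)" if "n \<le> k" for k
      using that by (auto simp: fun_eq_iff f_def d_def m_def)
    have fs_bb: "(\<lambda>s. f n s * of_real s) \<in> bounded_borel"
    proof (rule bounded_borelI[where K = "real (Suc n) * real n"])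
      show "cmod (f n s * of_real s) \<le> real (Suc n) * real n" for s
      proof -
        have "cmod (f n s) * cmod (m n s) \<le> real (Suc n) * real n"
          by (intro mult_mono f_le) (auto simp: m_def)
        moreover have "f n s * of_real s = f n s * m n s" using fun_cong[OF fs[of n], of s] by simp
        ultimately show ?thesis by (simp only: norm_mult)
      qed
    qed measurable
    have "ae_eq (\<Phi> (\<lambda>s. f n s * of_real s) \<phi>) (\<Phi> (f n) (\<lambda>x. of_real l * \<phi> x))"
    proof (rule L2_lim_unique)
      show "\<Phi> (f n) (\<Phi> (m k) \<phi>) \<in> L2" for k by (intro calc_L2 f m \<phi>)
      then show "L2_lim (\<lambda>k. \<Phi> (f n) (\<Phi> (m k) \<phi>)) (\<Phi> (\<lambda>s. f n s * of_real s) \<phi>)"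
      proof (rule L2_lim_eventually[of n, rotated])
        fix k assume "n \<le> k"
        show "ae_eq (\<Phi> (f n) (\<Phi> (m k) \<phi>)) (\<Phi> (\<lambda>s. f n s * of_real s) \<phi>)"
          unfolding fs[OF \<open>n \<le> k\<close>] by (rule ae_eq_sym[OF calc_mult[OF m \<phi> f]])
      qed (rule calc_L2[OF fs_bb \<phi>])
      show "L2_lim (\<lambda>k. \<Phi> (f n) (\<Phi> (m k) \<phi>)) (\<Phi> (f n) (\<lambda>x. of_real l * \<phi> x))"
        by (intro calc_continuous f calc_L2 m \<phi> l\<phi> m_lim)
    qed (intro calc_L2 f fs_bb \<phi> l\<phi>)+
    moreover have "ae_eq (\<Phi> (f n) (\<lambda>x. of_real l * \<phi> x + 0 * \<phi> x)) (\<lambda>x. of_real l * \<Phi> (f n) \<phi> x + 0 * \<Phi> (f n) \<phi> x)"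
      by (rule calc_linear[OF f \<phi> \<phi>])
    ultimately have 1: "ae_eq (\<Phi> (\<lambda>s. f n s * of_real s) \<phi>) (\<lambda>x. of_real l * \<Phi> (f n) \<phi> x)"
      using ae_eq_trans by (simp only: mult_zero_left add_0_right)
    have "(\<lambda>s. 1 * (f n s * of_real s) + (- of_real l) * f n s) = d n"
    proof
      fix s
      show "1 * (f n s * of_real s) + (- of_real l) * f n s = d n s"
      proof (cases "s = l")
        case False
        have "1 * (f n s * of_real s) + (- of_real l) * f n s = f n s * of_real (s - l)"
          by (simp add: algebra_simps)
        then show ?thesis using False by (simp add: f_def del: of_real_diff)
      qed (simp add: d_def f_def)
    qed
    then have "ae_eq (\<Phi> (d n) \<phi>) (\<lambda>x. 1 * \<Phi> (\<lambda>s. f n s * of_real s) \<phi> x + (- of_real l) * \<Phi> (f n) \<phi> x)"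
      using calc_add[OF f \<phi> fs_bb, of 1 "- of_real l" n] by simp
    with 1 show ?thesis unfolding ae_eq_def by (auto elim: eventually_elim2)
  qed
  have lim_bb: "(\<lambda>s. if s = l then 0 else 1 :: complex) \<in> bounded_borel"
    by (rule bounded_borelI[where K = 1]) auto
  have "L2_lim (\<lambda>n. \<Phi> (d n) \<phi>) (\<Phi> (\<lambda>s. if s = l then 0 else 1) \<phi>)"
  proof (rule calc_limit[OF d _ _ \<phi>])
    show "cmod (d n s) \<le> 1" for n s by (simp add: d_def)
    fix s :: real
    show "(\<lambda>n. d n s) \<longlonglongrightarrow> (if s = l then 0 else 1)"
    proof (cases "s = l")
      case False
      obtain k where k: "\<bar>s\<bar> \<le> real k" using real_arch_simple by blast
      have "(\<lambda>n. 1 / real (Suc n)) \<longlonglongrightarrow> 0" by (rule lim_1_over_n[THEN LIMSEQ_Suc])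
      then have "eventually (\<lambda>n. 1 / real (Suc n) < \<bar>s - l\<bar>) sequentially"
        using False by (intro order_tendstoD) auto
      then have "eventually (\<lambda>n. d n s = 1) sequentially"
        using eventually_ge_at_top[of k] by eventually_elim (use k in \<open>auto simp: d_def\<close>)
      then show ?thesis using False by (simp add: tendsto_eventually)
    qed (simp add: d_def)
  qed
  moreover have "L2_lim (\<lambda>n. \<Phi> (d n) \<phi>) (\<lambda>x. 0)"
    by (rule L2_lim_eventually[of 0]) (auto intro: zero calc_L2[OF d \<phi>])
  ultimately show ?thesis
    using calc_L2[OF lim_bb \<phi>] by (intro L2_lim_unique[of "\<lambda>n. \<Phi> (d n) \<phi>"]) (auto intro: calc_L2[OF d \<phi>])
qed

text \<open>\<open>g\<close> splits into the constant \<open>g l\<close> and \<open>g - g l\<close>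
  times the indicator of \<open>s \<noteq> l\<close>; the second part annihilates the eigenvector by
  \<open>eigenvector_off_spectrum\<close>.\<close>

lemma calc_eigenvector:
  assumes \<phi>: "\<phi> \<in> L2" and A: "(\<phi>, \<lambda>x. of_real l * \<phi> x) \<in> A" and g: "g \<in> bounded_borel"
  shows "ae_eq (\<Phi> g \<phi>) (\<lambda>x. g l * \<phi> x)"
proof -
  obtain K where K: "\<And>s. cmod (g s) \<le> K" using g unfolding bounded_borel_def bounded_iff by auto
  have [measurable]: "g \<in> borel_measurable borel" using g by (simp add: bounded_borel_def)
  let ?d = "\<lambda>s. if s = l then 0 else 1 :: complex"
  let ?r = "\<lambda>s. g s - g l"
  have one: "(\<lambda>s. 1) \<in> bounded_borel" by (rule bounded_borelI[where K = 1]) auto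
  have d: "?d \<in> bounded_borel" by (rule bounded_borelI[where K = 1]) auto
  have r_le: "cmod (?r s) \<le> K + K" for s
    by (rule order_trans[OF norm_triangle_ineq4 add_mono[OF K K]])
  have r: "?r \<in> bounded_borel" by (rule bounded_borelI[OF _ r_le]) measurable
  have rd: "(\<lambda>s. ?r s * ?d s) \<in> bounded_borel"
  proof (rule bounded_borelI)
    show "cmod (?r s * ?d s) \<le> K + K" for s
      using r_le[of s] order_trans[OF norm_ge_zero r_le[of s]] by simp
  qed measurable
  have "ae_eq (\<Phi> (\<lambda>s. ?r s * ?d s) \<phi>) (\<lambda>x. 0)"
    by (rule ae_eq_trans[OF calc_mult[OF d \<phi> r] calc_null[OF r calc_L2[OF d \<phi>] eigenvector_off_spectrum[OF \<phi> A]]])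
  moreover have "ae_eq (\<Phi> (\<lambda>s. 1) \<phi>) \<phi>" by (rule calc_one[OF one \<phi>])
  moreover have "(\<lambda>s. g l * 1 + 1 * (?r s * ?d s)) = g" by auto
  then have "ae_eq (\<Phi> g \<phi>) (\<lambda>x. g l * \<Phi> (\<lambda>s. 1) \<phi> x + 1 * \<Phi> (\<lambda>s. ?r s * ?d s) \<phi> x)"
    using calc_add[OF rd \<phi> one, of "g l" 1] by simp
  ultimately show ?thesis unfolding ae_eq_def by eventually_elim simp
qed

end

text \<open>Adjointness moves the calculus onto the basis vector, where it is a scalar; the
  conjugation of \<open>h\<close> is undone by that in the second slot of the inner product.\<close>

lemma (in L2_basis) calculus_coef:
  assumes \<Phi>: "is_functional_calculus A \<Phi>" and A: "\<And>j. (\<phi> j, \<lambda>x. of_real (l j) * \<phi> j x) \<in> A"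
    and h: "h \<in> bounded_borel" and u: "u \<in> L2"
  shows "coef (\<Phi> h u) j = h (l j) * coef u j"
proof -
  interpret abstract_calculus A \<Phi> by unfold_locales (rule \<Phi>)
  have h': "(\<lambda>s. cnj (h s)) \<in> bounded_borel"
  proof -
    have [measurable]: "h \<in> borel_measurable borel" "cnj \<in> borel_measurable borel"
      using h by (auto simp: bounded_borel_def intro!: borel_measurable_continuous_onI continuous_intros)
    obtain K where "\<forall>s. cmod (h s) \<le> K" using bounded_borelE[OF h] by blast
    then show ?thesis by (intro bounded_borelI[where K = K]) auto
  qed
  have "L2_inner (\<Phi> h u) (\<phi> j) = L2_inner u (\<Phi> (\<lambda>s. cnj (h s)) (\<phi> j))"
    by (rule calc_adjoint[OF h u basis_L2])
  also have "\<dots> = cnj (L2_inner (\<Phi> (\<lambda>s. cnj (h s)) (\<phi> j)) u)" by (rule L2_inner_cnj)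
  also have "L2_inner (\<Phi> (\<lambda>s. cnj (h s)) (\<phi> j)) u = L2_inner (\<lambda>x. cnj (h (l j)) * \<phi> j x) u"
    by (rule L2_inner_cong[OF calc_eigenvector[OF basis_L2 A h'] calc_L2[OF h' basis_L2] L2_cmult[OF basis_L2] u])
  finally show ?thesis
    by (simp add: coef_def L2_inner_cmult L2_inner_cnj[of u])
qed

section \<open>Completeness of the Hermite functions\<close>

lemma gauss_poly_L2: "f \<in> gauss_poly \<Longrightarrow> (\<lambda>x. complex_of_real (f x)) \<in> L2"
  unfolding L2_iff using integrable_gauss_poly_mult[of f f] gauss_poly_measurable[of f]
  by (auto simp: power2_eq_square)

lemma integrable_mult_square:
  fixes f g :: "real \<Rightarrow> real"
  assumes "integrable lborel (\<lambda>x. (f x)\<^sup>2)" "integrable lborel (\<lambda>x. (g x)\<^sup>2)"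
    and [measurable]: "f \<in> borel_measurable borel" "g \<in> borel_measurable borel"
  shows "integrable lborel (\<lambda>x. f x * g x)"
proof (rule Bochner_Integration.integrable_bound[OF Bochner_Integration.integrable_add[OF assms(1,2)]])
  show "AE x in lborel. norm (f x * g x) \<le> norm ((f x)\<^sup>2 + (g x)\<^sup>2)"
  proof (intro AE_I2)
    fix x
    have "2 * (\<bar>f x\<bar> * \<bar>g x\<bar>) \<le> (f x)\<^sup>2 + (g x)\<^sup>2"
      using zero_le_power2[of "\<bar>f x\<bar> - \<bar>g x\<bar>"] by (simp add: power2_diff)
    moreover have "0 \<le> \<bar>f x\<bar> * \<bar>g x\<bar>" by simp
    ultimately have "\<bar>f x\<bar> * \<bar>g x\<bar> \<le> (f x)\<^sup>2 + (g x)\<^sup>2" by linarith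
    then show "norm (f x * g x) \<le> norm ((f x)\<^sup>2 + (g x)\<^sup>2)" by (simp add: abs_mult)
  qed
qed measurable

text \<open>Densities are unique almost everywhere, and the positive and negative parts of
  \<open>G\<close> are never both nonzero, so their equality forces both to vanish.\<close>

lemma density_eq_imp_AE_zero:
  fixes G :: "'a::euclidean_space \<Rightarrow> real"
  assumes int: "integrable lborel G"
    and eq: "density lborel (\<lambda>x. ennreal (max 0 (G x))) = density lborel (\<lambda>x. ennreal (max 0 (- G x)))"
  shows "AE x in lborel. G x = 0"
proof -
  have [measurable]: "G \<in> borel_measurable borel" using int by simp
  have "AE x in lborel. ennreal (max 0 (G x)) = ennreal (max 0 (- G x))"
    by (rule sigma_finite_measure.density_unique[OF sigma_finite_lborel _ _ eq]) measurable
  then show ?thesis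
  proof (rule eventually_mono)
    fix x assume "ennreal (max 0 (G x)) = ennreal (max 0 (- G x))"
    then have "max 0 (G x) = max 0 (- G x)" by (subst (asm) ennreal_inj) auto
    then show "G x = 0" by (auto simp: max_def split: if_splits)
  qed
qed

text \<open>At \<open>t = 0\<close> the positive and negative parts of \<open>G\<close> have equal
  mass. Normalised to probability measures they have the same characteristic function, and Levy's
  uniqueness theorem makes them equal. Mass 0 cannot be normalised and is treated apart.\<close>

lemma fourier_zero_imp_AE_zero:
  fixes G :: "real \<Rightarrow> real"
  assumes int: "integrable lborel G"
    and fourier: "\<And>t. (\<integral>x. of_real (G x) * iexp (t * x) \<partial>lborel) = (0::complex)"
  shows "AE x in lborel. G x = 0"
proof -
  have [measurable]: "G \<in> borel_measurable borel" using int by simp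
  let ?p = "\<lambda>x. max 0 (G x)" and ?n = "\<lambda>x. max 0 (- G x)"
  have ip: "integrable lborel ?p" and "integrable lborel ?n" using int by auto
  then have in': "integrable lborel ?n" by simp
  have "complex_of_real (\<integral>x. G x \<partial>lborel) = (\<integral>x. of_real (G x) * iexp (0 * x) \<partial>lborel)"
    by simp
  then have G0: "(\<integral>x. G x \<partial>lborel) = 0" unfolding fourier by simp
  have pn: "?p x - ?n x = G x" for x by (simp add: max_def)
  have mass: "(\<integral>x. ?p x \<partial>lborel) = (\<integral>x. ?n x \<partial>lborel)"
    using Bochner_Integration.integral_diff[OF ip in'] G0 unfolding pn by simp
  define m where "m = (\<integral>x. ?p x \<partial>lborel)"
  have m0: "m \<ge> 0" unfolding m_def by simp
  show ?thesis
  proof (cases "m = 0")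
    case True
    then have "(\<integral>x. ?p x \<partial>lborel) = 0" "(\<integral>x. ?n x \<partial>lborel) = 0"
      using mass unfolding m_def by simp_all
    then have "AE x in lborel. ?p x = 0" "AE x in lborel. ?n x = 0"
      using integral_nonneg_eq_0_iff_AE[OF ip] integral_nonneg_eq_0_iff_AE[OF in'] by simp_all
    then show ?thesis by eventually_elim (use pn in \<open>metis diff_zero\<close>)
  next
    case False
    then have m: "m > 0" using m0 by simp
    have real_dist: "real_distribution (density lborel (\<lambda>x. ennreal (g x / m)))"
      if "integrable lborel g" "(\<integral>x. g x \<partial>lborel) = m" "\<And>x. 0 \<le> g x" for g :: "real \<Rightarrow> real"
    proof -
      have [measurable]: "g \<in> borel_measurable borel" using that by simp
      have "(\<integral>\<^sup>+x. ennreal (g x / m) \<partial>lborel) = ennreal (\<integral>x. g x / m \<partial>lborel)"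
        using that m by (intro nn_integral_eq_integral) auto
      then have "emeasure (density lborel (\<lambda>x. ennreal (g x / m))) UNIV = 1"
        using that m by (simp add: emeasure_density)
      then have "prob_space (density lborel (\<lambda>x. ennreal (g x / m)))" by (intro prob_spaceI) simp
      then show ?thesis by (simp add: real_distribution_def real_distribution_axioms_def)
    qed
    have char: "char (density lborel (\<lambda>x. ennreal (g x / m))) t = (\<integral>x. of_real (g x) * iexp (t * x) \<partial>lborel) / of_real m"
      if "g \<in> borel_measurable borel" "\<And>x. 0 \<le> g x" for g :: "real \<Rightarrow> real" and t
    proof -
      have "char (density lborel (\<lambda>x. ennreal (g x / m))) t = (\<integral>x. (g x / m) *\<^sub>R iexp (t * x) \<partial>lborel)"
        unfolding char_def using that m by (subst integral_density) auto
      also have "\<dots> = (\<integral>x. of_real (g x) * iexp (t * x) / of_real m \<partial>lborel)"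
        by (simp add: scaleR_conv_of_real)
      finally show ?thesis by simp
    qed
    have ie: "integrable lborel (\<lambda>x. of_real (g x) * iexp (t * x))" if "integrable lborel g" for g :: "real \<Rightarrow> real" and t
    proof (rule Bochner_Integration.integrable_bound[OF that])
      have [measurable]: "g \<in> borel_measurable borel" using that by simp
      show "(\<lambda>x. of_real (g x) * iexp (t * x)) \<in> borel_measurable lborel" by measurable
    qed (auto simp: norm_mult)
    have "(\<integral>x. of_real (?p x) * iexp (t * x) \<partial>lborel) = (\<integral>x. of_real (?n x) * iexp (t * x) \<partial>lborel)" for t
    proof -
      have "(\<integral>x. of_real (?p x) * iexp (t * x) \<partial>lborel) - (\<integral>x. of_real (?n x) * iexp (t * x) \<partial>lborel)
          = (\<integral>x. of_real (?p x) * iexp (t * x) - of_real (?n x) * iexp (t * x) \<partial>lborel)"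
        by (rule Bochner_Integration.integral_diff[OF ie[OF ip] ie[OF in'], symmetric])
      also have "\<dots> = (\<integral>x. of_real (G x) * iexp (t * x) \<partial>lborel)"
        by (intro Bochner_Integration.integral_cong refl) (simp only: left_diff_distrib[symmetric] of_real_diff[symmetric] pn)
      finally show ?thesis unfolding fourier by simp
    qed
    moreover have "char (density lborel (\<lambda>x. ennreal (?p x / m))) t = (\<integral>x. of_real (?p x) * iexp (t * x) \<partial>lborel) / of_real m" for t
      by (rule char) auto
    moreover have "char (density lborel (\<lambda>x. ennreal (?n x / m))) t = (\<integral>x. of_real (?n x) * iexp (t * x) \<partial>lborel) / of_real m" for t
      by (rule char) auto
    ultimately have "char (density lborel (\<lambda>x. ennreal (?p x / m))) = char (density lborel (\<lambda>x. ennreal (?n x / m)))"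
      by (intro ext) (simp only:)
    then have "density lborel (\<lambda>x. ennreal (?p x / m)) = density lborel (\<lambda>x. ennreal (?n x / m))"
      using ip in' mass by (intro Levy_uniqueness real_dist) (auto simp: m_def)
    moreover have "?p x / m = max 0 (G x / m)" "?n x / m = max 0 (- (G x / m))" for x
      using m by (simp_all add: max_divide_distrib_right)
    ultimately have "density lborel (\<lambda>x. ennreal (max 0 (G x / m))) = density lborel (\<lambda>x. ennreal (max 0 (- (G x / m))))"
      by simp
    then have "AE x in lborel. G x / m = 0"
      using int by (intro density_eq_imp_AE_zero) auto
    then show ?thesis using m by simp
  qed
qed

text \<open>Orthogonality to all \<open>h_n\<close> spreads to all \<open>x^k h_n\<close>, so
  \<open>G = g h_0\<close> has vanishing moments. Its Gaussian factor permits expanding the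
  exponential under the integral, hence the Fourier transform of \<open>G\<close> is 0; and
  \<open>h_0\<close> has no zeros.\<close>

lemma hermite_complete_real:
  fixes g :: "real \<Rightarrow> real"
  assumes [measurable]: "g \<in> borel_measurable borel" and sq: "integrable lborel (\<lambda>x. (g x)\<^sup>2)"
    and orth: "\<And>n. (\<integral>x. g x * hermite_fun n x \<partial>lborel) = 0"
  shows "AE x in lborel. g x = 0"
proof -
  have gp: "integrable lborel (\<lambda>x. g x * f x)" if "f \<in> gauss_poly" for f
    using sq integrable_gauss_poly_mult[OF that that] gauss_poly_measurable[OF that]
    by (intro integrable_mult_square) (auto simp: power2_eq_square)
  have xk: "(\<lambda>x. x ^ k * hermite_fun n x) \<in> gauss_poly" for k n
  proof (induction k)
    case (Suc k)
    then have "(\<lambda>x. x * (x ^ k * hermite_fun n x)) \<in> gauss_poly" by (rule gauss_poly_x)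
    then show ?case by (simp add: mult.assoc)
  qed (simp add: hermite_fun_gauss_poly)
  have moment: "(\<integral>x. g x * (x ^ k * hermite_fun n x) \<partial>lborel) = 0" for k n
  proof (induction k arbitrary: n)
    case 0
    then show ?case using orth by simp
  next
    case (Suc k)
    \<comment> \<open>The recurrence solved for \<open>x * h_n\<close> trades one power of
      \<open>x\<close> for the two neighbouring indices, which is why the induction on
      \<open>k\<close> keeps \<open>n\<close> arbitrary.\<close>
    have "x ^ Suc k * hermite_fun n x
        = sqrt (Suc n) / sqrt 2 * (x ^ k * hermite_fun (Suc n) x) + sqrt n / sqrt 2 * (x ^ k * hermite_fun (n - 1) x)" for x
    proof -
      have "sqrt (Suc n) / sqrt 2 * (x ^ k * hermite_fun (Suc n) x) + sqrt n / sqrt 2 * (x ^ k * hermite_fun (n - 1) x)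
          = x ^ k * ((sqrt (Suc n) * hermite_fun (Suc n) x + sqrt n * hermite_fun (n - 1) x) / sqrt 2)"
        by (simp add: field_simps del: of_nat_Suc)
      also have "\<dots> = x ^ k * (x * hermite_fun n x)" by (subst hermite_fun_Suc) simp
      finally show ?thesis by simp
    qed
    then have "(\<integral>x. g x * (x ^ Suc k * hermite_fun n x) \<partial>lborel)
        = (\<integral>x. sqrt (Suc n) / sqrt 2 * (g x * (x ^ k * hermite_fun (Suc n) x))
            + sqrt n / sqrt 2 * (g x * (x ^ k * hermite_fun (n - 1) x)) \<partial>lborel)"
      by (intro Bochner_Integration.integral_cong refl) (simp only: algebra_simps)
    also have "\<dots> = 0"
      by (subst Bochner_Integration.integral_add) (simp_all only: integrable_mult_right gp xk integral_mult_right_zero Suc.IH mult_zero_right add_0_right)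
    finally show ?case .
  qed
  define G where "G x = g x * hermite_fun 0 x" for x
  have intG: "integrable lborel G" unfolding G_def[abs_def] by (rule gp[OF hermite_fun_gauss_poly])
  then have [measurable]: "G \<in> borel_measurable borel" by simp
  \<comment> \<open>A majorant for all partial sums of the exponential series. Its Gaussian part is
    square integrable because \<open>|t x| <= x^2/4 + t^2\<close>.\<close>
  have dom: "integrable lborel (\<lambda>x. \<bar>G x\<bar> * exp (\<bar>t * x\<bar>))" for t
  proof -
    have "integrable lborel (\<lambda>x. \<bar>g x\<bar> * (hermite_fun 0 x * exp \<bar>t * x\<bar>))"
    proof (rule integrable_mult_square)
      show "integrable lborel (\<lambda>x. (hermite_fun 0 x * exp \<bar>t * x\<bar>)\<^sup>2)"
      proof (rule Bochner_Integration.integrable_bound[OF integrable_mult_right[OF integrable_exp_square, of "exp (2 * t\<^sup>2)"]])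
        show "AE x in lborel. norm ((hermite_fun 0 x * exp \<bar>t * x\<bar>)\<^sup>2) \<le> norm (exp (2 * t\<^sup>2) * exp (- x\<^sup>2 / 2))"
        proof (intro AE_I2)
          fix x :: real
          have "1 \<le> sqrt pi" using pi_gt3 by simp
          then have "(hermite_fun 0 x)\<^sup>2 \<le> exp (- x\<^sup>2 / 2) ^ 2"
            by (simp add: power_divide divide_le_eq)
          then have "(hermite_fun 0 x * exp \<bar>t * x\<bar>)\<^sup>2 \<le> exp (- x\<^sup>2 / 2) ^ 2 * exp \<bar>t * x\<bar> ^ 2"
            unfolding power_mult_distrib by (rule mult_right_mono) simp
          also have "\<dots> = exp (2 * (- x\<^sup>2 / 2) + 2 * \<bar>t * x\<bar>)" by (simp add: power2_eq_square exp_add[symmetric])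
          also have "\<dots> \<le> exp (2 * t\<^sup>2 + - x\<^sup>2 / 2)"
          proof -
            have "0 \<le> (\<bar>x\<bar> / 2 - \<bar>t\<bar>)\<^sup>2" by simp
            then have "\<bar>t * x\<bar> \<le> x\<^sup>2 / 4 + t\<^sup>2" by (simp add: power2_diff power_divide abs_mult mult.commute)
            then show ?thesis by (simp add: field_simps)
          qed
          finally have "(hermite_fun 0 x * exp \<bar>t * x\<bar>)\<^sup>2 \<le> exp (2 * t\<^sup>2) * exp (- x\<^sup>2 / 2)"
            by (simp only: exp_add)
          then show "norm ((hermite_fun 0 x * exp \<bar>t * x\<bar>)\<^sup>2) \<le> norm (exp (2 * t\<^sup>2) * exp (- x\<^sup>2 / 2))"
            by (simp del: hermite_fun.simps)
        qed
      qed measurable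
    qed (use sq in auto)
    moreover have "\<bar>G x\<bar> * exp \<bar>t * x\<bar> = \<bar>g x\<bar> * (hermite_fun 0 x * exp \<bar>t * x\<bar>)" for x
      by (simp add: G_def abs_mult)
    ultimately show ?thesis by simp
  qed
  have "(\<integral>x. of_real (G x) * iexp (t * x) \<partial>lborel) = (0::complex)" for t
  proof -
    let ?s = "\<lambda>n x. of_real (G x) * (\<Sum>k<n. (\<i> * of_real (t * x)) ^ k /\<^sub>R fact k) :: complex"
    have "(\<lambda>n. \<integral>x. ?s n x \<partial>lborel) \<longlonglongrightarrow> (\<integral>x. of_real (G x) * iexp (t * x) \<partial>lborel)"
    proof (rule integral_dominated_convergence[OF _ _ dom[of t]])
      show "AE x in lborel. (\<lambda>n. ?s n x) \<longlonglongrightarrow> of_real (G x) * iexp (t * x)"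
        by (intro AE_I2 tendsto_intros exp_converges[unfolded sums_def])
      show "AE x in lborel. norm (?s n x) \<le> \<bar>G x\<bar> * exp \<bar>t * x\<bar>" for n
      proof (intro AE_I2)
        fix x
        have "norm (\<Sum>k<n. (\<i> * of_real (t * x)) ^ k /\<^sub>R fact k :: complex) \<le> (\<Sum>k<n. \<bar>t * x\<bar> ^ k /\<^sub>R fact k)"
          by (rule order_trans[OF norm_sum]) (simp add: norm_power norm_mult abs_mult divide_inverse)
        also have "\<dots> \<le> (\<Sum>k. \<bar>t * x\<bar> ^ k /\<^sub>R fact k)"
          by (intro sum_le_suminf summable_exp_generic) auto
        also have "\<dots> = exp \<bar>t * x\<bar>" by (simp add: exp_def)
        finally show "norm (?s n x) \<le> \<bar>G x\<bar> * exp \<bar>t * x\<bar>"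
          by (simp only: norm_mult norm_of_real) (intro mult_left_mono, auto)
      qed
    qed measurable
    moreover have "(\<integral>x. ?s n x \<partial>lborel) = 0" for n
    proof -
      have e: "?s n x = (\<Sum>k<n. ((\<i> * of_real t) ^ k /\<^sub>R fact k) * of_real (g x * (x ^ k * hermite_fun 0 x)))" for x
        unfolding G_def sum_distrib_left
        by (intro sum.cong refl) (simp only: of_real_mult of_real_power power_mult_distrib scaleR_conv_of_real mult_ac)
      have "(\<integral>x. ?s n x \<partial>lborel)
          = (\<Sum>k<n. \<integral>x. ((\<i> * of_real t) ^ k /\<^sub>R fact k) * of_real (g x * (x ^ k * hermite_fun 0 x)) \<partial>lborel)"
        unfolding e by (intro Bochner_Integration.integral_sum integrable_mult_right integrable_of_real gp xk)
      also have "\<dots> = 0"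
        by (simp only: integral_mult_right_zero integral_complex_of_real moment of_real_0 mult_zero_right sum.neutral_const)
      finally show ?thesis .
    qed
    ultimately have "(\<lambda>n. 0) \<longlonglongrightarrow> (\<integral>x. of_real (G x) * iexp (t * x) \<partial>lborel)" by (simp only:)
    then show ?thesis using LIMSEQ_unique tendsto_const by blast
  qed
  then have "AE x in lborel. G x = 0" by (rule fourier_zero_imp_AE_zero[OF intG])
  then show ?thesis by (rule eventually_mono) (simp add: G_def)
qed

abbreviation hermite_c :: "nat \<Rightarrow> real \<Rightarrow> complex" where
  "hermite_c n \<equiv> \<lambda>y. complex_of_real (hermite_fun n y)"

interpretation hermite: L2_basis hermite_c
proof
  show "hermite_c j \<in> L2" for j by (rule gauss_poly_L2[OF hermite_fun_gauss_poly])
  show "L2_inner (hermite_c i) (hermite_c j) = (if i = j then 1 else 0)" for i j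
  proof -
    have "L2_inner (hermite_c i) (hermite_c j) = of_real (\<integral>x. hermite_fun i x * hermite_fun j x \<partial>lborel)"
      unfolding L2_inner_def integral_complex_of_real[symmetric] by simp
    then show ?thesis by (simp add: hermite_orthonormal)
  qed
  fix u :: "real \<Rightarrow> complex"
  assume u: "u \<in> L2" and orth: "\<And>j. L2_inner u (hermite_c j) = 0"
  have [measurable]: "u \<in> borel_measurable borel" using u by (simp add: L2_iff)
  have int: "integrable lborel (\<lambda>x. u x * of_real (hermite_fun n x))" for n
    using L2_mult_integrable[OF u gauss_poly_L2[OF hermite_fun_gauss_poly[of n]]] by simp
  have z: "(\<integral>x. u x * of_real (hermite_fun n x) \<partial>lborel) = 0" for n
    using orth[of n] by (simp add: L2_inner_def)
  have sq: "integrable lborel (\<lambda>x. (Re (u x))\<^sup>2)" "integrable lborel (\<lambda>x. (Im (u x))\<^sup>2)"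
  proof -
    have i: "integrable lborel (\<lambda>x. (cmod (u x))\<^sup>2)" using u by (simp add: L2_iff)
    show "integrable lborel (\<lambda>x. (Re (u x))\<^sup>2)" "integrable lborel (\<lambda>x. (Im (u x))\<^sup>2)"
      by (rule Bochner_Integration.integrable_bound[OF i]; simp add: cmod_power2)+
  qed
  have "AE x in lborel. Re (u x) = 0"
  proof (rule hermite_complete_real[OF _ sq(1)])
    show "(\<integral>x. Re (u x) * hermite_fun n x \<partial>lborel) = 0" for n
      using integral_Re[OF int[of n]] z[of n] by simp
  qed measurable
  moreover have "AE x in lborel. Im (u x) = 0"
  proof (rule hermite_complete_real[OF _ sq(2)])
    show "(\<integral>x. Im (u x) * hermite_fun n x \<partial>lborel) = 0" for n
      using integral_Im[OF int[of n]] z[of n] by simp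
  qed measurable
  ultimately show "ae_eq u (\<lambda>x. 0)"
    unfolding ae_eq_def by eventually_elim (simp add: complex_eq_iff)
qed

text \<open>On a large box the positive and negative parts of \<open>g\<close> define finite
  measures agreeing on all boxes, a generating system closed under intersection. The large box is
  there because \<open>g\<close> is assumed integrable on boxes only.\<close>

lemma AE_zero_if_box_integrals:
  fixes g :: "'a::euclidean_space \<Rightarrow> real"
  assumes int: "\<And>a b. integrable lborel (\<lambda>x. indicator (box a b) x * g x)"
    and zero: "\<And>a b. (\<integral>x. indicator (box a b) x * g x \<partial>lborel) = 0"
  shows "AE x in lborel. g x = 0"
proof -
  let ?B = "\<lambda>n::nat. box (- (real n *\<^sub>R One)) (real n *\<^sub>R One) :: 'a set"
  let ?E = "range (\<lambda>(a, b). box a b::'a set)"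
  have "AE x in lborel. indicator (?B n) x * g x = 0" for n
  proof (rule density_eq_imp_AE_zero)
    let ?G = "\<lambda>x. indicator (?B n) x * g x"
    let ?p = "\<lambda>x. max 0 (?G x)" and ?m = "\<lambda>x. max 0 (- ?G x)"
    show intG: "integrable lborel ?G" by (rule int)
    then have [measurable]: "?G \<in> borel_measurable borel" by simp
    have ip: "integrable lborel ?p" and im: "integrable lborel ?m" using intG by auto
    have em: "emeasure (density lborel (\<lambda>x. ennreal (f x))) (box a b) = ennreal (\<integral>x. indicator (box a b) x * f x \<partial>lborel)"
      if f: "integrable lborel f" "\<And>x. 0 \<le> f x" for f and a b :: 'a
    proof -
      have [measurable]: "f \<in> borel_measurable borel" using f by simp
      have "emeasure (density lborel (\<lambda>x. ennreal (f x))) (box a b) = (\<integral>\<^sup>+x. ennreal (indicator (box a b) x * f x) \<partial>lborel)"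
        by (subst emeasure_density) (auto intro!: nn_integral_cong simp: indicator_def)
      also have "\<dots> = ennreal (\<integral>x. indicator (box a b) x * f x \<partial>lborel)"
        using f integrable_mult_indicator[OF _ f(1), of "box a b"] by (intro nn_integral_eq_integral) auto
      finally show ?thesis .
    qed
    have boxes: "emeasure (density lborel (\<lambda>x. ennreal (?p x))) (box a b) = emeasure (density lborel (\<lambda>x. ennreal (?m x))) (box a b)" for a b
    proof -
      have ii: "integrable lborel (\<lambda>x. indicator (box a b) x * ?p x)" "integrable lborel (\<lambda>x. indicator (box a b) x * ?m x)"
        using integrable_mult_indicator[OF _ ip, of "box a b"] integrable_mult_indicator[OF _ im, of "box a b"] by auto
      obtain c d where cd: "box a b \<inter> ?B n = box c d" using box_Int_box[of a b] by blast
      have "(\<integral>x. indicator (box a b) x * ?p x \<partial>lborel) - (\<integral>x. indicator (box a b) x * ?m x \<partial>lborel)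
          = (\<integral>x. indicator (box a b) x * ?p x - indicator (box a b) x * ?m x \<partial>lborel)"
        using ii by simp
      also have "\<dots> = (\<integral>x. indicator (box c d) x * g x \<partial>lborel)"
        by (intro Bochner_Integration.integral_cong refl) (simp only: cd[symmetric], auto simp: indicator_def max_def)
      also have "\<dots> = 0" by (rule zero)
      finally show ?thesis using em[OF ip] em[OF im] by simp
    qed
    show "density lborel (\<lambda>x. ennreal (?p x)) = density lborel (\<lambda>x. ennreal (?m x))"
    proof (rule measure_eqI_generator_eq)
      show "Int_stable ?E" by (auto simp: Int_stable_def box_Int_box)
      show "?E \<subseteq> Pow UNIV" "sets (density lborel (\<lambda>x. ennreal (?p x))) = sigma_sets UNIV ?E"
        "sets (density lborel (\<lambda>x. ennreal (?m x))) = sigma_sets UNIV ?E"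
        by (simp_all add: borel_eq_box)
      show "range ?B \<subseteq> ?E" "(\<Union>i. ?B i) = UNIV" unfolding UN_box_eq_UNIV by auto
      show "emeasure (density lborel (\<lambda>x. ennreal (?p x))) (?B i) \<noteq> \<infinity>" for i
        using em[OF ip, of "- (real i *\<^sub>R One)" "real i *\<^sub>R One"] by simp
      show "emeasure (density lborel (\<lambda>x. ennreal (?p x))) X = emeasure (density lborel (\<lambda>x. ennreal (?m x))) X" if "X \<in> ?E" for X
        using that boxes by auto
    qed
  qed
  then have "AE x in lborel. \<forall>n. indicator (?B n) x * g x = 0" by (subst AE_all_countable) blast
  then show ?thesis
  proof (rule eventually_mono)
    fix x assume z: "\<forall>n. indicator (?B n) x * g x = 0"
    have "x \<in> (\<Union>i. ?B i)" unfolding UN_box_eq_UNIV by simp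
    then obtain n where "x \<in> ?B n" by blast
    then show "g x = 0" using z[rule_format, of n] by simp
  qed
qed

section \<open>Completeness of tensor products of Hermite functions\<close>

definition tensor_c :: "('n::finite \<Rightarrow> real \<Rightarrow> complex) \<Rightarrow> real ^ 'n \<Rightarrow> complex" where
  "tensor_c f x = (\<Prod>i\<in>UNIV. f i (x $ i))"

lemma
  assumes "\<And>i. f i \<in> L2"
  shows tensor_c_L2: "tensor_c f \<in> L2"
    and L2_sq_tensor_c: "L2_sq (tensor_c f) = (\<Prod>i\<in>UNIV. L2_sq (f i))"
proof -
  have [measurable]: "f i \<in> borel_measurable borel" for i using assms by (simp add: L2_iff)
  have eq: "(cmod (tensor_c f x))\<^sup>2 = (\<Prod>i\<in>UNIV. (cmod (f i (x $ i)))\<^sup>2)" for x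
    unfolding tensor_c_def by (simp add: prod_norm[symmetric] prod_power_distrib)
  have i: "integrable lborel (\<lambda>y. (cmod (f i y))\<^sup>2)" for i using assms by (simp add: L2_iff)
  have "tensor_c f \<in> borel_measurable borel" unfolding tensor_c_def[abs_def] by measurable
  then show "tensor_c f \<in> L2"
    unfolding L2_iff eq using lborel_prod_vec(1)[of "\<lambda>i y. (cmod (f i y))\<^sup>2", OF i] by simp
  show "L2_sq (tensor_c f) = (\<Prod>i\<in>UNIV. L2_sq (f i))"
    unfolding L2_sq_def eq by (rule lborel_prod_vec(2)[of "\<lambda>i y. (cmod (f i y))\<^sup>2", OF i])
qed

lemma tensor_c_fun_upd: "tensor_c (f(j := g)) x = g (x $ j) * (\<Prod>i\<in>- {j}. f i (x $ i))"
  unfolding tensor_c_def by (subst prod_UNIV_split[of _ j]) simp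

text \<open>Factors are replaced by Hermite functions one coordinate at a time; the set
  \<open>S\<close> in the induction holds the coordinates not yet of that form. Partial sums of the
  Hermite expansion in one coordinate give 0 by the induction hypothesis, and the inner product
  passes to the limit.\<close>

lemma tensor_c_hermite_span:
  fixes u :: "real ^ 'n::finite \<Rightarrow> complex"
  assumes u: "u \<in> L2" and orth: "\<And>\<alpha>. L2_inner (tensor_c (\<lambda>i. hermite_c (\<alpha> i))) u = 0"
    and f: "\<And>i. f i \<in> L2"
  shows "L2_inner (tensor_c f) u = 0"
proof -
  have "L2_inner (tensor_c f) u = 0"
    if "finite S" "\<And>i. f i \<in> L2" "\<And>i. i \<notin> S \<Longrightarrow> \<exists>n. f i = hermite_c n" for S :: "'n set" and f
    using that
  proof (induction S arbitrary: f rule: finite_induct)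
    case empty
    then obtain \<alpha> where "\<And>i. f i = hermite_c (\<alpha> i)" by (metis empty_iff)
    then have "f = (\<lambda>i. hermite_c (\<alpha> i))" by auto
    then show ?case using orth by simp
  next
    case (insert j S)
    let ?p = "hermite.psum (hermite.coef (f j))"
    have upd: "(f(j := g)) i \<in> L2" if "g \<in> L2" for g i using that insert.prems(1) by simp
    have zero: "L2_inner (tensor_c (f(j := ?p n))) u = 0" for n
    proof -
      have L: "(\<lambda>x. hermite.coef (f j) k * tensor_c (f(j := hermite_c k)) x) \<in> L2" for k
        by (intro L2_cmult tensor_c_L2 upd hermite.basis_L2)
      have "tensor_c (f(j := ?p n)) = (\<lambda>x. \<Sum>k<n. hermite.coef (f j) k * tensor_c (f(j := hermite_c k)) x)"
        unfolding tensor_c_fun_upd[abs_def] hermite.psum_def by (simp add: sum_distrib_right mult.assoc)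
      then have "L2_inner (tensor_c (f(j := ?p n))) u
          = (\<Sum>k<n. hermite.coef (f j) k * L2_inner (tensor_c (f(j := hermite_c k))) u)"
        by (simp add: L2_inner_sum[OF L u] L2_inner_cmult)
      also have "\<dots> = 0"
      proof (intro sum.neutral ballI)
        fix k
        have "L2_inner (tensor_c (f(j := hermite_c k))) u = 0"
        proof (rule insert.IH)
          show "(f(j := hermite_c k)) i \<in> L2" for i by (intro upd hermite.basis_L2)
          show "\<exists>n. (f(j := hermite_c k)) i = hermite_c n" if "i \<notin> S" for i
            using insert.prems(2)[of i] that by (cases "i = j") auto
        qed
        then show "hermite.coef (f j) k * L2_inner (tensor_c (f(j := hermite_c k))) u = 0" by simp
      qed
      finally show ?thesis .
    qed
    have "(\<lambda>n. L2_inner (tensor_c (f(j := ?p n))) u) \<longlonglongrightarrow> L2_inner (tensor_c f) u"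
    proof (rule L2_inner_tendsto[OF _ _ u])
      show "tensor_c (f(j := ?p n)) \<in> L2" for n by (intro tensor_c_L2 upd hermite.psum_L2)
      show "tensor_c f \<in> L2" by (intro tensor_c_L2 insert.prems(1))
      have d: "(\<lambda>x. ?p n x - f j x) \<in> L2" for n by (intro L2_diff hermite.psum_L2 insert.prems(1))
      \<comment> \<open>Two tensors differing in one factor have a tensor as difference, so the norm
        of the difference factorises.\<close>
      have "(\<lambda>x. tensor_c (f(j := ?p n)) x - tensor_c f x) = tensor_c (f(j := (\<lambda>y. ?p n y - f j y)))" for n
      proof
        fix x
        have "tensor_c f x = f j (x $ j) * (\<Prod>i\<in>- {j}. f i (x $ i))"
          using tensor_c_fun_upd[of f j "f j" x] by simp
        then show "tensor_c (f(j := ?p n)) x - tensor_c f x = tensor_c (f(j := (\<lambda>y. ?p n y - f j y))) x"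
          by (simp add: tensor_c_fun_upd left_diff_distrib)
      qed
      then have "L2_sq (\<lambda>x. tensor_c (f(j := ?p n)) x - tensor_c f x)
          = L2_sq (\<lambda>y. ?p n y - f j y) * (\<Prod>i\<in>- {j}. L2_sq (f i))" for n
        using L2_sq_tensor_c[of "f(j := (\<lambda>y. ?p n y - f j y))", OF upd[OF d]]
        by (subst (asm) prod_UNIV_split[of _ j]) simp
      moreover have "(\<lambda>n. L2_sq (\<lambda>y. ?p n y - f j y) * (\<Prod>i\<in>- {j}. L2_sq (f i))) \<longlonglongrightarrow> 0 * (\<Prod>i\<in>- {j}. L2_sq (f i))"
        by (intro tendsto_intros hermite.psum_tendsto insert.prems(1))
      ultimately show "(\<lambda>n. L2_sq (\<lambda>x. tensor_c (f(j := ?p n)) x - tensor_c f x)) \<longlonglongrightarrow> 0" by simp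
    qed
    then show ?case unfolding zero by (simp add: LIMSEQ_const_iff)
  qed
  from this[of UNIV f] show ?thesis using f by simp
qed

lemma tensor_c_hermite: "tensor_c (\<lambda>i. hermite_c (\<alpha> i)) x = of_real (tensor hermite_fun \<alpha> x)"
  by (simp add: tensor_c_def tensor_def)

text \<open>Indicators of boxes are tensors of square-integrable functions, so \<open>u\<close>
  integrates to 0 over every box.\<close>

lemma tensor_c_complete:
  fixes u :: "real ^ 'n::finite \<Rightarrow> complex"
  assumes u: "u \<in> L2" and orth: "\<And>\<alpha>. L2_inner (tensor_c (\<lambda>i. hermite_c (\<alpha> i))) u = 0"
  shows "ae_eq u (\<lambda>x. 0)"
proof -
  have [measurable]: "u \<in> borel_measurable borel" using u by (simp add: L2_iff)
  define I where "I a b i = (\<lambda>y. indicator {a $ i<..<b $ i} y :: complex)" for a b :: "real ^ 'n" and i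
  have I_L2: "I a b i \<in> L2" for a b i
  proof -
    have "emeasure lborel {a $ i<..<b $ i} < \<infinity>"
      using emeasure_lborel_box_finite[of "a $ i" "b $ i"] by (simp only: box_real)
    then have "integrable lborel (indicator {a $ i<..<b $ i} :: real \<Rightarrow> real)"
      by (intro integrable_real_indicator) auto
    moreover have "(cmod (I a b i y))\<^sup>2 = indicator {a $ i<..<b $ i} y" for y
      by (simp add: I_def indicator_def)
    ultimately show ?thesis unfolding L2_iff by (simp add: I_def[abs_def])
  qed
  have I: "tensor_c (I a b) x = indicator (box a b) x" for a b x
  proof (cases "x \<in> box a b")
    case True
    then show ?thesis by (simp add: tensor_c_def I_def mem_box_cart)
  next
    case False
    then obtain i where "\<not> (a $ i < x $ i \<and> x $ i < b $ i)" by (auto simp: mem_box_cart)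
    then have "I a b i (x $ i) = 0" by (auto simp: I_def)
    then have "tensor_c (I a b) x = 0" unfolding tensor_c_def by (intro prod_zero) auto
    then show ?thesis using False by simp
  qed
  have IT: "tensor_c (I a b) \<in> L2" for a b by (rule tensor_c_L2) (rule I_L2)
  have Iz: "L2_inner (tensor_c (I a b)) u = 0" for a b
    by (rule tensor_c_hermite_span[OF u orth]) (rule I_L2)
  have ci: "cnj (indicator (box a b) x) = indicator (box a b) x" for a b :: "real ^ 'n" and x by (simp add: indicator_def)
  have int: "integrable lborel (\<lambda>x. u x * indicator (box a b) x)" for a b
    using L2_mult_integrable[OF u IT[of a b]] by (simp only: I ci)
  have zero: "(\<integral>x. u x * indicator (box a b) x \<partial>lborel) = 0" for a b
  proof -
    have "L2_inner u (tensor_c (I a b)) = cnj (L2_inner (tensor_c (I a b)) u)" by (rule L2_inner_cnj)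
    also have "\<dots> = 0" by (simp add: Iz)
    finally show ?thesis by (simp only: L2_inner_def I ci)
  qed
  have re: "Re (u x * indicator S x) = indicator S x * Re (u x)" "Im (u x * indicator S x) = indicator S x * Im (u x)" for S x
    by (simp_all add: indicator_def)
  have "AE x in lborel. Re (u x) = 0"
    using integrable_Re[OF int] integral_Re[OF int] zero unfolding re
    by (intro AE_zero_if_box_integrals) auto
  moreover have "AE x in lborel. Im (u x) = 0"
    using integrable_Im[OF int] integral_Im[OF int] zero unfolding re
    by (intro AE_zero_if_box_integrals) auto
  ultimately show ?thesis unfolding ae_eq_def by eventually_elim (simp add: complex_eq_iff)
qed

text \<open>\<open>L2_basis\<close> is indexed by natural numbers; any enumeration of the countable
  set of multi-indices serves.\<close>

definition multi_index :: "nat \<Rightarrow> ('n::finite \<Rightarrow> nat)" where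
  "multi_index = from_nat_into UNIV"

lemma bij_multi_index: "bij (multi_index :: nat \<Rightarrow> ('n::finite \<Rightarrow> nat))"
proof -
  have "inj (\<lambda>n. (\<lambda>_. n) :: 'n \<Rightarrow> nat)" by (auto simp: inj_def fun_eq_iff)
  then have "infinite (UNIV :: ('n \<Rightarrow> nat) set)"
    using infinite_UNIV_nat range_inj_infinite rev_finite_subset by blast
  then show ?thesis unfolding multi_index_def by (intro bij_betw_from_nat_into) auto
qed

definition hermite_basis :: "nat \<Rightarrow> real ^ 'n::finite \<Rightarrow> complex" where
  "hermite_basis j x = of_real (tensor hermite_fun (multi_index j) x)"

lemma tensor_hermite_L2: "(\<lambda>x. of_real (tensor hermite_fun \<alpha> x)) \<in> L2"
  using tensor_c_L2[of "\<lambda>i. hermite_c (\<alpha> i)", OF hermite.basis_L2] by (simp add: tensor_c_hermite[abs_def])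

lemma tensor_hermite_inner:
  "L2_inner (\<lambda>x. of_real (tensor hermite_fun \<alpha> x)) (\<lambda>x. of_real (tensor hermite_fun \<beta> x)) = (if \<alpha> = \<beta> then 1 else 0)"
  unfolding L2_inner_def complex_cnj_complex_of_real of_real_mult[symmetric] integral_complex_of_real
    tensor_orthonormal(2)[of hermite_fun, OF integrable_hermite_mult hermite_orthonormal] by simp

interpretation hermite_vec: L2_basis "hermite_basis :: nat \<Rightarrow> real ^ 'n::finite \<Rightarrow> complex"
proof
  show "hermite_basis j \<in> L2" for j
    unfolding hermite_basis_def[abs_def] by (rule tensor_hermite_L2)
  show "L2_inner (hermite_basis i) (hermite_basis j :: real ^ 'n \<Rightarrow> complex) = (if i = j then 1 else 0)" for i j
    unfolding hermite_basis_def[abs_def] tensor_hermite_inner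
    using bij_multi_index[where 'n = 'n] by (auto simp: bij_def inj_eq)
  fix u :: "real ^ 'n \<Rightarrow> complex"
  assume u: "u \<in> L2" and orth: "\<And>j. L2_inner u (hermite_basis j) = 0"
  show "ae_eq u (\<lambda>x. 0)"
  proof (rule tensor_c_complete[OF u])
    fix \<alpha> :: "'n \<Rightarrow> nat"
    obtain j where "\<alpha> = multi_index j" using bij_multi_index[where 'n = 'n] by (metis bij_pointE)
    then have "tensor_c (\<lambda>i. hermite_c (\<alpha> i)) = hermite_basis j"
      by (simp add: tensor_c_hermite hermite_basis_def fun_eq_iff)
    then show "L2_inner (tensor_c (\<lambda>i. hermite_c (\<alpha> i))) u = 0"
      using orth[of j] by (subst L2_inner_cnj) simp
  qed
qed

section \<open>Smooth functions of product form\<close>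

text \<open>A list of partial derivatives never leaves the class \<open>S\<close>, so no formula for
  iterated derivatives is needed.\<close>

lemma smooth_coinduct:
  assumes "f \<in> S"
    and "\<And>g x. g \<in> S \<Longrightarrow> g differentiable (at x)"
    and "\<And>g b. g \<in> S \<Longrightarrow> b \<in> Basis \<Longrightarrow> partial_deriv b g \<in> S"
  shows "smooth f"
proof -
  have "foldr partial_deriv bs f \<in> S" if "set bs \<subseteq> Basis" for bs
    using that by (induction bs) (use assms in auto)
  then show ?thesis unfolding smooth_def using assms(2) by blast
qed

text \<open>An explicit chain of derivatives is easier to combine than iterated Frechet derivatives
  and is all that the factors of a tensor require.\<close>

definition smooth1 :: "(real \<Rightarrow> real) \<Rightarrow> bool" where
  "smooth1 f \<longleftrightarrow> (\<exists>D. D 0 = f \<and> (\<forall>n x. (D n has_real_derivative D (Suc n) x) (at x)))"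

lemma smooth1_deriv:
  assumes "smooth1 f"
  obtains f' where "smooth1 f'" "\<And>x. (f has_real_derivative f' x) (at x)"
proof -
  obtain D where D: "D 0 = f" "\<And>n x. (D n has_real_derivative D (Suc n) x) (at x)"
    using assms unfolding smooth1_def by blast
  have "smooth1 (D 1)" unfolding smooth1_def using D(2) by (intro exI[of _ "\<lambda>n. D (Suc n)"]) auto
  then show ?thesis using that[of "D 1"] D(1) D(2)[of 0] by simp
qed

lemma smooth1_coinduct:
  assumes "f \<in> S" and S: "\<And>g. g \<in> S \<Longrightarrow> \<exists>g'\<in>S. \<forall>x. (g has_real_derivative g' x) (at x)"
  shows "smooth1 f"
proof -
  obtain d where d: "\<And>g. g \<in> S \<Longrightarrow> d g \<in> S \<and> (\<forall>x. (g has_real_derivative d g x) (at x))"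
    using S by metis
  have mem: "(d ^^ n) f \<in> S" for n by (induction n) (use assms(1) d in auto)
  show ?thesis unfolding smooth1_def
    by (rule exI[of _ "\<lambda>n. (d ^^ n) f"]) (use d mem in auto)
qed

text \<open>Leibniz's rule produces sums of products of derivatives. When \<open>F\<close> and
  \<open>G\<close> are chains of derivatives this span is closed under differentiation, which
  replaces the binomial formula.\<close>

inductive_set product_span :: "(nat \<Rightarrow> real \<Rightarrow> real) \<Rightarrow> (nat \<Rightarrow> real \<Rightarrow> real) \<Rightarrow> (real \<Rightarrow> real) set"
  for F G where
  base: "(\<lambda>x. F i x * G j x) \<in> product_span F G"
| add: "f \<in> product_span F G \<Longrightarrow> g \<in> product_span F G \<Longrightarrow> (\<lambda>x. f x + g x) \<in> product_span F G"

lemma smooth1_mult: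
  assumes "smooth1 f" "smooth1 g"
  shows "smooth1 (\<lambda>x. f x * g x)"
proof -
  obtain F where F: "F 0 = f" "\<And>n x. (F n has_real_derivative F (Suc n) x) (at x)"
    using assms unfolding smooth1_def by blast
  obtain G where G: "G 0 = g" "\<And>n x. (G n has_real_derivative G (Suc n) x) (at x)"
    using assms unfolding smooth1_def by blast
  show ?thesis
  proof (rule smooth1_coinduct[of _ "product_span F G"])
    show "(\<lambda>x. f x * g x) \<in> product_span F G" using product_span.base[of F 0 G 0] F(1) G(1) by simp
    fix k assume "k \<in> product_span F G"
    then show "\<exists>k'\<in>product_span F G. \<forall>x. (k has_real_derivative k' x) (at x)"
    proof induction
      case (base i j)
      have "((\<lambda>x. F i x * G j x) has_real_derivative F (Suc i) x * G j x + F i x * G (Suc j) x) (at x)" for x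
        by (rule DERIV_cong[OF DERIV_mult[OF F(2) G(2)]]) simp
      moreover have "(\<lambda>x. F (Suc i) x * G j x + F i x * G (Suc j) x) \<in> product_span F G"
        by (intro product_span.intros)
      ultimately show ?case by (intro bexI[of _ "\<lambda>x. F (Suc i) x * G j x + F i x * G (Suc j) x"]) auto
    next
      case (add k1 k2)
      then obtain k1' k2' where "k1' \<in> product_span F G" "\<And>x. (k1 has_real_derivative k1' x) (at x)"
        "k2' \<in> product_span F G" "\<And>x. (k2 has_real_derivative k2' x) (at x)" by blast
      then show ?case
        by (intro bexI[of _ "\<lambda>x. k1' x + k2' x"]) (auto intro: DERIV_add product_span.intros)
    qed
  qed
qed

lemma smooth1_affine:
  assumes "smooth1 f"
  shows "smooth1 (\<lambda>x. f (a + b * x))"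
proof -
  obtain D where D: "D 0 = f" "\<And>n x. (D n has_real_derivative D (Suc n) x) (at x)"
    using assms unfolding smooth1_def by blast
  have "((\<lambda>x. b ^ n * D n (a + b * x)) has_real_derivative b ^ Suc n * D (Suc n) (a + b * x)) (at x)" for n x
  proof -
    have "((\<lambda>x. D n (a + b * x)) has_real_derivative D (Suc n) (a + b * x) * b) (at x)"
      by (rule DERIV_chain2[OF D(2)]) (auto intro!: derivative_eq_intros)
    then show ?thesis by (rule DERIV_cong[OF DERIV_cmult]) simp
  qed
  then show ?thesis unfolding smooth1_def
    by (intro exI[of _ "\<lambda>n x. b ^ n * D n (a + b * x)"]) (simp add: D(1))
qed

text \<open>On the real line a Frechet derivative is multiplication by its value at 1, the only
  basis vector.\<close>

lemma smooth_imp_smooth1: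
  fixes f :: "real \<Rightarrow> real"
  assumes "smooth f"
  shows "smooth1 f"
proof -
  have "((partial_deriv 1 ^^ n) f has_real_derivative (partial_deriv 1 ^^ Suc n) f x) (at x)" for n x
  proof -
    let ?g = "(partial_deriv 1 ^^ n) f :: real \<Rightarrow> real"
    have "foldr partial_deriv (replicate n (1::real)) f = ?g" by (induction n) auto
    moreover have "set (replicate n (1::real)) \<subseteq> Basis" by (cases n) auto
    ultimately have "?g differentiable (at x)" using assms unfolding smooth_def by metis
    then have d: "(?g has_derivative frechet_derivative ?g (at x)) (at x)"
      by (simp add: frechet_derivative_works)
    have scale: "frechet_derivative ?g (at x) h = h *\<^sub>R frechet_derivative ?g (at x) 1" for h
      using linear_scale[OF has_derivative_linear[OF d], of h 1] by (simp only: real_scaleR_def mult_1_right)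
    have "frechet_derivative ?g (at x) = (*) (frechet_derivative ?g (at x) 1)"
    proof
      fix h
      show "frechet_derivative ?g (at x) h = frechet_derivative ?g (at x) 1 * h"
        by (subst scale) (simp only: real_scaleR_def mult.commute)
    qed
    with d have "(?g has_field_derivative frechet_derivative ?g (at x) 1) (at x)"
      unfolding has_field_derivative_def by (simp only:)
    then show ?thesis by (simp add: partial_deriv_def)
  qed
  then show ?thesis unfolding smooth1_def by (intro exI[of _ "\<lambda>n. (partial_deriv 1 ^^ n) f"]) auto
qed

lemma smooth1_gauss_poly: "f \<in> gauss_poly \<Longrightarrow> smooth1 f"
  by (rule smooth1_coinduct[of _ gauss_poly]) (metis gauss_poly_deriv)+

definition tensor_r :: "('n::finite \<Rightarrow> real \<Rightarrow> real) \<Rightarrow> real ^ 'n \<Rightarrow> real" where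
  "tensor_r F x = (\<Prod>i\<in>UNIV. F i (x $ i))"

lemma tensor_r_fun_upd: "tensor_r (F(j := g)) x = g (x $ j) * (\<Prod>i\<in>- {j}. F i (x $ i))"
  unfolding tensor_r_def by (subst prod_UNIV_split[of _ j]) simp

lemma tensor_eq_tensor_r: "tensor hermite_fun \<alpha> = tensor_r (\<lambda>i. hermite_fun (\<alpha> i))"
  by (simp add: fun_eq_iff tensor_def tensor_r_def)

lemma tensor_r_has_derivative:
  assumes "\<And>i y. (F i has_real_derivative F' i y) (at y)"
  shows "((\<lambda>x. complex_of_real (tensor_r F x)) has_derivative
    (\<lambda>h. of_real (\<Sum>i\<in>UNIV. F' i (x $ i) * h $ i * (\<Prod>j\<in>- {i}. F j (x $ j))))) (at x)"
proof -
  have "((\<lambda>x. F i (x $ i)) has_derivative (\<lambda>h. F' i (x $ i) * h $ i)) (at x)" for i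
    by (rule has_derivative_compose[OF bounded_linear.has_derivative[OF bounded_linear_vec_nth has_derivative_ident]
          assms[unfolded has_field_derivative_def]])
  then have "((\<lambda>x. \<Prod>i\<in>UNIV. F i (x $ i)) has_derivative
      (\<lambda>h. \<Sum>i\<in>UNIV. F' i (x $ i) * h $ i * (\<Prod>j\<in>UNIV - {i}. F j (x $ j)))) (at x)"
    by (rule has_derivative_prod)
  then show ?thesis unfolding tensor_r_def Compl_eq_Diff_UNIV
    by (rule has_derivative_of_real)
qed

lemma partial_deriv_tensor_r:
  assumes "\<And>i y. (F i has_real_derivative F' i y) (at y)"
  shows "partial_deriv (axis j 1) (\<lambda>x. complex_of_real (tensor_r F x)) = (\<lambda>x. of_real (tensor_r (F(j := F' j)) x))"
proof
  fix x
  have "partial_deriv (axis j 1) (\<lambda>x. complex_of_real (tensor_r F x)) x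
      = of_real (\<Sum>i\<in>UNIV. F' i (x $ i) * axis j 1 $ i * (\<Prod>k\<in>- {i}. F k (x $ k)))"
    unfolding partial_deriv_def frechet_derivative_at[OF tensor_r_has_derivative[where F = F and F' = F', OF assms], symmetric] ..
  also have "(\<Sum>i\<in>UNIV. F' i (x $ i) * axis j 1 $ i * (\<Prod>k\<in>- {i}. F k (x $ k)))
      = (\<Sum>i\<in>UNIV. if i = j then F' i (x $ i) * (\<Prod>k\<in>- {i}. F k (x $ k)) else 0)"
    by (intro sum.cong refl) (simp add: axis_def)
  also have "\<dots> = tensor_r (F(j := F' j)) x" by (simp add: tensor_r_fun_upd)
  finally show "partial_deriv (axis j 1) (\<lambda>x. complex_of_real (tensor_r F x)) x = of_real (tensor_r (F(j := F' j)) x)" .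
qed

lemma smooth_tensor_r:
  assumes "\<And>i. smooth1 (F i)"
  shows "smooth (\<lambda>x. complex_of_real (tensor_r F x))"
proof (rule smooth_coinduct[of _ "{\<lambda>x. complex_of_real (tensor_r F x) | F. \<forall>i. smooth1 (F i)}"])
  show "(\<lambda>x. complex_of_real (tensor_r F x)) \<in> {\<lambda>x. complex_of_real (tensor_r F x) | F. \<forall>i. smooth1 (F i)}"
    using assms by blast
  fix g :: "real ^ 'a \<Rightarrow> complex" assume "g \<in> {\<lambda>x. complex_of_real (tensor_r F x) | F. \<forall>i. smooth1 (F i)}"
  then obtain F where g: "g = (\<lambda>x. complex_of_real (tensor_r F x))" and F: "\<And>i. smooth1 (F i)" by blast
  have "\<forall>i. \<exists>f'. smooth1 f' \<and> (\<forall>y. (F i has_real_derivative f' y) (at y))"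
    using F smooth1_deriv by metis
  then obtain F' where F': "\<And>i. smooth1 (F' i)" "\<And>i y. (F i has_real_derivative F' i y) (at y)" by metis
  show "g differentiable (at x)" for x
    unfolding g differentiable_def using tensor_r_has_derivative[where F = F and F' = F', OF F'(2)] by blast
  fix b :: "real ^ 'a" assume "b \<in> Basis"
  then obtain j where b: "b = axis j 1" unfolding Basis_vec_real by auto
  have "partial_deriv b g = (\<lambda>x. of_real (tensor_r (F(j := F' j)) x))"
    unfolding b g by (rule partial_deriv_tensor_r) (rule F'(2))
  moreover have "\<forall>i. smooth1 ((F(j := F' j)) i)" using F F'(1) by simp
  ultimately show "partial_deriv b g \<in> {\<lambda>x. complex_of_real (tensor_r F x) | F. \<forall>i. smooth1 (F i)}" by blast
qed

lemma norm_vec_square: "(norm (x :: real ^ 'n::finite))\<^sup>2 = (\<Sum>i\<in>UNIV. (x $ i)\<^sup>2)"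
  unfolding power2_norm_eq_inner inner_vec_def by (simp add: power2_eq_square)

text \<open>The oscillator is a sum of one-variable oscillators, each acting on a single factor of
  the tensor.\<close>

lemma hamiltonian_tensor_r:
  fixes F :: "'n::finite \<Rightarrow> real \<Rightarrow> real"
  assumes F': "\<And>i y. (F i has_real_derivative F' i y) (at y)" and F'': "\<And>i y. (F' i has_real_derivative F'' i y) (at y)"
  shows "- laplacian (\<lambda>x. complex_of_real (tensor_r F x)) x + of_real ((norm x)\<^sup>2) * of_real (tensor_r F x)
    = of_real (\<Sum>j\<in>UNIV. tensor_r (F(j := (\<lambda>y. y\<^sup>2 * F j y - F'' j y))) x)"
proof -
  have p: "partial_deriv (axis j 1) (partial_deriv (axis j 1) (\<lambda>x. complex_of_real (tensor_r F x))) x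
      = of_real (tensor_r (F(j := F'' j)) x)" for j
  proof -
    have "((F(j := F' j)) i has_real_derivative (F'(j := F'' j)) i y) (at y)" for i y
      using F' F'' by simp
    from partial_deriv_tensor_r[where F = "F(j := F' j)" and F' = "F'(j := F'' j)" and j = j, OF this]
    show ?thesis
      unfolding partial_deriv_tensor_r[where F = F and F' = F', OF F'] by simp
  qed
  have "- laplacian (\<lambda>x. complex_of_real (tensor_r F x)) x + of_real ((norm x)\<^sup>2) * of_real (tensor_r F x)
      = (\<Sum>j\<in>UNIV. of_real ((x $ j)\<^sup>2 * tensor_r F x - tensor_r (F(j := F'' j)) x))"
    unfolding laplacian_def Basis_vec_real sum.reindex[OF inj_axis_one] norm_vec_square
    by (simp add: p sum_subtractf sum_distrib_right)
  also have "\<dots> = (\<Sum>j\<in>UNIV. of_real (tensor_r (F(j := (\<lambda>y. y\<^sup>2 * F j y - F'' j y))) x))"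
  proof (intro sum.cong refl)
    fix j
    have "tensor_r F x = F j (x $ j) * (\<Prod>i\<in>- {j}. F i (x $ i))"
      using tensor_r_fun_upd[of F j "F j" x] by simp
    then show "complex_of_real ((x $ j)\<^sup>2 * tensor_r F x - tensor_r (F(j := F'' j)) x)
        = of_real (tensor_r (F(j := (\<lambda>y. y\<^sup>2 * F j y - F'' j y))) x)"
      by (simp add: tensor_r_fun_upd algebra_simps)
  qed
  finally show ?thesis by simp
qed

section \<open>The Hermite functions and the domain of the harmonic oscillator\<close>

lemma deriv_zero_if_locally_const:
  fixes f :: "real \<Rightarrow> real"
  assumes "(f has_real_derivative D) (at x)" "open S" "x \<in> S" "\<And>y. y \<in> S \<Longrightarrow> f y = c"
  shows "D = 0"
proof -
  have "((\<lambda>_. c) has_real_derivative D) (at x)"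
    by (rule has_field_derivative_transform_within_open[OF assms(1-3)]) (use assms(4) in auto)
  then show ?thesis using DERIV_const DERIV_unique by blast
qed

lemma bounded_if_zero_outside:
  fixes f :: "real \<Rightarrow> real"
  assumes "continuous_on UNIV f" "\<And>x. \<bar>x\<bar> > a \<Longrightarrow> f x = 0"
  obtains C where "C \<ge> 0" "\<And>x. \<bar>f x\<bar> \<le> C"
proof -
  have "compact (f ` {-a..a})"
    by (intro compact_continuous_image continuous_on_subset[OF assms(1)]) auto
  then obtain C where C: "\<And>y. y \<in> f ` {-a..a} \<Longrightarrow> norm y \<le> C"
    using compact_imp_bounded bounded_iff by metis
  have "\<bar>f x\<bar> \<le> max 0 C" for x
  proof (cases "\<bar>x\<bar> > a")
    case False
    then have "x \<in> {-a..a}" by (auto simp: abs_le_iff not_less)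
    then have "f x \<in> f ` {-a..a}" by (rule imageI)
    then show ?thesis using C[of "f x"] by simp
  qed (simp add: assms(2))
  then show ?thesis by (intro that[of "max 0 C"]) auto
qed

lemma smooth1_continuous: "smooth1 f \<Longrightarrow> continuous_on A f"
  by (meson DERIV_continuous continuous_at_imp_continuous_on smooth1_deriv)

text \<open>The plateau of \<open>\<eta>\<close> is given on \<open>[0, 1]\<close>, to one side of
  the origin. The product of \<open>\<eta> (1/2 + x)\<close> and \<open>\<eta> (1/2 - x)\<close> is
  a symmetric bump, equal to 1 near 0 because both arguments stay in that interval; it will localise
  the Hermite functions.\<close>

lemma cutoff_exists:
  assumes \<eta>: "test_function \<eta>" "\<And>s::real. s \<in> {0..1} \<Longrightarrow> \<eta> s = (1::real)" "\<And>s. s \<ge> 2 \<Longrightarrow> \<eta> s = 0"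
  obtains \<rho> \<rho>' \<rho>'' :: "real \<Rightarrow> real" and C where "smooth1 \<rho>"
    "\<And>x. (\<rho> has_real_derivative \<rho>' x) (at x)" "\<And>x. (\<rho>' has_real_derivative \<rho>'' x) (at x)"
    "\<And>x. \<bar>x\<bar> > 2 \<Longrightarrow> \<rho> x = 0"
    "\<And>x. \<bar>x\<bar> < 1 / 2 \<Longrightarrow> \<rho> x = 1 \<and> \<rho>' x = 0 \<and> \<rho>'' x = 0"
    "C \<ge> 0" "\<And>x. \<bar>\<rho> x\<bar> \<le> C" "\<And>x. \<bar>\<rho>' x\<bar> \<le> C" "\<And>x. \<bar>\<rho>'' x\<bar> \<le> C"
proof -
  have "smooth1 \<eta>" using \<eta>(1) by (simp add: test_function_def smooth_imp_smooth1)
  define \<rho> where "\<rho> x = \<eta> (1 / 2 + 1 * x) * \<eta> (1 / 2 + (-1) * x)" for x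
  have s: "smooth1 \<rho>" unfolding \<rho>_def[abs_def] by (intro smooth1_mult smooth1_affine \<open>smooth1 \<eta>\<close>)
  obtain \<rho>' where r1: "smooth1 \<rho>'" "\<And>x. (\<rho> has_real_derivative \<rho>' x) (at x)" using smooth1_deriv[OF s] by blast
  obtain \<rho>'' where r2: "smooth1 \<rho>''" "\<And>x. (\<rho>' has_real_derivative \<rho>'' x) (at x)" using smooth1_deriv[OF r1(1)] by blast
  have zero: "\<rho> x = 0" if "\<bar>x\<bar> > 2" for x
    using that \<eta>(3)[of "1 / 2 + x"] \<eta>(3)[of "1 / 2 - x"] by (cases "x > 0") (auto simp: \<rho>_def)
  have one: "\<rho> x = 1" if "\<bar>x\<bar> < 1 / 2" for x
  proof -
    have "1 / 2 + x \<in> {0..1}" "1 / 2 - x \<in> {0..1}" using that by (auto simp: abs_less_iff)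
    then show ?thesis using \<eta>(2)[of "1 / 2 + x"] \<eta>(2)[of "1 / 2 - x"] by (simp add: \<rho>_def)
  qed
  have o: "open {x::real. \<bar>x\<bar> > 2}" "open {x::real. \<bar>x\<bar> < 1 / 2}"
    by (intro open_Collect_less continuous_intros)+
  have zero': "\<rho>' x = 0" if "\<bar>x\<bar> > 2" for x
    by (rule deriv_zero_if_locally_const[OF r1(2) o(1)]) (use that zero in auto)
  have zero'': "\<rho>'' x = 0" if "\<bar>x\<bar> > 2" for x
    by (rule deriv_zero_if_locally_const[OF r2(2) o(1)]) (use that zero' in auto)
  have one': "\<rho>' x = 0" if "\<bar>x\<bar> < 1 / 2" for x
    by (rule deriv_zero_if_locally_const[OF r1(2) o(2)]) (use that one in auto)
  have one'': "\<rho>'' x = 0" if "\<bar>x\<bar> < 1 / 2" for x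
    by (rule deriv_zero_if_locally_const[OF r2(2) o(2)]) (use that one' in auto)
  obtain C0 where C0: "C0 \<ge> 0" "\<And>x. \<bar>\<rho> x\<bar> \<le> C0" using bounded_if_zero_outside[OF smooth1_continuous[OF s] zero] by blast
  obtain C1 where C1: "C1 \<ge> 0" "\<And>x. \<bar>\<rho>' x\<bar> \<le> C1" using bounded_if_zero_outside[OF smooth1_continuous[OF r1(1)] zero'] by blast
  obtain C2 where C2: "C2 \<ge> 0" "\<And>x. \<bar>\<rho>'' x\<bar> \<le> C2" using bounded_if_zero_outside[OF smooth1_continuous[OF r2(1)] zero''] by blast
  have "\<bar>\<rho> x\<bar> \<le> C0 + C1 + C2" "\<bar>\<rho>' x\<bar> \<le> C0 + C1 + C2" "\<bar>\<rho>'' x\<bar> \<le> C0 + C1 + C2" for x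
    using C0(1) C0(2)[of x] C1(1) C1(2)[of x] C2(1) C2(2)[of x] by linarith+
  then show ?thesis
    using s r1(2) r2(2) zero one one' one'' C0(1) C1(1) C2(1) by (intro that[of \<rho> \<rho>' \<rho>'' "C0 + C1 + C2"]) auto
qed

lemma L2_abs_gauss_poly: "f \<in> gauss_poly \<Longrightarrow> (\<lambda>x. complex_of_real \<bar>f x\<bar>) \<in> L2"
  using gauss_poly_L2[of f] gauss_poly_measurable[of f] unfolding L2_iff by auto

lemma multi_eigenvalue: "(\<Sum>j\<in>UNIV. 2 * real (\<alpha> j) + 1) = 2 * real (multi_total \<alpha>) + real CARD('n)"
  for \<alpha> :: "'n::finite \<Rightarrow> nat"
  by (simp add: sum.distrib multi_total_def sum_distrib_left)

text \<open>The weak equation may only be tested with compact support, which Hermite functions lack.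
  They are multiplied by the cutoff \<open>\<rho> (e m * y)\<close> in each coordinate, and the
  cutoff is removed by dominated convergence.\<close>

lemma harmonic_oscillator_coef:
  fixes u w :: "real ^ 'n::finite \<Rightarrow> complex" and \<eta> :: "real \<Rightarrow> real"
  assumes \<eta>: "test_function \<eta>" "\<And>s. s \<in> {0..1} \<Longrightarrow> \<eta> s = 1" "\<And>s. s \<ge> 2 \<Longrightarrow> \<eta> s = 0"
    and uw: "(u, w) \<in> harmonic_oscillator"
  shows "(\<integral>x. w x * of_real (tensor hermite_fun \<alpha> x) \<partial>lborel)
    = of_real (2 * real (multi_total \<alpha>) + real CARD('n)) * (\<integral>x. u x * of_real (tensor hermite_fun \<alpha> x) \<partial>lborel)"
proof -
  have u: "u \<in> L2" and w: "w \<in> L2" and weak: "\<And>\<phi>. test_function \<phi> \<Longrightarrow>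
      (\<integral>x. u x * (- laplacian \<phi> x + of_real ((norm x)\<^sup>2) * \<phi> x) \<partial>lborel) = (\<integral>x. w x * \<phi> x \<partial>lborel)"
    using uw unfolding harmonic_oscillator_def by auto
  have [measurable]: "u \<in> borel_measurable borel" "w \<in> borel_measurable borel" using u w by (auto simp: L2_iff)
  obtain \<rho> \<rho>' \<rho>'' :: "real \<Rightarrow> real" and C where \<rho>: "smooth1 \<rho>"
    "\<And>x. (\<rho> has_real_derivative \<rho>' x) (at x)" "\<And>x. (\<rho>' has_real_derivative \<rho>'' x) (at x)"
    "\<And>x. \<bar>x\<bar> > 2 \<Longrightarrow> \<rho> x = 0"
    "\<And>x. \<bar>x\<bar> < 1 / 2 \<Longrightarrow> \<rho> x = 1 \<and> \<rho>' x = 0 \<and> \<rho>'' x = 0"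
    and C: "C \<ge> 0" "\<And>x. \<bar>\<rho> x\<bar> \<le> C" "\<And>x. \<bar>\<rho>' x\<bar> \<le> C" "\<And>x. \<bar>\<rho>'' x\<bar> \<le> C"
    using cutoff_exists[OF \<eta>] by metis
  define e where "e m = 1 / real (Suc m)" for m
  have e: "0 < e m" "e m \<le> 1" for m by (auto simp: e_def)
  let ?h = "\<lambda>i. hermite_fun (\<alpha> i)" and ?h' = "\<lambda>i. hermite_fun' (\<alpha> i)"
  define F where "F m i y = \<rho> (e m * y) * ?h i y" for m i y
  define F1 where "F1 m i y = e m * \<rho>' (e m * y) * ?h i y + \<rho> (e m * y) * ?h' i y" for m i y
  define F2 where "F2 m i y = (e m)\<^sup>2 * \<rho>'' (e m * y) * ?h i y + 2 * e m * \<rho>' (e m * y) * ?h' i y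
      + \<rho> (e m * y) * ((y\<^sup>2 - (2 * real (\<alpha> i) + 1)) * ?h i y)" for m i y
  define G where "G m i y = y\<^sup>2 * F m i y - F2 m i y" for m i y
  \<comment> \<open>A majorant independent of \<open>m\<close>: in the formula for \<open>G\<close>
    the coefficient of \<open>h\<close> is at most \<open>(2 \<alpha> + 2) C\<close> and that of
    \<open>h'\<close> at most \<open>2 C\<close>.\<close>
  define B where "B i y = (2 * real (\<alpha> i) + 4) * C * (\<bar>?h i y\<bar> + \<bar>?h' i y\<bar>)" for i y
  have ch: "((\<lambda>y. \<rho> (e m * y)) has_real_derivative \<rho>' (e m * y) * e m) (at y)"
    "((\<lambda>y. \<rho>' (e m * y)) has_real_derivative \<rho>'' (e m * y) * e m) (at y)" for m y
    by (rule DERIV_chain2[OF \<rho>(2)], auto intro!: derivative_eq_intros, rule DERIV_chain2[OF \<rho>(3)], auto intro!: derivative_eq_intros)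
  have F': "(F m i has_real_derivative F1 m i y) (at y)" for m i y
    unfolding F_def[abs_def] F1_def
    by (rule DERIV_cong[OF DERIV_mult[OF ch(1) hermite_fun_deriv]]) (simp add: algebra_simps)
  have F'': "(F1 m i has_real_derivative F2 m i y) (at y)" for m i y
    unfolding F1_def[abs_def] F2_def
    by (rule DERIV_cong[OF DERIV_add[OF DERIV_mult[OF DERIV_cmult[OF ch(2)] hermite_fun_deriv] DERIV_mult[OF ch(1) hermite_fun'_deriv]]])
      (simp add: algebra_simps power2_eq_square)
  \<comment> \<open>The growing term \<open>y^2\<close> cancels, so no polynomial weight remains to
    be dominated.\<close>
  have G: "G m i y = \<rho> (e m * y) * ((2 * real (\<alpha> i) + 1) * ?h i y) - 2 * e m * \<rho>' (e m * y) * ?h' i y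
      - (e m)\<^sup>2 * \<rho>'' (e m * y) * ?h i y" for m i y
    unfolding G_def F_def F2_def by (simp add: algebra_simps)
  have B0: "0 \<le> B i y" for i y unfolding B_def using C(1) by simp
  have F_le: "\<bar>F m i y\<bar> \<le> B i y" for m i y
  proof -
    have "\<bar>F m i y\<bar> \<le> C * \<bar>?h i y\<bar>" unfolding F_def abs_mult by (intro mult_right_mono C) auto
    also have "\<dots> \<le> ((2 * real (\<alpha> i) + 4) * C) * (\<bar>?h i y\<bar> + \<bar>?h' i y\<bar>)"
      using C(1) by (intro mult_mono) (auto simp: algebra_simps)
    finally show ?thesis by (simp add: B_def)
  qed
  have G_le: "\<bar>G m i y\<bar> \<le> B i y" for m i y
  proof -
    have 1: "\<bar>\<rho> (e m * y) * ((2 * real (\<alpha> i) + 1) * ?h i y)\<bar> \<le> C * ((2 * real (\<alpha> i) + 1) * \<bar>?h i y\<bar>)"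
      unfolding abs_mult by (intro mult_mono C) auto
    have 2: "\<bar>2 * e m * \<rho>' (e m * y) * ?h' i y\<bar> \<le> 2 * 1 * C * \<bar>?h' i y\<bar>"
      unfolding abs_mult using e[of m] C by (intro mult_mono) auto
    have e2: "(e m)\<^sup>2 \<le> 1" using e[of m] by (simp add: power_le_one less_imp_le)
    have 3: "\<bar>(e m)\<^sup>2 * \<rho>'' (e m * y) * ?h i y\<bar> \<le> 1 * C * \<bar>?h i y\<bar>"
      unfolding abs_mult using e2 C by (intro mult_mono) auto
    have "\<bar>G m i y\<bar> \<le> C * ((2 * real (\<alpha> i) + 1) * \<bar>?h i y\<bar>) + 2 * 1 * C * \<bar>?h' i y\<bar> + 1 * C * \<bar>?h i y\<bar>"
      unfolding G using 1 2 3 by linarith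
    also have "\<dots> = C * ((2 * real (\<alpha> i) + 2) * \<bar>?h i y\<bar> + 2 * \<bar>?h' i y\<bar>)" by (simp add: algebra_simps)
    also have "\<dots> \<le> C * ((2 * real (\<alpha> i) + 4) * \<bar>?h i y\<bar> + (2 * real (\<alpha> i) + 4) * \<bar>?h' i y\<bar>)"
      using C(1) by (intro mult_left_mono add_mono mult_right_mono) auto
    finally show ?thesis by (simp add: B_def algebra_simps)
  qed
  \<comment> \<open>For fixed \<open>y\<close> the argument \<open>e m * y\<close> eventually enters
    the plateau of the cutoff, so both sequences are eventually constant.\<close>
  have lim_eq: "eventually (\<lambda>m. F m i y = ?h i y \<and> G m i y = (2 * real (\<alpha> i) + 1) * ?h i y) sequentially" for i y
  proof -
    have "(\<lambda>m. e m * y) \<longlonglongrightarrow> 0 * y" unfolding e_def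
      by (intro tendsto_intros lim_1_over_n[THEN LIMSEQ_Suc])
    then have "(\<lambda>m. \<bar>e m * y\<bar>) \<longlonglongrightarrow> 0" using tendsto_rabs_zero by simp
    then have "eventually (\<lambda>m. \<bar>e m * y\<bar> < 1 / 2) sequentially" by (rule order_tendstoD) simp
    then show ?thesis by (rule eventually_mono) (simp add: F_def G \<rho>(5))
  qed
  have F_lim: "(\<lambda>m. F m i y) \<longlonglongrightarrow> ?h i y" for i y
    by (rule tendsto_eventually, rule eventually_mono[OF lim_eq[of i y]]) simp
  have G_lim: "(\<lambda>m. G m i y) \<longlonglongrightarrow> (2 * real (\<alpha> i) + 1) * ?h i y" for i y
    by (rule tendsto_eventually, rule eventually_mono[OF lim_eq[of i y]]) simp
  let ?\<Psi> = "\<lambda>m x. complex_of_real (tensor_r (F m) x)"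
  have test: "test_function (?\<Psi> m)" for m
  proof -
    have "smooth1 (\<lambda>y. \<rho> (e m * y))" using smooth1_affine[OF \<rho>(1), of 0 "e m"] by simp
    from smooth1_mult[OF this smooth1_gauss_poly[OF hermite_fun_gauss_poly]]
    have "smooth1 (F m i)" for i unfolding F_def[abs_def] .
    moreover have "bounded {x. ?\<Psi> m x \<noteq> 0}"
    proof (rule bounded_subset[OF bounded_cbox])
      show "{x. ?\<Psi> m x \<noteq> 0} \<subseteq> cbox (\<chi> i. - 2 / e m) (\<chi> i. 2 / e m)"
      proof clarify
        fix x assume "?\<Psi> m x \<noteq> 0"
        then have "F m i (x $ i) \<noteq> 0" for i by (auto simp: tensor_r_def prod_zero_iff)
        then have "\<not> \<bar>e m * x $ i\<bar> > 2" for i using \<rho>(4)[of "e m * x $ i"] by (auto simp: F_def)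
        then have "\<bar>x $ i\<bar> \<le> 2 / e m" for i using e(1)[of m] by (simp add: abs_mult field_simps not_less)
        then show "x \<in> cbox (\<chi> i. - 2 / e m) (\<chi> i. 2 / e m)" by (auto simp: mem_box_cart abs_le_iff minus_le_iff)
      qed
    qed
    ultimately show ?thesis unfolding test_function_def compact_closure by (auto intro: smooth_tensor_r)
  qed
  have meas: "F m i \<in> borel_measurable borel" "G m i \<in> borel_measurable borel" for m i
  proof -
    have c: "continuous_on UNIV f" if "\<And>x. (f has_real_derivative f' x) (at x)" for f f' :: "real \<Rightarrow> real"
      using that by (meson DERIV_continuous continuous_at_imp_continuous_on)
    have [measurable]: "\<rho> \<in> borel_measurable borel" "\<rho>' \<in> borel_measurable borel"
      by (rule borel_measurable_continuous_onI, rule c[OF \<rho>(2)])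
        (rule borel_measurable_continuous_onI, rule c[OF \<rho>(3)])
    \<comment> \<open>Continuity of this second derivative is not among the properties at hand; it
      is identified with the derivative obtained from \<open>smooth1\<close>, which is
      continuous.\<close>
    have "\<rho>'' \<in> borel_measurable borel"
    proof -
      obtain r' where r': "smooth1 r'" "\<And>x. (\<rho> has_real_derivative r' x) (at x)" using smooth1_deriv[OF \<rho>(1)] by blast
      then have "r' = \<rho>'" using \<rho>(2) DERIV_unique by blast
      then obtain r'' where r'': "smooth1 r''" "\<And>x. (\<rho>' has_real_derivative r'' x) (at x)" using smooth1_deriv[of \<rho>'] r'(1) by blast
      then have "r'' = \<rho>''" using \<rho>(3) DERIV_unique by blast
      then show ?thesis using r''(1) by (intro borel_measurable_continuous_onI smooth1_continuous) simp
    qed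
    note [measurable] = this gauss_poly_measurable[OF hermite_fun'_gauss_poly]
    show "F m i \<in> borel_measurable borel" "G m i \<in> borel_measurable borel"
      unfolding F_def[abs_def] G[abs_def] by measurable
  qed
  have tmeas: "tensor_r f \<in> borel_measurable borel" if [measurable]: "\<And>i. f i \<in> borel_measurable borel" for f :: "'n \<Rightarrow> real \<Rightarrow> real"
    unfolding tensor_r_def[abs_def] by measurable
  define TB where "TB x = (\<Prod>i\<in>UNIV. B i (x $ i))" for x
  have TB_int: "integrable lborel (\<lambda>x. cmod (v x) * TB x)" if v: "v \<in> L2" for v
  proof -
    have "(\<lambda>y. complex_of_real (B i y)) \<in> L2" for i
    proof -
      have "(\<lambda>y. of_real ((2 * real (\<alpha> i) + 4) * C) * (complex_of_real \<bar>?h i y\<bar> + complex_of_real \<bar>?h' i y\<bar>)) \<in> L2"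
        by (intro L2_cmult L2_add L2_abs_gauss_poly hermite_fun_gauss_poly hermite_fun'_gauss_poly)
      then show ?thesis by (simp add: B_def)
    qed
    then have "tensor_c (\<lambda>i y. complex_of_real (B i y)) \<in> L2" by (rule tensor_c_L2)
    moreover have "tensor_c (\<lambda>i y. complex_of_real (B i y)) = (\<lambda>x. of_real (TB x))"
      by (rule ext) (simp add: tensor_c_def TB_def)
    ultimately have "(\<lambda>x. complex_of_real (TB x)) \<in> L2" by (simp only:)
    then have "integrable lborel (\<lambda>x. norm (v x * cnj (complex_of_real (TB x))))"
      by (intro integrable_norm L2_mult_integrable v)
    moreover have "0 \<le> TB x" for x unfolding TB_def by (intro prod_nonneg B0)
    ultimately show ?thesis by (simp add: norm_mult)
  qed
  have upd: "(if i = j then G m i (x $ i) else F m i (x $ i)) = ((F m)(j := G m j)) i (x $ i)" for m i j x by simp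
  have t_le: "\<bar>tensor_r f x\<bar> \<le> TB x" if "\<And>i y. \<bar>f i y\<bar> \<le> B i y" for f x
    unfolding tensor_r_def TB_def abs_prod by (intro prod_mono) (use that in auto)
  have lim_w: "(\<lambda>m. \<integral>x. w x * ?\<Psi> m x \<partial>lborel) \<longlonglongrightarrow> (\<integral>x. w x * of_real (tensor hermite_fun \<alpha> x) \<partial>lborel)"
  proof (rule integral_dominated_convergence[OF _ _ TB_int[OF w]])
    note [measurable] = tmeas[OF meas(1)]
    show "(\<lambda>x. w x * ?\<Psi> m x) \<in> borel_measurable lborel" for m by measurable
    show "(\<lambda>x. w x * of_real (tensor hermite_fun \<alpha> x)) \<in> borel_measurable lborel" by measurable
    show "AE x in lborel. (\<lambda>m. w x * ?\<Psi> m x) \<longlonglongrightarrow> w x * of_real (tensor hermite_fun \<alpha> x)"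
      unfolding tensor_r_def tensor_def by (intro AE_I2 tendsto_intros F_lim)
    show "AE x in lborel. norm (w x * ?\<Psi> m x) \<le> cmod (w x) * TB x" for m
      using t_le[OF F_le] by (intro AE_I2) (simp add: norm_mult mult_left_mono)
  qed
  let ?S = "\<lambda>m x. \<Sum>j\<in>UNIV. tensor_r ((F m)(j := G m j)) x"
  have ham: "- laplacian (?\<Psi> m) x + of_real ((norm x)\<^sup>2) * ?\<Psi> m x = of_real (?S m x)" for m x
    using hamiltonian_tensor_r[of "F m" "F1 m" "F2 m" x] F' F'' by (simp add: G_def[abs_def])
  have up_le: "\<bar>((F m)(j := G m j)) i y\<bar> \<le> B i y" for m j i y using F_le G_le by simp
  have lim_u: "(\<lambda>m. \<integral>x. u x * of_real (?S m x) \<partial>lborel)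
      \<longlonglongrightarrow> (\<integral>x. u x * of_real ((2 * real (multi_total \<alpha>) + real CARD('n)) * tensor hermite_fun \<alpha> x) \<partial>lborel)"
  proof (rule integral_dominated_convergence[OF _ _ integrable_mult_right[OF TB_int[OF u], of "real CARD('n)"]])
    have [measurable]: "tensor_r ((F m)(j := G m j)) \<in> borel_measurable borel" for m j
      by (rule tmeas) (use meas in simp)
    show "(\<lambda>x. u x * of_real (?S m x)) \<in> borel_measurable lborel" for m by measurable
    show "(\<lambda>x. u x * of_real ((2 * real (multi_total \<alpha>) + real CARD('n)) * tensor hermite_fun \<alpha> x)) \<in> borel_measurable lborel"
      by measurable
    show "AE x in lborel. (\<lambda>m. u x * of_real (?S m x))
        \<longlonglongrightarrow> u x * of_real ((2 * real (multi_total \<alpha>) + real CARD('n)) * tensor hermite_fun \<alpha> x)"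
    proof (rule AE_I2)
      fix x
      have "(\<lambda>m. tensor_r ((F m)(j := G m j)) x) \<longlonglongrightarrow> ((2 * real (\<alpha> j) + 1) * ?h j (x $ j)) * (\<Prod>i\<in>- {j}. ?h i (x $ i))" for j
        unfolding tensor_r_fun_upd by (intro tendsto_intros F_lim G_lim)
      then have "(\<lambda>m. ?S m x) \<longlonglongrightarrow> (\<Sum>j\<in>UNIV. ((2 * real (\<alpha> j) + 1) * ?h j (x $ j)) * (\<Prod>i\<in>- {j}. ?h i (x $ i)))"
        by (rule tendsto_sum)
      also have "(\<Sum>j\<in>UNIV. ((2 * real (\<alpha> j) + 1) * ?h j (x $ j)) * (\<Prod>i\<in>- {j}. ?h i (x $ i)))
          = (\<Sum>j\<in>UNIV. (2 * real (\<alpha> j) + 1) * tensor hermite_fun \<alpha> x)"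
      proof (intro sum.cong refl)
        fix j
        have "tensor hermite_fun \<alpha> x = ?h j (x $ j) * (\<Prod>i\<in>- {j}. ?h i (x $ i))"
          unfolding tensor_def by (rule prod_UNIV_split)
        then show "((2 * real (\<alpha> j) + 1) * ?h j (x $ j)) * (\<Prod>i\<in>- {j}. ?h i (x $ i)) = (2 * real (\<alpha> j) + 1) * tensor hermite_fun \<alpha> x"
          by (simp only: mult.assoc)
      qed
      also have "\<dots> = (2 * real (multi_total \<alpha>) + real CARD('n)) * tensor hermite_fun \<alpha> x"
        unfolding sum_distrib_right[symmetric] multi_eigenvalue ..
      finally show "(\<lambda>m. u x * of_real (?S m x)) \<longlonglongrightarrow> u x * of_real ((2 * real (multi_total \<alpha>) + real CARD('n)) * tensor hermite_fun \<alpha> x)"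
        by (intro tendsto_mult tendsto_const tendsto_of_real)
    qed
    show "AE x in lborel. norm (u x * of_real (?S m x)) \<le> real CARD('n) * (cmod (u x) * TB x)" for m
    proof (rule AE_I2)
      fix x
      have "\<bar>?S m x\<bar> \<le> (\<Sum>j\<in>(UNIV::'n set). TB x)"
        by (rule order_trans[OF sum_abs]) (intro sum_mono t_le up_le)
      then have "cmod (u x) * \<bar>?S m x\<bar> \<le> cmod (u x) * (real CARD('n) * TB x)"
        by (intro mult_left_mono) auto
      then show "norm (u x * of_real (?S m x)) \<le> real CARD('n) * (cmod (u x) * TB x)"
        by (simp only: norm_mult norm_of_real mult.left_commute)
    qed
  qed
  have "(\<integral>x. u x * of_real (?S m x) \<partial>lborel) = (\<integral>x. w x * ?\<Psi> m x \<partial>lborel)" for m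
    using weak[OF test[of m]] unfolding ham .
  then have "(\<integral>x. w x * of_real (tensor hermite_fun \<alpha> x) \<partial>lborel)
      = (\<integral>x. u x * of_real ((2 * real (multi_total \<alpha>) + real CARD('n)) * tensor hermite_fun \<alpha> x) \<partial>lborel)"
    using LIMSEQ_unique[OF lim_w] lim_u by simp
  also have "\<dots> = (\<integral>x. of_real (2 * real (multi_total \<alpha>) + real CARD('n)) * (u x * of_real (tensor hermite_fun \<alpha> x)) \<partial>lborel)"
    by (simp only: of_real_mult mult.left_commute)
  finally show ?thesis by (simp only: integral_mult_right_zero)
qed

section \<open>Hermite functions as weak eigenvectors of the oscillator\<close>

lemma has_derivative_zero_outside:
  fixes F :: "'a::real_normed_vector \<Rightarrow> 'b::real_normed_vector"
  assumes "(F has_derivative D) (at x)" "open S" "x \<in> S" "\<And>y. y \<in> S \<Longrightarrow> F y = 0"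
  shows "D = (\<lambda>h. 0)"
proof -
  have "((\<lambda>_. 0) has_derivative D) (at x)"
    by (rule has_derivative_transform_within_open[OF assms(1-3)]) (use assms(4) in auto)
  then show ?thesis using has_derivative_const has_derivative_unique by blast
qed

lemma integrable_compact_support:
  fixes f :: "'a::euclidean_space \<Rightarrow> complex"
  assumes "compact K" "continuous_on UNIV f" "\<And>x. x \<notin> K \<Longrightarrow> f x = 0"
  shows "integrable lborel f"
proof -
  have "integrable lborel (\<lambda>x. indicator K x *\<^sub>R f x)"
    by (rule borel_integrable_compact[OF assms(1) continuous_on_subset[OF assms(2)]]) simp
  moreover have "indicator K x *\<^sub>R f x = f x" for x using assms(3)[of x] by (cases "x \<in> K") auto
  ultimately show ?thesis by simp
qed

text \<open>By translation invariance the integrals of the difference quotients vanish.\<close>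

lemma integral_directional_derivative_zero:
  fixes F :: "'a::euclidean_space \<Rightarrow> complex"
  assumes d: "\<And>x. (F has_derivative F' x) (at x)" and cont: "continuous_on UNIV (\<lambda>x. F' x b)"
    and K: "compact K" "\<And>x. x \<notin> K \<Longrightarrow> F x = 0" and b: "b \<noteq> 0"
  shows "integrable lborel (\<lambda>x. F' x b)" "(\<integral>x. F' x b \<partial>lborel) = 0"
proof -
  have oK: "open (- K)" by (rule open_Compl[OF compact_imp_closed[OF K(1)]])
  have out: "F' x b = 0" if "x \<notin> K" for x
    using has_derivative_zero_outside[OF d oK, of x] that K(2) by simp
  show int': "integrable lborel (\<lambda>x. F' x b)" by (rule integrable_compact_support[OF K(1) cont out])
  have contF: "continuous_on UNIV F"
    using d has_derivative_continuous by (blast intro: continuous_at_imp_continuous_on)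
  have intF: "integrable lborel F" by (rule integrable_compact_support[OF K(1) contF K(2)])
  have "compact ((\<lambda>x. F' x b) ` K)"
    by (intro compact_continuous_image continuous_on_subset[OF cont] K(1)) simp
  then obtain C0 where C0: "\<And>y. y \<in> (\<lambda>x. F' x b) ` K \<Longrightarrow> norm y \<le> C0"
    using compact_imp_bounded bounded_iff by metis
  define C where "C = max 0 C0"
  have C: "norm (F' x b) \<le> C" for x
  proof (cases "x \<in> K")
    case True
    then have "norm (F' x b) \<le> C0" by (intro C0 imageI)
    then show ?thesis by (simp add: C_def)
  qed (simp add: out C_def)
  \<comment> \<open>The mean value inequality along \<open>b\<close> bounds all difference quotients
    uniformly, which gives the majorant for the limit.\<close>
  have mv: "norm (F (x + t *\<^sub>R b) - F x) \<le> C * t" if "0 \<le> t" for x t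
  proof -
    have "((\<lambda>s. F (x + s *\<^sub>R b)) has_derivative (\<lambda>h. F' (x + s *\<^sub>R b) (h *\<^sub>R b))) (at s within {0..t})" for s
    proof (rule has_derivative_at_withinI, rule has_derivative_compose[OF _ d])
      show "((\<lambda>s. x + s *\<^sub>R b) has_derivative (\<lambda>h. h *\<^sub>R b)) (at s)" by (auto intro!: derivative_eq_intros)
    qed
    moreover have "onorm (\<lambda>h. F' (x + s *\<^sub>R b) (h *\<^sub>R b)) \<le> C" for s
    proof (rule onorm_le)
      fix h
      have "F' (x + s *\<^sub>R b) (h *\<^sub>R b) = h *\<^sub>R F' (x + s *\<^sub>R b) b"
        by (rule linear_scale[OF has_derivative_linear[OF d]])
      then show "norm (F' (x + s *\<^sub>R b) (h *\<^sub>R b)) \<le> C * norm h"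
        using mult_right_mono[OF C[of "x + s *\<^sub>R b"], of "norm h"] by (simp add: mult.commute)
    qed
    ultimately have "norm (F (x + t *\<^sub>R b) - F (x + 0 *\<^sub>R b)) \<le> C * norm (t - 0)"
      using that by (intro differentiable_bound[of "{0..t}" "\<lambda>s. F (x + s *\<^sub>R b)"]) auto
    then show ?thesis using that by simp
  qed
  define e where "e n = 1 / real (Suc n)" for n
  have e: "0 < e n" "e n \<le> 1" for n by (auto simp: e_def)
  define q where "q n x = (F (x + e n *\<^sub>R b) - F x) /\<^sub>R e n" for n x
  \<comment> \<open>\<open>K\<close> together with its translates by \<open>- s b\<close> for
    \<open>0 <= s <= 1\<close>: every quotient with step at most 1 vanishes outside.\<close>
  define K' where "K' = K \<union> (\<lambda>(x, s). x - s *\<^sub>R b) ` (K \<times> {0..1::real})"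
  have cK': "compact K'"
    unfolding K'_def case_prod_unfold
    by (intro compact_Un K(1) compact_continuous_image compact_Times compact_Icc continuous_intros)
  have q_bound: "norm (q n x) \<le> C * indicator K' x" for n x
  proof (cases "x \<in> K'")
    case True
    have "norm (q n x) = norm (F (x + e n *\<^sub>R b) - F x) / e n"
      using e[of n] by (simp add: q_def divide_inverse mult.commute)
    also have "\<dots> \<le> C * e n / e n" using e[of n] by (intro divide_right_mono mv) auto
    finally show ?thesis using True e[of n] by simp
  next
    case False
    have "x + e n *\<^sub>R b \<notin> K"
    proof
      assume "x + e n *\<^sub>R b \<in> K"
      then have "(\<lambda>(x, s). x - s *\<^sub>R b) (x + e n *\<^sub>R b, e n) \<in> K'"
        unfolding K'_def using e[of n] by (intro UnI2 imageI) auto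
      then show False using False by simp
    qed
    moreover have "x \<notin> K" using False by (simp add: K'_def)
    ultimately show ?thesis using K(2) False by (simp add: q_def)
  qed
  have q_lim: "(\<lambda>n. q n x) \<longlonglongrightarrow> F' x b" for x
  proof -
    have "((\<lambda>h. norm (F (x + h) - F x - F' x h) / norm h) \<longlongrightarrow> 0) (at 0)"
      using d[of x] unfolding has_derivative_at by blast
    moreover have "filterlim (\<lambda>n. e n *\<^sub>R b) (at 0) sequentially"
    proof (rule filterlim_atI)
      have "(\<lambda>n. e n *\<^sub>R b) \<longlonglongrightarrow> 0 *\<^sub>R b" unfolding e_def by (intro tendsto_intros lim_1_over_n[THEN LIMSEQ_Suc])
      then show "(\<lambda>n. e n *\<^sub>R b) \<longlonglongrightarrow> 0" by simp
      show "\<forall>\<^sub>F n in sequentially. e n *\<^sub>R b \<noteq> 0" using b e(1) by (intro always_eventually) (simp add: less_imp_neq[symmetric])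
    qed
    ultimately have "(\<lambda>n. norm (F (x + e n *\<^sub>R b) - F x - F' x (e n *\<^sub>R b)) / norm (e n *\<^sub>R b)) \<longlonglongrightarrow> 0"
      by (rule filterlim_compose)
    from tendsto_mult_right[OF this, of "norm b"]
    have "(\<lambda>n. norm (F (x + e n *\<^sub>R b) - F x - F' x (e n *\<^sub>R b)) / norm (e n *\<^sub>R b) * norm b) \<longlonglongrightarrow> 0" by simp
    moreover have "norm (F (x + e n *\<^sub>R b) - F x - F' x (e n *\<^sub>R b)) / norm (e n *\<^sub>R b) * norm b = norm (q n x - F' x b)" for n
    proof -
      have "F' x (e n *\<^sub>R b) = e n *\<^sub>R F' x b" by (rule linear_scale[OF has_derivative_linear[OF d]])
      then have "F (x + e n *\<^sub>R b) - F x - F' x (e n *\<^sub>R b) = e n *\<^sub>R (q n x - F' x b)"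
        using e(1)[of n] by (simp add: q_def scaleR_diff_right)
      then show ?thesis using e(1)[of n] b by simp
    qed
    ultimately have "(\<lambda>n. norm (q n x - F' x b)) \<longlonglongrightarrow> 0" by simp
    then have "(\<lambda>n. q n x - F' x b) \<longlonglongrightarrow> 0" by (rule tendsto_norm_zero_cancel)
    then show ?thesis by (rule LIM_zero_cancel)
  qed
  have [measurable]: "F \<in> borel_measurable borel" by (rule borel_measurable_continuous_onI[OF contF])
  have shift: "integrable lborel (\<lambda>x. F (x + c)) \<and> (\<integral>x. F (x + c) \<partial>lborel) = (\<integral>x. F x \<partial>lborel)" for c
  proof -
    have m: "(+) c \<in> lborel \<rightarrow>\<^sub>M borel" by simp
    have "integrable (distr lborel borel ((+) c)) F" unfolding lborel_distr_plus by (rule intF)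
    then have "integrable lborel (\<lambda>x. F (c + x))" by (subst (asm) integrable_distr_eq) simp_all
    moreover have "(\<integral>x. F x \<partial>distr lborel borel ((+) c)) = (\<integral>x. F (c + x) \<partial>lborel)"
      by (rule integral_distr[OF m]) simp
    ultimately show ?thesis unfolding lborel_distr_plus by (simp add: add.commute)
  qed
  have q_int: "(\<integral>x. q n x \<partial>lborel) = 0" for n
    unfolding q_def using shift[of "e n *\<^sub>R b"] intF by simp
  have "(\<lambda>n. \<integral>x. q n x \<partial>lborel) \<longlonglongrightarrow> (\<integral>x. F' x b \<partial>lborel)"
  proof (rule integral_dominated_convergence[where w = "\<lambda>x. C * indicator K' x"])
    show "(\<lambda>x. F' x b) \<in> borel_measurable lborel" using int' by (rule borel_measurable_integrable)
    show "q n \<in> borel_measurable lborel" for n unfolding q_def[abs_def] by measurable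
    show "integrable lborel (\<lambda>x. C * indicator K' x)"
      using emeasure_compact_finite[OF cK'] compact_imp_closed[OF cK']
      by (intro integrable_mult_right integrable_real_indicator) auto
  qed (use q_lim q_bound in auto)
  then show "(\<integral>x. F' x b \<partial>lborel) = 0" unfolding q_int by (simp add: LIMSEQ_const_iff)
qed

text \<open>Green's identity. In each coordinate, with \<open>D\<close> the partial derivative,
  \<open>H D D \<phi> - (D D H) \<phi>\<close> is the derivative of
  \<open>H D \<phi> - (D H) \<phi>\<close>, which has compact support, so it integrates to 0;
  summing over the coordinates uses the eigenvalue equations of the factors.\<close>

lemma hermite_in_harmonic_oscillator:
  fixes \<alpha> :: "'n::finite \<Rightarrow> nat"
  shows "((\<lambda>x. of_real (tensor hermite_fun \<alpha> x)),
      (\<lambda>x. of_real (2 * real (multi_total \<alpha>) + real CARD('n)) * of_real (tensor hermite_fun \<alpha> x))) \<in> harmonic_oscillator"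
proof -
  let ?l = "complex_of_real (2 * real (multi_total \<alpha>) + real CARD('n))"
  let ?f = "\<lambda>i. hermite_fun (\<alpha> i)" and ?f' = "\<lambda>i. hermite_fun' (\<alpha> i)"
  let ?f'' = "\<lambda>i y. (y\<^sup>2 - (2 * real (\<alpha> i) + 1)) * hermite_fun (\<alpha> i) y"
  let ?H = "\<lambda>x. complex_of_real (tensor hermite_fun \<alpha> x)"
  let ?Hj = "\<lambda>j x. complex_of_real (tensor_r (?f(j := ?f' j)) x)"
  let ?Hjj = "\<lambda>j x. complex_of_real (((x $ j)\<^sup>2 - (2 * real (\<alpha> j) + 1)) * tensor hermite_fun \<alpha> x)"
  have H1: "(?H has_derivative frechet_derivative ?H (at x)) (at x)"
    and p1: "partial_deriv (axis j 1) ?H = ?Hj j" for x j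
  proof -
    have "?H differentiable (at x)"
      unfolding differentiable_def tensor_eq_tensor_r
      using tensor_r_has_derivative[where F = ?f and F' = ?f', OF hermite_fun_deriv] by blast
    then show "(?H has_derivative frechet_derivative ?H (at x)) (at x)" by (simp add: frechet_derivative_works)
    show "partial_deriv (axis j 1) ?H = ?Hj j"
      unfolding tensor_eq_tensor_r by (rule partial_deriv_tensor_r) (rule hermite_fun_deriv)
  qed
  have D2: "((?f(j := ?f' j)) i has_real_derivative (?f'(j := ?f'' j)) i y) (at y)" for i j y
    using hermite_fun_deriv[of "\<alpha> i" y] hermite_fun'_deriv[of "\<alpha> j" y] by simp
  have H2: "(?Hj j has_derivative frechet_derivative (?Hj j) (at x)) (at x)"
    and p2: "partial_deriv (axis j 1) (?Hj j) = ?Hjj j" for x j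
  proof -
    have "?Hj j differentiable (at x)"
      unfolding differentiable_def
      using tensor_r_has_derivative[where F = "?f(j := ?f' j)" and F' = "?f'(j := ?f'' j)", OF D2] by blast
    then show "(?Hj j has_derivative frechet_derivative (?Hj j) (at x)) (at x)" by (simp add: frechet_derivative_works)
    have "partial_deriv (axis j 1) (?Hj j)
        = (\<lambda>x. of_real (tensor_r ((?f(j := ?f' j))(j := (?f'(j := ?f'' j)) j)) x))"
      by (rule partial_deriv_tensor_r) (rule D2)
    also have "\<dots> = ?Hjj j"
    proof
      fix x
      have "tensor_r ((?f(j := ?f' j))(j := (?f'(j := ?f'' j)) j)) x = ?f'' j (x $ j) * (\<Prod>i\<in>- {j}. ?f i (x $ i))"
        by (simp add: tensor_r_fun_upd)
      also have "\<dots> = ((x $ j)\<^sup>2 - (2 * real (\<alpha> j) + 1)) * tensor hermite_fun \<alpha> x"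
        unfolding tensor_def by (subst prod_UNIV_split[of _ j]) (simp only: mult.assoc)
      finally show "complex_of_real (tensor_r ((?f(j := ?f' j))(j := (?f'(j := ?f'' j)) j)) x) = ?Hjj j x" by simp
    qed
    finally show "partial_deriv (axis j 1) (?Hj j) = ?Hjj j" .
  qed
  have cont_H: "continuous_on UNIV ?H" "continuous_on UNIV (?Hj j)" "continuous_on UNIV (?Hjj j)" for j
  proof -
    show h: "continuous_on UNIV ?H" and "continuous_on UNIV (?Hj j)"
      using H1 H2 has_derivative_continuous by (blast intro: continuous_at_imp_continuous_on)+
    have "continuous_on UNIV (\<lambda>x. complex_of_real ((x $ j)\<^sup>2 - (2 * real (\<alpha> j) + 1)) * ?H x)"
      by (intro continuous_intros h)
    then show "continuous_on UNIV (?Hjj j)" by simp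
  qed
  have "(\<integral>x. ?H x * (- laplacian \<phi> x + of_real ((norm x)\<^sup>2) * \<phi> x) \<partial>lborel) = (\<integral>x. ?l * ?H x * \<phi> x \<partial>lborel)"
    if \<phi>: "test_function \<phi>" for \<phi> :: "real ^ 'n \<Rightarrow> complex"
  proof -
    define K where "K = closure {x. \<phi> x \<noteq> 0}"
    have K: "compact K" using \<phi> by (simp add: test_function_def K_def)
    have \<phi>0: "\<phi> x = 0" if "x \<notin> K" for x using that closure_subset[of "{x. \<phi> x \<noteq> 0}"] unfolding K_def by blast
    let ?p = "\<lambda>j. partial_deriv (axis j 1) \<phi>"
    let ?pp = "\<lambda>j. partial_deriv (axis j 1) (?p j)"
    have ax: "axis j 1 \<in> (Basis :: (real ^ 'n) set)" for j unfolding Basis_vec_real by auto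
    have sm: "foldr partial_deriv bs \<phi> differentiable (at x)" if "set bs \<subseteq> Basis" for bs x
      using \<phi> that by (auto simp: test_function_def smooth_def)
    have dd: "(\<phi> has_derivative frechet_derivative \<phi> (at x)) (at x)"
      "(?p j has_derivative frechet_derivative (?p j) (at x)) (at x)"
      "(?pp j has_derivative frechet_derivative (?pp j) (at x)) (at x)" for x j
      using sm[of "[]" x] sm[of "[axis j 1]" x] sm[of "[axis j 1, axis j 1]" x] ax[of j]
      by (simp_all add: frechet_derivative_works)
    have cont: "continuous_on UNIV \<phi>" "continuous_on UNIV (?p j)" "continuous_on UNIV (?pp j)" for j
      using dd has_derivative_continuous by (blast intro: continuous_at_imp_continuous_on)+
    have oK: "open (- K)" by (rule open_Compl[OF compact_imp_closed[OF K]])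
    have p0: "?p j x = 0" if "x \<notin> K" for x j
      using has_derivative_zero_outside[OF dd(1) oK, of x] that \<phi>0 by (simp add: partial_deriv_def)
    \<comment> \<open>The flux in Green's identity; in its derivative along axis \<open>j\<close>
      the products of first derivatives cancel.\<close>
    let ?F = "\<lambda>j x. ?H x * ?p j x - ?Hj j x * \<phi> x"
    let ?F' = "\<lambda>j x h. ?H x * frechet_derivative (?p j) (at x) h + frechet_derivative ?H (at x) h * ?p j x
        - (?Hj j x * frechet_derivative \<phi> (at x) h + frechet_derivative (?Hj j) (at x) h * \<phi> x)"
    have F': "(?F j has_derivative ?F' j x) (at x)" for j x
      by (intro has_derivative_diff has_derivative_mult H1 H2 dd)
    have F'_eq: "?F' j x (axis j 1) = ?H x * ?pp j x - ?Hjj j x * \<phi> x" for j x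
    proof -
      have "frechet_derivative (?p j) (at x) (axis j 1) = ?pp j x" by (simp add: partial_deriv_def)
      moreover have "frechet_derivative ?H (at x) (axis j 1) = ?Hj j x"
        using fun_cong[OF p1[of j], of x] by (simp add: partial_deriv_def)
      moreover have "frechet_derivative \<phi> (at x) (axis j 1) = ?p j x" by (simp add: partial_deriv_def)
      moreover have "frechet_derivative (?Hj j) (at x) (axis j 1) = ?Hjj j x"
        using fun_cong[OF p2[of j], of x] by (simp only: partial_deriv_def)
      ultimately show ?thesis by (simp only:) simp
    qed
    have cF': "continuous_on UNIV (\<lambda>x. ?F' j x (axis j 1))" for j
      unfolding F'_eq by (intro continuous_on_diff continuous_on_mult cont_H cont)
    have F0: "?F j x = 0" if "x \<notin> K" for j x using p0[OF that] \<phi>0[OF that] by simp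
    have ax0: "axis j (1::real) \<noteq> 0" for j :: 'n by (simp add: axis_eq_0_iff)
    have Z: "integrable lborel (\<lambda>x. ?H x * ?pp j x - ?Hjj j x * \<phi> x)"
      "(\<integral>x. ?H x * ?pp j x - ?Hjj j x * \<phi> x \<partial>lborel) = 0" for j
    proof -
      note Z' = integral_directional_derivative_zero[where F = "?F j" and F' = "?F' j" and b = "axis j 1", OF F' cF' K]
      show "integrable lborel (\<lambda>x. ?H x * ?pp j x - ?Hjj j x * \<phi> x)"
        unfolding F'_eq[symmetric] by (rule Z'(1)[OF _ ax0]) (rule F0)
      show "(\<integral>x. ?H x * ?pp j x - ?Hjj j x * \<phi> x \<partial>lborel) = 0"
        unfolding F'_eq[symmetric] by (rule Z'(2)[OF _ ax0]) (rule F0)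
    qed
    have "(\<integral>x. (\<Sum>j\<in>UNIV. ?H x * ?pp j x - ?Hjj j x * \<phi> x) \<partial>lborel) = 0"
      by (subst Bochner_Integration.integral_sum, rule Z(1)) (simp only: Z(2) sum.neutral_const)
    moreover have "(\<Sum>j\<in>UNIV. ?H x * ?pp j x - ?Hjj j x * \<phi> x)
        = ?l * ?H x * \<phi> x - ?H x * (- laplacian \<phi> x + of_real ((norm x)\<^sup>2) * \<phi> x)" for x
    proof -
      have "(\<Sum>j\<in>UNIV. ?Hjj j x) = of_real (((norm x)\<^sup>2 - (2 * real (multi_total \<alpha>) + real CARD('n))) * tensor hermite_fun \<alpha> x)"
        unfolding norm_vec_square multi_eigenvalue[symmetric] sum_subtractf[symmetric] sum_distrib_right of_real_sum ..
      moreover have "laplacian \<phi> x = (\<Sum>j\<in>UNIV. ?pp j x)"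
        unfolding laplacian_def Basis_vec_real sum.reindex[OF inj_axis_one] by simp
      ultimately show ?thesis
        by (simp add: sum_subtractf sum_distrib_left[symmetric] sum_distrib_right[symmetric] algebra_simps del: of_real_diff)
          (simp add: algebra_simps)
    qed
    ultimately have "(\<integral>x. ?l * ?H x * \<phi> x - ?H x * (- laplacian \<phi> x + of_real ((norm x)\<^sup>2) * \<phi> x) \<partial>lborel) = 0"
      by simp
    moreover have "integrable lborel (\<lambda>x. ?l * ?H x * \<phi> x)"
      by (rule integrable_compact_support[OF K]) (use \<phi>0 in \<open>auto intro!: continuous_on_mult continuous_on_const cont_H cont\<close>)
    moreover have "integrable lborel (\<lambda>x. ?H x * (- laplacian \<phi> x + of_real ((norm x)\<^sup>2) * \<phi> x))"
    proof (rule integrable_compact_support[OF K])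
      have "continuous_on UNIV (laplacian \<phi>)"
        unfolding laplacian_def[abs_def] Basis_vec_real sum.reindex[OF inj_axis_one] comp_def
        by (intro continuous_on_sum cont)
      then show "continuous_on UNIV (\<lambda>x. ?H x * (- laplacian \<phi> x + of_real ((norm x)\<^sup>2) * \<phi> x))"
        by (intro continuous_intros cont_H cont)
      have pp0: "?pp j x = 0" if "x \<notin> K" for x j
        using has_derivative_zero_outside[OF dd(2) oK, of x j] that p0 by (simp add: partial_deriv_def[of _ "?p j"])
      show "?H x * (- laplacian \<phi> x + of_real ((norm x)\<^sup>2) * \<phi> x) = 0" if "x \<notin> K" for x
        unfolding laplacian_def Basis_vec_real sum.reindex[OF inj_axis_one] using pp0[OF that] \<phi>0[OF that] by simp
    qed
    ultimately show ?thesis by simp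
  qed
  then show ?thesis
    unfolding harmonic_oscillator_def using tensor_hermite_L2[of \<alpha>] L2_cmult[OF tensor_hermite_L2[of \<alpha>], of ?l] by auto
qed

section \<open>The Schroedinger flow of spectrally localized functions\<close>

definition hermite_coef :: "(real ^ 'n::finite \<Rightarrow> complex) \<Rightarrow> ('n \<Rightarrow> nat) \<Rightarrow> complex" where
  "hermite_coef u \<alpha> = L2_inner u (\<lambda>x. of_real (tensor hermite_fun \<alpha> x))"

abbreviation oscillator_eigenvalue :: "('n::finite \<Rightarrow> nat) \<Rightarrow> real" where
  "oscillator_eigenvalue (\<alpha> :: 'n \<Rightarrow> nat) \<equiv> 2 * real (multi_total \<alpha>) + real CARD('n)"

lemma coef_hermite_basis: "hermite_vec.coef u j = hermite_coef u (multi_index j)"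
  unfolding hermite_vec.coef_def hermite_coef_def unfolding hermite_basis_def[abs_def] ..

lemma multi_index_cases:
  fixes \<alpha> :: "'n::finite \<Rightarrow> nat"
  obtains j where "\<alpha> = multi_index j"
  using bij_multi_index[where 'n = 'n] by (metis bij_pointE)

lemma ae_eq_iff_hermite_coef:
  fixes u v :: "real ^ 'n::finite \<Rightarrow> complex"
  assumes "u \<in> L2" "v \<in> L2"
  shows "ae_eq u v \<longleftrightarrow> (\<forall>\<alpha>. hermite_coef u \<alpha> = hermite_coef v \<alpha>)"
  unfolding hermite_vec.ae_eq_iff_coef[OF assms] coef_hermite_basis by (metis multi_index_cases)

lemma hermite_coef_cmult: "hermite_coef (\<lambda>x. c * u x) \<alpha> = c * hermite_coef u \<alpha>"
  unfolding hermite_coef_def by (rule L2_inner_cmult)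

lemma hermite_coef_diff:
  "u \<in> L2 \<Longrightarrow> v \<in> L2 \<Longrightarrow> hermite_coef (\<lambda>x. u x - v x) \<alpha> = hermite_coef u \<alpha> - hermite_coef v \<alpha>"
  unfolding hermite_coef_def by (intro L2_inner_diff tensor_hermite_L2)

lemma wave_L2: "wave L c t \<in> L2"
  unfolding wave_def[abs_def] by (intro L2_sum L2_cmult tensor_hermite_L2)

lemma hermite_coef_wave:
  "hermite_coef (wave L c t) \<alpha> = (if \<alpha> \<in> multi_box L then c \<alpha> * cis (2 * t * real (multi_total \<alpha>)) else 0)"
proof -
  have "hermite_coef (wave L c t) \<alpha> = (\<Sum>\<beta>\<in>multi_box L. c \<beta> * cis (2 * t * real (multi_total \<beta>)) *
      L2_inner (\<lambda>x. of_real (tensor hermite_fun \<beta> x)) (\<lambda>x. of_real (tensor hermite_fun \<alpha> x)))"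
    unfolding hermite_coef_def wave_def[abs_def]
    by (subst L2_inner_sum) (intro L2_cmult tensor_hermite_L2, rule tensor_hermite_L2, simp only: L2_inner_cmult)
  then show ?thesis by (simp add: tensor_hermite_inner sum.delta if_distrib finite_multi_box cong: if_cong)
qed

lemma L2_sq_wave:
  fixes c :: "('n::finite \<Rightarrow> nat) \<Rightarrow> complex"
  shows "L2_sq (wave L c t) = coeff_norm2 L c"
proof -
  have "complex_of_real (L2_sq (wave L c t)) = (\<Sum>\<alpha>\<in>multi_box L. c \<alpha> * cis (2 * t * real (multi_total \<alpha>)) *
      cnj (hermite_coef (wave L c t) \<alpha>))"
    unfolding L2_inner_self[symmetric]
    by (subst (1) wave_def[abs_def], subst L2_inner_sum)
      (intro L2_cmult tensor_hermite_L2, rule wave_L2,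
        simp only: L2_inner_cmult hermite_coef_def L2_inner_cnj[of "\<lambda>x. of_real (tensor hermite_fun _ x)"])
  also have "\<dots> = (\<Sum>\<alpha>\<in>multi_box L. of_real ((cmod (c \<alpha>))\<^sup>2))"
  proof (rule sum.cong[OF refl])
    fix \<alpha> :: "'n \<Rightarrow> nat" assume \<alpha>: "\<alpha> \<in> multi_box L"
    let ?z = "c \<alpha> * cis (2 * t * real (multi_total \<alpha>))"
    have "?z * cnj ?z = of_real ((cmod ?z)\<^sup>2)" by (rule complex_norm_square[symmetric])
    then show "?z * cnj (hermite_coef (wave L c t) \<alpha>) = of_real ((cmod (c \<alpha>))\<^sup>2)"
      using \<alpha> by (simp add: hermite_coef_wave norm_mult)
  qed
  finally show ?thesis unfolding of_real_sum[symmetric] of_real_eq_iff .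
qed

context
  fixes \<eta> :: "real \<Rightarrow> real"
  assumes \<eta>: "test_function \<eta>" "\<And>s. s \<in> {0..1} \<Longrightarrow> \<eta> s = 1" "\<And>s. s \<ge> 2 \<Longrightarrow> \<eta> s = 0"
begin

text \<open>The choice has a witness: the diagonal calculus of the Hermite basis, admissible because
  \<open>harmonic_oscillator_coef\<close> describes every pair of the graph on coefficients. The
  cutoffs needed there are made from \<open>\<eta>\<close>.\<close>

lemma is_functional_calculus_harmonic_oscillator:
  "is_functional_calculus harmonic_oscillator
    (functional_calculus (harmonic_oscillator :: ((real ^ 'n::finite \<Rightarrow> complex) \<times> _) set))"
  unfolding functional_calculus_def
proof (rule someI[of "is_functional_calculus harmonic_oscillator"], rule hermite_vec.is_functional_calculus_calculus)
  fix u w :: "real ^ 'n \<Rightarrow> complex" assume uw: "(u, w) \<in> harmonic_oscillator"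
  then have "u \<in> L2" "w \<in> L2" by (auto simp: harmonic_oscillator_def)
  moreover have "hermite_coef w \<alpha> = of_real (oscillator_eigenvalue \<alpha>) * hermite_coef u \<alpha>" for \<alpha>
    using harmonic_oscillator_coef[OF \<eta> uw, of \<alpha>] unfolding hermite_coef_def L2_inner_def complex_cnj_complex_of_real .
  ultimately show "u \<in> L2 \<and> w \<in> L2 \<and> (\<forall>j. hermite_vec.coef w j
      = of_real (oscillator_eigenvalue (multi_index j :: 'n \<Rightarrow> nat)) * hermite_vec.coef u j)"
    unfolding coef_hermite_basis by blast
qed

text \<open>Whatever calculus was chosen, the Hermite functions are eigenvectors in the graph, and
  \<open>calculus_coef\<close> fixes its action on coefficients.\<close>

lemma harmonic_oscillator_calculus:
  fixes u :: "real ^ 'n::finite \<Rightarrow> complex"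
  assumes h: "h \<in> bounded_borel" and u: "u \<in> L2"
  shows "functional_calculus harmonic_oscillator h u \<in> L2"
    and "hermite_coef (functional_calculus harmonic_oscillator h u) \<alpha> = h (oscillator_eigenvalue \<alpha>) * hermite_coef u \<alpha>"
proof -
  let ?\<Phi> = "functional_calculus (harmonic_oscillator :: ((real ^ 'n::finite \<Rightarrow> complex) \<times> _) set)"
  interpret abstract_calculus harmonic_oscillator ?\<Phi>
    by unfold_locales (rule is_functional_calculus_harmonic_oscillator)
  show "?\<Phi> h u \<in> L2" by (rule calc_L2[OF h u])
  obtain j where j: "\<alpha> = multi_index j" by (rule multi_index_cases)
  have "(hermite_basis j :: real ^ 'n \<Rightarrow> complex,
      \<lambda>x. of_real (oscillator_eigenvalue (multi_index j :: 'n \<Rightarrow> nat)) * hermite_basis j x)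
      \<in> harmonic_oscillator" for j
    unfolding hermite_basis_def[abs_def] by (rule hermite_in_harmonic_oscillator)
  from hermite_vec.calculus_coef[OF is_functional_calculus_harmonic_oscillator this h u, of j]
  show "hermite_coef (?\<Phi> h u) \<alpha> = h (oscillator_eigenvalue \<alpha>) * hermite_coef u \<alpha>"
    unfolding coef_hermite_basis j .
qed

lemma bounded_borel_cutoff: "(\<lambda>s. complex_of_real (\<eta> (a * s))) \<in> bounded_borel"
proof -
  have cont: "continuous_on UNIV \<eta>"
    using \<eta>(1) by (intro smooth1_continuous smooth_imp_smooth1) (simp add: test_function_def)
  have "bounded (closure {x. \<eta> x \<noteq> 0})" using \<eta>(1) by (simp add: test_function_def compact_imp_bounded)
  then obtain b where b: "\<And>x. x \<in> closure {x. \<eta> x \<noteq> 0} \<Longrightarrow> norm x \<le> b" unfolding bounded_iff by blast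
  have "\<eta> x = 0" if "\<bar>x\<bar> > b" for x
    using b[of x] closure_subset[of "{x. \<eta> x \<noteq> 0}"] that by force
  then obtain K where K: "\<And>x. \<bar>\<eta> x\<bar> \<le> K" using bounded_if_zero_outside[OF cont] by blast
  have [measurable]: "\<eta> \<in> borel_measurable borel" by (rule borel_measurable_continuous_onI[OF cont])
  show ?thesis by (rule bounded_borelI[where K = K]) (use K in auto)
qed

lemma
  fixes u :: "real ^ 'n::finite \<Rightarrow> complex"
  assumes u: "u \<in> L2"
  shows freq_localization_L2: "freq_localization \<eta> N u \<in> L2"
    and hermite_coef_freq_localization: "hermite_coef (freq_localization \<eta> N u) \<alpha>
      = (\<eta> (oscillator_eigenvalue \<alpha> / (real N)\<^sup>2) - \<eta> (4 * oscillator_eigenvalue \<alpha> / (real N)\<^sup>2)) * hermite_coef u \<alpha>"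
proof -
  have h: "(\<lambda>s. complex_of_real (\<eta> (s / (real N)\<^sup>2))) \<in> bounded_borel"
    "(\<lambda>s. complex_of_real (\<eta> (4 * s / (real N)\<^sup>2))) \<in> bounded_borel"
    using bounded_borel_cutoff[of "1 / (real N)\<^sup>2"] bounded_borel_cutoff[of "4 / (real N)\<^sup>2"] by simp_all
  note L = harmonic_oscillator_calculus(1)[OF h(1) u] harmonic_oscillator_calculus(1)[OF h(2) u]
  show "freq_localization \<eta> N u \<in> L2"
    unfolding freq_localization_def[abs_def] by (intro L2_diff L)
  show "hermite_coef (freq_localization \<eta> N u) \<alpha>
      = (\<eta> (oscillator_eigenvalue \<alpha> / (real N)\<^sup>2) - \<eta> (4 * oscillator_eigenvalue \<alpha> / (real N)\<^sup>2)) * hermite_coef u \<alpha>"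
    unfolding freq_localization_def hermite_coef_diff[OF L] harmonic_oscillator_calculus(2)[OF h(1) u]
      harmonic_oscillator_calculus(2)[OF h(2) u] by (simp add: left_diff_distrib)
qed

text \<open>Both cutoffs equal 1 as long as the eigenvalue is at most \<open>N^2/4\<close>, and both
  vanish from \<open>2 N^2\<close> on. An eigenvalue below \<open>2 N^2\<close> keeps every entry of
  \<open>\<alpha>\<close> below \<open>N^2\<close>, which explains the box.\<close>

lemma hermite_coef_freq_localization_support:
  fixes u :: "real ^ 'n::finite \<Rightarrow> complex"
  assumes u: "u \<in> L2" and N: "1 \<le> N" and nz: "hermite_coef (freq_localization \<eta> N u) \<alpha> \<noteq> 0"
  shows "(real N)\<^sup>2 / 4 < oscillator_eigenvalue \<alpha>" "\<alpha> \<in> multi_box (N\<^sup>2)"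
proof -
  let ?l = "oscillator_eigenvalue \<alpha>"
  have N': "0 < (real N)\<^sup>2" using N by simp
  have nz': "\<eta> (?l / (real N)\<^sup>2) - \<eta> (4 * ?l / (real N)\<^sup>2) \<noteq> 0"
    using nz unfolding hermite_coef_freq_localization[OF u] by auto
  show "(real N)\<^sup>2 / 4 < ?l"
  proof (rule ccontr)
    assume "\<not> ?thesis"
    then have "?l / (real N)\<^sup>2 \<in> {0..1}" "4 * ?l / (real N)\<^sup>2 \<in> {0..1}"
      using N' by (auto simp: divide_le_eq)
    then show False using nz' \<eta>(2) by simp
  qed
  have "?l < 2 * (real N)\<^sup>2"
  proof (rule ccontr)
    assume "\<not> ?thesis"
    then have "2 \<le> ?l / (real N)\<^sup>2" "2 \<le> 4 * ?l / (real N)\<^sup>2"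
      using N' by (auto simp: le_divide_eq)
    then show False using nz' \<eta>(3) by simp
  qed
  then have "real (multi_total \<alpha>) \<le> real (N\<^sup>2)" unfolding of_nat_power by linarith
  then have "multi_total \<alpha> \<le> N\<^sup>2" by (simp only: of_nat_le_iff)
  moreover have "\<alpha> i \<le> multi_total \<alpha>" for i
    unfolding multi_total_def by (rule member_le_sum) auto
  ultimately show "\<alpha> \<in> multi_box (N\<^sup>2)" unfolding multi_box_def using order_trans by blast
qed

text \<open>The eigenvalue phase splits into \<open>cis(t d)\<close> and the phase in
  \<open>wave\<close>, and coefficients outside the box vanish. The norm is read off from the wave
  at time 0.\<close>

lemma flow_freq_localization:
  fixes u :: "real ^ 'n::finite \<Rightarrow> complex"
  assumes u: "u \<in> L2" and N: "1 \<le> N"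
  defines "w \<equiv> freq_localization \<eta> N u"
  shows "ae_eq (schroedinger_flow t w) (\<lambda>x. cis (t * real CARD('n)) * wave (N\<^sup>2) (hermite_coef w) t x)"
    and "L2_norm w = ennreal (sqrt (coeff_norm2 (N\<^sup>2) (hermite_coef w)))"
proof -
  have w: "w \<in> L2" unfolding w_def by (rule freq_localization_L2[OF u])
  have supp: "\<alpha> \<in> multi_box (N\<^sup>2)" if "hermite_coef w \<alpha> \<noteq> 0" for \<alpha>
    using hermite_coef_freq_localization_support(2)[OF u N] that unfolding w_def by blast
  have h: "(\<lambda>s. exp (\<i> * of_real (t * s))) \<in> bounded_borel"
    by (rule bounded_borelI[where K = 1])
      (auto intro!: borel_measurable_continuous_onI continuous_intros simp: norm_exp_i_times[of "t * _", simplified])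
  show "ae_eq (schroedinger_flow t w) (\<lambda>x. cis (t * real CARD('n)) * wave (N\<^sup>2) (hermite_coef w) t x)"
    unfolding schroedinger_flow_def
  proof (subst ae_eq_iff_hermite_coef, rule harmonic_oscillator_calculus(1)[OF h w], rule L2_cmult[OF wave_L2], rule allI)
    fix \<alpha> :: "'n \<Rightarrow> nat"
    have "exp (\<i> * of_real (t * oscillator_eigenvalue \<alpha>)) = cis (t * real CARD('n)) * cis (2 * t * real (multi_total \<alpha>))"
      unfolding cis_conv_exp[symmetric] cis_mult by (simp add: algebra_simps)
    then show "hermite_coef (functional_calculus harmonic_oscillator (\<lambda>s. exp (\<i> * of_real (t * s))) w) \<alpha>
        = hermite_coef (\<lambda>x. cis (t * real CARD('n)) * wave (N\<^sup>2) (hermite_coef w) t x) \<alpha>"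
      unfolding harmonic_oscillator_calculus(2)[OF h w] hermite_coef_cmult hermite_coef_wave using supp[of \<alpha>] by auto
  qed
  have "ae_eq w (wave (N\<^sup>2) (hermite_coef w) 0)"
    unfolding ae_eq_iff_hermite_coef[OF w wave_L2] hermite_coef_wave using supp by auto
  then show "L2_norm w = ennreal (sqrt (coeff_norm2 (N\<^sup>2) (hermite_coef w)))"
    by (simp only: L2_norm_cong L2_norm_eq[OF wave_L2] L2_sq_wave)
qed

text \<open>At each time the flows are waves up to phases of modulus one, so the space-time bound
  for waves applies to the squared norm, and the square root is taken.\<close>

lemma flow_mult_bound:
  assumes card: "2 \<le> CARD('n::finite)"
  obtains C where "C > 0"
    "\<And>N M (u :: real ^ 'n \<Rightarrow> complex) v. 1 \<le> M \<Longrightarrow> M \<le> N \<Longrightarrow> u \<in> L2 \<Longrightarrow> v \<in> L2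
      \<Longrightarrow> L2_L2_norm {-1..1} (\<lambda>t x. schroedinger_flow t (freq_localization \<eta> N v) x *
            schroedinger_flow t (freq_localization \<eta> M u) x)
        \<le> ennreal (C * sqrt (real M ^ (CARD('n) - 2) * (real M / real N)))
          * L2_norm (freq_localization \<eta> N v) * L2_norm (freq_localization \<eta> M u)"
proof -
  obtain C where C: "C > 0" and bound: "\<And>N M (c :: ('n \<Rightarrow> nat) \<Rightarrow> complex) d. 1 \<le> M \<Longrightarrow> M \<le> N
      \<Longrightarrow> (\<And>\<alpha>. c \<alpha> \<noteq> 0 \<Longrightarrow> (real N)\<^sup>2 / 4 < oscillator_eigenvalue \<alpha>)
      \<Longrightarrow> (\<integral>\<^sup>+t. \<integral>\<^sup>+x. ennreal ((cmod (wave (N\<^sup>2) c t x * wave (M\<^sup>2) d t x))\<^sup>2) \<partial>lborel \<partial>time_interval)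
        \<le> ennreal (C * (real M ^ (CARD('n) - 2) * (real M / real N)) * coeff_norm2 (N\<^sup>2) c * coeff_norm2 (M\<^sup>2) d)"
    using wave_mult_bound[OF card] by blast
  show ?thesis
  proof (rule that[of "sqrt C"])
    fix N M :: nat and u v :: "real ^ 'n \<Rightarrow> complex"
    assume M: "1 \<le> M" and MN: "M \<le> N" and u: "u \<in> L2" and v: "v \<in> L2"
    have N: "1 \<le> N" using M MN by simp
    let ?v = "freq_localization \<eta> N v" and ?u = "freq_localization \<eta> M u"
    let ?c = "hermite_coef ?v" and ?d = "hermite_coef ?u"
    let ?R = "real M ^ (CARD('n) - 2) * (real M / real N)"
    let ?B = "sqrt C * sqrt ?R * sqrt (coeff_norm2 (N\<^sup>2) ?c) * sqrt (coeff_norm2 (M\<^sup>2) ?d)"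
    have nn: "0 \<le> ?R" "0 \<le> coeff_norm2 (N\<^sup>2) ?c" "0 \<le> coeff_norm2 (M\<^sup>2) ?d" by (auto intro: sum_nonneg)
    have eq: "(L2_norm (\<lambda>x. schroedinger_flow t ?v x * schroedinger_flow t ?u x))\<^sup>2
        = (\<integral>\<^sup>+x. ennreal ((cmod (wave (N\<^sup>2) ?c t x * wave (M\<^sup>2) ?d t x))\<^sup>2) \<partial>lborel)" for t
    proof -
      let ?e = "cis (t * real CARD('n))"
      have "ae_eq (\<lambda>x. schroedinger_flow t ?v x * schroedinger_flow t ?u x)
          (\<lambda>x. (?e * wave (N\<^sup>2) ?c t x) * (?e * wave (M\<^sup>2) ?d t x))"
        using flow_freq_localization(1)[OF v N, of t] flow_freq_localization(1)[OF u M, of t]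
        unfolding ae_eq_def by eventually_elim (simp only:)
      from L2_norm_cong[OF this] show ?thesis
        by (simp only: L2_norm_square norm_mult norm_cis mult_1_left)
    qed
    have "L2_L2_norm {-1..1} (\<lambda>t x. schroedinger_flow t ?v x * schroedinger_flow t ?u x) \<le> ennreal ?B"
      unfolding L2_L2_norm_def
    proof (rule L2_norm_on_le)
      have "(\<integral>\<^sup>+t. \<integral>\<^sup>+x. ennreal ((cmod (wave (N\<^sup>2) ?c t x * wave (M\<^sup>2) ?d t x))\<^sup>2) \<partial>lborel \<partial>time_interval)
          \<le> ennreal (C * ?R * coeff_norm2 (N\<^sup>2) ?c * coeff_norm2 (M\<^sup>2) ?d)"
        by (intro bound[OF M MN] hermite_coef_freq_localization_support(1)[OF v N])
      also have "C * ?R * coeff_norm2 (N\<^sup>2) ?c * coeff_norm2 (M\<^sup>2) ?d = ?B\<^sup>2"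
        unfolding power_mult_distrib using C nn by (simp only: real_sqrt_pow2 less_imp_le)
      finally show "(\<integral>\<^sup>+t. (L2_norm (\<lambda>x. schroedinger_flow t ?v x * schroedinger_flow t ?u x))\<^sup>2 \<partial>time_interval)
          \<le> ennreal (?B\<^sup>2)"
        unfolding eq .
      show "0 \<le> ?B" using C nn by (intro mult_nonneg_nonneg real_sqrt_ge_zero) auto
    qed
    also have "ennreal ?B = ennreal (sqrt C * sqrt ?R) * L2_norm ?v * L2_norm ?u"
    proof -
      have "0 \<le> sqrt C * sqrt ?R" using C nn by (intro mult_nonneg_nonneg real_sqrt_ge_zero) auto
      then show ?thesis
        unfolding flow_freq_localization(2)[OF v N] flow_freq_localization(2)[OF u M]
        using nn by (simp only: ennreal_mult mult_nonneg_nonneg real_sqrt_ge_zero)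
    qed
    finally show "L2_L2_norm {-1..1} (\<lambda>t x. schroedinger_flow t ?v x * schroedinger_flow t ?u x)
        \<le> ennreal (sqrt C * sqrt ?R) * L2_norm ?v * L2_norm ?u" .
  qed (use C in simp)
qed

end

section \<open>The final form of the estimate\<close>

lemma sqrt_le_powr_ratio:
  fixes m n \<delta> :: real
  assumes "0 < m" "m \<le> n" "0 \<le> \<delta>" "2 \<le> d"
  shows "sqrt (m ^ (d - 2) * (m / n)) \<le> m powr ((real d - 2) / 2) * (m / n) powr (1 / 2 - \<delta>)"
proof -
  have r: "0 < m / n" "m / n \<le> 1" using assms by auto
  have "sqrt (m ^ (d - 2) * (m / n)) = (m ^ (d - 2)) powr (1 / 2) * (m / n) powr (1 / 2)"
    unfolding real_sqrt_mult using assms r by (simp add: powr_half_sqrt)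
  also have "(m ^ (d - 2)) powr (1 / 2) = m powr ((real d - 2) / 2)"
    using assms by (simp add: powr_realpow[symmetric] powr_powr of_nat_diff)
  \<comment> \<open>The base is at most 1, so lowering the exponent by \<open>\<delta>\<close> can
    only increase the power.\<close>
  also have "(m / n) powr (1 / 2) \<le> (m / n) powr (1 / 2 - \<delta>)"
    using assms r by (intro powr_mono') auto
  finally show ?thesis by (simp add: mult_left_mono)
qed

theorem theorem31:
  fixes \<eta> :: "real \<Rightarrow> real"
  assumes "CARD('n::finite) \<ge> 2"
    and "test_function \<eta>"
    and "\<And>s. s \<in> {0..1} \<Longrightarrow> \<eta> s = 1"
    and "\<And>s. s \<ge> 2 \<Longrightarrow> \<eta> s = 0"
  shows "\<forall>\<delta>::real. 0 < \<delta> \<and> \<delta> \<le> 1/2 \<longrightarrow>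
    (\<exists>C::real. C > 0 \<and>
      (\<forall>N\<in>dyadic. \<forall>M\<in>dyadic. \<forall>u\<in>L2. \<forall>v\<in>L2.
        L2_L2_norm {-1..1} (\<lambda>t (x :: real ^ 'n).
            schroedinger_flow t (freq_localization \<eta> N v) x *
            schroedinger_flow t (freq_localization \<eta> M u) x)
        \<le> ennreal (C * real (min N M) powr ((real CARD('n) - 2) / 2) *
                   (real (min N M) / real (max N M)) powr (1/2 - \<delta>)) *
          L2_norm (freq_localization \<eta> N v) * L2_norm (freq_localization \<eta> M u)))"
proof (intro allI impI, elim conjE)
  fix \<delta> :: real assume \<delta>: "0 < \<delta>"
  let ?P = "\<lambda>N M u v. L2_L2_norm {-1..1} (\<lambda>t (x :: real ^ 'n). schroedinger_flow t (freq_localization \<eta> N v) x *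
      schroedinger_flow t (freq_localization \<eta> M u) x)"
  obtain C where C: "C > 0" and bound: "\<And>N M (u :: real ^ 'n \<Rightarrow> complex) v. 1 \<le> M \<Longrightarrow> M \<le> N \<Longrightarrow> u \<in> L2 \<Longrightarrow> v \<in> L2
      \<Longrightarrow> ?P N M u v \<le> ennreal (C * sqrt (real M ^ (CARD('n) - 2) * (real M / real N)))
          * L2_norm (freq_localization \<eta> N v) * L2_norm (freq_localization \<eta> M u)"
    using flow_mult_bound[OF assms(2-4,1)] by blast
  have ordered: "?P N M u v \<le> ennreal (C * real M powr ((real CARD('n) - 2) / 2) * (real M / real N) powr (1/2 - \<delta>))
      * L2_norm (freq_localization \<eta> N v) * L2_norm (freq_localization \<eta> M u)"
    if "1 \<le> M" "M \<le> N" "u \<in> L2" "v \<in> L2" for N M and u v :: "real ^ 'n \<Rightarrow> complex"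
  proof (rule order_trans[OF bound[OF that]], intro mult_right_mono ennreal_leI)
    show "C * sqrt (real M ^ (CARD('n) - 2) * (real M / real N))
        \<le> C * real M powr ((real CARD('n) - 2) / 2) * (real M / real N) powr (1/2 - \<delta>)"
      unfolding mult.assoc[of C] using that C \<delta> assms(1) by (intro mult_left_mono sqrt_le_powr_ratio) auto
  qed auto
  show "\<exists>C::real. C > 0 \<and> (\<forall>N\<in>dyadic. \<forall>M\<in>dyadic. \<forall>u\<in>L2. \<forall>v\<in>L2. ?P N M u v
      \<le> ennreal (C * real (min N M) powr ((real CARD('n) - 2) / 2) * (real (min N M) / real (max N M)) powr (1/2 - \<delta>)) *
          L2_norm (freq_localization \<eta> N v) * L2_norm (freq_localization \<eta> M u))"
  proof (intro exI[of _ C] conjI ballI C)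
    fix N M and u v :: "real ^ 'n \<Rightarrow> complex"
    assume "N \<in> dyadic" "M \<in> dyadic" and u: "u \<in> L2" and v: "v \<in> L2"
    then have pos: "1 \<le> N" "1 \<le> M" by (auto simp: dyadic_def)
    show "?P N M u v
      \<le> ennreal (C * real (min N M) powr ((real CARD('n) - 2) / 2) * (real (min N M) / real (max N M)) powr (1/2 - \<delta>)) *
          L2_norm (freq_localization \<eta> N v) * L2_norm (freq_localization \<eta> M u)"
    proof (cases "M \<le> N")
      case True
      then show ?thesis using ordered[OF pos(2) True u v] by (simp only: min_absorb2 max_absorb1)
    next
      case False
      then have NM: "N \<le> M" by simp
      \<comment> \<open>The product of the two flows and the right-hand side are symmetric, so
        exchanging the functions reduces to the ordered case.\<close>
      have "?P N M u v = ?P M N v u" by (simp only: mult.commute)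
      then show ?thesis using ordered[OF pos(1) NM v u] NM
        by (simp only: min_absorb1 max_absorb2 mult.assoc mult.commute[of "L2_norm (freq_localization \<eta> M u)"])
    qed
  qed
qed

end
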